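(* Let $K$ be a compact Hausdorff space. Then $C(K)\hat{\otimes}_s C(K)$ has the Dunford-Pettis Property if and only if $K$ is scattered.
   Context: $C(K)$ denotes the Banach space (sup norm) of continuous scalar-valued functions on a compact Hausdorff space $K$, the scalar field $\mathbb{K}$ being $\mathbb{R}$ or $\mathbb{C}$. $E\hat{\otimes}_s E$ denotes the 2-fold symmetric projective tensor product of the Banach space $E$, i.e. the closed linear span of $\{x\otimes x : x\in E\}$ in the (completed) projective tensor product $E\hat{\otimes}E$; its dual is naturally isometric to the space of continuous symmetric bilinear forms on $E\times E$. All operators are linear and continuous. An operator between Banach spaces is weakly compact if it maps bounded sets to relatively weakly compact sets, and completely continuous if it maps weakly convergent sequences to norm convergent sequences. A Banach space $E$ has the Dunford-Pettis Property (DPP) if, for every Banach space $F$, every weakly compact operator from $E$ into $F$ is completely continuous. A topological space is scattered if every nonempty subset has an isolated point in its relative topology. *)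

theory Defs
  imports "HOL-Algebra.Module" "HOL-Analysis.Analysis"
begin

section \<open>Normed spaces with explicit carriers\<close>

text \<open>
  A normed space over \<open>'k\<close> is a HOL-Algebra module with a norm. Explicit carriers, rather than the
  class \<open>banach\<close>, allow complex spaces and quantification over all Banach spaces \<open>F\<close>
  inside a definition. The ring multiplication and unit that a module record inherits are irrelevant
  and left \<open>undefined\<close> where there is no natural choice.
\<close>

record ('k, 'v) normed_vs = "('k, 'v) Module.module" +
  nrm :: "'v \<Rightarrow> real"

text \<open>The scalar field, serving both as ring of scalars and as a normed space over itself.\<close>

definition scalars :: "('k::real_normed_field, 'k) normed_vs" where
  "scalars = \<lparr>carrier = UNIV, monoid.mult = (*), one = 1, zero = 0, add = (+),
     module.smult = (*), nrm = norm\<rparr>"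

locale normed_vector_space = Module.module scalars V
  for V :: "('k::real_normed_field, 'v) normed_vs" (structure) +
  assumes nrm_nonneg: "x \<in> carrier V \<Longrightarrow> 0 \<le> nrm V x"
    and nrm_eq_0_iff: "x \<in> carrier V \<Longrightarrow> nrm V x = 0 \<longleftrightarrow> x = \<zero>"
    and nrm_triangle: "\<lbrakk>x \<in> carrier V; y \<in> carrier V\<rbrakk> \<Longrightarrow> nrm V (x \<oplus> y) \<le> nrm V x + nrm V y"
    and nrm_smult: "x \<in> carrier V \<Longrightarrow> nrm V (a \<odot> x) = norm a * nrm V x"

text \<open>The value 0 off the carrier is needed because the locale \<open>Metric_space\<close> requires symmetry and
  nonnegativity of the distance on the whole type.\<close>

definition nrm_dist :: "('k::real_normed_field, 'v) normed_vs \<Rightarrow> 'v \<Rightarrow> 'v \<Rightarrow> real" where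
  "nrm_dist V x y = (if x \<in> carrier V \<and> y \<in> carrier V then nrm V (x \<ominus>\<^bsub>V\<^esub> y) else 0)"

abbreviation norm_topology :: "('k::real_normed_field, 'v) normed_vs \<Rightarrow> 'v topology" where
  "norm_topology V \<equiv> Metric_space.mtopology (carrier V) (nrm_dist V)"

abbreviation Cauchy_in :: "('k::real_normed_field, 'v) normed_vs \<Rightarrow> (nat \<Rightarrow> 'v) \<Rightarrow> bool" where
  "Cauchy_in V \<equiv> Metric_space.MCauchy (carrier V) (nrm_dist V)"

definition banach_space :: "('k::real_normed_field, 'v) normed_vs \<Rightarrow> bool" where
  "banach_space V \<longleftrightarrow> normed_vector_space V \<and> Metric_space.mcomplete (carrier V) (nrm_dist V)"

definition linear_op ::
  "('k::real_normed_field, 'v) normed_vs \<Rightarrow> ('k, 'w) normed_vs \<Rightarrow> ('v \<Rightarrow> 'w) \<Rightarrow> bool" where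
  "linear_op V W T \<longleftrightarrow> T \<in> carrier V \<rightarrow> carrier W \<and>
     (\<forall>x\<in>carrier V. \<forall>y\<in>carrier V. T (x \<oplus>\<^bsub>V\<^esub> y) = T x \<oplus>\<^bsub>W\<^esub> T y) \<and>
     (\<forall>a. \<forall>x\<in>carrier V. T (a \<odot>\<^bsub>V\<^esub> x) = a \<odot>\<^bsub>W\<^esub> T x)"

definition operator ::
  "('k::real_normed_field, 'v) normed_vs \<Rightarrow> ('k, 'w) normed_vs \<Rightarrow> ('v \<Rightarrow> 'w) \<Rightarrow> bool" where
  "operator V W T \<longleftrightarrow> linear_op V W T \<and> continuous_map (norm_topology V) (norm_topology W) T"

definition closed_span ::
  "('k::real_normed_field, 'v) normed_vs \<Rightarrow> 'v set \<Rightarrow> ('k, 'v) normed_vs" where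
  "closed_span V S =
     V\<lparr>carrier := norm_topology V closure_of ((\<lambda>H. submodule H scalars V) hull S)\<rparr>"


section \<open>Weak topology and the Dunford-Pettis Property\<close>

definition weak_topology :: "('k::real_normed_field, 'v) normed_vs \<Rightarrow> 'v topology" where
  "weak_topology V =
     topology_generated_by {{x \<in> carrier V. \<phi> x \<in> U} | \<phi> U. operator V scalars \<phi> \<and> open U}"

definition weakly_compact_op ::
  "('k::real_normed_field, 'v) normed_vs \<Rightarrow> ('k, 'w) normed_vs \<Rightarrow> ('v \<Rightarrow> 'w) \<Rightarrow> bool" where
  "weakly_compact_op V W T \<longleftrightarrow>
     (\<forall>B. Metric_space.mbounded (carrier V) (nrm_dist V) B \<longrightarrow>
        compactin (weak_topology W) (weak_topology W closure_of (T ` B)))"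

definition completely_continuous_op ::
  "('k::real_normed_field, 'v) normed_vs \<Rightarrow> ('k, 'w) normed_vs \<Rightarrow> ('v \<Rightarrow> 'w) \<Rightarrow> bool" where
  "completely_continuous_op V W T \<longleftrightarrow>
     (\<forall>s l. limitin (weak_topology V) s l sequentially \<and> range s \<subseteq> carrier V \<longrightarrow>
        (\<exists>m. limitin (norm_topology W) (\<lambda>n. T (s n)) m sequentially))"

text \<open>
  HOL has no quantifier over types, so \<open>F\<close> ranges over all Banach spaces whose carrier lies in the
  type \<open>(nat \<Rightarrow> 'e) + 'u\<close>. The parameter \<open>'u\<close> is an arbitrary type, so no Banach
  space is excluded: a space on \<open>'u\<close> is copied isometrically by \<open>Inr\<close>. The left summand makes the
  property the full one already for each fixed \<open>'u\<close>: the closure of the range of an operator on \<open>E\<close> consists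
  of limits of sequences, so it has at most as many elements as \<open>nat \<Rightarrow> 'e\<close>.
\<close>

definition dunford_pettis ::
  "'u itself \<Rightarrow> ('k::real_normed_field, 'e) normed_vs \<Rightarrow> bool" where
  "dunford_pettis u E \<longleftrightarrow>
     (\<forall>(F :: ('k, (nat \<Rightarrow> 'e) + 'u) normed_vs) T.
        banach_space F \<and> operator E F T \<and> weakly_compact_op E F T
        \<longrightarrow> completely_continuous_op E F T)"


section \<open>Completion\<close>

text \<open>Cauchy sequences modulo null sequences.\<close>

definition Cauchy_rel :: "('k::real_normed_field, 'v) normed_vs \<Rightarrow> ((nat \<Rightarrow> 'v) \<times> (nat \<Rightarrow> 'v)) set" where
  "Cauchy_rel V = {(s, t). Cauchy_in V s \<and> Cauchy_in V t \<and>
     (\<lambda>n. nrm_dist V (s n) (t n)) \<longlonglongrightarrow> 0}"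

definition completion ::
  "('k::real_normed_field, 'v) normed_vs \<Rightarrow> ('k, (nat \<Rightarrow> 'v) set) normed_vs" where
  "completion V =
     \<lparr>carrier = {s. Cauchy_in V s} // Cauchy_rel V,
      monoid.mult = undefined, one = undefined,
      zero = Cauchy_rel V `` {\<lambda>n. \<zero>\<^bsub>V\<^esub>},
      add = (\<lambda>A B. \<Union>s\<in>A. \<Union>t\<in>B. Cauchy_rel V `` {\<lambda>n. s n \<oplus>\<^bsub>V\<^esub> t n}),
      module.smult = (\<lambda>a A. \<Union>s\<in>A. Cauchy_rel V `` {\<lambda>n. a \<odot>\<^bsub>V\<^esub> s n}),
      nrm = (\<lambda>A. THE r. \<exists>s\<in>A. (\<lambda>n. nrm V (s n)) \<longlonglongrightarrow> r)\<rparr>"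

definition completion_emb :: "('k::real_normed_field, 'v) normed_vs \<Rightarrow> 'v \<Rightarrow> (nat \<Rightarrow> 'v) set" where
  "completion_emb V x = Cauchy_rel V `` {\<lambda>n. x}"


section \<open>Projective and symmetric projective tensor products\<close>

definition bilinear_forms ::
  "('k::real_normed_field, 'v) normed_vs \<Rightarrow> ('k, 'w) normed_vs \<Rightarrow> ('v \<Rightarrow> 'w \<Rightarrow> 'k) set" where
  "bilinear_forms V W =
     {b. (\<forall>x\<in>carrier V. linear_op W scalars (b x)) \<and>
         (\<forall>y\<in>carrier W. linear_op V scalars (\<lambda>x. b x y))}"

text \<open>
  The algebraic tensor product is realised as the space of functionals on the bilinear forms spanned
  by the evaluations \<open>x \<otimes> y : b \<mapsto> b x y\<close>. Scalar multiples are absorbed into one of the factors,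
  so this span consists of the finite sums of elementary tensors. Functionals are 0 outside the set
  of bilinear forms.
\<close>

definition tensor ::
  "('k::real_normed_field, 'v) normed_vs \<Rightarrow> ('k, 'w) normed_vs \<Rightarrow> 'v \<Rightarrow> 'w \<Rightarrow> ('v \<Rightarrow> 'w \<Rightarrow> 'k) \<Rightarrow> 'k" where
  "tensor V W x y = (\<lambda>b. if b \<in> bilinear_forms V W then b x y else 0)"

definition tensor_rep ::
  "('k::real_normed_field, 'v) normed_vs \<Rightarrow> ('k, 'w) normed_vs \<Rightarrow> (('v \<Rightarrow> 'w \<Rightarrow> 'k) \<Rightarrow> 'k) \<Rightarrow>
     nat \<Rightarrow> (nat \<Rightarrow> 'v) \<Rightarrow> (nat \<Rightarrow> 'w) \<Rightarrow> bool" where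
  "tensor_rep V W u n x y \<longleftrightarrow> (\<forall>i<n. x i \<in> carrier V \<and> y i \<in> carrier W) \<and>
     u = (\<lambda>b. \<Sum>i<n. tensor V W (x i) (y i) b)"

definition projective_norm ::
  "('k::real_normed_field, 'v) normed_vs \<Rightarrow> ('k, 'w) normed_vs \<Rightarrow> (('v \<Rightarrow> 'w \<Rightarrow> 'k) \<Rightarrow> 'k) \<Rightarrow> real" where
  "projective_norm V W u =
     Inf {\<Sum>i<n. nrm V (x i) * nrm W (y i) | n x y. tensor_rep V W u n x y}"

definition algebraic_tensor ::
  "('k::real_normed_field, 'v) normed_vs \<Rightarrow> ('k, 'w) normed_vs \<Rightarrow>
     ('k, ('v \<Rightarrow> 'w \<Rightarrow> 'k) \<Rightarrow> 'k) normed_vs" where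
  "algebraic_tensor V W =
     \<lparr>carrier = {u. \<exists>n x y. tensor_rep V W u n x y},
      monoid.mult = undefined, one = undefined,
      zero = (\<lambda>b. 0), add = (\<lambda>u v b. u b + v b),
      module.smult = (\<lambda>a u b. a * u b),
      nrm = projective_norm V W\<rparr>"

definition projective_tensor ::
  "('k::real_normed_field, 'v) normed_vs \<Rightarrow> ('k, 'w) normed_vs \<Rightarrow>
     ('k, (nat \<Rightarrow> ('v \<Rightarrow> 'w \<Rightarrow> 'k) \<Rightarrow> 'k) set) normed_vs" where
  "projective_tensor V W = completion (algebraic_tensor V W)"

definition sym_projective_tensor ::
  "('k::real_normed_field, 'v) normed_vs \<Rightarrow>
     ('k, (nat \<Rightarrow> ('v \<Rightarrow> 'v \<Rightarrow> 'k) \<Rightarrow> 'k) set) normed_vs" where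
  "sym_projective_tensor V = closed_span (projective_tensor V V)
     ((\<lambda>x. completion_emb (algebraic_tensor V V) (tensor V V x x)) ` carrier V)"


section \<open>The space C(K) and scattered spaces\<close>

text \<open>Functions are 0 outside \<open>topspace K\<close>, so that each continuous function on \<open>K\<close> has exactly
  one representative; inserting 0 only affects the supremum for empty \<open>K\<close>.\<close>

definition C_space :: "'a topology \<Rightarrow> ('k::real_normed_field, 'a \<Rightarrow> 'k) normed_vs" where
  "C_space K =
     \<lparr>carrier = {f. continuous_map K euclidean f \<and> (\<forall>t. t \<notin> topspace K \<longrightarrow> f t = 0)},
      monoid.mult = (\<lambda>f g t. f t * g t), one = (\<lambda>t. if t \<in> topspace K then 1 else 0),
      zero = (\<lambda>t. 0), add = (\<lambda>f g t. f t + g t),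
      module.smult = (\<lambda>a f t. a * f t),
      nrm = (\<lambda>f. Sup (insert 0 ((\<lambda>t. norm (f t)) ` topspace K)))\<rparr>"

definition scattered_space :: "'a topology \<Rightarrow> bool" where
  "scattered_space X \<longleftrightarrow>
     (\<forall>S. S \<subseteq> topspace X \<and> S \<noteq> {} \<longrightarrow> (\<exists>x\<in>S. openin (subtopology X S) {x}))"

end

(* A bilinear form b on C(K) satisfies |b(f_0, g_0) + ... + b(f_(N-1), g_(N-1))| <= 2 |b| sqrt N whenever
   |f_0| + ... + |f_(N-1)| <= 1 pointwise and the g_i are real with |g_i| <= 1 (average over signs, using
   a Riesz product).

   Let K be scattered and T weakly compact. Functionals on C(K) are concentrated, up to e, on finite sets,
   and by the bound so are the bilinear forms phi(T(f . g)). By weak compactness there are a unit vector u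
   and a finite set A such that T(x . x) hardly varies among the unit vectors x that agree with u on A.
   Perturbing u away from A shows that the concentration is uniform in |phi| <= 1. Hence T(v) depends,
   up to e |v|, on finitely many of the values of v on K x K only, and these converge along a weakly
   convergent sequence.

   Let K not be scattered. A subset without isolated points supplies two disjoint open sets: one contains
   disjointly supported f_n >= 0 with f_n(t_n) = 1, the other a dyadic tree on which functions g_n behave
   like Rademacher functions. Let q_n be the n-th Rademacher coefficient, so that q_n(g_n) = 1, q_k(f_n) = 0
   and (q_n(g))_n is square-summable for each g. The operator into l_2 induced by the bilinear forms
   f(t_n) q_n(g) is weakly compact and maps the tensors f_n . g_n, which are weakly null by the bound, to
   half the unit vectors. So it is not completely continuous. *)
theory Submission
  imports Defs
begin


section \<open>Normed spaces\<close>

text \<open>Both directions rest on sqrt N being of smaller order than N. A signed sum of the g_i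
  may reach N at a point; the Riesz product of the factors 1 + i eps_i g_i / sqrt N stays below sqrt
  e everywhere, yet keeps g_i / sqrt N as its coefficient at eps_i. Hence the factor sqrt N and the
  constant 2. The obstacle in the scattered case is uniformity: each functional phi has its own
  finite set, but the norm of T(v) is a supremum over all phi. Weak compactness closes the gap. Were
  there no neighbourhood of small norm oscillation, vectors far from the convex hull of their
  predecessors would have a weak cluster point, against Mazur's theorem. A neighbourhood of a single
  u suffices: u may be altered off A so that u and f have disjoint supports; u, u + f and u - f are
  all admissible, and the parallelogram identity isolates the quadratic form at f. In the other case
  the g_n are not expected to be weakly null. The disjoint f_n make the tensors so, while the q_n
  keep their images apart.\<close>

lemma scalars_simps [simp]:
  "carrier scalars = UNIV" "a \<oplus>\<^bsub>scalars\<^esub> b = a + b" "a \<otimes>\<^bsub>scalars\<^esub> b = a * b"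
  "\<one>\<^bsub>scalars\<^esub> = 1" "\<zero>\<^bsub>scalars\<^esub> = 0" "a \<odot>\<^bsub>scalars\<^esub> b = a * b" "nrm scalars a = norm a"
  by (simp_all add: scalars_def)

lemma cring_scalars: "cring (scalars :: ('k::real_normed_field, 'k) normed_vs)"
proof (rule cringI)
  show "abelian_group (scalars :: ('k, 'k) normed_vs)"
    by (rule abelian_groupI) (auto simp: add.assoc add.commute intro: exI[of _ "- _"] simp: eq_neg_iff_add_eq_0[symmetric])
  show "Group.comm_monoid (scalars :: ('k, 'k) normed_vs)"
    by (rule comm_monoidI) (auto simp: mult.assoc mult.commute)
qed (auto simp: algebra_simps)

lemma normed_vector_spaceI:
  fixes V :: "('k::real_normed_field, 'v) normed_vs" (structure)
  assumes "\<zero> \<in> carrier V"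
    and "\<And>x y. \<lbrakk>x \<in> carrier V; y \<in> carrier V\<rbrakk> \<Longrightarrow> x \<oplus> y \<in> carrier V"
    and "\<And>a x. x \<in> carrier V \<Longrightarrow> a \<odot> x \<in> carrier V"
    and "\<And>x y z. \<lbrakk>x \<in> carrier V; y \<in> carrier V; z \<in> carrier V\<rbrakk> \<Longrightarrow> (x \<oplus> y) \<oplus> z = x \<oplus> (y \<oplus> z)"
    and "\<And>x y. \<lbrakk>x \<in> carrier V; y \<in> carrier V\<rbrakk> \<Longrightarrow> x \<oplus> y = y \<oplus> x"
    and "\<And>x. x \<in> carrier V \<Longrightarrow> \<zero> \<oplus> x = x"
    and "\<And>x. x \<in> carrier V \<Longrightarrow> (-1) \<odot> x \<oplus> x = \<zero>"
    and "\<And>a b x. x \<in> carrier V \<Longrightarrow> (a + b) \<odot> x = a \<odot> x \<oplus> b \<odot> x"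
    and "\<And>a x y. \<lbrakk>x \<in> carrier V; y \<in> carrier V\<rbrakk> \<Longrightarrow> a \<odot> (x \<oplus> y) = a \<odot> x \<oplus> a \<odot> y"
    and "\<And>a b x. x \<in> carrier V \<Longrightarrow> (a * b) \<odot> x = a \<odot> (b \<odot> x)"
    and "\<And>x. x \<in> carrier V \<Longrightarrow> 1 \<odot> x = x"
    and "\<And>x. x \<in> carrier V \<Longrightarrow> 0 \<le> nrm V x"
    and "\<And>x. \<lbrakk>x \<in> carrier V; nrm V x = 0\<rbrakk> \<Longrightarrow> x = \<zero>"
    and tri: "\<And>x y. \<lbrakk>x \<in> carrier V; y \<in> carrier V\<rbrakk> \<Longrightarrow> nrm V (x \<oplus> y) \<le> nrm V x + nrm V y"
    and sm: "\<And>a x. x \<in> carrier V \<Longrightarrow> nrm V (a \<odot> x) = norm a * nrm V x"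
  shows "normed_vector_space V"
proof -
  have ag: "abelian_group V"
    by (rule abelian_groupI) (use assms in \<open>blast intro: exI\<close>)+
  have m: "Module.module scalars V"
    by (rule moduleI) (use assms cring_scalars ag in auto)
  then interpret Module.module scalars V .
  have "nrm V \<zero> = 0" using sm[of \<zero> 0] smult_l_null[of \<zero>] by simp
  then show ?thesis using m assms
    by (auto simp: normed_vector_space_def normed_vector_space_axioms_def)
qed

context normed_vector_space
begin

lemma zero_carrier [simp]: "\<zero> \<in> carrier V"
  and add_carrier [simp]: "\<lbrakk>x \<in> carrier V; y \<in> carrier V\<rbrakk> \<Longrightarrow> x \<oplus> y \<in> carrier V"
  and smult_carrier [simp]: "x \<in> carrier V \<Longrightarrow> a \<odot> x \<in> carrier V"
  and diff_carrier [simp]: "\<lbrakk>x \<in> carrier V; y \<in> carrier V\<rbrakk> \<Longrightarrow> x \<ominus> y \<in> carrier V"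
  by auto

lemma smult_add_left: "x \<in> carrier V \<Longrightarrow> (a + b) \<odot> x = a \<odot> x \<oplus> b \<odot> x"
  and smult_add_right: "\<lbrakk>x \<in> carrier V; y \<in> carrier V\<rbrakk> \<Longrightarrow> a \<odot> (x \<oplus> y) = a \<odot> x \<oplus> a \<odot> y"
  and smult_smult: "x \<in> carrier V \<Longrightarrow> a \<odot> (b \<odot> x) = (a * b) \<odot> x"
  and smult_1 [simp]: "x \<in> carrier V \<Longrightarrow> 1 \<odot> x = x"
  and smult_0 [simp]: "x \<in> carrier V \<Longrightarrow> 0 \<odot> x = \<zero>"
  and smult_zero [simp]: "a \<odot> \<zero> = \<zero>"
  using smult_l_distr[of a b x] smult_r_distr[of a x y] smult_assoc1[of a b x] smult_one[of x]
    smult_l_null[of x] smult_r_null[of a] by simp_all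

lemma diff_conv: "\<lbrakk>x \<in> carrier V; y \<in> carrier V\<rbrakk> \<Longrightarrow> x \<ominus> y = x \<oplus> (-1) \<odot> y"
proof -
  assume a: "x \<in> carrier V" "y \<in> carrier V"
  have "y \<oplus> (-1) \<odot> y = \<zero>"
    using smult_add_left[of y 1 "-1"] a by simp
  then have "\<ominus> y = (-1) \<odot> y"
    using a by (metis M.minus_equality M.add.m_comm smult_carrier)
  then show ?thesis by (simp add: a_minus_def)
qed

lemmas vs_ac = M.a_assoc M.a_comm M.a_lcomm

lemma diff_self [simp]: "x \<in> carrier V \<Longrightarrow> x \<ominus> x = \<zero>"
  by (simp add: a_minus_def M.r_neg)

lemma add_diff_cancel [simp]: "\<lbrakk>x \<in> carrier V; y \<in> carrier V\<rbrakk> \<Longrightarrow> (x \<ominus> y) \<oplus> y = x"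
  by (simp add: a_minus_def M.a_assoc M.l_neg)

lemma diff_eq_zero_iff: "\<lbrakk>x \<in> carrier V; y \<in> carrier V\<rbrakk> \<Longrightarrow> x \<ominus> y = \<zero> \<longleftrightarrow> x = y"
  by (metis add_diff_cancel diff_self M.l_zero)

lemma diff_trans: "\<lbrakk>x \<in> carrier V; y \<in> carrier V; z \<in> carrier V\<rbrakk> \<Longrightarrow> x \<ominus> z = (x \<ominus> y) \<oplus> (y \<ominus> z)"
  by (simp add: a_minus_def M.a_assoc) (metis M.a_assoc M.add.inv_closed M.l_neg M.l_zero)

lemma nrm_zero [simp]: "nrm V \<zero> = 0"
  by (simp add: nrm_eq_0_iff)

lemma nrm_uminus: "x \<in> carrier V \<Longrightarrow> nrm V ((-1) \<odot> x) = nrm V x"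
  by (simp add: nrm_smult)

lemma smult_diff: "\<lbrakk>x \<in> carrier V; y \<in> carrier V\<rbrakk> \<Longrightarrow> a \<odot> (x \<ominus> y) = a \<odot> x \<ominus> a \<odot> y"
  by (simp add: diff_conv smult_add_right smult_smult)

lemma add_diff_add: "\<lbrakk>x \<in> carrier V; y \<in> carrier V; z \<in> carrier V; w \<in> carrier V\<rbrakk> \<Longrightarrow>
    (x \<oplus> y) \<ominus> (z \<oplus> w) = (x \<ominus> z) \<oplus> (y \<ominus> w)"
  by (simp add: diff_conv smult_add_right vs_ac)

lemma diff_swap: "\<lbrakk>x \<in> carrier V; y \<in> carrier V\<rbrakk> \<Longrightarrow> y \<ominus> x = (-1) \<odot> (x \<ominus> y)"
  by (simp add: diff_conv smult_add_right smult_smult M.a_comm)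

lemma nrm_diff_commute: "\<lbrakk>x \<in> carrier V; y \<in> carrier V\<rbrakk> \<Longrightarrow> nrm V (x \<ominus> y) = nrm V (y \<ominus> x)"
  by (metis diff_carrier diff_swap nrm_uminus)

lemma nrm_diff_triangle:
  "\<lbrakk>x \<in> carrier V; y \<in> carrier V; z \<in> carrier V\<rbrakk> \<Longrightarrow> nrm V (x \<ominus> z) \<le> nrm V (x \<ominus> y) + nrm V (y \<ominus> z)"
  by (metis diff_carrier diff_trans nrm_triangle)

lemma nrm_diff_le: "\<lbrakk>x \<in> carrier V; y \<in> carrier V\<rbrakk> \<Longrightarrow> nrm V (x \<ominus> y) \<le> nrm V x + nrm V y"
  by (metis diff_conv nrm_triangle nrm_uminus smult_carrier)

lemma nrm_le_add_diff: "\<lbrakk>x \<in> carrier V; y \<in> carrier V\<rbrakk> \<Longrightarrow> nrm V x \<le> nrm V y + nrm V (x \<ominus> y)"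
  by (metis add_diff_cancel add.commute diff_carrier nrm_triangle)

lemma abs_nrm_diff_le: "\<lbrakk>x \<in> carrier V; y \<in> carrier V\<rbrakk> \<Longrightarrow> \<bar>nrm V x - nrm V y\<bar> \<le> nrm V (x \<ominus> y)"
  using nrm_le_add_diff[of x y] nrm_le_add_diff[of y x] nrm_diff_commute[of x y] by simp

lemma nrm_dist_eq: "\<lbrakk>x \<in> carrier V; y \<in> carrier V\<rbrakk> \<Longrightarrow> nrm_dist V x y = nrm V (x \<ominus> y)"
  by (simp add: nrm_dist_def)

sublocale ms: Metric_space "carrier V" "nrm_dist V"
proof
  show "0 \<le> nrm_dist V x y" for x y
    by (simp add: nrm_dist_def nrm_nonneg)
  show "nrm_dist V x y = nrm_dist V y x" for x y
    by (simp add: nrm_dist_def nrm_diff_commute)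
  show "\<lbrakk>x \<in> carrier V; y \<in> carrier V\<rbrakk> \<Longrightarrow> (nrm_dist V x y = 0) = (x = y)" for x y
    by (simp add: nrm_dist_def nrm_eq_0_iff diff_eq_zero_iff)
  show "\<lbrakk>x \<in> carrier V; y \<in> carrier V; z \<in> carrier V\<rbrakk> \<Longrightarrow> nrm_dist V x z \<le> nrm_dist V x y + nrm_dist V y z" for x y z
    by (simp add: nrm_dist_def nrm_diff_triangle)
qed

lemma Cauchy_in_iff: "Cauchy_in V s \<longleftrightarrow> (\<forall>n. s n \<in> carrier V) \<and>
    (\<forall>e>0. \<exists>N. \<forall>m\<ge>N. \<forall>n\<ge>N. nrm V (s m \<ominus> s n) < e)"
  unfolding ms.MCauchy_def image_subset_iff
  by (intro conj_cong) (auto simp: nrm_dist_eq)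

lemma limitin_iff: "(\<And>n. s n \<in> carrier V) \<Longrightarrow>
    limitin (norm_topology V) s l sequentially \<longleftrightarrow> l \<in> carrier V \<and> (\<lambda>n. nrm V (s n \<ominus> l)) \<longlonglongrightarrow> 0"
  unfolding ms.limitin_metric_dist_null
  by (auto simp: nrm_dist_eq)

end

lemma normed_vector_space_scalars: "normed_vector_space scalars"
  by (rule normed_vector_spaceI) (auto simp: algebra_simps norm_triangle_ineq norm_mult)

lemma nrm_dist_scalars: "nrm_dist scalars = dist"
proof -
  interpret S: normed_vector_space "scalars :: ('k::real_normed_field,'k) normed_vs" by (rule normed_vector_space_scalars)
  show "(nrm_dist scalars :: 'k \<Rightarrow> _) = dist"
    by (auto simp: fun_eq_iff S.nrm_dist_eq S.diff_conv dist_norm)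
qed

lemma banach_space_scalars: "banach_space (scalars :: ('k::{real_normed_field, banach}, 'k) normed_vs)"
  by (simp add: banach_space_def normed_vector_space_scalars nrm_dist_scalars complete_UNIV)

section \<open>Linear operators, and continuity versus boundedness\<close>

lemma linear_op_scalarsD:
  assumes "linear_op V scalars \<phi>"
  shows "\<And>x y. \<lbrakk>x \<in> carrier V; y \<in> carrier V\<rbrakk> \<Longrightarrow> \<phi> (x \<oplus>\<^bsub>V\<^esub> y) = \<phi> x + \<phi> y"
    and "\<And>a x. x \<in> carrier V \<Longrightarrow> \<phi> (a \<odot>\<^bsub>V\<^esub> x) = a * \<phi> x"
  using assms by (auto simp: linear_op_def)

lemma linear_opD:
  assumes "linear_op V W T"
  shows "\<And>x. x \<in> carrier V \<Longrightarrow> T x \<in> carrier W"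
    and "\<And>x y. \<lbrakk>x \<in> carrier V; y \<in> carrier V\<rbrakk> \<Longrightarrow> T (x \<oplus>\<^bsub>V\<^esub> y) = T x \<oplus>\<^bsub>W\<^esub> T y"
    and "\<And>a x. x \<in> carrier V \<Longrightarrow> T (a \<odot>\<^bsub>V\<^esub> x) = a \<odot>\<^bsub>W\<^esub> T x"
  using assms by (auto simp: linear_op_def)

lemma linear_op_diff:
  assumes "normed_vector_space V" "normed_vector_space W" "linear_op V W T" "x \<in> carrier V" "y \<in> carrier V"
  shows "T (x \<ominus>\<^bsub>V\<^esub> y) = T x \<ominus>\<^bsub>W\<^esub> T y"
proof -
  interpret V: normed_vector_space V by fact
  interpret W: normed_vector_space W by fact
  show ?thesis using assms linear_opD[OF assms(3)] by (simp add: V.diff_conv W.diff_conv)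
qed

lemma linear_op_scalars_diff:
  assumes "normed_vector_space V" "linear_op V scalars \<phi>" "x \<in> carrier V" "y \<in> carrier V"
  shows "\<phi> (x \<ominus>\<^bsub>V\<^esub> y) = \<phi> x - \<phi> y"
proof -
  interpret V: normed_vector_space V by fact
  show ?thesis using assms linear_op_scalarsD[OF assms(2)] by (simp add: V.diff_conv)
qed

lemma linear_op_zero:
  assumes "normed_vector_space V" "normed_vector_space W" "linear_op V W T"
  shows "T \<zero>\<^bsub>V\<^esub> = \<zero>\<^bsub>W\<^esub>"
proof -
  interpret V: normed_vector_space V by fact
  interpret W: normed_vector_space W by fact
  show ?thesis using linear_opD(3)[OF assms(3), of "\<zero>\<^bsub>V\<^esub>" 0] linear_opD(1)[OF assms(3), of "\<zero>\<^bsub>V\<^esub>"] by simp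
qed

lemma operatorI:
  assumes V: "normed_vector_space V" and W: "normed_vector_space W" and T: "linear_op V W T"
    and B: "\<And>x. x \<in> carrier V \<Longrightarrow> nrm W (T x) \<le> M * nrm V x"
  shows "operator V W T"
proof -
  interpret V: normed_vector_space V by fact
  interpret W: normed_vector_space W by fact
  have "\<exists>\<delta>>0. \<forall>x. x \<in> carrier V \<and> nrm_dist V a x < \<delta> \<longrightarrow> nrm_dist W (T a) (T x) < e"
    if a: "a \<in> carrier V" and e: "0 < e" for a e
  proof (intro exI conjI allI impI)
    show "0 < e / (\<bar>M\<bar> + 1)" using e by (simp add: add_nonneg_pos)
    fix x assume x: "x \<in> carrier V \<and> nrm_dist V a x < e / (\<bar>M\<bar> + 1)"
    have "nrm_dist W (T a) (T x) = nrm W (T (a \<ominus>\<^bsub>V\<^esub> x))"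
      using a x by (simp add: W.nrm_dist_eq linear_opD(1)[OF T] linear_op_diff[OF V W T])
    also have "\<dots> \<le> M * nrm V (a \<ominus>\<^bsub>V\<^esub> x)" using B a x by simp
    also have "\<dots> \<le> (\<bar>M\<bar> + 1) * nrm V (a \<ominus>\<^bsub>V\<^esub> x)"
      using a x by (intro mult_right_mono) (auto simp: V.nrm_nonneg)
    also have "\<dots> < e" using x a conjunct1[OF x] by (auto simp add: V.nrm_dist_eq pos_less_divide_eq add_nonneg_pos mult.commute)
    finally show "nrm_dist W (T a) (T x) < e" .
  qed
  then have "continuous_map (norm_topology V) (norm_topology W) T"
    using linear_opD(1)[OF T]
    by (simp add: V.ms.metric_continuous_map[OF W.ms.Metric_space_axioms] image_subset_iff)
  then show ?thesis using T by (simp add: operator_def)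
qed

lemma operator_bounded:
  assumes V: "normed_vector_space V" and W: "normed_vector_space W" and T: "operator V W T"
  obtains M where "0 < M" "\<And>x. x \<in> carrier V \<Longrightarrow> nrm W (T x) \<le> M * nrm V x"
proof -
  interpret V: normed_vector_space V by fact
  interpret W: normed_vector_space W by fact
  have lin: "linear_op V W T" and cont: "continuous_map (norm_topology V) (norm_topology W) T"
    using T by (auto simp: operator_def)
  note TC = linear_opD(1)[OF lin]
  obtain d where d: "d > 0" "\<And>x. x \<in> carrier V \<Longrightarrow> nrm_dist V \<zero>\<^bsub>V\<^esub> x < d \<Longrightarrow> nrm_dist W (T \<zero>\<^bsub>V\<^esub>) (T x) < 1"
    using cont unfolding V.ms.metric_continuous_map[OF W.ms.Metric_space_axioms]
    by (meson V.zero_carrier zero_less_one)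
  have d': "nrm W (T x) < 1" if "x \<in> carrier V" "nrm V x < d" for x
    using d(2)[of x] that TC[of x] V.nrm_diff_commute[of "\<zero>\<^bsub>V\<^esub>" x] W.nrm_diff_commute[of "\<zero>\<^bsub>W\<^esub>" "T x"]
    by (simp add: linear_op_zero[OF V W lin] V.nrm_dist_eq W.nrm_dist_eq V.diff_conv W.diff_conv)
  show ?thesis
  proof
    show "0 < 2 / d" using d by simp
    fix x assume x: "x \<in> carrier V"
    show "nrm W (T x) \<le> 2 / d * nrm V x"
    proof (cases "nrm V x = 0")
      case True
      then show ?thesis using x by (simp add: V.nrm_eq_0_iff linear_op_zero[OF V W lin])
    next
      case False
      then have p: "nrm V x > 0" using V.nrm_nonneg[OF x] by simp
      \<comment> \<open>The vector c x has norm d/2, inside the ball on which continuity at zero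
        keeps T below 1; this is the origin of the bound 2/d.\<close>
      define c where "c = d / 2 / nrm V x"
      have c: "c > 0" using p d by (simp add: c_def)
      have "nrm W (T (of_real c \<odot>\<^bsub>V\<^esub> x)) < 1"
        using x p d c by (intro d') (auto simp: V.nrm_smult c_def simp del: of_real_divide of_real_mult)
      then have "c * nrm W (T x) < 1"
        using c x by (simp add: linear_opD(3)[OF lin] W.nrm_smult TC)
      then show ?thesis using c p d by (simp add: c_def field_simps)
    qed
  qed
qed

lemma operator_scalars_iff:
  assumes V: "normed_vector_space V"
  shows "operator V scalars \<phi> \<longleftrightarrow>
    linear_op V scalars \<phi> \<and> (\<exists>M. \<forall>x\<in>carrier V. norm (\<phi> x) \<le> M * nrm V x)"
  using operator_bounded[OF V normed_vector_space_scalars, of \<phi>]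
    operatorI[OF V normed_vector_space_scalars, of \<phi>]
  by (metis operator_def scalars_simps(7))

text \<open>The bound makes continuity automatic. This set norms the space, so estimates uniform
  over it are norm estimates.\<close>

definition dual_ball :: "('k::real_normed_field, 'v) normed_vs \<Rightarrow> ('v \<Rightarrow> 'k) set" where
  "dual_ball V = {\<phi>. linear_op V scalars \<phi> \<and> (\<forall>x\<in>carrier V. norm (\<phi> x) \<le> nrm V x)}"


section \<open>Separation\<close>

context normed_vector_space
begin

text \<open>Only nonnegative real scalars are tested: V is treated as a real space, so that one
  separation argument serves both scalar fields.\<close>

definition sublinear :: "('v \<Rightarrow> real) \<Rightarrow> bool" where
  "sublinear p \<longleftrightarrow> (\<forall>x\<in>carrier V. \<forall>y\<in>carrier V. p (x \<oplus> y) \<le> p x + p y) \<and>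
     (\<forall>x\<in>carrier V. \<forall>t\<ge>0. p (of_real t \<odot> x) = t * p x)"

lemma sublinearD:
  assumes "sublinear p"
  shows "\<And>x y. \<lbrakk>x \<in> carrier V; y \<in> carrier V\<rbrakk> \<Longrightarrow> p (x \<oplus> y) \<le> p x + p y"
    and "\<And>x t. \<lbrakk>x \<in> carrier V; 0 \<le> t\<rbrakk> \<Longrightarrow> p (of_real t \<odot> x) = t * p x"
  using assms by (auto simp: sublinear_def)

lemma sublinear_zero: "sublinear p \<Longrightarrow> p \<zero> = 0"
  using sublinearD(2)[of p \<zero> 0] by simp

lemma add_uminus [simp]: "x \<in> carrier V \<Longrightarrow> x \<oplus> (-1) \<odot> x = \<zero>"
  using diff_conv[of x x] by simp

lemma sublinear_lower: "sublinear p \<Longrightarrow> x \<in> carrier V \<Longrightarrow> - p ((-1) \<odot> x) \<le> p x"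
  using sublinearD(1)[of p x "(-1) \<odot> x"] sublinear_zero[of p] by simp

text \<open>The inequality for the factor 1/t, applied to t x, is the missing reverse
  inequality.\<close>

lemma sublinear_homI:
  assumes "\<And>x t. \<lbrakk>x \<in> carrier V; 0 < t\<rbrakk> \<Longrightarrow> p (of_real t \<odot> x) \<le> t * p x" and "p \<zero> = 0"
    and "x \<in> carrier V" "0 \<le> t"
  shows "p (of_real t \<odot> x) = t * p x"
proof (cases "t = 0")
  case False
  then have t: "t > 0" using assms by simp
  have "p (of_real (1/t) \<odot> (of_real t \<odot> x)) \<le> (1/t) * p (of_real t \<odot> x)"
    using assms t by (intro assms(1)) auto
  also have "of_real (1/t) \<odot> (of_real t \<odot> x) = x"
    using t assms by (simp add: smult_smult flip: of_real_mult)
  finally have "t * p x \<le> p (of_real t \<odot> x)" using t by (simp add: field_simps)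
  then show ?thesis using assms(1)[OF assms(3) t] by (rule antisym[rotated])
qed (use assms in simp)

text \<open>The value t = 0 gives r <= q, and t = 1 gives r(x) + q(y) <= q(x + y). A minimal q
  therefore equals r and is superadditive.\<close>

lemma sublinear_inf_line:
  assumes q: "sublinear q" and y: "y \<in> carrier V"
  defines "r \<equiv> \<lambda>x. INF t\<in>{0..}. q (x \<oplus> of_real t \<odot> y) - t * q y"
  shows "sublinear r" and "\<And>x t. x \<in> carrier V \<Longrightarrow> t \<ge> 0 \<Longrightarrow> r x \<le> q (x \<oplus> of_real t \<odot> y) - t * q y"
proof -
  have bdd: "bdd_below ((\<lambda>t. q (x \<oplus> of_real t \<odot> y) - t * q y) ` {0..})" if x: "x \<in> carrier V" for x
  proof (rule bdd_belowI2)
    fix t :: real assume t: "t \<in> {0..}"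
    have "t * q y = q (of_real t \<odot> y)" using sublinearD(2)[OF q y] t by simp
    also have "\<dots> = q ((x \<oplus> of_real t \<odot> y) \<oplus> (-1) \<odot> x)"
      using x y by (simp add: M.a_comm[of x] M.a_assoc)
    also have "\<dots> \<le> q (x \<oplus> of_real t \<odot> y) + q ((-1) \<odot> x)" using sublinearD(1)[OF q] x y by simp
    finally show "- q ((-1) \<odot> x) \<le> q (x \<oplus> of_real t \<odot> y) - t * q y" by simp
  qed
  show upper: "r x \<le> q (x \<oplus> of_real t \<odot> y) - t * q y" if "x \<in> carrier V" "t \<ge> 0" for x t
    unfolding r_def using bdd[OF that(1)] that by (intro cINF_lower) auto
  have approx: "\<exists>t\<ge>0. q (x \<oplus> of_real t \<odot> y) - t * q y < r x + e" if "x \<in> carrier V" "e > 0" for x e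
    using cInf_lessD[of "(\<lambda>t. q (x \<oplus> of_real t \<odot> y) - t * q y) ` {0..}" "r x + e"] that(2)
    by (auto simp: r_def)
  have r0: "r \<zero> = 0"
  proof (rule antisym)
    show "r \<zero> \<le> 0" using upper[of \<zero> 0] sublinear_zero[OF q] y by simp
    show "0 \<le> r \<zero>" unfolding r_def
      using y sublinearD(2)[OF q y] by (intro cINF_greatest) auto
  qed
  show "sublinear r"
    unfolding sublinear_def
  proof (intro conjI ballI allI impI)
    fix x x' assume x: "x \<in> carrier V" "x' \<in> carrier V"
    show "r (x \<oplus> x') \<le> r x + r x'"
    proof (rule field_le_epsilon)
      fix e :: real assume e: "e > 0"
      obtain t where t: "t \<ge> 0" "q (x \<oplus> of_real t \<odot> y) - t * q y < r x + e/2" using approx[OF x(1), of "e/2"] e by auto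
      obtain s where s: "s \<ge> 0" "q (x' \<oplus> of_real s \<odot> y) - s * q y < r x' + e/2" using approx[OF x(2), of "e/2"] e by auto
      have "r (x \<oplus> x') \<le> q ((x \<oplus> x') \<oplus> of_real (t + s) \<odot> y) - (t + s) * q y"
        using x s t by (intro upper) auto
      also have "(x \<oplus> x') \<oplus> of_real (t + s) \<odot> y = (x \<oplus> of_real t \<odot> y) \<oplus> (x' \<oplus> of_real s \<odot> y)"
        using x y by (simp add: smult_add_left vs_ac)
      also have "q \<dots> \<le> q (x \<oplus> of_real t \<odot> y) + q (x' \<oplus> of_real s \<odot> y)"
        using sublinearD(1)[OF q] x y by simp
      finally show "r (x \<oplus> x') \<le> r x + r x' + e" using s t by (simp add: algebra_simps)
    qed
  next
    fix x and t :: real assume x: "x \<in> carrier V" and t: "0 \<le> t"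
    show "r (of_real t \<odot> x) = t * r x"
    proof (rule sublinear_homI[where p = r, OF _ r0 x t])
      fix x and t :: real assume x: "x \<in> carrier V" and t: "0 < t"
      have "r (of_real t \<odot> x) \<le> t * r x + e" if e: "e > 0" for e
      proof -
        obtain s where s: "s \<ge> 0" "q (x \<oplus> of_real s \<odot> y) - s * q y < r x + e/t" using approx[OF x, of "e/t"] e t by auto
        have "r (of_real t \<odot> x) \<le> q (of_real t \<odot> x \<oplus> of_real (t * s) \<odot> y) - (t * s) * q y"
          using x y s t by (intro upper) auto
        also have "of_real t \<odot> x \<oplus> of_real (t * s) \<odot> y = of_real t \<odot> (x \<oplus> of_real s \<odot> y)"
          using x y by (simp add: smult_add_right smult_smult)
        also have "q \<dots> - (t * s) * q y = t * (q (x \<oplus> of_real s \<odot> y) - s * q y)"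
          using sublinearD(2)[OF q] x y t by (simp add: algebra_simps)
        also have "\<dots> \<le> t * (r x + e/t)" using s t by (intro mult_left_mono) auto
        finally show ?thesis using t by (simp add: algebra_simps)
      qed
      then show "r (of_real t \<odot> x) \<le> t * r x" by (rule field_le_epsilon)
    qed
  qed
qed

text \<open>A minimal element of the set of sublinear functionals below \<open>p\<close> is linear, since it
  agrees with its infimum along every line.\<close>

lemma sublinear_dominates_additive:
  assumes p: "sublinear p"
  obtains u where "\<And>x y. \<lbrakk>x \<in> carrier V; y \<in> carrier V\<rbrakk> \<Longrightarrow> u (x \<oplus> y) = u x + u y"
    and "\<And>t x. x \<in> carrier V \<Longrightarrow> u (of_real t \<odot> x) = t * u x" and "\<And>x. x \<in> carrier V \<Longrightarrow> u x \<le> p x"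
proof -
  \<comment> \<open>Fixing the value 0 off the carrier matters: there the values could otherwise
    decrease without end, and no minimal element would exist.\<close>
  define A where "A = {q. sublinear q \<and> (\<forall>x\<in>carrier V. q x \<le> p x) \<and> (\<forall>x. x \<notin> carrier V \<longrightarrow> q x = 0)}"
  define ext where "ext q = (\<lambda>x. if x \<in> carrier V then q x else (0::real))" for q
  have ext: "ext q \<in> A" if "sublinear q" "\<And>x. x \<in> carrier V \<Longrightarrow> q x \<le> p x" for q
    using that by (auto simp: A_def ext_def sublinear_def)
  define P where "P q q' \<longleftrightarrow> (\<forall>x. q' x \<le> q x)" for q q' :: "'v \<Rightarrow> real"
  have "\<exists>m\<in>A. \<forall>q\<in>A. P m q \<longrightarrow> q = m"
  proof (rule predicate_Zorn)
    show "partial_order_on A (relation_of P A)"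
      by (rule partial_order_on_relation_ofI) (auto simp: P_def fun_eq_iff intro: order_trans antisym)
    fix C assume "C \<in> Chains (relation_of P A)"
    then have CA: "C \<subseteq> A" and chain: "\<And>q q'. q \<in> C \<Longrightarrow> q' \<in> C \<Longrightarrow> P q q' \<or> P q' q"
      by (auto simp: Chains_def relation_of_def)
    show "\<exists>u\<in>A. \<forall>q\<in>C. P q u"
    proof (cases "C = {}")
      case True
      then show ?thesis using ext[OF p] by auto
    next
      case False
      define u where "u = (\<lambda>x. INF q\<in>C. q x)"
      have sub: "sublinear q" "x \<in> carrier V \<Longrightarrow> q x \<le> p x" "x \<notin> carrier V \<Longrightarrow> q x = 0" if "q \<in> C" for q x
        using that CA by (auto simp: A_def)
      have bdd: "bdd_below ((\<lambda>q. q x) ` C)" for x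
      proof (cases "x \<in> carrier V")
        case True
        then show ?thesis
          by (intro bdd_belowI2[of _ "- p ((-1) \<odot> x)"])
            (meson sublinear_lower[OF sub(1)] sub(2) smult_carrier neg_le_iff_le order_trans)
      next
        case False
        then show ?thesis by (intro bdd_belowI2[of _ 0]) (simp add: sub(3))
      qed
      have upper: "u x \<le> q x" if "q \<in> C" for q x
        unfolding u_def using bdd that by (rule cINF_lower)
      have approx: "\<exists>q\<in>C. q x < u x + e" if "e > 0" for x e
        using cInf_lessD[of "(\<lambda>q. q x) ` C" "u x + e"] that False by (auto simp: u_def)
      have "sublinear u"
        unfolding sublinear_def
      proof (intro conjI ballI allI impI)
        fix x y assume x: "x \<in> carrier V" "y \<in> carrier V"
        show "u (x \<oplus> y) \<le> u x + u y"
        proof (rule field_le_epsilon)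
          fix e :: real assume e: "e > 0"
          obtain q where q: "q \<in> C" "q x < u x + e/2" using approx[of "e/2" x] e by auto
          obtain q' where q': "q' \<in> C" "q' y < u y + e/2" using approx[of "e/2" y] e by auto
          \<comment> \<open>The smaller of the two members of the chain is good at x and at y
            simultaneously, so its own subadditivity can be used.\<close>
          obtain r where r: "r \<in> C" "r x \<le> q x" "r y \<le> q' y"
            using chain[OF q(1) q'(1)] q(1) q'(1) by (auto simp: P_def)
          have "u (x \<oplus> y) \<le> r (x \<oplus> y)" using r upper by simp
          also have "\<dots> \<le> r x + r y" using sublinearD(1)[OF sub(1)[OF r(1)]] x by simp
          finally show "u (x \<oplus> y) \<le> u x + u y + e" using q q' r by simp
        qed
      next
        fix x and t :: real assume x: "x \<in> carrier V" and t: "0 \<le> t"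
        have "(\<lambda>q. q \<zero>) ` C = {0}" using False sublinear_zero[OF sub(1)] by force
        then have u0: "u \<zero> = 0" by (simp add: u_def)
        show "u (of_real t \<odot> x) = t * u x"
        proof (rule sublinear_homI[where p = u, OF _ u0 x t])
          fix x and t :: real assume x: "x \<in> carrier V" and t: "0 < t"
          have "u (of_real t \<odot> x) \<le> t * u x + e" if e: "e > 0" for e
          proof -
            obtain q where q: "q \<in> C" "q x < u x + e/t" using approx[of "e/t" x] e t by auto
            have "u (of_real t \<odot> x) \<le> q (of_real t \<odot> x)" using q upper by simp
            also have "\<dots> = t * q x" using sublinearD(2)[OF sub(1)[OF q(1)]] x t by simp
            also have "\<dots> \<le> t * (u x + e/t)" using q t by (intro mult_left_mono) auto
            finally show ?thesis using t by (simp add: algebra_simps)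
          qed
          then show "u (of_real t \<odot> x) \<le> t * u x" by (rule field_le_epsilon)
        qed
      qed
      moreover have "u x \<le> p x" if "x \<in> carrier V" for x
        using False upper sub(2) that by (meson all_not_in_conv order_trans)
      moreover have "u x = 0" if "x \<notin> carrier V" for x
      proof -
        have "(\<lambda>q. q x) ` C = {0}" using False sub(3)[OF _ that] by force
        then show ?thesis by (simp add: u_def)
      qed
      ultimately have "u \<in> A" by (auto simp: A_def)
      then show ?thesis using upper by (auto simp: P_def)
    qed
  qed
  then obtain m where m: "m \<in> A" and min: "\<And>q. q \<in> A \<Longrightarrow> P m q \<Longrightarrow> q = m" by blast
  have sm: "sublinear m" using m by (simp add: A_def)
  have add: "m (x \<oplus> y) = m x + m y" if x: "x \<in> carrier V" and y: "y \<in> carrier V" for x y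
  proof (rule antisym)
    show "m (x \<oplus> y) \<le> m x + m y" using sublinearD(1)[OF sm] x y .
    define r where "r = (\<lambda>x. INF t\<in>{0..}. m (x \<oplus> of_real t \<odot> y) - t * m y)"
    have r: "sublinear r" "\<And>x t. x \<in> carrier V \<Longrightarrow> t \<ge> 0 \<Longrightarrow> r x \<le> m (x \<oplus> of_real t \<odot> y) - t * m y"
      using sublinear_inf_line[OF sm y] by (auto simp: r_def)
    have rm: "r x \<le> m x" if "x \<in> carrier V" for x using r(2)[OF that, of 0] that y by simp
    then have "ext r \<in> A" using r(1) m by (intro ext) (auto simp: A_def intro: order_trans)
    moreover have "P m (ext r)" using rm m by (auto simp: P_def ext_def A_def)
    ultimately have "ext r = m" by (rule min)
    then have "m x = r x" using x by (auto simp: ext_def dest: fun_cong[of _ _ x])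
    then show "m x + m y \<le> m (x \<oplus> y)" using r(2)[OF x, of 1] y by simp
  qed
  have neg: "m ((-1) \<odot> x) = - m x" if "x \<in> carrier V" for x
    using add[of x "(-1) \<odot> x"] that sublinear_zero[OF sm] by simp
  have "m (of_real t \<odot> x) = t * m x" if x: "x \<in> carrier V" for t x
  proof (cases "t \<ge> 0")
    case False
    have "m (of_real t \<odot> x) = m ((-1) \<odot> (of_real (-t) \<odot> x))" using x by (simp add: smult_smult)
    also have "\<dots> = t * m x" using neg sublinearD(2)[OF sm x, of "- t"] x False by simp
    finally show ?thesis .
  qed (use sublinearD(2)[OF sm x] in simp)
  then show thesis using that[of m] add m by (auto simp: A_def)
qed

definition convex_in :: "'v set \<Rightarrow> bool" where
  "convex_in C \<longleftrightarrow> C \<subseteq> carrier V \<and>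
     (\<forall>x\<in>C. \<forall>y\<in>C. \<forall>t\<in>{0..1::real}. of_real (1 - t) \<odot> x \<oplus> of_real t \<odot> y \<in> C)"

text \<open>Let p(x) be the infimum of |x + t w| - t e over t >= 0 and w in C. It lies below the
  norm, and t = 1 gives p(-w) <= -e for w in C, so any linear u below p has u(w) >= e. The distance
  assumption on C keeps p bounded below by minus the norm.\<close>

lemma separate_convex_real:
  assumes C: "convex_in C" "C \<noteq> {}" and e: "\<And>w. w \<in> C \<Longrightarrow> e \<le> nrm V w"
  obtains u where "\<And>x y. \<lbrakk>x \<in> carrier V; y \<in> carrier V\<rbrakk> \<Longrightarrow> u (x \<oplus> y) = u x + u y"
    and "\<And>t x. x \<in> carrier V \<Longrightarrow> u (of_real t \<odot> x) = t * u x"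
    and "\<And>x. x \<in> carrier V \<Longrightarrow> u x \<le> nrm V x" and "\<And>w. w \<in> C \<Longrightarrow> e \<le> u w"
proof -
  have CC: "w \<in> carrier V" if "w \<in> C" for w using C that by (auto simp: convex_in_def)
  define D where "D = {0::real..} \<times> C"
  define F where "F = (\<lambda>x (t, w). nrm V (x \<oplus> of_real t \<odot> w) - t * e)"
  define p where "p x = (INF d\<in>D. F x d)" for x
  have D0: "D \<noteq> {}" using C by (auto simp: D_def)
  have lower: "- nrm V x \<le> F x d" if x: "x \<in> carrier V" and d: "d \<in> D" for x d
  proof -
    obtain t w where tw: "d = (t, w)" "t \<ge> 0" "w \<in> C" using d by (auto simp: D_def)
    have "t * e \<le> t * nrm V w" using tw e by (simp add: mult_left_mono)
    also have "\<dots> = nrm V (of_real t \<odot> w)" using tw CC by (simp add: nrm_smult)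
    also have "of_real t \<odot> w = (x \<oplus> of_real t \<odot> w) \<ominus> x"
      using x CC[OF tw(3)] by (simp add: diff_conv M.a_comm[of x] M.a_assoc)
    also have "nrm V \<dots> \<le> nrm V (x \<oplus> of_real t \<odot> w) + nrm V x"
      using x CC[OF tw(3)] by (intro nrm_diff_le) auto
    finally show ?thesis by (simp add: F_def tw)
  qed
  have bdd: "bdd_below (F x ` D)" if "x \<in> carrier V" for x
    using lower[OF that] by (rule bdd_belowI2)
  have upper: "p x \<le> nrm V (x \<oplus> of_real t \<odot> w) - t * e" if "x \<in> carrier V" "t \<ge> 0" "w \<in> C" for x t w
    using cINF_lower[OF bdd[OF that(1)], of "(t, w)"] that by (simp add: p_def D_def F_def)
  have approx: "\<exists>t w. t \<ge> 0 \<and> w \<in> C \<and> nrm V (x \<oplus> of_real t \<odot> w) - t * e < p x + r" if "x \<in> carrier V" "r > 0" for x r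
    using cInf_lessD[of "F x ` D" "p x + r"] that(2) D0 by (auto simp: p_def D_def F_def)
  obtain w0 where w0: "w0 \<in> C" using C by auto
  have p_le: "p x \<le> nrm V x" if "x \<in> carrier V" for x
    using upper[OF that, of 0 w0] w0 CC that by simp
  have p0: "p \<zero> = 0"
  proof (rule antisym)
    show "p \<zero> \<le> 0" using p_le[of \<zero>] by simp
    show "0 \<le> p \<zero>" unfolding p_def using lower[of \<zero>] D0 by (intro cINF_greatest) auto
  qed
  have "sublinear p"
    unfolding sublinear_def
  proof (intro conjI ballI allI impI)
    fix x x' assume x: "x \<in> carrier V" "x' \<in> carrier V"
    show "p (x \<oplus> x') \<le> p x + p x'"
    proof (rule field_le_epsilon)
      fix r :: real assume r: "r > 0"
      obtain t w where t: "t \<ge> 0" "w \<in> C" "nrm V (x \<oplus> of_real t \<odot> w) - t * e < p x + r/2" using approx[OF x(1), of "r/2"] r by auto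
      obtain s v where s: "s \<ge> 0" "v \<in> C" "nrm V (x' \<oplus> of_real s \<odot> v) - s * e < p x' + r/2" using approx[OF x(2), of "r/2"] r by auto
      \<comment> \<open>Convexity of C enters here: t w + s v is t + s times a point of C, so the
        two witnesses merge into one.\<close>
      obtain z where z: "z \<in> C" "of_real (t + s) \<odot> z = of_real t \<odot> w \<oplus> of_real s \<odot> v"
      proof (cases "t + s = 0")
        case True
        then have "t = 0" "s = 0" using s t by auto
        then show ?thesis using that[OF w0] CC w0 s t by simp
      next
        case False
        define l where "l = s / (t + s)"
        have l: "l \<in> {0..1}" "(t + s) * l = s" "(t + s) * (1 - l) = t" using s t False by (auto simp: l_def field_simps)
        have "of_real (t + s) \<odot> (of_real (1 - l) \<odot> w \<oplus> of_real l \<odot> v) = of_real t \<odot> w \<oplus> of_real s \<odot> v"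
          using CC s t l by (simp add: smult_add_right smult_smult del: of_real_add of_real_diff flip: of_real_mult)
        moreover have "of_real (1 - l) \<odot> w \<oplus> of_real l \<odot> v \<in> C"
          using C(1) s(2) t(2) l(1) unfolding convex_in_def by blast
        ultimately show ?thesis using that by blast
      qed
      have "p (x \<oplus> x') \<le> nrm V ((x \<oplus> x') \<oplus> of_real (t + s) \<odot> z) - (t + s) * e"
        using x s t z by (intro upper) auto
      also have "(x \<oplus> x') \<oplus> of_real (t + s) \<odot> z = (x \<oplus> of_real t \<odot> w) \<oplus> (x' \<oplus> of_real s \<odot> v)"
        using x s t z(2) CC by (simp add: vs_ac)
      also have "nrm V \<dots> \<le> nrm V (x \<oplus> of_real t \<odot> w) + nrm V (x' \<oplus> of_real s \<odot> v)"
        using x s t CC by (intro nrm_triangle) auto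
      finally show "p (x \<oplus> x') \<le> p x + p x' + r" using s t by (simp add: algebra_simps)
    qed
  next
    fix x and t :: real assume x: "x \<in> carrier V" and t: "0 \<le> t"
    show "p (of_real t \<odot> x) = t * p x"
    proof (rule sublinear_homI[where p = p, OF _ p0 x t])
      fix x and t :: real assume x: "x \<in> carrier V" and t: "0 < t"
      have "p (of_real t \<odot> x) \<le> t * p x + r" if r: "r > 0" for r
      proof -
        obtain s w where s: "s \<ge> 0" "w \<in> C" "nrm V (x \<oplus> of_real s \<odot> w) - s * e < p x + r/t"
          using approx[OF x, of "r/t"] r t by auto
        have "p (of_real t \<odot> x) \<le> nrm V (of_real t \<odot> x \<oplus> of_real (t * s) \<odot> w) - (t * s) * e"
          using x s t by (intro upper) auto
        also have "of_real t \<odot> x \<oplus> of_real (t * s) \<odot> w = of_real t \<odot> (x \<oplus> of_real s \<odot> w)"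
          using x CC[OF s(2)] by (simp add: smult_add_right smult_smult)
        also have "nrm V \<dots> - (t * s) * e = t * (nrm V (x \<oplus> of_real s \<odot> w) - s * e)"
          using x CC[OF s(2)] t by (simp add: algebra_simps nrm_smult)
        also have "\<dots> \<le> t * (p x + r/t)" using s t by (intro mult_left_mono) auto
        finally show ?thesis using t by (simp add: algebra_simps)
      qed
      then show "p (of_real t \<odot> x) \<le> t * p x" by (rule field_le_epsilon)
    qed
  qed
  then obtain u where u: "\<And>x y. \<lbrakk>x \<in> carrier V; y \<in> carrier V\<rbrakk> \<Longrightarrow> u (x \<oplus> y) = u x + u y"
    "\<And>t x. x \<in> carrier V \<Longrightarrow> u (of_real t \<odot> x) = t * u x" "\<And>x. x \<in> carrier V \<Longrightarrow> u x \<le> p x"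
    using sublinear_dominates_additive by metis
  have "e \<le> u w" if w: "w \<in> C" for w
  proof -
    have "u (of_real (-1) \<odot> w) \<le> p (of_real (-1) \<odot> w)" using u(3) CC[OF w] by simp
    also have "\<dots> \<le> nrm V (of_real (-1) \<odot> w \<oplus> of_real 1 \<odot> w) - 1 * e"
      by (rule upper) (simp_all only: smult_carrier CC[OF w] w zero_le_one)
    also have "of_real (-1) \<odot> w \<oplus> of_real 1 \<odot> w = \<zero>" using CC[OF w] by (simp add: M.a_comm)
    finally show ?thesis using u(2)[OF CC[OF w], of "-1"] by simp
  qed
  moreover have "u x \<le> nrm V x" if "x \<in> carrier V" for x
    using u(3)[OF that] p_le[OF that] by simp
  ultimately show ?thesis using that u(1,2) by blast
qed

end

text \<open>The scalar-valued functional is recovered from its pairing with \<open>1\<close>, because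
  \<open>\<mu> \<mapsto> (\<lambda> \<mapsto> (\<lambda> * \<mu>) \<bullet> 1)\<close> is an injective, hence bijective, linear map from the field to its real dual.\<close>

lemma real_functional_imp_functional:
  fixes V :: "('k::{real_normed_field, euclidean_space}, 'v) normed_vs"
  assumes V: "normed_vector_space V"
    and add: "\<And>x y. \<lbrakk>x \<in> carrier V; y \<in> carrier V\<rbrakk> \<Longrightarrow> u (x \<oplus>\<^bsub>V\<^esub> y) = u x + u y"
    and sm: "\<And>t x. x \<in> carrier V \<Longrightarrow> u (of_real t \<odot>\<^bsub>V\<^esub> x) = t * u x"
    and le: "\<And>x. x \<in> carrier V \<Longrightarrow> u x \<le> nrm V x"
  obtains \<phi> where "\<phi> \<in> dual_ball V" "\<And>x. x \<in> carrier V \<Longrightarrow> \<phi> x \<bullet> 1 = u x"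
proof -
  interpret normed_vector_space V by fact
  define L where "L \<mu> = (\<Sum>b\<in>Basis. ((b * \<mu>) \<bullet> (1::'k)) *\<^sub>R b)" for \<mu> :: 'k
  have linL: "linear L"
    by (rule linearI) (simp_all add: L_def distrib_left inner_add_left scaleR_left_distrib sum.distrib scaleR_sum_right)
  have L_inner: "L \<mu> \<bullet> l = (l * \<mu>) \<bullet> 1" for \<mu> l
  proof -
    have "(l * \<mu>) \<bullet> 1 = ((\<Sum>b\<in>Basis. (l \<bullet> b) *\<^sub>R b) * \<mu>) \<bullet> 1" by (simp add: euclidean_representation)
    also have "\<dots> = (\<Sum>b\<in>Basis. (l \<bullet> b) * ((b * \<mu>) \<bullet> 1))" by (simp add: sum_distrib_right inner_sum_left)
    also have "\<dots> = L \<mu> \<bullet> l" by (simp add: L_def inner_sum_left inner_sum_right inner_commute[of _ l] mult.commute)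
    finally show ?thesis by simp
  qed
  have one: "(1::'k) \<bullet> 1 = 1" by (simp add: dot_square_norm)
  have "inj L"
    unfolding linear_injective_0[OF linL]
  proof (intro allI impI)
    fix \<mu> :: 'k assume "L \<mu> = 0"
    then have "(inverse \<mu> * \<mu>) \<bullet> 1 = 0" by (simp flip: L_inner)
    then show "\<mu> = 0" using one by (cases "\<mu> = 0") auto
  qed
  then have "surj L" by (rule linear_injective_imp_surjective[OF linL _ refl])
  \<comment> \<open>The coordinates of \<open>L (\<phi> x)\<close> are prescribed to be the values
    of u at b x for the basis scalars b; surjectivity of L provides the scalar.\<close>
  define \<phi> where "\<phi> x = (SOME \<mu>. L \<mu> = (\<Sum>b\<in>Basis. u (b \<odot>\<^bsub>V\<^esub> x) *\<^sub>R b))" for x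
  have L\<phi>: "L (\<phi> x) = (\<Sum>b\<in>Basis. u (b \<odot>\<^bsub>V\<^esub> x) *\<^sub>R b)" for x
    unfolding \<phi>_def by (rule someI_ex) (metis \<open>surj L\<close> surjD)
  have usum: "u ((\<Sum>b\<in>B. of_real (c b) * b) \<odot>\<^bsub>V\<^esub> x) = (\<Sum>b\<in>B. c b * u (b \<odot>\<^bsub>V\<^esub> x))"
    if "finite B" "x \<in> carrier V" for B c x
    using that
  proof (induction B rule: finite_induct)
    case empty
    then show ?case using sm[of "\<zero>\<^bsub>V\<^esub>" 0] by simp
  next
    case (insert b B)
    then show ?case by (simp add: smult_add_left add flip: smult_smult sm)
  qed
  have key: "(l * \<phi> x) \<bullet> 1 = u (l \<odot>\<^bsub>V\<^esub> x)" if x: "x \<in> carrier V" for l x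
  proof -
    have "(l * \<phi> x) \<bullet> 1 = (\<Sum>b\<in>Basis. (l \<bullet> b) * u (b \<odot>\<^bsub>V\<^esub> x))"
      by (simp add: L\<phi> inner_sum_right inner_commute[of _ l] mult.commute flip: L_inner)
    also have "\<dots> = u ((\<Sum>b\<in>Basis. of_real (l \<bullet> b) * b) \<odot>\<^bsub>V\<^esub> x)" using x by (simp add: usum)
    also have "(\<Sum>b\<in>Basis. of_real (l \<bullet> b) * b) = l"
      using euclidean_representation[of l] by (simp add: scaleR_conv_of_real)
    finally show ?thesis .
  qed
  have uniq: "\<mu> = \<phi> x" if "\<And>l. (l * \<mu>) \<bullet> 1 = u (l \<odot>\<^bsub>V\<^esub> x)" "x \<in> carrier V" for \<mu> x
  proof -
    have "L \<mu> \<bullet> l = L (\<phi> x) \<bullet> l" for l using that key by (simp add: L_inner)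
    then have "L \<mu> = L (\<phi> x)" by (metis inner_commute vector_eq_rdot)
    then show ?thesis using \<open>inj L\<close> by (simp add: inj_eq)
  qed
  have "linear_op V scalars \<phi>"
    unfolding linear_op_def
  proof (intro conjI ballI allI)
    fix x y assume x: "x \<in> carrier V" "y \<in> carrier V"
    have "\<phi> x + \<phi> y = \<phi> (x \<oplus>\<^bsub>V\<^esub> y)"
      by (rule uniq) (use x in \<open>simp_all add: distrib_left inner_add_left key smult_add_right add\<close>)
    then show "\<phi> (x \<oplus>\<^bsub>V\<^esub> y) = \<phi> x \<oplus>\<^bsub>scalars\<^esub> \<phi> y" by simp
  next
    fix a x assume x: "x \<in> carrier V"
    have "a * \<phi> x = \<phi> (a \<odot>\<^bsub>V\<^esub> x)"
      by (rule uniq) (use x in \<open>simp_all add: key smult_smult flip: mult.assoc\<close>)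
    then show "\<phi> (a \<odot>\<^bsub>V\<^esub> x) = a \<odot>\<^bsub>scalars\<^esub> \<phi> x" by simp
  qed simp
  moreover have "norm (\<phi> x) \<le> nrm V x" if x: "x \<in> carrier V" for x
  proof (cases "\<phi> x = 0")
    case False
    \<comment> \<open>A unimodular factor turns \<open>\<phi> x\<close> into its absolute value,
      whose pairing with 1 is itself; the real estimate at l x thus bounds the modulus.\<close>
    define l where "l = of_real (norm (\<phi> x)) / \<phi> x"
    have "norm (\<phi> x) = (of_real (norm (\<phi> x)) :: 'k) \<bullet> 1"
      by (simp add: of_real_def one)
    also have "\<dots> = u (l \<odot>\<^bsub>V\<^esub> x)" using False by (simp add: l_def flip: key[OF x])
    also have "\<dots> \<le> nrm V (l \<odot>\<^bsub>V\<^esub> x)" using x by (intro le) simp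
    also have "\<dots> = nrm V x" using x False by (simp add: nrm_smult l_def norm_divide)
    finally show ?thesis .
  qed (use x nrm_nonneg in simp)
  ultimately have "\<phi> \<in> dual_ball V" by (simp add: dual_ball_def)
  moreover have "\<phi> x \<bullet> 1 = u x" if "x \<in> carrier V" for x using key[OF that, of 1] that by simp
  ultimately show thesis by (rule that)
qed

text \<open>For the two scalar fields the pairing with 1 is the real part. This is the geometric
  Hahn-Banach theorem for a convex set outside the open ball of radius e.\<close>

lemma separate_convex:
  fixes V :: "('k::{real_normed_field, euclidean_space}, 'v) normed_vs"
  assumes V: "normed_vector_space V"
    and C: "normed_vector_space.convex_in V C" "C \<noteq> {}" and e: "\<And>w. w \<in> C \<Longrightarrow> e \<le> nrm V w"
  obtains \<phi> where "\<phi> \<in> dual_ball V" "\<And>w. w \<in> C \<Longrightarrow> e \<le> \<phi> w \<bullet> 1"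
proof -
  interpret normed_vector_space V by fact
  obtain u where u: "\<And>x y. \<lbrakk>x \<in> carrier V; y \<in> carrier V\<rbrakk> \<Longrightarrow> u (x \<oplus>\<^bsub>V\<^esub> y) = u x + u y"
     "\<And>t x. x \<in> carrier V \<Longrightarrow> u (of_real t \<odot>\<^bsub>V\<^esub> x) = t * u x"
     "\<And>x. x \<in> carrier V \<Longrightarrow> u x \<le> nrm V x" "\<And>w. w \<in> C \<Longrightarrow> e \<le> u w"
    using separate_convex_real[OF C e] by blast
  obtain \<phi> where "\<phi> \<in> dual_ball V" "\<And>x. x \<in> carrier V \<Longrightarrow> \<phi> x \<bullet> 1 = u x"
    using real_functional_imp_functional[OF V u(1-3)] by blast
  then show thesis using that u(4) C(1) by (metis convex_in_def subsetD)
qed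

lemma inner_one_le_norm: "x \<bullet> (1::'k::{real_normed_field, euclidean_space}) \<le> norm x"
  using norm_cauchy_schwarz[of x 1] by simp

text \<open>The convex set to be separated is {x}, with e = \<open>nrm V x\<close>.\<close>

lemma norming_functional:
  fixes V :: "('k::{real_normed_field, euclidean_space}, 'v) normed_vs"
  assumes V: "normed_vector_space V" and x: "x \<in> carrier V"
  obtains \<phi> where "\<phi> \<in> dual_ball V" "norm (\<phi> x) = nrm V x"
proof -
  interpret normed_vector_space V by fact
  have "convex_in {x}"
    using x smult_add_left[of x "of_real (1 - t)" "of_real t" for t] by (auto simp: convex_in_def)
  then obtain \<phi> where "\<phi> \<in> dual_ball V" "nrm V x \<le> \<phi> x \<bullet> 1"
    using separate_convex[OF V, of "{x}" "nrm V x"] by auto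
  then show thesis using that[of \<phi>] x inner_one_le_norm[of "\<phi> x"] by (force simp: dual_ball_def)
qed


section \<open>Testing vectors against the dual unit ball\<close>

lemma dual_ballD:
  assumes "\<phi> \<in> dual_ball V"
  shows "\<And>x y. \<lbrakk>x \<in> carrier V; y \<in> carrier V\<rbrakk> \<Longrightarrow> \<phi> (x \<oplus>\<^bsub>V\<^esub> y) = \<phi> x + \<phi> y"
    and "\<And>a x. x \<in> carrier V \<Longrightarrow> \<phi> (a \<odot>\<^bsub>V\<^esub> x) = a * \<phi> x"
    and "\<And>x. x \<in> carrier V \<Longrightarrow> norm (\<phi> x) \<le> nrm V x"
  using assms by (auto simp: dual_ball_def linear_op_def)

lemma dual_ball_diff:
  "\<lbrakk>normed_vector_space V; \<phi> \<in> dual_ball V; x \<in> carrier V; y \<in> carrier V\<rbrakk> \<Longrightarrow> \<phi> (x \<ominus>\<^bsub>V\<^esub> y) = \<phi> x - \<phi> y"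
  by (rule linear_op_scalars_diff) (auto simp: dual_ball_def)

lemma dual_ball_operator: "normed_vector_space V \<Longrightarrow> \<phi> \<in> dual_ball V \<Longrightarrow> operator V scalars \<phi>"
  unfolding operator_scalars_iff by (auto simp: dual_ball_def intro: exI[of _ 1])

lemma nrm_le_by_functionals:
  fixes V :: "('k::{real_normed_field, euclidean_space}, 'v) normed_vs"
  assumes "normed_vector_space V" "x \<in> carrier V" "\<And>\<phi>. \<phi> \<in> dual_ball V \<Longrightarrow> norm (\<phi> x) \<le> r"
  shows "nrm V x \<le> r"
  using norming_functional[OF assms(1,2)] assms(3) by metis

text \<open>Reduces vector identities to scalar ones, where \<open>algebra_simps\<close> is
  available; the convexity computations below rely on this.\<close>

lemma eq_by_functionals:
  fixes V :: "('k::{real_normed_field, euclidean_space}, 'v) normed_vs"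
  assumes V: "normed_vector_space V" and x: "x \<in> carrier V" "y \<in> carrier V"
    and eq: "\<And>\<phi>. \<phi> \<in> dual_ball V \<Longrightarrow> \<phi> x = \<phi> y"
  shows "x = y"
proof -
  interpret normed_vector_space V by fact
  have "nrm V (x \<ominus>\<^bsub>V\<^esub> y) \<le> 0"
    by (rule nrm_le_by_functionals[OF V]) (use x eq in \<open>auto simp: dual_ball_diff[OF V]\<close>)
  then show ?thesis using x nrm_nonneg[of "x \<ominus>\<^bsub>V\<^esub> y"] by (simp add: nrm_eq_0_iff diff_eq_zero_iff)
qed

section \<open>The weak topology\<close>

lemma openin_weak_topology:
  "operator V scalars \<phi> \<Longrightarrow> open U \<Longrightarrow> openin (weak_topology V) {x \<in> carrier V. \<phi> x \<in> U}"
  unfolding weak_topology_def by (rule topology_generated_by_Basis) blast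

lemma topspace_weak_topology [simp]:
  fixes V :: "('k::real_normed_field, 'v) normed_vs"
  assumes "normed_vector_space V" shows "topspace (weak_topology V) = carrier V"
proof -
  \<comment> \<open>The zero functional exhibits the whole carrier as a set of the generating
    family.\<close>
  have "operator V scalars (\<lambda>x. 0)"
    unfolding operator_scalars_iff[OF assms] by (auto simp: linear_op_def intro: exI[of _ 0])
  then have "carrier V = {x \<in> carrier V. (\<lambda>x. 0) x \<in> UNIV} \<and> operator V scalars (\<lambda>x. 0) \<and> open (UNIV :: 'k set)"
    by auto
  then show ?thesis unfolding weak_topology_def topology_generated_by_topspace by blast
qed

lemma continuous_map_weak_topology:
  "normed_vector_space V \<Longrightarrow> operator V scalars \<phi> \<Longrightarrow> continuous_map (weak_topology V) euclidean \<phi>"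
  by (auto simp: continuous_map_def openin_weak_topology)

lemma limitin_weak_topologyD:
  assumes "normed_vector_space V" "limitin (weak_topology V) s l sequentially" "operator V scalars \<phi>"
  shows "(\<lambda>n. \<phi> (s n)) \<longlonglongrightarrow> \<phi> l"
  using continuous_map_limit[OF continuous_map_weak_topology[OF assms(1,3)] assms(2)]
  by (simp add: o_def)

lemma compactin_indexed_cover:
  assumes "compactin X K" "\<And>z. z \<in> K \<Longrightarrow> openin X (U z) \<and> z \<in> U z"
  obtains D where "finite D" "D \<subseteq> K" "K \<subseteq> (\<Union>z\<in>D. U z)"
proof -
  have "\<forall>V\<in>U ` K. openin X V" "K \<subseteq> \<Union>(U ` K)" using assms(2) by auto
  then obtain \<F> where \<F>: "finite \<F>" "\<F> \<subseteq> U ` K" "K \<subseteq> \<Union>\<F>"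
    using assms(1)[unfolded compactin_def, THEN conjunct2, rule_format, of "U ` K"] by blast
  then obtain D where "finite D" "D \<subseteq> K" "\<F> = U ` D" using finite_subset_image by metis
  then show thesis using that \<F>(3) by blast
qed

text \<open>A cluster point replaces a convergent subsequence: the weak topology is not known to be
  first countable, and the Eberlein-Smulian theorem is avoided in this way.\<close>

lemma compactin_cluster_point:
  assumes K: "compactin X K" and y: "\<And>n::nat. y n \<in> K"
  obtains z where "z \<in> K" "\<And>U N. openin X U \<Longrightarrow> z \<in> U \<Longrightarrow> \<exists>n\<ge>N. y n \<in> U"
proof (rule ccontr)
  assume no: "\<not> thesis"
  note found = that
  have "\<exists>U N. openin X U \<and> z \<in> U \<and> (\<forall>n\<ge>N. y n \<notin> U)" if z: "z \<in> K" for z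
  proof (rule ccontr)
    assume "\<not> ?thesis"
    then have "\<And>U N. openin X U \<Longrightarrow> z \<in> U \<Longrightarrow> \<exists>n\<ge>N. y n \<in> U" by blast
    then show False using found[OF z] no by blast
  qed
  then obtain U N where U: "\<And>z. z \<in> K \<Longrightarrow> openin X (U z) \<and> z \<in> U z \<and> (\<forall>n\<ge>N z. y n \<notin> U z)" by metis
  obtain D where D: "finite D" "D \<subseteq> K" "K \<subseteq> (\<Union>z\<in>D. U z)"
  proof (rule compactin_indexed_cover[OF K])
    show "openin X (U z) \<and> z \<in> U z" if "z \<in> K" for z using U[OF that] by simp
  qed
  \<comment> \<open>The sum dominates every N z, so the term with index m avoids all the covering
    sets.\<close>
  define m where "m = (\<Sum>z\<in>D. N z)"
  obtain z where "z \<in> D" "y m \<in> U z" using D y by blast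
  moreover have "N z \<le> m" unfolding m_def using D \<open>z \<in> D\<close> by (simp add: member_le_sum)
  ultimately show False using U D by blast
qed

text \<open>The only form in which weak compactness of an operator enters the scattered
  direction.\<close>

lemma weakly_compact_op_cluster_point:
  assumes V: "normed_vector_space V" and W: "normed_vector_space W" and T: "linear_op V W T" "weakly_compact_op V W T"
    and x: "\<And>n::nat. x n \<in> carrier V" "\<And>n. nrm V (x n) \<le> R"
  obtains z where "z \<in> carrier W"
    "\<And>\<phi> e N. \<lbrakk>operator W scalars \<phi>; 0 < e\<rbrakk> \<Longrightarrow> \<exists>n\<ge>N. norm (\<phi> (T (x n)) - \<phi> z) < e"
proof -
  interpret V: normed_vector_space V by fact
  define B where "B = {v \<in> carrier V. nrm V v \<le> R}"
  have "B \<subseteq> V.ms.mcball \<zero>\<^bsub>V\<^esub> R"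
    by (auto simp: B_def V.ms.mcball_def V.nrm_dist_eq) (metis V.diff_conv V.nrm_diff_commute V.smult_zero V.zero_carrier V.M.r_zero)
  then have "V.ms.mbounded B" unfolding V.ms.mbounded_def by blast
  then have c: "compactin (weak_topology W) (weak_topology W closure_of (T ` B))"
    using T by (simp add: weakly_compact_op_def)
  have "T ` B \<subseteq> topspace (weak_topology W)"
    using linear_opD(1)[OF T(1)] by (auto simp: B_def topspace_weak_topology[OF W])
  then have "T (x n) \<in> weak_topology W closure_of (T ` B)" for n
    using x closure_of_subset[of "T ` B" "weak_topology W"] by (auto simp: B_def)
  then obtain z where z: "z \<in> weak_topology W closure_of (T ` B)"
    "\<And>U N. openin (weak_topology W) U \<Longrightarrow> z \<in> U \<Longrightarrow> \<exists>n\<ge>N. T (x n) \<in> U"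
    using compactin_cluster_point[OF c, of "\<lambda>n. T (x n)"] by blast
  have zW: "z \<in> carrier W" using z(1) closure_of_subset_topspace[of "weak_topology W"] by (auto simp: topspace_weak_topology[OF W])
  show thesis
  proof
    fix \<phi> e N assume \<phi>: "operator W scalars \<phi>" and e: "(0::real) < e"
    show "\<exists>n\<ge>N. norm (\<phi> (T (x n)) - \<phi> z) < e"
      using z(2)[OF openin_weak_topology[OF \<phi>, of "ball (\<phi> z) e"], of N] zW e by (auto simp: dist_norm norm_minus_commute)
  qed fact
qed

text \<open>A signed series \<open>\<Sum>k. \<plusminus> 3\<^sup>-\<^sup>k \<phi>\<^sub>k\<close> of norming functionals: each sign is chosen so that the partial
  sum does not cancel at the \<open>k\<close>-th vector, and the tail is too small to spoil this.\<close>

lemma weakly_bounded_imp_bounded: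
  fixes V :: "('k::{real_normed_field, euclidean_space}, 'v) normed_vs"
  assumes V: "normed_vector_space V" and z: "\<And>n::nat. z n \<in> carrier V"
    and bd: "\<And>\<phi>. operator V scalars \<phi> \<Longrightarrow> \<exists>M. \<forall>n. norm (\<phi> (z n)) \<le> M"
  obtains R where "\<And>n. nrm V (z n) \<le> R"
proof (rule ccontr)
  assume "\<not> thesis"
  interpret normed_vector_space V by fact
  \<comment> \<open>The partial sum up to k will have modulus at least |w_k| / 3^k at w_k, and the
    tail at most half of that. The limit functional then exceeds half of |w_k| / 3^k there, hence
    exceeds k.\<close>
  have "\<exists>n. 2 * 3 ^ k * real k < nrm V (z n)" for k
    using \<open>\<not> thesis\<close> that by (meson not_le)
  then obtain m where m: "\<And>k. 2 * 3 ^ k * real k < nrm V (z (m k))" by metis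
  define w where "w k = z (m k)" for k
  have w: "w k \<in> carrier V" for k by (simp add: w_def z)
  have "\<exists>\<phi>. \<phi> \<in> dual_ball V \<and> norm (\<phi> (w k)) = nrm V (w k)" for k
    using norming_functional[OF V w] by blast
  then obtain \<phi> where \<phi>: "\<And>k. \<phi> k \<in> dual_ball V" "\<And>k. norm (\<phi> k (w k)) = nrm V (w k)"
    by metis
  define P where "P S \<longleftrightarrow> linear_op V scalars S" for S :: "'v \<Rightarrow> 'k"
  define Q where "Q k S S' \<longleftrightarrow> (\<forall>x\<in>carrier V. norm (S' x - S x) \<le> (1/3)^k * nrm V x) \<and> (1/3)^k * nrm V (w k) \<le> norm (S' (w k))" for k and S S' :: "'v \<Rightarrow> 'k"
  have "\<exists>S. S 0 = (\<lambda>x. 0) \<and> (\<forall>n. P (S n)) \<and> (\<forall>n. Q n (S n) (S (Suc n)))"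
  proof -
    have P0: "P (\<lambda>x. 0)" by (simp add: P_def linear_op_def)
    have step: "\<exists>S'. P S' \<and> Q k S S'" if S: "P S" for k S
    proof -
      define a where "a = (of_real ((1/3)^k) :: 'k)"
      have na: "norm a = (1/3)^k" by (simp add: a_def norm_power norm_divide)
      have lin: "P (\<lambda>x. S x + c * \<phi> k x)" for c
        using S dual_ballD[OF \<phi>(1)[of k]] by (auto simp: P_def linear_op_def algebra_simps)
      have bdd: "norm ((S x + c * \<phi> k x) - S x) \<le> (1/3)^k * nrm V x" if "x \<in> carrier V" "norm c = (1/3)^k" for x c
        using that dual_ballD(3)[OF \<phi>(1)[of k] that(1)] by (simp add: norm_mult mult_left_mono)
      \<comment> \<open>The values for the two signs differ by twice |w_k| / 3^k, so one of them has
        at least modulus |w_k| / 3^k.\<close>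
      have "2 * ((1/3)^k * nrm V (w k)) = norm ((S (w k) + a * \<phi> k (w k)) - (S (w k) + (- a) * \<phi> k (w k)))"
        by (simp add: norm_mult na \<phi>(2) flip: mult_2)
      also have "\<dots> \<le> norm (S (w k) + a * \<phi> k (w k)) + norm (S (w k) + (- a) * \<phi> k (w k))"
        by (rule norm_triangle_ineq4)
      finally consider "(1/3)^k * nrm V (w k) \<le> norm (S (w k) + a * \<phi> k (w k))" | "(1/3)^k * nrm V (w k) \<le> norm (S (w k) + (- a) * \<phi> k (w k))"
        by linarith
      then show ?thesis
      proof cases
        case 1
        then show ?thesis using lin[of a] bdd[of _ a] na by (intro exI[of _ "\<lambda>x. S x + a * \<phi> k x"]) (simp add: Q_def)
      next
        case 2
        then show ?thesis using lin[of "-a"] bdd[of _ "-a"] na by (intro exI[of _ "\<lambda>x. S x + (-a) * \<phi> k x"]) (simp add: Q_def)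
      qed
    qed
    have "\<exists>S. \<forall>n. (P (S n) \<and> (n = 0 \<longrightarrow> S n = (\<lambda>x. 0))) \<and> Q n (S n) (S (Suc n))"
      by (rule dependent_nat_choice) (use P0 step in auto)
    then show ?thesis by metis
  qed
  then obtain S where S0: "S 0 = (\<lambda>x. 0)" and SP: "\<And>n. linear_op V scalars (S n)"
    and Sd: "\<And>n x. x \<in> carrier V \<Longrightarrow> norm (S (Suc n) x - S n x) \<le> (1/3)^n * nrm V x"
    and Sw: "\<And>n. (1/3)^n * nrm V (w n) \<le> norm (S (Suc n) (w n))"
    by (auto simp: P_def Q_def)
  define d where "d n x = S (Suc n) x - S n x" for n x
  have Ssum: "S n x = (\<Sum>j<n. d j x)" for n x by (induction n) (auto simp: S0 d_def)
  have geo: "summable (\<lambda>n. (1/3)^n * nrm V x)" for x by (intro summable_mult2 summable_geometric) simp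
  have dsum: "summable (\<lambda>n. d n x)" "summable (\<lambda>n. norm (d n x))" if "x \<in> carrier V" for x
    using that Sd geo[of x] by (auto simp: d_def intro!: summable_comparison_test'[OF geo[of x]])
  have dlin: "d n (x \<oplus>\<^bsub>V\<^esub> y) = d n x + d n y" "d n (a \<odot>\<^bsub>V\<^esub> x) = a * d n x"
    if "x \<in> carrier V" "y \<in> carrier V" for n a x y
    using that linear_op_scalarsD[OF SP] by (auto simp: d_def algebra_simps)
  define \<psi> where "\<psi> x = (\<Sum>n. d n x)" for x
  have "linear_op V scalars \<psi>"
    using dsum(1) dlin by (auto simp: linear_op_def \<psi>_def suminf_add suminf_mult)
  moreover have tail: "norm (\<psi> x - S n x) \<le> (1/3)^n * (3/2) * nrm V x" if "x \<in> carrier V" for x n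
  proof -
    have "\<psi> x - S n x = (\<Sum>j. d (j + n) x)"
      unfolding \<psi>_def Ssum using suminf_split_initial_segment[OF dsum(1)[OF that], of n] by simp
    also have "norm \<dots> \<le> (\<Sum>j. norm (d (j + n) x))"
      using dsum(2)[OF that] by (intro summable_norm) (simp add: summable_iff_shift[of "\<lambda>j. norm (d j x)"])
    also have "\<dots> \<le> (\<Sum>j. (1/3)^(j+n) * nrm V x)"
    proof (rule suminf_le)
      show "summable (\<lambda>j. norm (d (j + n) x))"
        using dsum(2)[OF that] by (simp only: summable_iff_shift[of "\<lambda>j. norm (d j x)"])
      show "summable (\<lambda>j. (1/3)^(j + n) * nrm V x)"
        using geo[of x] by (simp only: summable_iff_shift[of "\<lambda>j. (1/3)^j * nrm V x"])
    qed (use Sd[OF that] in \<open>simp add: d_def\<close>)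
    also have "\<dots> = (\<Sum>j. (1/3)^j * ((1/3)^n * nrm V x))" by (simp add: power_add mult_ac)
    also have "\<dots> = (\<Sum>j. (1/3)^j) * ((1/3)^n * nrm V x)"
      by (rule suminf_mult2[symmetric]) (simp add: summable_geometric)
    also have "\<dots> = (1/3)^n * (3/2) * nrm V x" by (simp add: suminf_geometric)
    finally show ?thesis .
  qed
  ultimately have "operator V scalars \<psi>"
    unfolding operator_scalars_iff[OF V] using tail[of _ 0] by (auto simp: S0 intro!: exI[of _ "3/2"])
  then obtain M where M: "\<And>n. norm (\<psi> (z n)) \<le> M" using bd by blast
  obtain k :: nat where k: "M < real k" using reals_Archimedean2 by blast
  have "(1/3)^k * nrm V (w k) \<le> norm (S (Suc k) (w k))" by (rule Sw)
  also have "\<dots> \<le> norm (\<psi> (w k)) + norm (\<psi> (w k) - S (Suc k) (w k))"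
    by (metis norm_triangle_sub norm_minus_commute)
  also have "\<dots> \<le> M + (1/3)^Suc k * (3/2) * nrm V (w k)"
    using M[of "m k"] tail[OF w, of k "Suc k"] by (simp add: w_def)
  finally have "(1/3)^k * nrm V (w k) \<le> 2 * M" by simp
  moreover have "(1/3)^k * nrm V (w k) > (1/3)^k * (2 * 3^k * real k)"
    using m[of k] by (intro mult_strict_left_mono) (auto simp: w_def)
  moreover have "(1/3)^k * (2 * 3^k * real k) = 2 * real k" by (simp add: power_divide)
  ultimately show False using k by simp
qed

section \<open>Small oscillation of weakly compact images\<close>

definition totally_bounded_in :: "('k::real_normed_field, 'v) normed_vs \<Rightarrow> 'v set \<Rightarrow> bool" where
  "totally_bounded_in V C \<longleftrightarrow> C \<subseteq> carrier V \<and>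
     (\<forall>e>0. \<exists>D. finite D \<and> D \<subseteq> carrier V \<and> (\<forall>c\<in>C. \<exists>d\<in>D. nrm V (c \<ominus>\<^bsub>V\<^esub> d) \<le> e))"

text \<open>For convex C this is the convex hull of C and w. Growing hulls one point at a time
  preserves convexity and total boundedness without general convex combinations.\<close>

definition join_point :: "('k::real_normed_field, 'v) normed_vs \<Rightarrow> 'v set \<Rightarrow> 'v \<Rightarrow> 'v set" where
  "join_point V C w = {of_real (1 - t) \<odot>\<^bsub>V\<^esub> c \<oplus>\<^bsub>V\<^esub> of_real t \<odot>\<^bsub>V\<^esub> w | t c. c \<in> C \<and> t \<in> {0..1::real}}"

lemma join_point_contains:
  assumes V: "normed_vector_space V" and "C \<subseteq> carrier V" "w \<in> carrier V" "C \<noteq> {}"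
  shows "C \<subseteq> join_point V C w" "w \<in> join_point V C w" "join_point V C w \<subseteq> carrier V"
proof -
  interpret normed_vector_space V by fact
  show "C \<subseteq> join_point V C w"
  proof
    fix c assume "c \<in> C"
    then show "c \<in> join_point V C w" unfolding join_point_def
      using assms by (intro CollectI exI[of _ 0] exI[of _ c]) auto
  qed
  obtain c where "c \<in> C" using assms by auto
  then show "w \<in> join_point V C w" unfolding join_point_def
    using assms by (intro CollectI exI[of _ 1] exI[of _ c]) auto
  show "join_point V C w \<subseteq> carrier V" using assms by (auto simp: join_point_def)
qed

lemma convex_join_point:
  fixes V :: "('k::{real_normed_field, euclidean_space}, 'v) normed_vs"
  assumes V: "normed_vector_space V" and C: "normed_vector_space.convex_in V C" "C \<noteq> {}" and w: "w \<in> carrier V"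
  shows "normed_vector_space.convex_in V (join_point V C w)"
proof -
  interpret normed_vector_space V by fact
  have CC: "c \<in> carrier V" if "c \<in> C" for c using that C by (auto simp: convex_in_def)
  show ?thesis
    unfolding convex_in_def
  proof (intro conjI ballI)
    show "join_point V C w \<subseteq> carrier V" using join_point_contains[OF V _ w C(2)] CC by blast
    fix x y s assume x: "x \<in> join_point V C w" and y: "y \<in> join_point V C w" and s: "s \<in> {0..1::real}"
    obtain t c where x': "x = of_real (1 - t) \<odot>\<^bsub>V\<^esub> c \<oplus>\<^bsub>V\<^esub> of_real t \<odot>\<^bsub>V\<^esub> w" "c \<in> C" "t \<in> {0..1}"
      using x by (auto simp: join_point_def)
    obtain t' c' where y': "y = of_real (1 - t') \<odot>\<^bsub>V\<^esub> c' \<oplus>\<^bsub>V\<^esub> of_real t' \<odot>\<^bsub>V\<^esub> w" "c' \<in> C" "t' \<in> {0..1}"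
      using y by (auto simp: join_point_def)
    \<comment> \<open>The weight of w in the combination is 1 - a - b; the remaining a + b falls on
      c and c' in the proportion l. For a + b = 0 any l in [0,1] would do.\<close>
    define a where "a = (1 - s) * (1 - t)"
    define b where "b = s * (1 - t')"
    define l where "l = (if a + b = 0 then 0 else b / (a + b))"
    have ab: "a \<ge> 0" "b \<ge> 0" "a \<le> 1 - s" "b \<le> s" using s x' y' by (auto simp: a_def b_def mult_left_le)
    have l: "l \<in> {0..1}" "(a + b) * l = b" "(a + b) * (1 - l) = a"
      using ab by (auto simp: l_def field_simps add_nonneg_eq_0_iff)
    define c'' where "c'' = of_real (1 - l) \<odot>\<^bsub>V\<^esub> c \<oplus>\<^bsub>V\<^esub> of_real l \<odot>\<^bsub>V\<^esub> c'"
    have c'': "c'' \<in> C" using C(1) x'(2) y'(2) l(1) unfolding convex_in_def c''_def by blast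
    have "of_real (1 - s) \<odot>\<^bsub>V\<^esub> x \<oplus>\<^bsub>V\<^esub> of_real s \<odot>\<^bsub>V\<^esub> y =
        of_real (1 - (1 - a - b)) \<odot>\<^bsub>V\<^esub> c'' \<oplus>\<^bsub>V\<^esub> of_real (1 - a - b) \<odot>\<^bsub>V\<^esub> w"
    proof (rule eq_by_functionals[OF V])
      fix \<phi> assume \<phi>: "\<phi> \<in> dual_ball V"
      have "\<phi> (of_real (1 - (1 - a - b)) \<odot>\<^bsub>V\<^esub> c'') = of_real ((a + b) * (1 - l)) * \<phi> c + of_real ((a + b) * l) * \<phi> c'"
        using CC x' y' w by (simp add: c''_def dual_ballD[OF \<phi>] del: of_real_diff) (simp add: algebra_simps)
      then show "\<phi> (of_real (1 - s) \<odot>\<^bsub>V\<^esub> x \<oplus>\<^bsub>V\<^esub> of_real s \<odot>\<^bsub>V\<^esub> y) =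
          \<phi> (of_real (1 - (1 - a - b)) \<odot>\<^bsub>V\<^esub> c'' \<oplus>\<^bsub>V\<^esub> of_real (1 - a - b) \<odot>\<^bsub>V\<^esub> w)"
        using CC x' y' w CC[OF c''] unfolding l by (simp add: dual_ballD[OF \<phi>] del: of_real_diff) (simp add: a_def b_def algebra_simps)
    qed (use CC x' y' w c'' in auto)
    then show "of_real (1 - s) \<odot>\<^bsub>V\<^esub> x \<oplus>\<^bsub>V\<^esub> of_real s \<odot>\<^bsub>V\<^esub> y \<in> join_point V C w"
      unfolding join_point_def using c'' ab s by (intro CollectI exI[of _ "1 - a - b"] exI[of _ c'']) auto
  qed
qed

lemma totally_bounded_join_point:
  fixes V :: "('k::{real_normed_field, euclidean_space}, 'v) normed_vs"
  assumes V: "normed_vector_space V" and C: "totally_bounded_in V C" "C \<noteq> {}" and w: "w \<in> carrier V"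
  shows "totally_bounded_in V (join_point V C w)"
proof -
  interpret normed_vector_space V by fact
  have CC: "c \<in> carrier V" if "c \<in> C" for c using that C by (auto simp: totally_bounded_in_def)
  show ?thesis
    unfolding totally_bounded_in_def
  proof (intro conjI allI impI)
    show "join_point V C w \<subseteq> carrier V" using join_point_contains[OF V _ w C(2)] CC by blast
    fix e :: real assume e: "e > 0"
    then obtain D where D: "finite D" "D \<subseteq> carrier V" "\<And>c. c \<in> C \<Longrightarrow> \<exists>d\<in>D. nrm V (c \<ominus>\<^bsub>V\<^esub> d) \<le> e/2"
      using C(1) half_gt_zero[OF e] unfolding totally_bounded_in_def by meson
    \<comment> \<open>R bounds |w - d| for all d in D, so a grid of mesh 1/M for t adds an error of
      at most R/M <= e/2 to the e/2 coming from d.\<close>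
    define R where "R = (\<Sum>d\<in>D. nrm V d) + nrm V w"
    have R: "nrm V d + nrm V w \<le> R" if "d \<in> D" for d
      unfolding R_def using D that by (auto intro!: member_le_sum nrm_nonneg)
    obtain M :: nat where M: "2 * R / e < real M" using reals_Archimedean2 by blast
    have R0: "0 \<le> R" unfolding R_def using D w by (intro add_nonneg_nonneg sum_nonneg) (auto intro: nrm_nonneg)
    have M0: "M > 0" using M R0 e by (cases M) (auto simp: field_simps)
    define D' where "D' = (\<lambda>(k, d). of_real (1 - real k / real M) \<odot>\<^bsub>V\<^esub> d \<oplus>\<^bsub>V\<^esub> of_real (real k / real M) \<odot>\<^bsub>V\<^esub> w) ` ({..M} \<times> D)"
    show "\<exists>D. finite D \<and> D \<subseteq> carrier V \<and> (\<forall>c\<in>join_point V C w. \<exists>d\<in>D. nrm V (c \<ominus>\<^bsub>V\<^esub> d) \<le> e)"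
    proof (intro exI[of _ D'] conjI ballI)
      show "finite D'" using D by (simp add: D'_def)
      show "D' \<subseteq> carrier V" using D w by (auto simp: D'_def)
      fix x assume "x \<in> join_point V C w"
      then obtain t c where x: "x = of_real (1 - t) \<odot>\<^bsub>V\<^esub> c \<oplus>\<^bsub>V\<^esub> of_real t \<odot>\<^bsub>V\<^esub> w" "c \<in> C" "t \<in> {0..1}"
        by (auto simp: join_point_def)
      obtain d where d: "d \<in> D" "nrm V (c \<ominus>\<^bsub>V\<^esub> d) \<le> e/2" using D(3)[OF x(2)] by blast
      have cV: "c \<in> carrier V" "d \<in> carrier V" using CC x(2) D d(1) by auto
      define k where "k = nat \<lfloor>t * M\<rfloor>"
      define s where "s = real k / real M"
      have k: "real k \<le> t * M" "t * M \<le> real k + 1" using x(3) by (auto simp: k_def)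
      have "t * M \<le> M" using x(3) by (simp add: mult_left_le_one_le)
      then have kM: "k \<le> M" using k(1) by linarith
      have "t - s = (t * M - real k) / M" using M0 by (simp add: s_def field_simps)
      then have s: "\<bar>t - s\<bar> \<le> 1 / M" using k M0 by (simp add: divide_right_mono)
      have "nrm V (x \<ominus>\<^bsub>V\<^esub> (of_real (1 - s) \<odot>\<^bsub>V\<^esub> d \<oplus>\<^bsub>V\<^esub> of_real s \<odot>\<^bsub>V\<^esub> w)) \<le> e"
      proof (rule nrm_le_by_functionals[OF V])
        fix \<phi> assume \<phi>: "\<phi> \<in> dual_ball V"
        have "\<phi> (x \<ominus>\<^bsub>V\<^esub> (of_real (1 - s) \<odot>\<^bsub>V\<^esub> d \<oplus>\<^bsub>V\<^esub> of_real s \<odot>\<^bsub>V\<^esub> w)) =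
            of_real (1 - t) * \<phi> (c \<ominus>\<^bsub>V\<^esub> d) + of_real (t - s) * (\<phi> w - \<phi> d)"
          using x cV w by (simp add: dual_ball_diff[OF V \<phi>] dual_ballD[OF \<phi>] algebra_simps)
        also have "norm \<dots> \<le> norm (of_real (1 - t) * \<phi> (c \<ominus>\<^bsub>V\<^esub> d)) + norm (of_real (t - s) * (\<phi> w - \<phi> d))"
          by (rule norm_triangle_ineq)
        also have "\<dots> = \<bar>1 - t\<bar> * norm (\<phi> (c \<ominus>\<^bsub>V\<^esub> d)) + \<bar>t - s\<bar> * norm (\<phi> w - \<phi> d)"
          by (simp add: norm_mult del: of_real_diff)
        also have "\<dots> \<le> 1 * (e/2) + 1 / M * R"
        proof (intro add_mono mult_mono s)
          show "norm (\<phi> (c \<ominus>\<^bsub>V\<^esub> d)) \<le> e/2" using dual_ballD(3)[OF \<phi>, of "c \<ominus>\<^bsub>V\<^esub> d"] d cV by simp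
          show "norm (\<phi> w - \<phi> d) \<le> R"
            using norm_triangle_ineq4[of "\<phi> w" "\<phi> d"] dual_ballD(3)[OF \<phi>, of w] dual_ballD(3)[OF \<phi>, of d] w cV R[OF d(1)] by simp
        qed (use x in auto)
        also have "\<dots> \<le> e" using M M0 e by (simp add: field_simps)
        finally show "norm (\<phi> (x \<ominus>\<^bsub>V\<^esub> (of_real (1 - s) \<odot>\<^bsub>V\<^esub> d \<oplus>\<^bsub>V\<^esub> of_real s \<odot>\<^bsub>V\<^esub> w))) \<le> e" .
      qed (use x cV w in auto)
      moreover have "of_real (1 - s) \<odot>\<^bsub>V\<^esub> d \<oplus>\<^bsub>V\<^esub> of_real s \<odot>\<^bsub>V\<^esub> w \<in> D'"
        unfolding D'_def s_def using kM d by (intro image_eqI[of _ _ "(k, d)"]) auto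
      ultimately show "\<exists>d\<in>D'. nrm V (x \<ominus>\<^bsub>V\<^esub> d) \<le> e" by blast
    qed
  qed
qed


section \<open>Norm oscillation of a weakly compact family indexed by functions\<close>

definition agree_on :: "'a set \<Rightarrow> ('a \<Rightarrow> 'c) \<Rightarrow> ('a \<Rightarrow> 'c) \<Rightarrow> bool" where
  "agree_on A f g \<longleftrightarrow> (\<forall>a\<in>A. f a = g a)"

lemma agree_on_refl [simp]: "agree_on A f f"
  and agree_on_trans: "agree_on A f g \<Longrightarrow> agree_on A g h \<Longrightarrow> agree_on A f h"
  and agree_on_mono: "agree_on B f g \<Longrightarrow> A \<subseteq> B \<Longrightarrow> agree_on A f g"
  by (auto simp: agree_on_def)

text \<open>For finite A, \<open>agree_on A\<close> describes the basic neighbourhoods of a product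
  of discrete spaces. Then \<open>conc\<close> makes y uniformly continuous into the weak topology,
  and \<open>cluster\<close> replaces relative weak compactness. The aim, as in Namioka's theorem,
  is a neighbourhood on which y has small norm oscillation.\<close>

locale weakly_compact_family =
  fixes F :: "('k::{real_normed_field, euclidean_space}, 'w) normed_vs"
    and Z :: "('a \<Rightarrow> 'c) set" and y :: "('a \<Rightarrow> 'c) \<Rightarrow> 'w"
  assumes F: "normed_vector_space F" and Z_ne: "Z \<noteq> {}" and yF: "\<And>x. x \<in> Z \<Longrightarrow> y x \<in> carrier F"
    and cluster: "\<And>s::nat \<Rightarrow> _. (\<And>n. s n \<in> Z) \<Longrightarrow>
        \<exists>z\<in>carrier F. \<forall>\<phi>\<in>dual_ball F. \<forall>e>0. \<forall>N. \<exists>n\<ge>N. norm (\<phi> (y (s n)) - \<phi> z) < e"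
    and conc: "\<And>\<phi> e. \<phi> \<in> dual_ball F \<Longrightarrow> e > 0 \<Longrightarrow>
        \<exists>A. finite A \<and> (\<forall>x\<in>Z. \<forall>x'\<in>Z. agree_on A x x' \<longrightarrow> norm (\<phi> (y x) - \<phi> (y x')) \<le> e)"
begin

sublocale F: normed_vector_space F by (rule F)

text \<open>Otherwise there is a sequence in which each vector is far from the convex hull \<open>C n\<close> of its
  predecessors, as witnessed by a functional that changes little from then on. A weak cluster
  point \<open>z\<close> is then far from all of these hulls, contradicting Mazur's theorem.\<close>

lemma near_totally_bounded:
  assumes e: "e > 0"
  obtains A x0 C where "finite A" "x0 \<in> Z" "totally_bounded_in F C"
    "\<And>x. x \<in> Z \<Longrightarrow> agree_on A x x0 \<Longrightarrow> \<exists>c\<in>C. nrm F (y x \<ominus>\<^bsub>F\<^esub> c) < e"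
proof (rule ccontr)
  assume no: "\<not> thesis"
  note found = that
  have far: "\<exists>x\<in>Z. agree_on A x x0 \<and> (\<forall>c\<in>C. e \<le> nrm F (y x \<ominus>\<^bsub>F\<^esub> c))"
    if "finite A" "x0 \<in> Z" "totally_bounded_in F C" for A x0 C
  proof (rule ccontr)
    assume "\<not> ?thesis"
    then have "\<And>x. x \<in> Z \<Longrightarrow> agree_on A x x0 \<Longrightarrow> \<exists>c\<in>C. nrm F (y x \<ominus>\<^bsub>F\<^esub> c) < e"
      by (meson not_le)
    then show False using found[OF that] no by blast
  qed
  \<comment> \<open>A state consists of the hull C of the images so far, the coordinates A frozen so
    far and the last point x. Later points agree with x' on A', and A' determines the value of the
    new functional up to e/4; hence this functional keeps nearly the value it takes at y x'.\<close>
  define P where "P = (\<lambda>(C, A::'a set, x). totally_bounded_in F C \<and> F.convex_in C \<and> finite A \<and> x \<in> Z \<and> y x \<in> C)"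
  define Q where "Q = (\<lambda>(C, A, x) (C', A', x'). C \<subseteq> C' \<and> A \<subseteq> A' \<and> agree_on A x' x \<and>
     (\<exists>\<phi>\<in>dual_ball F. (\<forall>c\<in>C. e \<le> (\<phi> (y x') - \<phi> c) \<bullet> 1) \<and>
        (\<forall>x1\<in>Z. \<forall>x2\<in>Z. agree_on A' x1 x2 \<longrightarrow> norm (\<phi> (y x1) - \<phi> (y x2)) \<le> e/4)))"
  have "\<exists>S. \<forall>n::nat. P (S n) \<and> Q (S n) (S (Suc n))"
  proof (rule dependent_nat_choice)
    obtain x where x: "x \<in> Z" using Z_ne by auto
    have "P ({y x}, {}, x)"
      using x yF[OF x] F.smult_add_left[of "y x" "of_real (1 - t)" "of_real t" for t]
      by (auto simp: P_def totally_bounded_in_def F.convex_in_def intro!: exI[of _ "{y x}"])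
    then show "\<exists>S. P S" by blast
  next
    fix S :: "'w set \<times> 'a set \<times> ('a \<Rightarrow> 'c)" and n :: nat assume "P S"
    then obtain C A x where S: "S = (C, A, x)" and tb: "totally_bounded_in F C" and cv: "F.convex_in C"
      and A: "finite A" and x: "x \<in> Z" "y x \<in> C" by (auto simp: P_def)
    have CC: "c \<in> carrier F" if "c \<in> C" for c using tb that by (auto simp: totally_bounded_in_def)
    obtain x' where x': "x' \<in> Z" "agree_on A x' x" "\<And>c. c \<in> C \<Longrightarrow> e \<le> nrm F (y x' \<ominus>\<^bsub>F\<^esub> c)"
      using far[OF A x(1) tb] by blast
    have "F.convex_in ((\<lambda>c. y x' \<ominus>\<^bsub>F\<^esub> c) ` C)"
      unfolding F.convex_in_def
    proof (intro conjI ballI)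
      show "(\<lambda>c. y x' \<ominus>\<^bsub>F\<^esub> c) ` C \<subseteq> carrier F" using CC yF[OF x'(1)] by auto
      fix u v t assume "u \<in> (\<lambda>c. y x' \<ominus>\<^bsub>F\<^esub> c) ` C" "v \<in> (\<lambda>c. y x' \<ominus>\<^bsub>F\<^esub> c) ` C" and t: "t \<in> {0..1::real}"
      then obtain c d where c: "c \<in> C" "u = y x' \<ominus>\<^bsub>F\<^esub> c" and d: "d \<in> C" "v = y x' \<ominus>\<^bsub>F\<^esub> d" by auto
      let ?m = "of_real (1 - t) \<odot>\<^bsub>F\<^esub> c \<oplus>\<^bsub>F\<^esub> of_real t \<odot>\<^bsub>F\<^esub> d"
      have m: "?m \<in> C" using cv c d t unfolding F.convex_in_def by blast
      have "of_real (1 - t) \<odot>\<^bsub>F\<^esub> u \<oplus>\<^bsub>F\<^esub> of_real t \<odot>\<^bsub>F\<^esub> v = y x' \<ominus>\<^bsub>F\<^esub> ?m"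
      proof (rule eq_by_functionals[OF F])
        fix \<phi> assume \<phi>: "\<phi> \<in> dual_ball F"
        show "\<phi> (of_real (1 - t) \<odot>\<^bsub>F\<^esub> u \<oplus>\<^bsub>F\<^esub> of_real t \<odot>\<^bsub>F\<^esub> v) = \<phi> (y x' \<ominus>\<^bsub>F\<^esub> ?m)"
          using CC[OF c(1)] CC[OF d(1)] yF[OF x'(1)]
          by (simp add: c d dual_ballD[OF \<phi>] dual_ball_diff[OF F \<phi>] algebra_simps)
      qed (use CC[OF c(1)] CC[OF d(1)] yF[OF x'(1)] in \<open>auto simp: c d\<close>)
      then show "of_real (1 - t) \<odot>\<^bsub>F\<^esub> u \<oplus>\<^bsub>F\<^esub> of_real t \<odot>\<^bsub>F\<^esub> v \<in> (\<lambda>c. y x' \<ominus>\<^bsub>F\<^esub> c) ` C" using m by auto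
    qed
    then obtain \<phi> where \<phi>: "\<phi> \<in> dual_ball F" "\<And>c. c \<in> C \<Longrightarrow> e \<le> \<phi> (y x' \<ominus>\<^bsub>F\<^esub> c) \<bullet> 1"
    proof (rule separate_convex[OF F, of _ e])
      show "(\<lambda>c. y x' \<ominus>\<^bsub>F\<^esub> c) ` C \<noteq> {}" using x(2) by auto
    qed (use x'(3) in auto)
    obtain A' where A': "finite A'" "\<forall>x\<in>Z. \<forall>x'\<in>Z. agree_on A' x x' \<longrightarrow> norm (\<phi> (y x) - \<phi> (y x')) \<le> e/4"
      using conc[OF \<phi>(1), of "e/4"] e by auto
    have "C \<subseteq> join_point F C (y x')" "y x' \<in> join_point F C (y x')"
      using join_point_contains[OF F, of C "y x'"] CC yF[OF x'(1)] x by auto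
    moreover have "F.convex_in (join_point F C (y x'))" "totally_bounded_in F (join_point F C (y x'))"
      using convex_join_point[OF F cv] totally_bounded_join_point[OF F tb] x yF[OF x'(1)] by auto
    moreover have "\<forall>c\<in>C. e \<le> (\<phi> (y x') - \<phi> c) \<bullet> 1"
      using \<phi> CC yF[OF x'(1)] by (simp add: dual_ball_diff[OF F])
    moreover have "\<forall>x1\<in>Z. \<forall>x2\<in>Z. agree_on (A \<union> A') x1 x2 \<longrightarrow> norm (\<phi> (y x1) - \<phi> (y x2)) \<le> e/4"
      using A'(2) by (auto simp: agree_on_def)
    ultimately have "P (join_point F C (y x'), A \<union> A', x')" "Q S (join_point F C (y x'), A \<union> A', x')"
      using A A' x' \<phi>(1) by (auto simp: P_def Q_def S)
    then show "\<exists>S'. P S' \<and> Q S S'" by blast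
  qed
  then obtain S where S: "\<And>n::nat. P (S n)" "\<And>n. Q (S n) (S (Suc n))" by blast
  define C where "C n = fst (S n)" for n
  define A where "A n = fst (snd (S n))" for n
  define x where "x n = snd (snd (S n))" for n
  have Seq: "S n = (C n, A n, x n)" for n by (simp add: C_def A_def x_def)
  have tb: "totally_bounded_in F (C n)" and cv: "F.convex_in (C n)" and xZ: "x n \<in> Z" and yC: "y (x n) \<in> C n" for n
    using S(1)[of n] by (auto simp: Seq P_def)
  have Cm: "C n \<subseteq> C (Suc n)" and Am: "A n \<subseteq> A (Suc n)" and ag: "agree_on (A n) (x (Suc n)) (x n)" for n
    using S(2)[of n] by (auto simp: Seq Q_def)
  have "\<exists>\<phi>\<in>dual_ball F. (\<forall>c\<in>C n. e \<le> (\<phi> (y (x (Suc n))) - \<phi> c) \<bullet> 1) \<and>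
        (\<forall>x1\<in>Z. \<forall>x2\<in>Z. agree_on (A (Suc n)) x1 x2 \<longrightarrow> norm (\<phi> (y x1) - \<phi> (y x2)) \<le> e/4)" for n
    using S(2)[of n] by (auto simp: Seq Q_def)
  then obtain \<phi> where \<phi>: "\<And>n. \<phi> n \<in> dual_ball F"
    and \<phi>C: "\<And>n c. c \<in> C n \<Longrightarrow> e \<le> (\<phi> n (y (x (Suc n))) - \<phi> n c) \<bullet> 1"
    and \<phi>A: "\<And>n x1 x2. \<lbrakk>x1 \<in> Z; x2 \<in> Z; agree_on (A (Suc n)) x1 x2\<rbrakk> \<Longrightarrow> norm (\<phi> n (y x1) - \<phi> n (y x2)) \<le> e/4"
    by metis
  have Cmono: "C m \<subseteq> C n" and Amono: "A m \<subseteq> A n" if "m \<le> n" for m n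
    using lift_Suc_mono_le[of C, OF Cm that] lift_Suc_mono_le[of A, OF Am that] by auto
  have agm: "agree_on (A n) (x m) (x n)" if "n \<le> m" for n m
    using that
  proof (induction m rule: dec_induct)
    case (step m)
    then show ?case using ag[of m] Amono[of n m] agree_on_mono agree_on_trans by (metis less_imp_le_nat)
  qed simp
  obtain z where z: "z \<in> carrier F"
    "\<And>\<phi> e N. \<phi> \<in> dual_ball F \<Longrightarrow> e > 0 \<Longrightarrow> \<exists>n\<ge>N. norm (\<phi> (y (x n)) - \<phi> z) < e"
    using cluster[of x] xZ by blast
  have CC: "c \<in> carrier F" if "c \<in> C n" for c n using tb that by (auto simp: totally_bounded_in_def)
  define W where "W = {z \<ominus>\<^bsub>F\<^esub> c | c n. c \<in> C n}"
  \<comment> \<open>The functional \<open>\<phi> n\<close> separates y (x (Suc n)) from C n by e;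
    passing to a later point costs e/4, and passing on to z another e/4.\<close>
  have "e/2 \<le> nrm F w" if w: "w \<in> W" for w
  proof -
    obtain c n where c: "w = z \<ominus>\<^bsub>F\<^esub> c" "c \<in> C n" using w by (auto simp: W_def)
    obtain m where m: "m \<ge> Suc n" "norm (\<phi> n (y (x m)) - \<phi> n z) < e/4" using z(2)[OF \<phi>, of "e/4"] e by auto
    have "norm (\<phi> n (y (x m)) - \<phi> n (y (x (Suc n)))) \<le> e/4"
      using \<phi>A[OF xZ xZ agm[OF m(1)]] .
    then have "norm (\<phi> n (y (x (Suc n))) - \<phi> n z) \<le> e/2"
      using m(2) norm_triangle_ineq[of "\<phi> n (y (x (Suc n))) - \<phi> n (y (x m))" "\<phi> n (y (x m)) - \<phi> n z"]
      by (simp add: norm_minus_commute)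
    then have "(\<phi> n (y (x (Suc n))) - \<phi> n z) \<bullet> 1 \<le> e/2"
      using inner_one_le_norm order_trans by blast
    then have "e/2 \<le> (\<phi> n z - \<phi> n c) \<bullet> 1" using \<phi>C[OF c(2)] by (simp add: inner_diff_left)
    also have "\<dots> = \<phi> n w \<bullet> 1" using c z(1) CC by (simp add: dual_ball_diff[OF F \<phi>])
    also have "\<dots> \<le> norm (\<phi> n w)" by (rule inner_one_le_norm)
    also have "\<dots> \<le> nrm F w" using dual_ballD(3)[OF \<phi>] c z(1) CC by simp
    finally show ?thesis .
  qed
  moreover have "F.convex_in W"
    unfolding F.convex_in_def
  proof (intro conjI ballI)
    show "W \<subseteq> carrier F" using CC z(1) by (auto simp: W_def)
    fix u v t assume "u \<in> W" "v \<in> W" and t: "t \<in> {0..1::real}"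
    then obtain c d m n where c: "c \<in> C m" "u = z \<ominus>\<^bsub>F\<^esub> c" and d: "d \<in> C n" "v = z \<ominus>\<^bsub>F\<^esub> d" by (auto simp: W_def)
    have c': "c \<in> C (max m n)" and d': "d \<in> C (max m n)" using c d Cmono[of m "max m n"] Cmono[of n "max m n"] by auto
    let ?m = "of_real (1 - t) \<odot>\<^bsub>F\<^esub> c \<oplus>\<^bsub>F\<^esub> of_real t \<odot>\<^bsub>F\<^esub> d"
    have m: "?m \<in> C (max m n)" using cv[of "max m n"] c' d' t unfolding F.convex_in_def by blast
    have "of_real (1 - t) \<odot>\<^bsub>F\<^esub> u \<oplus>\<^bsub>F\<^esub> of_real t \<odot>\<^bsub>F\<^esub> v = z \<ominus>\<^bsub>F\<^esub> ?m"
    proof (rule eq_by_functionals[OF F])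
      fix \<phi> assume \<phi>: "\<phi> \<in> dual_ball F"
      show "\<phi> (of_real (1 - t) \<odot>\<^bsub>F\<^esub> u \<oplus>\<^bsub>F\<^esub> of_real t \<odot>\<^bsub>F\<^esub> v) = \<phi> (z \<ominus>\<^bsub>F\<^esub> ?m)"
        using CC[OF c(1)] CC[OF d(1)] z(1)
        by (simp add: c d dual_ballD[OF \<phi>] dual_ball_diff[OF F \<phi>] algebra_simps)
    qed (use CC[OF c(1)] CC[OF d(1)] z(1) in \<open>auto simp: c d\<close>)
    then show "of_real (1 - t) \<odot>\<^bsub>F\<^esub> u \<oplus>\<^bsub>F\<^esub> of_real t \<odot>\<^bsub>F\<^esub> v \<in> W" using m by (auto simp: W_def)
  qed
  moreover have "W \<noteq> {}" using yC by (auto simp: W_def)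
  ultimately obtain \<psi> where \<psi>: "\<psi> \<in> dual_ball F" "\<And>w. w \<in> W \<Longrightarrow> e/2 \<le> \<psi> w \<bullet> 1"
    using separate_convex[OF F, of W "e/2"] by blast
  obtain n where n: "norm (\<psi> (y (x n)) - \<psi> z) < e/2" using z(2)[OF \<psi>(1), of "e/2"] e by auto
  have "e/2 \<le> \<psi> (z \<ominus>\<^bsub>F\<^esub> y (x n)) \<bullet> 1" using \<psi>(2) yC by (auto simp: W_def)
  also have "\<dots> \<le> norm (\<psi> (z \<ominus>\<^bsub>F\<^esub> y (x n)))" by (rule inner_one_le_norm)
  also have "\<dots> = norm (\<psi> (y (x n)) - \<psi> z)"
    using z(1) yF[OF xZ] by (simp add: dual_ball_diff[OF F \<psi>(1)] norm_minus_commute)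
  finally show False using n by simp
qed

text \<open>Among finitely many balls covering the image, either one suffices, or a point outside of it is
  separated from it by a functional, so that the others suffice near that point.\<close>

lemma one_ball_suffices:
  assumes "finite D" "D \<subseteq> carrier F" "finite A" "x0 \<in> Z"
    and "\<And>x. x \<in> Z \<Longrightarrow> agree_on A x x0 \<Longrightarrow> \<exists>d\<in>D. nrm F (y x \<ominus>\<^bsub>F\<^esub> d) \<le> r"
  shows "\<exists>A x0 d. finite A \<and> x0 \<in> Z \<and> d \<in> carrier F \<and> (\<forall>x\<in>Z. agree_on A x x0 \<longrightarrow> nrm F (y x \<ominus>\<^bsub>F\<^esub> d) \<le> r)"
  using assms
proof (induction D arbitrary: A x0 rule: finite_induct)
  case empty
  then show ?case by auto
next
  case (insert d D)
  have d: "d \<in> carrier F" using insert.prems by simp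
  show ?case
  proof (cases "\<forall>x\<in>Z. agree_on A x x0 \<longrightarrow> nrm F (y x \<ominus>\<^bsub>F\<^esub> d) \<le> r")
    case True
    then show ?thesis using insert.prems d by blast
  next
    case False
    then obtain x1 where x1: "x1 \<in> Z" "agree_on A x1 x0" "nrm F (y x1 \<ominus>\<^bsub>F\<^esub> d) > r" by force
    obtain \<phi> where \<phi>: "\<phi> \<in> dual_ball F" "norm (\<phi> (y x1 \<ominus>\<^bsub>F\<^esub> d)) = nrm F (y x1 \<ominus>\<^bsub>F\<^esub> d)"
      using norming_functional[OF F, of "y x1 \<ominus>\<^bsub>F\<^esub> d"] d yF[OF x1(1)] by auto
    \<comment> \<open>Half of the excess over r: at points that agree with x1 on B the functional
      still shows a distance of at least \<open>r + \<rho>\<close> from d.\<close>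
    define \<rho> where "\<rho> = (nrm F (y x1 \<ominus>\<^bsub>F\<^esub> d) - r) / 2"
    have \<rho>: "\<rho> > 0" using x1 by (simp add: \<rho>_def)
    obtain B where B: "finite B" "\<forall>x\<in>Z. \<forall>x'\<in>Z. agree_on B x x' \<longrightarrow> norm (\<phi> (y x) - \<phi> (y x')) \<le> \<rho>"
      using conc[OF \<phi>(1) \<rho>] by blast
    show ?thesis
    proof (rule insert.IH)
      show "D \<subseteq> carrier F" "finite (A \<union> B)" "x1 \<in> Z" using insert.prems B x1 by auto
      fix x assume x: "x \<in> Z" "agree_on (A \<union> B) x x1"
      then have "agree_on A x x0" using x1 by (auto simp: agree_on_def)
      then obtain d' where d': "d' \<in> insert d D" "nrm F (y x \<ominus>\<^bsub>F\<^esub> d') \<le> r" using insert.prems(4)[OF x(1)] by auto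
      have "norm (\<phi> (y x1) - \<phi> (y x)) \<le> \<rho>" using B(2) x x1(1) by (auto simp: agree_on_def)
      moreover have "nrm F (y x1 \<ominus>\<^bsub>F\<^esub> d) \<le> norm (\<phi> (y x1) - \<phi> (y x)) + norm (\<phi> (y x) - \<phi> d)"
        using \<phi>(2) norm_triangle_ineq[of "\<phi> (y x1) - \<phi> (y x)" "\<phi> (y x) - \<phi> d"] d yF[OF x1(1)]
        by (simp add: dual_ball_diff[OF F \<phi>(1)])
      moreover have "norm (\<phi> (y x) - \<phi> d) \<le> nrm F (y x \<ominus>\<^bsub>F\<^esub> d)"
        using dual_ballD(3)[OF \<phi>(1), of "y x \<ominus>\<^bsub>F\<^esub> d"] d yF[OF x(1)] by (simp add: dual_ball_diff[OF F \<phi>(1)])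
      ultimately have "nrm F (y x \<ominus>\<^bsub>F\<^esub> d) > r" using \<rho> by (simp add: \<rho>_def field_simps)
      then show "\<exists>d\<in>D. nrm F (y x \<ominus>\<^bsub>F\<^esub> d) \<le> r" using d' by (metis insertE not_le)
    qed
  qed
qed

text \<open>Total boundedness covers the images near x0 by finitely many balls of radius e/2, and
  near some x1 a single one of them suffices; two of its points are at most e apart.\<close>

lemma small_oscillation:
  assumes e: "e > 0"
  obtains A x0 where "finite A" "x0 \<in> Z" "\<And>x. x \<in> Z \<Longrightarrow> agree_on A x x0 \<Longrightarrow> nrm F (y x \<ominus>\<^bsub>F\<^esub> y x0) \<le> e"
proof -
  obtain A x0 C where A: "finite A" "x0 \<in> Z" and C: "totally_bounded_in F C"
    and near: "\<And>x. x \<in> Z \<Longrightarrow> agree_on A x x0 \<Longrightarrow> \<exists>c\<in>C. nrm F (y x \<ominus>\<^bsub>F\<^esub> c) < e/4"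
    using near_totally_bounded[of "e/4"] e by (metis divide_pos_pos zero_less_numeral)
  obtain D where D: "finite D" "D \<subseteq> carrier F" "\<And>c. c \<in> C \<Longrightarrow> \<exists>d\<in>D. nrm F (c \<ominus>\<^bsub>F\<^esub> d) \<le> e/4"
    using C e unfolding totally_bounded_in_def by (metis divide_pos_pos zero_less_numeral)
  have "\<exists>d\<in>D. nrm F (y x \<ominus>\<^bsub>F\<^esub> d) \<le> e/2" if x: "x \<in> Z" "agree_on A x x0" for x
  proof -
    obtain c where c: "c \<in> C" "nrm F (y x \<ominus>\<^bsub>F\<^esub> c) < e/4" using near[OF x] by blast
    obtain d where d: "d \<in> D" "nrm F (c \<ominus>\<^bsub>F\<^esub> d) \<le> e/4" using D(3)[OF c(1)] by blast
    have "nrm F (y x \<ominus>\<^bsub>F\<^esub> d) \<le> nrm F (y x \<ominus>\<^bsub>F\<^esub> c) + nrm F (c \<ominus>\<^bsub>F\<^esub> d)"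
      using yF[OF x(1)] c(1) C d(1) D(2) by (intro F.nrm_diff_triangle) (auto simp: totally_bounded_in_def)
    then show ?thesis using c d by force
  qed
  then obtain A' x1 d where x1: "finite A'" "x1 \<in> Z" "d \<in> carrier F"
    and d: "\<And>x. x \<in> Z \<Longrightarrow> agree_on A' x x1 \<Longrightarrow> nrm F (y x \<ominus>\<^bsub>F\<^esub> d) \<le> e/2"
    using one_ball_suffices[OF D(1,2) A] by metis
  have "nrm F (y x \<ominus>\<^bsub>F\<^esub> y x1) \<le> e" if x: "x \<in> Z" "agree_on A' x x1" for x
    using F.nrm_diff_triangle[of "y x" d "y x1"] d[OF x] d[OF x1(2)] F.nrm_diff_commute[of d "y x1"]
      x1 yF[OF x(1)] yF[OF x1(2)] by simp
  then show thesis using that x1 by blast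
qed

end


section \<open>The space of continuous functions\<close>

abbreviation cont_funs :: "'a topology \<Rightarrow> ('a \<Rightarrow> 'k::real_normed_field) set" where
  "cont_funs K \<equiv> carrier (C_space K)"

abbreviation sup_nrm :: "'a topology \<Rightarrow> ('a \<Rightarrow> 'k::real_normed_field) \<Rightarrow> real" where
  "sup_nrm K \<equiv> nrm (C_space K)"

lemma cont_funs_iff: "f \<in> cont_funs K \<longleftrightarrow> continuous_map K euclidean f \<and> (\<forall>t. t \<notin> topspace K \<longrightarrow> f t = 0)"
  by (simp add: C_space_def)

lemma C_space_simps [simp]:
  "\<zero>\<^bsub>C_space K\<^esub> = (\<lambda>t. 0)" "f \<oplus>\<^bsub>C_space K\<^esub> g = (\<lambda>t. f t + g t)" "a \<odot>\<^bsub>C_space K\<^esub> f = (\<lambda>t. a * f t)"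
  by (simp_all add: C_space_def)

lemma continuous_map_field_mult:
  fixes f g :: "'a \<Rightarrow> 'k::real_normed_field"
  shows "continuous_map X euclidean f \<Longrightarrow> continuous_map X euclidean g \<Longrightarrow> continuous_map X euclidean (\<lambda>t. f t * g t)"
  by (simp add: continuous_map_atin tendsto_mult)

lemma continuous_map_of_real:
  "continuous_map X euclideanreal f \<Longrightarrow> continuous_map X euclidean (\<lambda>t. of_real (f t) :: 'k::real_normed_field)"
  by (simp add: continuous_map_atin tendsto_of_real)

lemma cont_funs_zero [simp]: "(\<lambda>t. 0) \<in> cont_funs K"
  and cont_funs_add: "f \<in> cont_funs K \<Longrightarrow> g \<in> cont_funs K \<Longrightarrow> (\<lambda>t. f t + g t) \<in> cont_funs K"
  and cont_funs_diff: "f \<in> cont_funs K \<Longrightarrow> g \<in> cont_funs K \<Longrightarrow> (\<lambda>t. f t - g t) \<in> cont_funs K"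
  and cont_funs_cmult: "f \<in> cont_funs K \<Longrightarrow> (\<lambda>t. a * f t) \<in> cont_funs K"
  and cont_funs_real_mult: "continuous_map K euclideanreal \<xi> \<Longrightarrow> f \<in> cont_funs K \<Longrightarrow> (\<lambda>t. of_real (\<xi> t) * f t) \<in> cont_funs K"
  by (auto simp: cont_funs_iff intro!: continuous_map_field_mult continuous_map_of_real continuous_map_add continuous_map_diff)

lemma cont_funs_sum: "finite I \<Longrightarrow> (\<And>i. i \<in> I \<Longrightarrow> f i \<in> cont_funs K) \<Longrightarrow> (\<lambda>t. \<Sum>i\<in>I. f i t) \<in> cont_funs K"
  by (induction I rule: finite_induct) (auto simp: cont_funs_add)

lemma Sup_upper_sup_nrm:
  assumes "compact_space K" "f \<in> cont_funs K"
  shows "bdd_above (insert 0 ((\<lambda>t. norm (f t)) ` topspace K))"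
proof -
  have "compactin euclideanreal ((\<lambda>t. norm (f t)) ` topspace K)"
    using assms by (intro image_compactin[of K]) (auto simp: cont_funs_iff compact_space_def intro: continuous_map_norm)
  then show ?thesis by (simp add: compact_imp_bounded bounded_imp_bdd_above)
qed

lemma norm_le_sup_nrm:
  assumes "compact_space K" "f \<in> cont_funs K"
  shows "norm (f t) \<le> sup_nrm K f"
proof (cases "t \<in> topspace K")
  case True
  then show ?thesis using Sup_upper_sup_nrm[OF assms] by (auto simp: C_space_def intro!: cSup_upper)
next
  case False
  then show ?thesis using assms(2) Sup_upper_sup_nrm[OF assms] by (auto simp: C_space_def intro!: cSup_upper)
qed

lemma sup_nrm_nonneg: "compact_space K \<Longrightarrow> f \<in> cont_funs K \<Longrightarrow> 0 \<le> sup_nrm K f"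
  by (rule order_trans[OF norm_ge_zero norm_le_sup_nrm])

lemma sup_nrm_le: "0 \<le> r \<Longrightarrow> (\<And>t. norm (f t) \<le> r) \<Longrightarrow> sup_nrm K f \<le> r"
  by (auto simp: C_space_def intro!: cSup_least)

lemma normed_vector_space_C_space:
  assumes K: "compact_space K"
  shows "normed_vector_space (C_space K :: ('k::real_normed_field, 'a \<Rightarrow> 'k) normed_vs)"
proof (rule normed_vector_spaceI)
  fix f :: "'a \<Rightarrow> 'k" assume f: "f \<in> cont_funs K"
  show "0 \<le> sup_nrm K f" using K f by (rule sup_nrm_nonneg)
  show "f = \<zero>\<^bsub>C_space K\<^esub>" if "sup_nrm K f = 0"
    using norm_le_sup_nrm[OF K f] that by auto
  show "sup_nrm K (f \<oplus>\<^bsub>C_space K\<^esub> g) \<le> sup_nrm K f + sup_nrm K g" if "g \<in> cont_funs K" for g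
    using K f that by (auto intro!: sup_nrm_le add_nonneg_nonneg sup_nrm_nonneg norm_triangle_le add_mono norm_le_sup_nrm)
  have le: "sup_nrm K (a \<odot>\<^bsub>C_space K\<^esub> g) \<le> norm a * sup_nrm K g" if "g \<in> cont_funs K" for a and g :: "'a \<Rightarrow> 'k"
    using K that by (auto simp: norm_mult intro!: sup_nrm_le mult_nonneg_nonneg sup_nrm_nonneg mult_left_mono norm_le_sup_nrm)
  show "sup_nrm K (a \<odot>\<^bsub>C_space K\<^esub> f) = norm a * sup_nrm K f" for a
  proof (cases "a = 0")
    case True
    have "sup_nrm K (\<lambda>t. 0 :: 'k) = 0"
      using sup_nrm_le[of 0 "\<lambda>t. 0 :: 'k" K] sup_nrm_nonneg[OF K, of "\<lambda>t. 0 :: 'k"] by simp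
    then show ?thesis using True by simp
  next
    case False
    have "sup_nrm K (inverse a \<odot>\<^bsub>C_space K\<^esub> (a \<odot>\<^bsub>C_space K\<^esub> f)) \<le> norm (inverse a) * sup_nrm K (a \<odot>\<^bsub>C_space K\<^esub> f)"
      using f by (intro le) (simp add: cont_funs_cmult)
    then have "norm a * sup_nrm K (inverse a \<odot>\<^bsub>C_space K\<^esub> (a \<odot>\<^bsub>C_space K\<^esub> f)) \<le> norm a * (norm (inverse a) * sup_nrm K (a \<odot>\<^bsub>C_space K\<^esub> f))"
      by (rule mult_left_mono) simp
    then have "norm a * sup_nrm K f \<le> sup_nrm K (a \<odot>\<^bsub>C_space K\<^esub> f)"
      using False by (simp add: norm_inverse flip: mult.assoc)
    then show ?thesis using le[OF f, of a] by simp
  qed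
qed (auto simp: cont_funs_add cont_funs_cmult algebra_simps)

definition unit_funs :: "'a topology \<Rightarrow> ('a \<Rightarrow> 'k::real_normed_field) set" where
  "unit_funs K = {f \<in> cont_funs K. \<forall>t. norm (f t) \<le> 1}"

lemma unit_funsD: "f \<in> unit_funs K \<Longrightarrow> f \<in> cont_funs K" "f \<in> unit_funs K \<Longrightarrow> norm (f t) \<le> 1"
  by (auto simp: unit_funs_def)

lemma zero_unit_funs [simp]: "(\<lambda>t. 0) \<in> unit_funs K"
  by (simp add: unit_funs_def)

lemma unit_funs_sup_nrm: "f \<in> unit_funs K \<Longrightarrow> sup_nrm K f \<le> 1"
  by (rule sup_nrm_le) (auto simp: unit_funs_def)

lemma unit_funs_real_mult:
  assumes "continuous_map K euclideanreal \<xi>" "\<And>t. t \<in> topspace K \<Longrightarrow> 0 \<le> \<xi> t \<and> \<xi> t \<le> 1" "f \<in> unit_funs K"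
  shows "(\<lambda>t. of_real (\<xi> t) * f t) \<in> unit_funs K"
proof -
  have "norm (of_real (\<xi> t) * f t) \<le> 1" for t
  proof (cases "t \<in> topspace K")
    case True
    then show ?thesis using assms(2)[OF True] unit_funsD(2)[OF assms(3), of t]
      by (simp add: norm_mult mult_le_one)
  next
    case False
    then have "f t = 0" using unit_funsD(1)[OF assms(3)] by (simp add: cont_funs_iff)
    then show ?thesis by simp
  qed
  then show ?thesis using assms by (auto simp: unit_funs_def cont_funs_real_mult)
qed

lemma phase_exists:
  fixes a b :: "'k::real_normed_field"
  obtains \<theta> where "norm \<theta> = 1" "norm (a + \<theta> * b) = norm a + norm b"
proof (cases "a = 0 \<or> b = 0")
  case True
  then show ?thesis using that[of 1] by auto
next
  case False
  \<comment> \<open>This gives \<open>\<theta> * b\<close> the phase of a and the modulus of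
    b.\<close>
  define \<theta> where "\<theta> = (a / of_real (norm a)) * (of_real (norm b) / b)"
  have "a + \<theta> * b = of_real (1 + norm b / norm a) * a"
    using False by (simp add: \<theta>_def field_simps)
  then have "norm (a + \<theta> * b) = (1 + norm b / norm a) * norm a"
    by (simp only: norm_mult norm_of_real) (simp add: add_nonneg_nonneg)
  also have "\<dots> = norm a + norm b" using False by (simp add: field_simps)
  finally show ?thesis using False by (intro that[of \<theta>]) (simp_all add: \<theta>_def norm_mult norm_divide)
qed

section \<open>Urysohn functions and cut-offs\<close>

locale compact_Hausdorff =
  fixes K :: "'a topology"
  assumes compact_K: "compact_space K" and Hausdorff_K: "Hausdorff_space K"
begin

lemma normal_K: "normal_space K"
  using compact_K Hausdorff_K by (simp add: compact_Hausdorff_or_regular_imp_normal_space)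

lemma closedin_finite: "finite A \<Longrightarrow> A \<subseteq> topspace K \<Longrightarrow> closedin K A"
  using t1_space_closedin_finite[THEN iffD1, OF Hausdorff_imp_t1_space[OF Hausdorff_K]] by simp

lemma Urysohn01:
  assumes "closedin K S" "closedin K T" "S \<inter> T = {}"
  obtains \<xi> where "continuous_map K euclideanreal \<xi>" "\<And>t. t \<in> topspace K \<Longrightarrow> 0 \<le> \<xi> t \<and> \<xi> t \<le> 1"
    "\<And>t. t \<in> S \<Longrightarrow> \<xi> t = 0" "\<And>t. t \<in> T \<Longrightarrow> \<xi> t = 1"
proof -
  obtain \<xi> where "continuous_map K (top_of_set {0..1::real}) \<xi>" "\<xi> ` S \<subseteq> {0}" "\<xi> ` T \<subseteq> {1}"
    using Urysohn_lemma[OF normal_K assms(1,2), of 0 1] assms(3) by (auto simp: disjnt_def)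
  then show thesis using that[of \<xi>] by (auto simp: continuous_map_in_subtopology Pi_iff)
qed

lemma shrink_open:
  assumes "closedin K S" "openin K U" "S \<subseteq> U"
  obtains V where "openin K V" "S \<subseteq> V" "K closure_of V \<subseteq> U"
proof -
  have "\<exists>V. openin K V \<and> S \<subseteq> V \<and> K closure_of V \<subseteq> U"
    using normal_space_alt[THEN iffD1, OF normal_K, rule_format, of S U] assms by simp
  then show thesis using that by blast
qed

text \<open>Near A the function f is below \<open>\<eta>\<close>, say on O'. Taking
  \<open>\<zeta>\<close> equal to 1 off O' and 0 near A alters f only where it is small, and turns
  vanishing on A into vanishing near A.\<close>

lemma cutoff:
  assumes f: "f \<in> cont_funs K" and A: "closedin K A" "\<And>a. a \<in> A \<Longrightarrow> f a = 0" and \<eta>: "\<eta> > 0"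
  obtains \<zeta> G where "continuous_map K euclideanreal \<zeta>" "\<And>t. t \<in> topspace K \<Longrightarrow> 0 \<le> \<zeta> t \<and> \<zeta> t \<le> 1"
    "openin K G" "A \<subseteq> G" "\<And>t. t \<in> G \<Longrightarrow> \<zeta> t = 0" "\<And>t. norm (f t - of_real (\<zeta> t) * f t) \<le> \<eta>"
proof -
  define O' where "O' = {t \<in> topspace K. f t \<in> ball 0 \<eta>}"
  have O': "openin K O'" unfolding O'_def using f
    by (intro openin_continuous_map_preimage[where Y = euclidean]) (auto simp: cont_funs_iff)
  have "A \<subseteq> O'" using A \<eta> closedin_subset[OF A(1)] by (auto simp: O'_def)
  then obtain G where G: "openin K G" "A \<subseteq> G" "K closure_of G \<subseteq> O'" using shrink_open[OF A(1) O'] by metis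
  have c: "closedin K (topspace K - O')" using O' by blast
  have "K closure_of G \<inter> (topspace K - O') = {}" using G(3) by blast
  from Urysohn01[OF closedin_closure_of c this] obtain \<zeta> where \<zeta>: "continuous_map K euclideanreal \<zeta>" "\<And>t. t \<in> topspace K \<Longrightarrow> 0 \<le> \<zeta> t \<and> \<zeta> t \<le> 1"
    "\<And>t. t \<in> K closure_of G \<Longrightarrow> \<zeta> t = 0" "\<And>t. t \<in> topspace K - O' \<Longrightarrow> \<zeta> t = 1"
    by blast
  show thesis
  proof (rule that[OF \<zeta>(1,2) G(1,2)])
    show "\<zeta> t = 0" if "t \<in> G" for t
      using \<zeta>(3) that closure_of_subset[OF openin_subset[OF G(1)]] by auto
    fix t
    show "norm (f t - of_real (\<zeta> t) * f t) \<le> \<eta>"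
    proof (cases "t \<in> topspace K")
      case True
      show ?thesis
      proof (cases "t \<in> O'")
        case True
        then have t: "norm (f t) < \<eta>" "t \<in> topspace K" by (auto simp: O'_def)
        have "f t - of_real (\<zeta> t) * f t = of_real (1 - \<zeta> t) * f t" by (simp add: algebra_simps)
        then have "norm (f t - of_real (\<zeta> t) * f t) = (1 - \<zeta> t) * norm (f t)"
          using \<zeta>(2)[OF t(2)] by (simp add: norm_mult del: of_real_diff)
        also have "\<dots> \<le> norm (f t)" using \<zeta>(2)[OF t(2)] by (simp add: mult_left_le_one_le)
        finally show ?thesis using t by simp
      qed (use \<zeta>(4)[of t] True \<eta> in simp)
    next
      case False
      then have "f t = 0" using f by (simp add: cont_funs_iff)
      then show ?thesis using \<eta> by simp
    qed
  qed
qed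

end

section \<open>Functionals on continuous functions over scattered spaces\<close>

locale C_functional = compact_Hausdorff K for K :: "'a topology" +
  fixes \<nu> :: "('a \<Rightarrow> 'k::real_normed_field) \<Rightarrow> 'k" and M :: real
  assumes add: "\<And>f g. f \<in> cont_funs K \<Longrightarrow> g \<in> cont_funs K \<Longrightarrow> \<nu> (\<lambda>t. f t + g t) = \<nu> f + \<nu> g"
    and cmult: "\<And>a f. f \<in> cont_funs K \<Longrightarrow> \<nu> (\<lambda>t. a * f t) = a * \<nu> f"
    and bound: "\<And>f. f \<in> cont_funs K \<Longrightarrow> norm (\<nu> f) \<le> M * sup_nrm K f"
begin

lemma diff: "f \<in> cont_funs K \<Longrightarrow> g \<in> cont_funs K \<Longrightarrow> \<nu> (\<lambda>t. f t - g t) = \<nu> f - \<nu> g"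
  using add[of f "\<lambda>t. (-1) * g t"] cmult[of g "-1"] cont_funs_cmult[of g K "-1"] by simp

lemma M_bound: "f \<in> cont_funs K \<Longrightarrow> (\<And>t. norm (f t) \<le> r) \<Longrightarrow> norm (\<nu> f) \<le> \<bar>M\<bar> * r"
proof -
  assume f: "f \<in> cont_funs K" and r: "\<And>t. norm (f t) \<le> r"
  have r0: "0 \<le> r" using r norm_ge_zero order_trans by blast
  have "norm (\<nu> f) \<le> M * sup_nrm K f" by (rule bound[OF f])
  also have "\<dots> \<le> \<bar>M\<bar> * sup_nrm K f" using sup_nrm_nonneg[OF compact_K f] by (intro mult_right_mono) auto
  also have "\<dots> \<le> \<bar>M\<bar> * r" using sup_nrm_le[OF r0 r] by (intro mult_left_mono) auto
  finally show ?thesis .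
qed

lemma zero: "\<nu> (\<lambda>t. 0) = 0"
  using cmult[of "\<lambda>t. 0" 0] by simp

text \<open>Says that the measure \<open>\<nu>\<close> has variation at most e on U minus A, in a
  form that avoids the Riesz representation theorem.\<close>

definition small_on :: "'a set \<Rightarrow> 'a set \<Rightarrow> real \<Rightarrow> bool" where
  "small_on U A e \<longleftrightarrow> openin K U \<and> finite A \<and>
     (\<forall>f\<in>unit_funs K. (\<forall>t. t \<notin> U \<longrightarrow> f t = 0) \<and> (\<forall>a\<in>A. f a = 0) \<longrightarrow> norm (\<nu> f) \<le> e)"

text \<open>That is, \<open>\<nu>\<close> is purely atomic on H, with outer regularity built
  in.\<close>

definition good :: "'a set \<Rightarrow> bool" where
  "good H \<longleftrightarrow> (\<forall>e>0. \<exists>U A. H \<subseteq> U \<and> small_on U A e)"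

lemma good_mono: "good H \<Longrightarrow> H' \<subseteq> H \<Longrightarrow> good H'"
  unfolding good_def by (meson order_trans)

text \<open>A Urysohn function that is 0 off U1 and 1 on the closure of V minus U2 splits f into a
  part supported in U1 and a part supported in U2, both in the unit ball.\<close>

lemma small_on_glue:
  assumes s1: "small_on U1 A1 e1" and s2: "small_on U2 A2 e2" and H: "closedin K H" "H \<subseteq> U1 \<union> U2"
  obtains U A where "H \<subseteq> U" "small_on U A (e1 + e2)"
proof -
  have op: "openin K U1" "openin K U2" using s1 s2 by (auto simp: small_on_def)
  obtain V where V: "openin K V" "H \<subseteq> V" "K closure_of V \<subseteq> U1 \<union> U2"
    using shrink_open[of H "U1 \<union> U2"] H op by blast
  have VC: "V \<subseteq> K closure_of V" using V(1) by (simp add: closure_of_subset openin_subset)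
  have "closedin K (topspace K - U1)" "closedin K (K closure_of V - U2)"
    using op by (auto intro: closedin_diff)
  note cl = this
  have "(topspace K - U1) \<inter> (K closure_of V - U2) = {}" using V(3) by blast
  from Urysohn01[OF cl this] obtain \<xi> where \<xi>: "continuous_map K euclideanreal \<xi>" "\<And>t. t \<in> topspace K \<Longrightarrow> 0 \<le> \<xi> t \<and> \<xi> t \<le> 1"
    "\<And>t. t \<in> topspace K - U1 \<Longrightarrow> \<xi> t = 0" "\<And>t. t \<in> K closure_of V - U2 \<Longrightarrow> \<xi> t = 1"
    by blast
  have "small_on V (A1 \<union> A2) (e1 + e2)"
    unfolding small_on_def
  proof (intro conjI ballI impI)
    show "openin K V" "finite (A1 \<union> A2)" using V s1 s2 by (auto simp: small_on_def)
    fix f :: "'a \<Rightarrow> 'k" assume f: "f \<in> unit_funs K" and f0: "(\<forall>t. t \<notin> V \<longrightarrow> f t = 0) \<and> (\<forall>a\<in>A1 \<union> A2. f a = 0)"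
    define f1 where "f1 = (\<lambda>t. of_real (\<xi> t) * f t)"
    define f2 where "f2 = (\<lambda>t. of_real (1 - \<xi> t) * f t)"
    have f1: "f1 \<in> unit_funs K" unfolding f1_def by (rule unit_funs_real_mult[OF \<xi>(1,2) f])
    have f2: "f2 \<in> unit_funs K" unfolding f2_def
      by (rule unit_funs_real_mult[OF _ _ f]) (use \<xi>(2) in \<open>auto intro: continuous_map_diff \<xi>(1)\<close>)
    have ft: "t \<notin> topspace K \<Longrightarrow> f t = 0" for t using unit_funsD(1)[OF f] by (simp add: cont_funs_iff)
    have "f1 t = 0" if "t \<notin> U1" for t
      using that \<xi>(3)[of t] ft[of t] by (cases "t \<in> topspace K") (auto simp: f1_def)
    then have n1: "norm (\<nu> f1) \<le> e1" using s1 f1 f0 by (auto simp: small_on_def f1_def)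
    have "f2 t = 0" if "t \<notin> U2" for t
      using that \<xi>(4)[of t] f0 VC by (cases "t \<in> V") (auto simp: f2_def)
    then have n2: "norm (\<nu> f2) \<le> e2" using s2 f2 f0 by (auto simp: small_on_def f2_def)
    have "f = (\<lambda>t. f1 t + f2 t)" by (auto simp: f1_def f2_def algebra_simps)
    then have "\<nu> f = \<nu> f1 + \<nu> f2" using add[OF unit_funsD(1)[OF f1] unit_funsD(1)[OF f2]] by simp
    then show "norm (\<nu> f) \<le> e1 + e2" using n1 n2 norm_triangle_ineq[of "\<nu> f1" "\<nu> f2"] by simp
  qed
  then show thesis using that[OF V(2)] by simp
qed

lemma good_Un: "closedin K H1 \<Longrightarrow> closedin K H2 \<Longrightarrow> good H1 \<Longrightarrow> good H2 \<Longrightarrow> good (H1 \<union> H2)"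
  unfolding good_def
proof (intro allI impI)
  fix e :: real assume H: "closedin K H1" "closedin K H2" and e: "0 < e"
    and g: "\<forall>e>0. \<exists>U A. H1 \<subseteq> U \<and> small_on U A e" "\<forall>e>0. \<exists>U A. H2 \<subseteq> U \<and> small_on U A e"
  obtain U1 A1 where 1: "H1 \<subseteq> U1" "small_on U1 A1 (e/2)" using g(1) e half_gt_zero by blast
  obtain U2 A2 where 2: "H2 \<subseteq> U2" "small_on U2 A2 (e/2)" using g(2) e half_gt_zero by blast
  show "\<exists>U A. H1 \<union> H2 \<subseteq> U \<and> small_on U A e"
    using small_on_glue[OF 1(2) 2(2), of "H1 \<union> H2"] H 1(1) 2(1) by (metis closedin_Un field_sum_of_halves sup.mono)
qed

lemma good_Union: "finite \<H> \<Longrightarrow> (\<And>H. H \<in> \<H> \<Longrightarrow> closedin K H \<and> good H) \<Longrightarrow> good (\<Union>\<H>)"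
proof (induction \<H> rule: finite_induct)
  case empty
  have "small_on {} {} e" if "e > 0" for e
  proof -
    have "norm (\<nu> f) \<le> e" if "\<forall>t. f t = 0" for f
    proof -
      have "f = (\<lambda>t. 0)" using that by auto
      then show ?thesis using zero \<open>e > 0\<close> by simp
    qed
    then show ?thesis by (auto simp: small_on_def)
  qed
  then show ?case unfolding good_def by blast
next
  case (insert H \<H>)
  then show ?case using good_Un[of H "\<Union>\<H>"] by (simp add: closedin_Union)
qed

lemma good_locally:
  assumes H: "closedin K H" and loc: "\<And>t. t \<in> H \<Longrightarrow> \<exists>U H'. openin K U \<and> t \<in> U \<and> U \<subseteq> H' \<and> closedin K H' \<and> good H'"
  shows "good H"
proof -
  obtain U H' where U: "\<And>t. t \<in> H \<Longrightarrow> openin K (U t) \<and> t \<in> U t \<and> U t \<subseteq> H' t \<and> closedin K (H' t) \<and> good (H' t)"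
    using loc by metis
  have "compactin K H" using compact_K H by (rule closedin_compact_space)
  then obtain D where D: "finite D" "D \<subseteq> H" "H \<subseteq> (\<Union>t\<in>D. U t)"
  proof (rule compactin_indexed_cover)
    show "openin K (U t) \<and> t \<in> U t" if "t \<in> H" for t using U[OF that] by simp
  qed
  have "good (\<Union>(H' ` D))" using D U by (intro good_Union) auto
  then show ?thesis by (rule good_mono) (use D U in blast)
qed

text \<open>If \<open>f0\<close> vanishes near \<open>t\<close> and nearly attains the norm of \<open>\<nu>\<close> on such functions, then \<open>\<nu>\<close> is small on
  functions supported in the zero set of \<open>f0\<close>, because adding them to \<open>f0\<close> does not increase the norm.\<close>

lemma good_singleton:
  assumes t: "t \<in> topspace K" shows "good {t}"
  unfolding good_def
proof (intro allI impI)
  fix e :: real assume e: "e > 0"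
  define X where "X = {norm (\<nu> f) | f. f \<in> unit_funs K \<and> (\<exists>W. openin K W \<and> t \<in> W \<and> (\<forall>s\<in>W. f s = 0))}"
  have Xbd: "bdd_above X"
    by (rule bdd_aboveI[of _ "\<bar>M\<bar> * 1"]) (auto simp: X_def intro!: M_bound[where r = 1, simplified] dest: unit_funsD)
  have "norm (\<nu> (\<lambda>t. 0)) \<in> X" unfolding X_def using t by (blast intro: zero_unit_funs)
  then have "\<exists>x\<in>X. Sup X - e/2 < x" using e less_cSup_iff[of X "Sup X - e/2"] Xbd by auto
  then obtain f0 W where f0: "f0 \<in> unit_funs K" "openin K W" "t \<in> W" "\<And>s. s \<in> W \<Longrightarrow> f0 s = 0"
    and near: "Sup X - e/2 < norm (\<nu> f0)" by (auto simp: X_def)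
  have "small_on W {t} e"
    unfolding small_on_def
  proof (intro conjI ballI impI)
    fix f :: "'a \<Rightarrow> 'k" assume f: "f \<in> unit_funs K" and "(\<forall>s. s \<notin> W \<longrightarrow> f s = 0) \<and> (\<forall>a\<in>{t}. f a = 0)"
    then have fW: "\<And>s. s \<notin> W \<Longrightarrow> f s = 0" and ft: "f t = 0" by auto
    \<comment> \<open>Replacing f by f', which like f0 vanishes near t, costs at most
      \<open>\<bar>M\<bar> * \<eta> \<le> e/2\<close>; the other e/2 is the amount by which f0 may
      miss the supremum.\<close>
    define \<eta> where "\<eta> = e / (2 * (\<bar>M\<bar> + 1))"
    have \<eta>: "\<eta> > 0" using e by (simp add: \<eta>_def add_nonneg_pos)
    obtain \<zeta> G where \<zeta>: "continuous_map K euclideanreal \<zeta>" "\<And>t. t \<in> topspace K \<Longrightarrow> 0 \<le> \<zeta> t \<and> \<zeta> t \<le> 1"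
      "openin K G" "{t} \<subseteq> G" "\<And>t. t \<in> G \<Longrightarrow> \<zeta> t = 0" "\<And>t. norm (f t - of_real (\<zeta> t) * f t) \<le> \<eta>"
      using cutoff[OF unit_funsD(1)[OF f] closedin_finite[of "{t}"] _ \<eta>] t ft by auto
    define f' where "f' = (\<lambda>t. of_real (\<zeta> t) * f t)"
    have f': "f' \<in> unit_funs K" unfolding f'_def by (rule unit_funs_real_mult[OF \<zeta>(1,2) f])
    obtain \<theta> where \<theta>: "norm \<theta> = 1" "norm (\<nu> f0 + \<theta> * \<nu> f') = norm (\<nu> f0) + norm (\<nu> f')" using phase_exists .
    define g where "g = (\<lambda>s. f0 s + \<theta> * f' s)"
    have "g \<in> unit_funs K"
      unfolding unit_funs_def
    proof (intro CollectI conjI allI)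
      show "g \<in> cont_funs K" unfolding g_def using f0(1) f' by (intro cont_funs_add cont_funs_cmult unit_funsD)
      show "norm (g s) \<le> 1" for s
        using f0(4)[of s] fW[of s] unit_funsD(2)[OF f0(1), of s] unit_funsD(2)[OF f', of s] \<theta>(1)
        by (cases "s \<in> W") (auto simp: g_def f'_def norm_mult)
    qed
    moreover have "\<forall>s\<in>W \<inter> G. g s = 0" using f0(4) \<zeta>(5) by (auto simp: g_def f'_def)
    ultimately have "norm (\<nu> g) \<in> X"
      unfolding X_def using f0(2,3) \<zeta>(3,4) by (blast intro: openin_Int)
    then have "norm (\<nu> g) \<le> Sup X" using Xbd by (rule cSup_upper)
    moreover have "\<nu> g = \<nu> f0 + \<theta> * \<nu> f'"
      using f0(1) f' by (simp add: g_def add cmult cont_funs_cmult unit_funsD(1))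
    ultimately have "norm (\<nu> f') \<le> e/2" using near \<theta>(2) by simp
    moreover have "norm (\<nu> (\<lambda>t. f t - f' t)) \<le> \<bar>M\<bar> * \<eta>"
      using \<zeta>(6) f f' by (intro M_bound cont_funs_diff unit_funsD(1)) (auto simp: f'_def)
    moreover have "\<bar>M\<bar> * \<eta> \<le> e/2" using e by (simp add: \<eta>_def field_simps)
    ultimately show "norm (\<nu> f) \<le> e"
      using norm_triangle_sub[of "\<nu> f" "\<nu> f'"] f f' by (simp add: diff unit_funsD(1))
  qed (use f0 in auto)
  then show "\<exists>U A. {t} \<subseteq> U \<and> small_on U A e" using f0(3) by blast
qed

text \<open>Rudin's theorem that measures on scattered compact spaces are atomic. No transfinite
  induction is needed: were S nonempty, an isolated point t of S would have a closed neighbourhood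
  meeting S in t alone. The singleton lemma treats a neighbourhood of t, the rest is locally nice,
  and glueing makes t nice.\<close>

lemma scattered_concentrated:
  assumes scat: "scattered_space K" and e: "e > 0"
  obtains A where "finite A" "\<And>f. f \<in> unit_funs K \<Longrightarrow> (\<And>a. a \<in> A \<Longrightarrow> f a = 0) \<Longrightarrow> norm (\<nu> f) \<le> e"
proof -
  define nice where "nice t \<longleftrightarrow> (\<exists>U H'. openin K U \<and> t \<in> U \<and> U \<subseteq> H' \<and> closedin K H' \<and> good H')" for t
  define S where "S = {t \<in> topspace K. \<not> nice t}"
  have "S = {}"
  proof (rule ccontr)
    assume "S \<noteq> {}"
    moreover have "S \<subseteq> topspace K" by (auto simp: S_def)
    ultimately obtain t where t: "t \<in> S" "openin (subtopology K S) {t}"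
      using scat unfolding scattered_space_def by blast
    obtain W where W: "openin K W" "W \<inter> S = {t}" using t(2) by (auto simp: openin_subtopology)
    have tK: "t \<in> topspace K" using t by (auto simp: S_def)
    obtain V where V: "openin K V" "{t} \<subseteq> V" "K closure_of V \<subseteq> W"
      using shrink_open[of "{t}" W] W closedin_finite[of "{t}"] tK by auto
    let ?H = "K closure_of V"
    have "good ?H"
      unfolding good_def
    proof (intro allI impI)
      fix e :: real assume e: "e > 0"
      obtain U1 A1 where 1: "t \<in> U1" "small_on U1 A1 (e/2)"
        using good_singleton[OF tK] half_gt_zero[OF e] unfolding good_def by blast
      have cl: "closedin K (?H - U1)" using 1(2) by (auto simp: small_on_def intro: closedin_diff)
      have "good (?H - U1)"
      proof (rule good_locally[OF cl])
        fix s assume s: "s \<in> ?H - U1"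
        then have "s \<in> W" "s \<noteq> t" "s \<in> topspace K" using V(3) 1(1) closure_of_subset_topspace[of K V] by auto
        then have "nice s" using W(2) by (auto simp: S_def)
        then show "\<exists>U H'. openin K U \<and> s \<in> U \<and> U \<subseteq> H' \<and> closedin K H' \<and> good H'" by (simp add: nice_def)
      qed
      then obtain U2 A2 where 2: "?H - U1 \<subseteq> U2" "small_on U2 A2 (e/2)"
        using half_gt_zero[OF e] unfolding good_def by blast
      show "\<exists>U A. ?H \<subseteq> U \<and> small_on U A e"
        using small_on_glue[OF 1(2) 2(2), of ?H] 2(1) by (metis Diff_subset_conv closedin_closure_of field_sum_of_halves)
    qed
    moreover have "V \<subseteq> ?H" using V(1) by (simp add: closure_of_subset openin_subset)
    ultimately have "nice t" unfolding nice_def using V(1,2) by (intro exI[of _ V] exI[of _ ?H]) auto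
    then show False using t by (simp add: S_def)
  qed
  have "good (topspace K)"
  proof (rule good_locally[OF closedin_topspace])
    fix t assume "t \<in> topspace K"
    then have "nice t" using \<open>S = {}\<close> unfolding S_def by blast
    then show "\<exists>U H'. openin K U \<and> t \<in> U \<and> U \<subseteq> H' \<and> closedin K H' \<and> good H'" by (simp only: nice_def)
  qed
  then obtain U A where U: "topspace K \<subseteq> U" "small_on U A e" using e unfolding good_def by blast
  show thesis
  proof (rule that[of A])
    show "finite A" using U by (simp add: small_on_def)
    fix f :: "'a \<Rightarrow> 'k" assume f: "f \<in> unit_funs K" "\<And>a. a \<in> A \<Longrightarrow> f a = 0"
    then have "\<forall>s. s \<notin> U \<longrightarrow> f s = 0" using U(1) unit_funsD(1)[OF f(1)] by (auto simp: cont_funs_iff)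
    then show "norm (\<nu> f) \<le> e" using U(2) f by (auto simp: small_on_def)
  qed
qed

end


section \<open>Bilinear forms on continuous functions\<close>

definition sign :: "bool \<Rightarrow> real" where
  "sign e = (if e then 1 else - 1)"

lemma abs_sign [simp]: "\<bar>sign e\<bar> = 1" and sign_square [simp]: "sign e * sign e = 1"
  by (simp_all add: sign_def)

abbreviation signs :: "nat \<Rightarrow> (nat \<Rightarrow> bool) set" where
  "signs N \<equiv> PiE {..<N} (\<lambda>_. UNIV)"

lemma finite_signs [simp]: "finite (signs N)" and card_signs [simp]: "card (signs N) = 2 ^ N"
  by (simp_all add: finite_PiE card_PiE)

text \<open>The perturbations of 1 are imaginary because |1 + i x|^2 = 1 + x^2 has no linear term; N
  factors with x of size 1/sqrt N therefore stay bounded.\<close>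

definition riesz_product :: "nat \<Rightarrow> real \<Rightarrow> (nat \<Rightarrow> real) \<Rightarrow> (nat \<Rightarrow> bool) \<Rightarrow> complex" where
  "riesz_product N a \<gamma> \<epsilon> = (\<Prod>m<N. 1 + \<i> * of_real (a * sign (\<epsilon> m) * \<gamma> m))"

text \<open>The sum over sign vectors factorises over the coordinates: an index m different from n
  contributes 2, because its sign terms cancel, and m = n contributes 2 i a
  \<open>\<gamma> n\<close>.\<close>

lemma riesz_product_coefficient:
  assumes n: "n < N"
  shows "(\<Sum>\<epsilon>\<in>signs N. sign (\<epsilon> n) * Im (riesz_product N a \<gamma> \<epsilon>)) = 2 ^ N * (a * \<gamma> n)"
proof -
  define \<phi> where "\<phi> m e = (if m = n then of_real (sign e) else 1) * (1 + \<i> * of_real (a * sign e * \<gamma> m))" for m e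
  have "(\<Sum>\<epsilon>\<in>signs N. of_real (sign (\<epsilon> n)) * riesz_product N a \<gamma> \<epsilon>) = (\<Sum>\<epsilon>\<in>signs N. \<Prod>m<N. \<phi> m (\<epsilon> m))"
  proof (rule sum.cong[OF refl])
    fix \<epsilon>
    have "(\<Prod>m<N. \<phi> m (\<epsilon> m)) = (\<Prod>m<N. if m = n then of_real (sign (\<epsilon> n)) else 1) * riesz_product N a \<gamma> \<epsilon>"
      unfolding riesz_product_def \<phi>_def prod.distrib by (intro arg_cong2[where f = "(*)"] prod.cong) auto
    then show "of_real (sign (\<epsilon> n)) * riesz_product N a \<gamma> \<epsilon> = (\<Prod>m<N. \<phi> m (\<epsilon> m))"
      using n by (simp add: prod.delta)
  qed
  also have "\<dots> = (\<Prod>m<N. \<Sum>e\<in>UNIV. \<phi> m e)" by (rule prod_sum_PiE[symmetric]) auto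
  also have "\<dots> = (\<Prod>m<N. 2 * (if m = n then \<i> * of_real (a * \<gamma> n) else 1))"
    by (intro prod.cong) (auto simp: \<phi>_def UNIV_bool sign_def)
  also have "\<dots> = 2 ^ N * (\<i> * of_real (a * \<gamma> n))"
    using n by (simp add: prod.distrib prod.delta)
  finally have "Im (\<Sum>\<epsilon>\<in>signs N. of_real (sign (\<epsilon> n)) * riesz_product N a \<gamma> \<epsilon>) = Im (of_real (2 ^ N * (a * \<gamma> n)) * \<i>)"
    by (simp add: mult_ac)
  then show ?thesis by (simp add: Im_sum flip: of_real_mult)
qed

text \<open>Each factor has squared modulus at most 1 + 1/N <= exp(1/N), so the product has squared
  modulus at most exp(1), which is below 2^2.\<close>

lemma riesz_product_bound:
  fixes N :: nat
  assumes N: "N > 0" and \<gamma>: "\<And>m. \<bar>\<gamma> m\<bar> \<le> 1"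
  shows "\<bar>Im (riesz_product N (1 / sqrt N) \<gamma> \<epsilon>)\<bar> \<le> 2"
proof -
  define z where "z m = 1 + \<i> * of_real (1 / sqrt N * sign (\<epsilon> m) * \<gamma> m)" for m
  have "(cmod (z m))\<^sup>2 \<le> exp (1 / N)" for m
  proof -
    have "(\<gamma> m)\<^sup>2 \<le> 1" using \<gamma>[of m] by (simp add: abs_square_le_1)
    then have "(\<gamma> m)\<^sup>2 / N \<le> 1 / N" by (simp add: divide_right_mono)
    moreover have "(cmod (z m))\<^sup>2 = 1 + (\<gamma> m)\<^sup>2 / N"
      by (simp add: z_def cmod_power2 power_mult_distrib power_divide power2_eq_square[of "sign _"])
    ultimately show ?thesis using exp_ge_add_one_self[of "1/N"] by linarith
  qed
  then have "(\<Prod>m<N. (cmod (z m))\<^sup>2) \<le> (\<Prod>m<N. exp (1 / N))"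
    by (intro prod_mono) auto
  also have "\<dots> = exp 1" using N by (simp flip: exp_of_nat_mult)
  also have "\<dots> \<le> 2\<^sup>2" using exp_le by simp
  finally have "(cmod (\<Prod>m<N. z m))\<^sup>2 \<le> 2\<^sup>2" by (simp add: prod_norm[symmetric] prod_power_distrib)
  then have "cmod (\<Prod>m<N. z m) \<le> 2" by (rule power2_le_imp_le) simp
  then show ?thesis using abs_Im_le_cmod[of "\<Prod>m<N. z m"] by (simp add: riesz_product_def z_def)
qed

lemma continuous_map_Im_riesz_product:
  assumes "\<And>m. m < N \<Longrightarrow> continuous_map X euclideanreal (\<gamma> m)"
  shows "continuous_map X euclideanreal (\<lambda>t. Im (riesz_product N a (\<lambda>m. \<gamma> m t) \<epsilon>))"
proof -
  have "continuous_map X euclidean (\<lambda>t. \<Prod>m<n. 1 + \<i> * of_real (a * sign (\<epsilon> m) * \<gamma> m t))" if "n \<le> N" for n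
    using that
  proof (induction n)
    case (Suc n)
    then have "continuous_map X euclidean (\<lambda>t. 1 + \<i> * complex_of_real (a * sign (\<epsilon> n) * \<gamma> n t))"
      by (intro continuous_map_add continuous_map_field_mult continuous_map_of_real
          continuous_map_real_mult_left assms) auto
    then show ?case using Suc by (simp add: continuous_map_field_mult)
  qed simp
  from this[of N] show ?thesis
    by (simp add: riesz_product_def continuous_map_atin tendsto_Im)
qed

section \<open>Bounded bilinear forms and their diagonal sums\<close>

locale bounded_form = compact_Hausdorff K for K :: "'a topology" +
  fixes b :: "('a \<Rightarrow> 'k::{real_normed_field, euclidean_space}) \<Rightarrow> ('a \<Rightarrow> 'k) \<Rightarrow> 'k" and M :: real
  assumes add_left: "\<And>f f' g. \<lbrakk>f \<in> cont_funs K; f' \<in> cont_funs K; g \<in> cont_funs K\<rbrakk> \<Longrightarrow> b (\<lambda>t. f t + f' t) g = b f g + b f' g"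
    and cmult_left: "\<And>a f g. \<lbrakk>f \<in> cont_funs K; g \<in> cont_funs K\<rbrakk> \<Longrightarrow> b (\<lambda>t. a * f t) g = a * b f g"
    and add_right: "\<And>f g g'. \<lbrakk>f \<in> cont_funs K; g \<in> cont_funs K; g' \<in> cont_funs K\<rbrakk> \<Longrightarrow> b f (\<lambda>t. g t + g' t) = b f g + b f g'"
    and cmult_right: "\<And>a f g. \<lbrakk>f \<in> cont_funs K; g \<in> cont_funs K\<rbrakk> \<Longrightarrow> b f (\<lambda>t. a * g t) = a * b f g"
    and bound: "\<And>f g. \<lbrakk>f \<in> cont_funs K; g \<in> cont_funs K\<rbrakk> \<Longrightarrow> norm (b f g) \<le> M * (sup_nrm K f * sup_nrm K g)"
    and M_nonneg: "0 \<le> M"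
begin

lemma flip_form: "bounded_form K (\<lambda>f g. b g f) M"
proof unfold_locales
  fix f g :: "'a \<Rightarrow> 'k" assume "f \<in> cont_funs K" "g \<in> cont_funs K"
  then show "norm (b g f) \<le> M * (sup_nrm K f * sup_nrm K g)" using bound[of g f] by (simp only: mult.commute)
qed (simp_all add: add_left add_right cmult_left cmult_right M_nonneg)

lemma diff_left: "\<lbrakk>f \<in> cont_funs K; f' \<in> cont_funs K; g \<in> cont_funs K\<rbrakk> \<Longrightarrow> b (\<lambda>t. f t - f' t) g = b f g - b f' g"
  using add_left[OF _ cont_funs_cmult[of f' K "-1"], of f g] cmult_left[of f' g "-1"] by simp

lemma diff_right: "\<lbrakk>f \<in> cont_funs K; g \<in> cont_funs K; g' \<in> cont_funs K\<rbrakk> \<Longrightarrow> b f (\<lambda>t. g t - g' t) = b f g - b f g'"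
  using add_right[OF _ _ cont_funs_cmult[of g' K "-1"], of f g] cmult_right[of f g' "-1"] by simp

lemma sum_left: "\<lbrakk>finite I; \<And>i. i \<in> I \<Longrightarrow> f i \<in> cont_funs K; g \<in> cont_funs K\<rbrakk> \<Longrightarrow>
    b (\<lambda>t. \<Sum>i\<in>I. c i * f i t) g = (\<Sum>i\<in>I. c i * b (f i) g)"
proof (induction I rule: finite_induct)
  case empty
  then show ?case using cmult_left[of "\<lambda>t. 0" g 0] by simp
next
  case (insert i I)
  then show ?case
    using add_left[of "\<lambda>t. c i * f i t" "\<lambda>t. \<Sum>i\<in>I. c i * f i t" g]
    by (simp add: cmult_left cont_funs_cmult cont_funs_sum)
qed

lemma sum_right: "\<lbrakk>finite I; \<And>i. i \<in> I \<Longrightarrow> g i \<in> cont_funs K; f \<in> cont_funs K\<rbrakk> \<Longrightarrow>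
    b f (\<lambda>t. \<Sum>i\<in>I. c i * g i t) = (\<Sum>i\<in>I. c i * b f (g i))"
proof -
  interpret flip: bounded_form K "\<lambda>f g. b g f" M by (rule flip_form)
  show "\<lbrakk>finite I; \<And>i. i \<in> I \<Longrightarrow> g i \<in> cont_funs K; f \<in> cont_funs K\<rbrakk> \<Longrightarrow> ?thesis" by (rule flip.sum_left)
qed

lemma bound_le:
  assumes "f \<in> cont_funs K" "g \<in> cont_funs K" "\<And>t. norm (f t) \<le> r" "\<And>t. norm (g t) \<le> s"
  shows "norm (b f g) \<le> M * (r * s)"
proof -
  have r: "0 \<le> r" "0 \<le> s" using assms(3,4) norm_ge_zero order_trans by metis+
  have "norm (b f g) \<le> M * (sup_nrm K f * sup_nrm K g)" using assms by (intro bound)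
  also have "\<dots> \<le> M * (r * s)"
    using assms r M_nonneg sup_nrm_nonneg[OF compact_K]
    by (intro mult_left_mono mult_mono sup_nrm_le) auto
  finally show ?thesis .
qed

lemma left_functional: "g \<in> cont_funs K \<Longrightarrow> C_functional K (\<lambda>f. b f g) (M * sup_nrm K g)"
proof unfold_locales
  fix f :: "'a \<Rightarrow> 'k" assume "g \<in> cont_funs K" "f \<in> cont_funs K"
  then show "norm (b f g) \<le> M * sup_nrm K g * sup_nrm K f" using bound[of f g] by (simp only: mult_ac)
qed (simp_all add: add_left cmult_left)

text \<open>Averaging \<open>b (\<Sum>i. \<epsilon> i * f i) (G \<epsilon>)\<close> over all signs, where \<open>G \<epsilon>\<close> is the imaginary part of a Riesz
  product, singles out the diagonal terms, up to the factor \<open>1 / sqrt N\<close>.\<close>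

lemma diagonal_bound:
  fixes N :: nat
  assumes N: "N > 0" and f: "\<And>i. i < N \<Longrightarrow> f i \<in> cont_funs K" "\<And>t. (\<Sum>i<N. norm (f i t)) \<le> 1"
    and \<gamma>: "\<And>i. i < N \<Longrightarrow> continuous_map K euclideanreal (\<gamma> i)" "\<And>i t. \<bar>\<gamma> i t\<bar> \<le> 1" "\<And>i t. t \<notin> topspace K \<Longrightarrow> \<gamma> i t = 0"
  shows "norm (\<Sum>i<N. b (f i) (\<lambda>t. of_real (\<gamma> i t))) \<le> 2 * M * sqrt N"
proof -
  define a where "a = 1 / sqrt N"
  have a: "a > 0" using N by (simp add: a_def)
  define R where "R \<epsilon> t = Im (riesz_product N a (\<lambda>m. \<gamma> m t) \<epsilon>)" for \<epsilon> t
  define G where "G \<epsilon> = (\<lambda>t. of_real (R \<epsilon> t) :: 'k)" for \<epsilon>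
  define F where "F \<epsilon> = (\<lambda>t. \<Sum>i<N. of_real (sign (\<epsilon> i)) * f i t)" for \<epsilon>
  have R2: "\<bar>R \<epsilon> t\<bar> \<le> 2" for \<epsilon> t
    unfolding R_def a_def by (rule riesz_product_bound[OF N \<gamma>(2)])
  have R0: "R \<epsilon> t = 0" if "t \<notin> topspace K" for \<epsilon> t
    using \<gamma>(3)[OF that] by (simp add: R_def riesz_product_def)
  have "continuous_map K euclideanreal (R \<epsilon>)" for \<epsilon>
    unfolding R_def by (rule continuous_map_Im_riesz_product[OF \<gamma>(1)])
  then have GC: "G \<epsilon> \<in> cont_funs K" for \<epsilon>
    by (simp add: cont_funs_iff G_def continuous_map_of_real R0)
  have FC: "F \<epsilon> \<in> cont_funs K" for \<epsilon>
    unfolding F_def using f(1) by (intro cont_funs_sum cont_funs_cmult) auto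
  have gC: "(\<lambda>t. of_real (\<gamma> i t)) \<in> cont_funs K" if "i < N" for i
    using \<gamma> that by (simp add: cont_funs_iff continuous_map_of_real)
  have F1: "norm (F \<epsilon> t) \<le> 1" for \<epsilon> t
    unfolding F_def by (rule order_trans[OF norm_sum]) (use f(2) in \<open>simp add: norm_mult\<close>)
  have "(\<Sum>\<epsilon>\<in>signs N. b (F \<epsilon>) (G \<epsilon>)) = (\<Sum>\<epsilon>\<in>signs N. \<Sum>i<N. of_real (sign (\<epsilon> i)) * b (f i) (G \<epsilon>))"
    unfolding F_def using f(1) GC by (intro sum.cong refl sum_left) auto
  also have "\<dots> = (\<Sum>i<N. \<Sum>\<epsilon>\<in>signs N. of_real (sign (\<epsilon> i)) * b (f i) (G \<epsilon>))" by (rule sum.swap)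
  also have "\<dots> = (\<Sum>i<N. b (f i) (\<lambda>t. \<Sum>\<epsilon>\<in>signs N. of_real (sign (\<epsilon> i)) * G \<epsilon> t))"
    using f(1) GC by (intro sum.cong refl sum_right[symmetric]) auto
  also have "\<dots> = (\<Sum>i<N. b (f i) (\<lambda>t. of_real (2 ^ N * a) * of_real (\<gamma> i t)))"
  proof (intro sum.cong refl arg_cong2[where f = b] ext)
    fix i t assume "i \<in> {..<N}"
    then have "(\<Sum>\<epsilon>\<in>signs N. sign (\<epsilon> i) * R \<epsilon> t) = 2 ^ N * (a * \<gamma> i t)"
      unfolding R_def by (intro riesz_product_coefficient) auto
    then have "of_real (\<Sum>\<epsilon>\<in>signs N. sign (\<epsilon> i) * R \<epsilon> t) = (of_real (2 ^ N * (a * \<gamma> i t)) :: 'k)" by (rule arg_cong)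
    then show "(\<Sum>\<epsilon>\<in>signs N. of_real (sign (\<epsilon> i)) * G \<epsilon> t) = of_real (2 ^ N * a) * of_real (\<gamma> i t)"
      by (simp add: G_def mult_ac)
  qed
  also have "\<dots> = of_real (2 ^ N * a) * (\<Sum>i<N. b (f i) (\<lambda>t. of_real (\<gamma> i t)))"
    unfolding sum_distrib_left using f(1) gC by (intro sum.cong refl cmult_right) auto
  finally have "norm (of_real (2 ^ N * a) * (\<Sum>i<N. b (f i) (\<lambda>t. of_real (\<gamma> i t)))) = norm (\<Sum>\<epsilon>\<in>signs N. b (F \<epsilon>) (G \<epsilon>))"
    by simp
  \<comment> \<open>F is bounded by 1 through the pointwise condition on the f i, and G by 2 as part
    of a Riesz product; this is where the constant 2 comes from.\<close>
  also have "\<dots> \<le> (\<Sum>\<epsilon>\<in>signs N. M * (1 * 2))"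
    using FC GC F1 R2 by (intro sum_norm_le bound_le) (auto simp: G_def)
  finally have "2 ^ N * (a * norm (\<Sum>i<N. b (f i) (\<lambda>t. of_real (\<gamma> i t)))) \<le> 2 ^ N * (2 * M)"
    using a by (simp only: norm_mult norm_of_real) (simp add: abs_mult)
  then have "a * norm (\<Sum>i<N. b (f i) (\<lambda>t. of_real (\<gamma> i t))) \<le> 2 * M" by simp
  then show ?thesis using N by (simp add: a_def field_simps)
qed

end

section \<open>Bump functions at finitely many points\<close>

context compact_Hausdorff
begin

lemma disjoint_nhds:
  assumes "finite A" "A \<subseteq> topspace K"
  obtains U where "\<And>a. a \<in> A \<Longrightarrow> openin K (U a)" "\<And>a. a \<in> A \<Longrightarrow> a \<in> U a"
    "\<And>a a'. \<lbrakk>a \<in> A; a' \<in> A; a \<noteq> a'\<rbrakk> \<Longrightarrow> U a \<inter> U a' = {}"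
proof -
  have "\<exists>U. (\<forall>a\<in>A. openin K (U a) \<and> a \<in> U a) \<and> (\<forall>a\<in>A. \<forall>a'\<in>A. a \<noteq> a' \<longrightarrow> U a \<inter> U a' = {})"
    using assms
  proof (induction A rule: finite_induct)
    case (insert x A)
    then have "\<exists>U. (\<forall>a\<in>A. openin K (U a) \<and> a \<in> U a) \<and> (\<forall>a\<in>A. \<forall>a'\<in>A. a \<noteq> a' \<longrightarrow> U a \<inter> U a' = {})" by simp
    then obtain U where U1: "\<forall>a\<in>A. openin K (U a) \<and> a \<in> U a"
      and U2: "\<forall>a\<in>A. \<forall>a'\<in>A. a \<noteq> a' \<longrightarrow> U a \<inter> U a' = {}"
      by (elim exE conjE) (rule that)
    note U = bspec[OF U1] U2[rule_format]
    have "openin K (topspace K - A)" using closedin_finite[of A] insert by auto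
    then obtain V where V: "openin K V" "{x} \<subseteq> V" "K closure_of V \<subseteq> topspace K - A"
      using shrink_open[of "{x}" "topspace K - A"] closedin_finite[of "{x}"] insert by auto
    have VC: "V \<subseteq> K closure_of V" using V(1) by (simp add: closure_of_subset openin_subset)
    \<comment> \<open>The earlier neighbourhoods are cut by the closure of the new one, which misses
      the earlier points.\<close>
    define W where "W a = (if a = x then V else U a - K closure_of V)" for a
    have "openin K (W a) \<and> a \<in> W a" if "a \<in> insert x A" for a
      using that V U(1)[of a] by (auto simp: W_def)
    moreover have "W a \<inter> W a' = {}" if "a \<in> insert x A" "a' \<in> insert x A" "a \<noteq> a'" for a a'
      using that U(2)[of a a'] VC by (auto simp: W_def)
    ultimately show ?case by (intro exI[of _ W]) blast
  qed simp
  then obtain U where "\<forall>a\<in>A. openin K (U a) \<and> a \<in> U a" "\<forall>a\<in>A. \<forall>a'\<in>A. a \<noteq> a' \<longrightarrow> U a \<inter> U a' = {}"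
    by (elim exE conjE) (rule that)
  then show thesis by (intro that[of U]) auto
qed

text \<open>The supports lie in disjoint neighbourhoods, so at most one p a is nonzero at any given
  t; this yields the last property.\<close>

lemma bumps:
  assumes A: "finite A" "A \<subseteq> topspace K"
  obtains p :: "'a \<Rightarrow> 'a \<Rightarrow> real" where "\<And>a. a \<in> A \<Longrightarrow> continuous_map K euclideanreal (p a)"
    "\<And>a t. a \<in> A \<Longrightarrow> 0 \<le> p a t \<and> p a t \<le> 1" "\<And>a t. a \<in> A \<Longrightarrow> t \<notin> topspace K \<Longrightarrow> p a t = 0"
    "\<And>a. a \<in> A \<Longrightarrow> p a a = 1" "\<And>a a'. \<lbrakk>a \<in> A; a' \<in> A; a \<noteq> a'\<rbrakk> \<Longrightarrow> p a a' = 0"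
    "\<And>B t. B \<subseteq> A \<Longrightarrow> (\<Sum>a\<in>B. p a t) \<le> 1"
proof -
  obtain U where U: "\<And>a. a \<in> A \<Longrightarrow> openin K (U a)" "\<And>a. a \<in> A \<Longrightarrow> a \<in> U a"
    "\<And>a a'. \<lbrakk>a \<in> A; a' \<in> A; a \<noteq> a'\<rbrakk> \<Longrightarrow> U a \<inter> U a' = {}"
    using disjoint_nhds[OF A] by metis
  have ex: "\<exists>p. continuous_map K euclideanreal p \<and> (\<forall>t. 0 \<le> p t \<and> p t \<le> 1) \<and> (\<forall>t. t \<notin> U a \<longrightarrow> p t = 0) \<and> p a = 1"
    if a: "a \<in> A" for a
  proof -
    have "closedin K (topspace K - U a)" "closedin K {a}" "(topspace K - U a) \<inter> {a} = {}"
      using U(1,2)[OF a] closedin_finite[of "{a}"] A a by auto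
    from Urysohn01[OF this] obtain \<xi> where \<xi>: "continuous_map K euclideanreal \<xi>" "\<And>t. t \<in> topspace K \<Longrightarrow> 0 \<le> \<xi> t \<and> \<xi> t \<le> 1"
      "\<And>t. t \<in> topspace K - U a \<Longrightarrow> \<xi> t = 0" "\<And>t. t \<in> {a} \<Longrightarrow> \<xi> t = 1" by blast
    define p where "p t = (if t \<in> topspace K then \<xi> t else 0)" for t
    have "continuous_map K euclideanreal p"
      by (rule continuous_map_eq[OF \<xi>(1)]) (simp add: p_def)
    then show ?thesis using \<xi>(2,3) \<xi>(4)[of a] A a by (intro exI[of _ p]) (auto simp: p_def)
  qed
  have "\<forall>a\<in>A. \<exists>p. continuous_map K euclideanreal p \<and> (\<forall>t. 0 \<le> p t \<and> p t \<le> 1) \<and> (\<forall>t. t \<notin> U a \<longrightarrow> p t = 0) \<and> p a = 1"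
    using ex by blast
  from bchoice[OF this] obtain p where p: "\<And>a. a \<in> A \<Longrightarrow> continuous_map K euclideanreal (p a)"
    "\<And>a t. a \<in> A \<Longrightarrow> 0 \<le> p a t \<and> p a t \<le> 1" "\<And>a t. a \<in> A \<Longrightarrow> t \<notin> U a \<Longrightarrow> p a t = 0" "\<And>a. a \<in> A \<Longrightarrow> p a a = 1"
    by blast
  show thesis
  proof (rule that[OF p(1) p(2)])
    show "p a t = 0" if "a \<in> A" "t \<notin> topspace K" for a t
      using p(3)[OF that(1)] U(1)[OF that(1)] that(2) openin_subset by blast
    show "p a a' = 0" if "a \<in> A" "a' \<in> A" "a \<noteq> a'" for a a'
      using p(3)[OF that(1)] U(2)[OF that(2)] U(3)[OF that] by blast
    show "(\<Sum>a\<in>B. p a t) \<le> 1" if B: "B \<subseteq> A" for B t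
    proof (cases "\<exists>a\<in>B. t \<in> U a")
      case True
      then obtain a where a: "a \<in> B" "t \<in> U a" by blast
      have "(\<Sum>a\<in>B. p a t) = (\<Sum>a'\<in>B. if a' = a then p a t else 0)"
      proof (rule sum.cong[OF refl])
        fix a' assume a': "a' \<in> B"
        show "p a' t = (if a' = a then p a t else 0)"
          using a a' B U(3)[of a a'] p(3)[of a' t] by auto
      qed
      also have "\<dots> \<le> 1" using a B A p(2)[of a t] finite_subset[of B A] by (auto simp: sum.delta)
      finally show ?thesis .
    next
      case False
      then have "(\<Sum>a\<in>B. p a t) = 0" using B p(3) by (intro sum.neutral) auto
      then show ?thesis by simp
    qed
  qed (use p in auto)
qed

end

text \<open>The factor 1/2 keeps the difference in the unit ball, to which the concentration
  estimates are confined.\<close>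

lemma unit_funs_half_diff:
  assumes "f \<in> unit_funs K" "g \<in> unit_funs K"
  shows "(\<lambda>t. (1/2) * (f t - g t)) \<in> unit_funs K"
proof -
  have "norm ((1/2) * (f t - g t)) \<le> 1" for t
    using norm_triangle_ineq4[of "f t" "g t"] unit_funsD(2)[OF assms(1), of t] unit_funsD(2)[OF assms(2), of t]
    by (simp add: norm_mult norm_divide)
  then show ?thesis
    using cont_funs_cmult[OF cont_funs_diff[OF unit_funsD(1)[OF assms(1)] unit_funsD(1)[OF assms(2)]], of "1/2"]
    by (auto simp: unit_funs_def)
qed

section \<open>Concentration of a single form over a scattered space\<close>

context bounded_form
begin

text \<open>Otherwise there are arbitrarily many pairs \<open>(f i, g i)\<close> with \<open>\<bar>b (f i) (g i)\<bar> > e\<close>, where \<open>f i\<close> may be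
  cut off to a small neighbourhood of a finite set \<open>D i\<close>, the sets \<open>D i\<close> being disjoint. This
  contradicts the bound for the diagonal terms.\<close>

lemma concentrated_real:
  assumes scat: "scattered_space K" and e: "e > 0"
  obtains A where "finite A" "A \<subseteq> topspace K"
    "\<And>f \<gamma>. \<lbrakk>f \<in> unit_funs K; \<And>a. a \<in> A \<Longrightarrow> f a = 0; continuous_map K euclideanreal \<gamma>; \<And>t. \<bar>\<gamma> t\<bar> \<le> 1; \<And>t. t \<notin> topspace K \<Longrightarrow> \<gamma> t = 0\<rbrakk> \<Longrightarrow>
        norm (b f (\<lambda>t. of_real (\<gamma> t))) \<le> e"
proof (rule ccontr)
  assume no: "\<not> thesis"
  note found = that
  define real_unit where "real_unit = (\<lambda>\<gamma>. continuous_map K euclideanreal \<gamma> \<and> (\<forall>t. \<bar>\<gamma> t\<bar> \<le> 1) \<and> (\<forall>t. t \<notin> topspace K \<longrightarrow> \<gamma> t = 0))"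
  have ru: "(\<lambda>t. of_real (\<gamma> t)) \<in> unit_funs K" if "real_unit \<gamma>" for \<gamma>
    using that by (auto simp: real_unit_def unit_funs_def cont_funs_iff continuous_map_of_real)
  have far: "\<exists>f \<gamma>. f \<in> unit_funs K \<and> (\<forall>a\<in>A. f a = 0) \<and> real_unit \<gamma> \<and> e < norm (b f (\<lambda>t. of_real (\<gamma> t)))"
    if "finite A" "A \<subseteq> topspace K" for A
  proof (rule ccontr)
    assume none: "\<not> ?thesis"
    have small: "norm (b f (\<lambda>t. of_real (\<gamma> t))) \<le> e"
      if f: "f \<in> unit_funs K" "\<And>a. a \<in> A \<Longrightarrow> f a = 0" and \<gamma>: "continuous_map K euclideanreal \<gamma>" "\<And>t. \<bar>\<gamma> t\<bar> \<le> 1" "\<And>t. t \<notin> topspace K \<Longrightarrow> \<gamma> t = 0" for f \<gamma>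
    proof -
      have "real_unit \<gamma>" using \<gamma> by (simp add: real_unit_def)
      then have "\<not> e < norm (b f (\<lambda>t. of_real (\<gamma> t)))" using none f by blast
      then show ?thesis by simp
    qed
    show False by (rule notE[OF no found[OF that small]])
  qed
  define P where "P = (\<lambda>(A, f :: 'a \<Rightarrow> 'k, \<gamma> :: 'a \<Rightarrow> real). finite A \<and> A \<subseteq> topspace K)"
  \<comment> \<open>The new pair is chosen against the old set A: f vanishes on A, while A' is so
    large that the functional b(., \<open>\<gamma>\<close>) is at most e/2 on unit functions
    vanishing on A'.\<close>
  define Q where "Q = (\<lambda>(A, f0 :: 'a \<Rightarrow> 'k, \<gamma>0 :: 'a \<Rightarrow> real) (A', f, \<gamma>). A \<subseteq> A' \<and> f \<in> unit_funs K \<and> (\<forall>a\<in>A. f a = 0) \<and> real_unit \<gamma> \<and>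
     e < norm (b f (\<lambda>t. of_real (\<gamma> t))) \<and> (\<forall>h\<in>unit_funs K. (\<forall>a\<in>A'. h a = 0) \<longrightarrow> norm (b h (\<lambda>t. of_real (\<gamma> t))) \<le> e/2))"
  have "\<exists>S. \<forall>n::nat. P (S n) \<and> Q (S n) (S (Suc n))"
  proof (rule dependent_nat_choice)
    show "\<exists>S. P S" by (rule exI[of _ "({}, \<lambda>t. 0, \<lambda>t. 0)"]) (simp add: P_def)
  next
    fix S :: "'a set \<times> ('a \<Rightarrow> 'k) \<times> ('a \<Rightarrow> real)" and n :: nat assume "P S"
    then obtain A f0 \<gamma>0 where S: "S = (A, f0, \<gamma>0)" "finite A" "A \<subseteq> topspace K" by (auto simp: P_def)
    obtain f \<gamma> where f: "f \<in> unit_funs K" "\<forall>a\<in>A. f a = 0" "real_unit \<gamma>" "e < norm (b f (\<lambda>t. of_real (\<gamma> t)))"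
      using far[OF S(2,3)] by blast
    interpret \<nu>: C_functional K "\<lambda>h. b h (\<lambda>t. of_real (\<gamma> t))" "M * sup_nrm K (\<lambda>t. of_real (\<gamma> t) :: 'k)"
      by (rule left_functional[OF unit_funsD(1)[OF ru[OF f(3)]]])
    obtain B where B: "finite B" "\<And>h. h \<in> unit_funs K \<Longrightarrow> (\<And>a. a \<in> B \<Longrightarrow> h a = 0) \<Longrightarrow> norm (b h (\<lambda>t. of_real (\<gamma> t))) \<le> e/2"
      using \<nu>.scattered_concentrated[OF scat half_gt_zero[OF e]] by blast
    define A' where "A' = A \<union> (B \<inter> topspace K)"
    have "norm (b h (\<lambda>t. of_real (\<gamma> t))) \<le> e/2" if h: "h \<in> unit_funs K" "\<forall>a\<in>A'. h a = 0" for h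
    proof (rule B(2)[OF h(1)])
      show "h a = 0" if "a \<in> B" for a
        using that h(2) unit_funsD(1)[OF h(1)] by (cases "a \<in> topspace K") (auto simp: A'_def cont_funs_iff)
    qed
    then have "P (A', f, \<gamma>)" "Q S (A', f, \<gamma>)" using S B f by (auto simp: P_def Q_def A'_def)
    then show "\<exists>S'. P S' \<and> Q S S'" by blast
  qed
  then obtain S where S: "\<And>n::nat. P (S n)" "\<And>n. Q (S n) (S (Suc n))" by blast
  define A where "A n = fst (S n)" for n
  define f where "f n = fst (snd (S (Suc n)))" for n
  define \<gamma> where "\<gamma> n = snd (snd (S (Suc n)))" for n
  have Q0: "Q (A n, fst (snd (S n)), snd (snd (S n))) (A (Suc n), f n, \<gamma> n)" for n
    using S(2)[of n] by (simp add: A_def f_def \<gamma>_def)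
  have A: "finite (A n)" "A n \<subseteq> topspace K" for n using S(1)[of n] by (auto simp: P_def A_def)
  have Q': "A n \<subseteq> A (Suc n)" "f n \<in> unit_funs K" "\<And>a. a \<in> A n \<Longrightarrow> f n a = 0" "real_unit (\<gamma> n)" "e < norm (b (f n) (\<lambda>t. of_real (\<gamma> n t)))"
    "\<And>h. \<lbrakk>h \<in> unit_funs K; \<forall>a\<in>A (Suc n). h a = 0\<rbrakk> \<Longrightarrow> norm (b h (\<lambda>t. of_real (\<gamma> n t))) \<le> e/2" for n
    using Q0[of n] by (auto simp: Q_def)
  have Amono: "A m \<subseteq> A n" if "m \<le> n" for m n using lift_Suc_mono_le[of A, OF Q'(1) that] .
  define D where "D n = A (Suc n) - A n" for n
  \<comment> \<open>N diagonal terms exceeding e/2 force N e/2 <= 2 M sqrt N by the diagonal bound,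
    that is, sqrt N <= 4 M / e.\<close>
  obtain N :: nat where N: "(4 * M / e)\<^sup>2 < N" using reals_Archimedean2 by blast
  then have N0: "N > 0" by (cases N) (auto simp: not_less[symmetric])
  obtain p :: "'a \<Rightarrow> 'a \<Rightarrow> real" where p: "\<And>a. a \<in> A N \<Longrightarrow> continuous_map K euclideanreal (p a)"
    "\<And>a t. a \<in> A N \<Longrightarrow> 0 \<le> p a t \<and> p a t \<le> 1" "\<And>a t. a \<in> A N \<Longrightarrow> t \<notin> topspace K \<Longrightarrow> p a t = 0"
    "\<And>a. a \<in> A N \<Longrightarrow> p a a = 1" "\<And>a a'. \<lbrakk>a \<in> A N; a' \<in> A N; a \<noteq> a'\<rbrakk> \<Longrightarrow> p a a' = 0"
    "\<And>B t. B \<subseteq> A N \<Longrightarrow> (\<Sum>a\<in>B. p a t) \<le> 1"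
    using bumps[OF A, of N] by blast
  have DA: "D n \<subseteq> A N" if "n < N" for n using that Amono[of "Suc n" N] by (auto simp: D_def)
  \<comment> \<open>The cut-off \<open>\<xi> n\<close> is 1 on D n, the points new in A (Suc n).
    Since f n vanishes on A n, the remainder \<open>(1 - \<xi> n) * f n\<close> vanishes on all of A
    (Suc n) and contributes at most e/2.\<close>
  define \<xi> where "\<xi> n t = (\<Sum>a\<in>D n. p a t)" for n t
  have \<xi>c: "continuous_map K euclideanreal (\<xi> n)" if "n < N" for n
    unfolding \<xi>_def using p(1) DA[OF that] A by (intro continuous_map_sum) (auto simp: D_def)
  have \<xi>01: "0 \<le> \<xi> n t \<and> \<xi> n t \<le> 1" if "n < N" for n t
    unfolding \<xi>_def using p(2,6) DA[OF that] by (auto intro!: sum_nonneg)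
  have \<xi>1: "\<xi> n a = 1" if n: "n < N" and a: "a \<in> D n" for n a
  proof -
    have "\<xi> n a = (\<Sum>a'\<in>D n. if a' = a then 1 else 0)"
      unfolding \<xi>_def using p(4,5) DA[OF n] a by (intro sum.cong) (auto simp: subset_iff)
    then show ?thesis using a A by (simp add: D_def)
  qed
  have cut: "(\<lambda>t. of_real (\<xi> n t) * f n t) \<in> unit_funs K" "(\<lambda>t. of_real (1 - \<xi> n t) * f n t) \<in> unit_funs K" if "n < N" for n
    using \<xi>01[OF that] by (intro unit_funs_real_mult Q'(2) \<xi>c that continuous_map_diff; simp)+
  define c where "c n = b (\<lambda>t. of_real (\<xi> n t) * f n t) (\<lambda>t. of_real (\<gamma> n t))" for n
  have c: "e/2 < norm (c n)" if n: "n < N" for n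
  proof -
    have gC: "(\<lambda>t. of_real (\<gamma> n t)) \<in> cont_funs K" using ru[OF Q'(4)] by (rule unit_funsD)
    have "(\<lambda>t. of_real (\<xi> n t) * f n t + of_real (1 - \<xi> n t) * f n t) = f n" by (auto simp: algebra_simps)
    then have "b (f n) (\<lambda>t. of_real (\<gamma> n t)) = c n + b (\<lambda>t. of_real (1 - \<xi> n t) * f n t) (\<lambda>t. of_real (\<gamma> n t))"
      unfolding c_def using add_left[OF unit_funsD(1)[OF cut(1)[OF n]] unit_funsD(1)[OF cut(2)[OF n]] gC] by simp
    moreover have "norm (b (\<lambda>t. of_real (1 - \<xi> n t) * f n t) (\<lambda>t. of_real (\<gamma> n t))) \<le> e/2"
    proof (rule Q'(6)[OF cut(2)[OF n]], intro ballI)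
      fix a assume "a \<in> A (Suc n)"
      then show "of_real (1 - \<xi> n a) * f n a = 0"
        using \<xi>1[OF n, of a] Q'(3)[of a n] by (cases "a \<in> A n") (auto simp: D_def)
    qed
    ultimately show ?thesis using Q'(5)[of n] norm_triangle_ineq[of "c n" "b (\<lambda>t. of_real (1 - \<xi> n t) * f n t) (\<lambda>t. of_real (\<gamma> n t))"] by simp
  qed
  \<comment> \<open>Unimodular factors make all diagonal terms positive, so that they cannot
    cancel.\<close>
  define \<theta> where "\<theta> n = of_real (norm (c n)) / c n" for n
  have \<theta>: "norm (\<theta> n) = 1" if "n < N" for n using c[OF that] e by (auto simp: \<theta>_def norm_divide)
  define F where "F n = (\<lambda>t. \<theta> n * (of_real (\<xi> n t) * f n t))" for n
  have "norm (\<Sum>n<N. b (F n) (\<lambda>t. of_real (\<gamma> n t))) \<le> 2 * M * sqrt N"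
  proof (rule diagonal_bound[OF N0])
    show "F n \<in> cont_funs K" if "n < N" for n unfolding F_def using cut(1)[OF that] by (intro cont_funs_cmult unit_funsD)
    have disj: "D m \<inter> D n = {}" if "m < n" for m n using Amono[of "Suc m" n] that by (auto simp: D_def)
    have disj': "D m \<inter> D n = {}" if "m \<noteq> n" for m n
      using that disj[of m n] disj[of n m] by (cases m n rule: linorder_cases) auto
    fix t
    have "(\<Sum>n<N. norm (F n t)) \<le> (\<Sum>n<N. \<xi> n t)"
    proof (rule sum_mono)
      fix n assume "n \<in> {..<N}"
      then show "norm (F n t) \<le> \<xi> n t" using \<theta>[of n] \<xi>01[of n t] unit_funsD(2)[OF Q'(2), of n t]
        by (simp add: F_def norm_mult mult_left_le)
    qed
    also have "\<dots> = (\<Sum>a\<in>(\<Union>n<N. D n). p a t)"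
      unfolding \<xi>_def by (rule sum.UNION_disjoint[symmetric]) (use A disj' in \<open>auto simp: D_def\<close>)
    also have "\<dots> \<le> 1" using DA by (intro p(6)) auto
    finally show "(\<Sum>n<N. norm (F n t)) \<le> 1" .
  qed (use Q'(4) in \<open>auto simp: real_unit_def\<close>)
  moreover have "b (F n) (\<lambda>t. of_real (\<gamma> n t)) = of_real (norm (c n))" if "n < N" for n
  proof -
    have "b (F n) (\<lambda>t. of_real (\<gamma> n t)) = \<theta> n * c n"
      unfolding F_def c_def using cut(1)[OF that] ru[OF Q'(4)] by (intro cmult_left unit_funsD)
    then show ?thesis using c[OF that] e by (auto simp: \<theta>_def)
  qed
  ultimately have "norm (\<Sum>n<N. of_real (norm (c n)) :: 'k) \<le> 2 * M * sqrt N" by simp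
  then have "\<bar>\<Sum>n<N. norm (c n)\<bar> \<le> 2 * M * sqrt N" by (simp flip: of_real_sum)
  moreover have "(\<Sum>n<N. e/2) \<le> (\<Sum>n<N. norm (c n))" using c by (intro sum_mono) (auto simp: less_imp_le)
  ultimately have le: "real N * e \<le> 4 * M * sqrt N" by simp
  have "sqrt N * (sqrt N * e) = real N * e" by (simp flip: mult.assoc)
  also have "\<dots> \<le> sqrt N * (4 * M)" using le by (simp only: mult.commute[of "sqrt N"])
  finally have "sqrt N * e \<le> 4 * M" using N0 by simp
  then have "sqrt N \<le> 4 * M / e" using e by (simp add: pos_le_divide_eq)
  then have "(sqrt N)\<^sup>2 \<le> (4 * M / e)\<^sup>2" by (intro power_mono) auto
  then show False using N by simp
qed

text \<open>The real-valued case is applied to the coordinates of g, each of modulus at most 1; d is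
  the dimension of the scalar field.\<close>

lemma concentrated_left:
  assumes scat: "scattered_space K" and e: "e > 0"
  obtains A where "finite A" "A \<subseteq> topspace K"
    "\<And>f g. \<lbrakk>f \<in> unit_funs K; g \<in> unit_funs K; \<And>a. a \<in> A \<Longrightarrow> f a = 0\<rbrakk> \<Longrightarrow> norm (b f g) \<le> e"
proof -
  define d where "d = real DIM('k)"
  have d: "d > 0" by (simp add: d_def)
  obtain A where A: "finite A" "A \<subseteq> topspace K"
    "\<And>f \<gamma>. \<lbrakk>f \<in> unit_funs K; \<And>a. a \<in> A \<Longrightarrow> f a = 0; continuous_map K euclideanreal \<gamma>; \<And>t. \<bar>\<gamma> t\<bar> \<le> 1; \<And>t. t \<notin> topspace K \<Longrightarrow> \<gamma> t = 0\<rbrakk> \<Longrightarrow>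
        norm (b f (\<lambda>t. of_real (\<gamma> t))) \<le> e / d"
    using concentrated_real[OF scat, of "e / d"] d e by (metis divide_pos_pos)
  show thesis
  proof (rule that[OF A(1,2)])
    fix f g :: "'a \<Rightarrow> 'k" assume f: "f \<in> unit_funs K" "\<And>a. a \<in> A \<Longrightarrow> f a = 0" and g: "g \<in> unit_funs K"
    have gC: "continuous_map K euclidean g" "\<And>t. t \<notin> topspace K \<Longrightarrow> g t = 0" using unit_funsD(1)[OF g] by (auto simp: cont_funs_iff)
    have cont: "continuous_map K euclideanreal (\<lambda>t. g t \<bullet> \<beta>)" for \<beta>
      using gC(1) by (simp add: continuous_map_atin tendsto_inner)
    have comp: "(\<lambda>t. of_real (g t \<bullet> \<beta>)) \<in> cont_funs K" for \<beta> using cont gC(2) by (simp add: cont_funs_iff continuous_map_of_real)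
    have geq: "g = (\<lambda>t. \<Sum>\<beta>\<in>Basis. \<beta> * of_real (g t \<bullet> \<beta>))"
    proof
      show "g t = (\<Sum>\<beta>\<in>Basis. \<beta> * of_real (g t \<bullet> \<beta>))" for t
        using euclidean_representation[of "g t"] by (simp add: scaleR_conv_of_real mult.commute)
    qed
    have "b f g = b f (\<lambda>t. \<Sum>\<beta>\<in>Basis. \<beta> * of_real (g t \<bullet> \<beta>))" by (rule arg_cong[OF geq])
    also have "\<dots> = (\<Sum>\<beta>\<in>Basis. \<beta> * b f (\<lambda>t. of_real (g t \<bullet> \<beta>)))"
      by (rule sum_right) (use comp unit_funsD(1)[OF f(1)] in auto)
    also have "norm \<dots> \<le> (\<Sum>\<beta>\<in>(Basis::'k set). e / d)"
    proof (rule sum_norm_le)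
      fix \<beta> :: 'k assume \<beta>: "\<beta> \<in> Basis"
      have "\<bar>g t \<bullet> \<beta>\<bar> \<le> 1" for t
        using Basis_le_norm[OF \<beta>, of "g t"] unit_funsD(2)[OF g, of t] by simp
      then have "norm (b f (\<lambda>t. of_real (g t \<bullet> \<beta>))) \<le> e / d"
        using gC(2) by (intro A(3) f cont) auto
      then show "norm (\<beta> * b f (\<lambda>t. of_real (g t \<bullet> \<beta>))) \<le> e / d" using \<beta> by (simp add: norm_mult)
    qed
    also have "\<dots> = e" using d by (simp add: d_def)
    finally show "norm (b f g) \<le> e" .
  qed
qed

lemma concentrated_difference:
  assumes scat: "scattered_space K" and e: "e > 0"
  obtains A where "finite A" "A \<subseteq> topspace K"
    "\<And>f f' g. \<lbrakk>f \<in> unit_funs K; f' \<in> unit_funs K; g \<in> unit_funs K; \<And>a. a \<in> A \<Longrightarrow> f a = f' a\<rbrakk> \<Longrightarrow> norm (b f g - b f' g) \<le> e"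
proof -
  obtain A where A: "finite A" "A \<subseteq> topspace K"
    "\<And>f g. \<lbrakk>f \<in> unit_funs K; g \<in> unit_funs K; \<And>a. a \<in> A \<Longrightarrow> f a = 0\<rbrakk> \<Longrightarrow> norm (b f g) \<le> e/2"
    using concentrated_left[OF scat half_gt_zero[OF e]] by blast
  show thesis
  proof (rule that[OF A(1,2)])
    fix f f' g :: "'a \<Rightarrow> 'k" assume f: "f \<in> unit_funs K" "f' \<in> unit_funs K" and g: "g \<in> unit_funs K" and eq: "\<And>a. a \<in> A \<Longrightarrow> f a = f' a"
    define B where "B = b (\<lambda>t. (1/2) * (f t - f' t)) g"
    have "norm B \<le> e/2"
      unfolding B_def using eq by (intro A(3) unit_funs_half_diff f g) auto
    moreover have "B = (1/2) * (b f g - b f' g)"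
      unfolding B_def using f g by (simp only: cmult_left cont_funs_diff diff_left unit_funsD(1))
    then have "b f g - b f' g = 2 * B" by (simp add: mult.commute)
    ultimately show "norm (b f g - b f' g) \<le> e" by (simp add: norm_mult)
  qed
qed

text \<open>b(f,f) - b(f',f') = b(f - f', f) + b(f', f - f') has one term for each argument, hence
  the use of the flipped form.\<close>

lemma concentrated_square:
  assumes scat: "scattered_space K" and e: "e > 0"
  obtains A where "finite A" "A \<subseteq> topspace K"
    "\<And>f f'. \<lbrakk>f \<in> unit_funs K; f' \<in> unit_funs K; \<And>a. a \<in> A \<Longrightarrow> f a = f' a\<rbrakk> \<Longrightarrow> norm (b f f - b f' f') \<le> e"
proof -
  interpret flip: bounded_form K "\<lambda>f g. b g f" M by (rule flip_form)
  obtain A where A: "finite A" "A \<subseteq> topspace K"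
    "\<And>f f' g. \<lbrakk>f \<in> unit_funs K; f' \<in> unit_funs K; g \<in> unit_funs K; \<And>a. a \<in> A \<Longrightarrow> f a = f' a\<rbrakk> \<Longrightarrow> norm (b f g - b f' g) \<le> e/2"
    using concentrated_difference[OF scat half_gt_zero[OF e]] by blast
  obtain B where B: "finite B" "B \<subseteq> topspace K"
    "\<And>f f' g. \<lbrakk>f \<in> unit_funs K; f' \<in> unit_funs K; g \<in> unit_funs K; \<And>a. a \<in> B \<Longrightarrow> f a = f' a\<rbrakk> \<Longrightarrow> norm (b g f - b g f') \<le> e/2"
    using flip.concentrated_difference[OF scat half_gt_zero[OF e]] by blast
  show thesis
  proof (rule that[of "A \<union> B"])
    fix f f' :: "'a \<Rightarrow> 'k" assume f: "f \<in> unit_funs K" "f' \<in> unit_funs K" and eq: "\<And>a. a \<in> A \<union> B \<Longrightarrow> f a = f' a"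
    have "norm (b f f - b f' f) \<le> e/2" "norm (b f' f - b f' f') \<le> e/2" using A(3) B(3) f eq by auto
    then show "norm (b f f - b f' f') \<le> e" using norm_triangle_ineq[of "b f f - b f' f" "b f' f - b f' f'"] by simp
  qed (use A B in auto)
qed

end


section \<open>Perturbation away from a finite set, and interpolation on it\<close>

lemma unit_funs_half_sum:
  assumes "f \<in> unit_funs K" "g \<in> unit_funs K"
  shows "(\<lambda>t. (1/2) * (f t + g t)) \<in> unit_funs K"
proof -
  have "norm ((1/2) * (f t + g t)) \<le> 1" for t
    using norm_triangle_ineq[of "f t" "g t"] unit_funsD(2)[OF assms(1), of t] unit_funsD(2)[OF assms(2), of t]
    by (simp add: norm_mult norm_divide)
  then show ?thesis
    using cont_funs_cmult[OF cont_funs_add[OF unit_funsD(1)[OF assms(1)] unit_funsD(1)[OF assms(2)]], of "1/2"]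
    by (auto simp: unit_funs_def)
qed

context compact_Hausdorff
begin

text \<open>f is cut off to vanish on a neighbourhood G of A, and u0 is cut off to vanish outside G.
  The supports being disjoint, adding or subtracting f' does not leave the unit ball, and on A the
  values of u0 remain.\<close>

lemma disjoint_perturbation:
  assumes A: "finite A" and u0: "u0 \<in> unit_funs K" and f: "f \<in> unit_funs K" "\<And>a. a \<in> A \<Longrightarrow> f a = 0" and \<eta>: "\<eta> > 0"
  obtains f' u where "f' \<in> unit_funs K" "u \<in> unit_funs K" "agree_on A u u0"
    "(\<lambda>t. u t + f' t) \<in> unit_funs K" "(\<lambda>t. u t - f' t) \<in> unit_funs K" "agree_on A (\<lambda>t. u t + f' t) u0" "agree_on A (\<lambda>t. u t - f' t) u0"
    "\<And>t. norm (f t - f' t) \<le> \<eta>"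
proof -
  \<comment> \<open>Points of A outside K are harmless, as all functions vanish there.\<close>
  define B where "B = A \<inter> topspace K"
  have B: "closedin K B" using A by (intro closedin_finite) (auto simp: B_def)
  obtain \<zeta> G where \<zeta>: "continuous_map K euclideanreal \<zeta>" "\<And>t. t \<in> topspace K \<Longrightarrow> 0 \<le> \<zeta> t \<and> \<zeta> t \<le> 1"
    "openin K G" "B \<subseteq> G" "\<And>t. t \<in> G \<Longrightarrow> \<zeta> t = 0" "\<And>t. norm (f t - of_real (\<zeta> t) * f t) \<le> \<eta>"
    using cutoff[OF unit_funsD(1)[OF f(1)] B _ \<eta>] f(2) by (auto simp: B_def)
  have "closedin K (topspace K - G)" "(topspace K - G) \<inter> B = {}" using \<zeta>(3,4) by auto
  from Urysohn01[OF this(1) B this(2)] obtain \<xi> where \<xi>: "continuous_map K euclideanreal \<xi>" "\<And>t. t \<in> topspace K \<Longrightarrow> 0 \<le> \<xi> t \<and> \<xi> t \<le> 1"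
    "\<And>t. t \<in> topspace K - G \<Longrightarrow> \<xi> t = 0" "\<And>t. t \<in> B \<Longrightarrow> \<xi> t = 1" by blast
  define f' where "f' = (\<lambda>t. of_real (\<zeta> t) * f t)"
  define u where "u = (\<lambda>t. of_real (\<xi> t) * u0 t)"
  have f': "f' \<in> unit_funs K" unfolding f'_def by (rule unit_funs_real_mult[OF \<zeta>(1,2) f(1)])
  have u: "u \<in> unit_funs K" unfolding u_def by (rule unit_funs_real_mult[OF \<xi>(1,2) u0])
  have off: "u0 t = 0" "f t = 0" if "t \<notin> topspace K" for t using that unit_funsD(1)[OF u0] unit_funsD(1)[OF f(1)] by (auto simp: cont_funs_iff)
  have disj: "u t = 0 \<or> f' t = 0" for t
    using \<zeta>(5)[of t] \<xi>(3)[of t] off(1)[of t] by (cases "t \<in> G") (auto simp: u_def f'_def)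
  have uA: "u a = u0 a" if "a \<in> A" for a using that \<xi>(4)[of a] off(1)[of a] by (auto simp: u_def B_def)
  have f'A: "f' a = 0" if "a \<in> A" for a using f(2)[OF that] by (simp add: f'_def)
  have "norm (u t + f' t) \<le> 1" "norm (u t - f' t) \<le> 1" for t
    using disj[of t] unit_funsD(2)[OF u, of t] unit_funsD(2)[OF f', of t] by auto
  then have "(\<lambda>t. u t + f' t) \<in> unit_funs K" "(\<lambda>t. u t - f' t) \<in> unit_funs K"
    using cont_funs_add[OF unit_funsD(1)[OF u] unit_funsD(1)[OF f']] cont_funs_diff[OF unit_funsD(1)[OF u] unit_funsD(1)[OF f']]
    by (auto simp: unit_funs_def)
  note sums = this
  show thesis
    by (rule that[OF f' u _ sums]) (use uA f'A \<zeta>(6) in \<open>auto simp: agree_on_def f'_def\<close>)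
qed

text \<open>Interpolation at B maps the unit ball into itself, because the bumps have disjoint
  supports. The difference between f and its interpolant vanishes on B, which is the situation of
  the concentration estimates.\<close>

lemma finite_interpolation:
  assumes B: "finite B" "B \<subseteq> topspace K"
  obtains q :: "'a \<Rightarrow> 'a \<Rightarrow> 'k::real_normed_field" where "\<And>a. a \<in> B \<Longrightarrow> q a \<in> unit_funs K"
    "\<And>f. f \<in> unit_funs K \<Longrightarrow> (\<lambda>t. \<Sum>a\<in>B. f a * q a t) \<in> unit_funs K"
    "\<And>f a. a \<in> B \<Longrightarrow> (\<Sum>a'\<in>B. f a' * q a' a) = f a"
proof -
  obtain p :: "'a \<Rightarrow> 'a \<Rightarrow> real" where p: "\<And>a. a \<in> B \<Longrightarrow> continuous_map K euclideanreal (p a)"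
    "\<And>a t. a \<in> B \<Longrightarrow> 0 \<le> p a t \<and> p a t \<le> 1" "\<And>a t. a \<in> B \<Longrightarrow> t \<notin> topspace K \<Longrightarrow> p a t = 0"
    "\<And>a. a \<in> B \<Longrightarrow> p a a = 1" "\<And>a a'. \<lbrakk>a \<in> B; a' \<in> B; a \<noteq> a'\<rbrakk> \<Longrightarrow> p a a' = 0"
    "\<And>C t. C \<subseteq> B \<Longrightarrow> (\<Sum>a\<in>C. p a t) \<le> 1"
    using bumps[OF B] by blast
  define q where "q a = (\<lambda>t. of_real (p a t) :: 'k)" for a
  have q: "q a \<in> unit_funs K" if "a \<in> B" for a
    using p(1-3)[OF that] by (auto simp: q_def unit_funs_def cont_funs_iff continuous_map_of_real)
  show thesis
  proof (rule that[OF q])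
    fix f :: "'a \<Rightarrow> 'k" assume f: "f \<in> unit_funs K"
    have "norm (\<Sum>a\<in>B. f a * q a t) \<le> 1" for t
    proof -
      have "norm (\<Sum>a\<in>B. f a * q a t) \<le> (\<Sum>a\<in>B. p a t)"
      proof (rule sum_norm_le)
        fix a assume "a \<in> B"
        then show "norm (f a * q a t) \<le> p a t"
          using p(2)[of a t] unit_funsD(2)[OF f, of a] by (simp add: q_def norm_mult mult_left_le_one_le)
      qed
      also have "\<dots> \<le> 1" by (rule p(6)) simp
      finally show ?thesis .
    qed
    moreover have "(\<lambda>t. \<Sum>a\<in>B. f a * q a t) \<in> cont_funs K"
      using q B by (intro cont_funs_sum cont_funs_cmult unit_funsD) auto
    ultimately show "(\<lambda>t. \<Sum>a\<in>B. f a * q a t) \<in> unit_funs K" by (simp add: unit_funs_def)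
  next
    fix f :: "'a \<Rightarrow> 'k" and a assume a: "a \<in> B"
    have "(\<Sum>a'\<in>B. f a' * q a' a) = (\<Sum>a'\<in>B. if a' = a then f a else 0)"
      using p(4,5) a by (intro sum.cong) (auto simp: q_def)
    then show "(\<Sum>a'\<in>B. f a' * q a' a) = f a" using a B by simp
  qed
qed

end

text \<open>The forms in view are phi(T(f . g)) with phi in the dual unit ball. What weak
  compactness provides is recorded in the two oscillation assumptions, for squares x . x and for
  products p . x with p fixed; in both the finite set serves all forms at once.\<close>

locale form_family = compact_Hausdorff K for K :: "'a topology" +
  fixes I :: "'i set" and b :: "'i \<Rightarrow> ('a \<Rightarrow> 'k::{real_normed_field, euclidean_space}) \<Rightarrow> ('a \<Rightarrow> 'k) \<Rightarrow> 'k" and M :: real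
  assumes form: "\<And>\<phi>. \<phi> \<in> I \<Longrightarrow> bounded_form K (b \<phi>) M" and M0: "0 \<le> M"
    and sym: "\<And>\<phi> f g. \<lbrakk>\<phi> \<in> I; f \<in> cont_funs K; g \<in> cont_funs K\<rbrakk> \<Longrightarrow> b \<phi> f g = b \<phi> g f"
    and oscillation_square: "\<And>e. e > 0 \<Longrightarrow> \<exists>A u. finite A \<and> u \<in> unit_funs K \<and>
        (\<forall>x\<in>unit_funs K. agree_on A x u \<longrightarrow> (\<forall>\<phi>\<in>I. norm (b \<phi> x x - b \<phi> u u) \<le> e))"
    and oscillation_linear: "\<And>e p. e > 0 \<Longrightarrow> p \<in> unit_funs K \<Longrightarrow> \<exists>A u. finite A \<and> u \<in> unit_funs K \<and>
        (\<forall>x\<in>unit_funs K. agree_on A x u \<longrightarrow> (\<forall>\<phi>\<in>I. norm (b \<phi> p x - b \<phi> p u) \<le> e))"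
begin

text \<open>If \<open>f\<close> is supported away from \<open>u\<close>, then \<open>u\<close>, \<open>u + f\<close> and \<open>u - f\<close> all belong to the unit ball, and
  \<open>b \<phi> f f\<close> is a combination of the values of the quadratic form at these three points.\<close>

lemma small_square:
  assumes e: "e > 0"
  obtains A where "finite A" "\<And>\<phi> f. \<lbrakk>\<phi> \<in> I; f \<in> unit_funs K; \<And>a. a \<in> A \<Longrightarrow> f a = 0\<rbrakk> \<Longrightarrow> norm (b \<phi> f f) \<le> e"
proof -
  have e4: "e/4 > 0" using e by simp
  obtain A u0 where A: "finite A" "u0 \<in> unit_funs K"
    and osc: "\<And>x \<phi>. \<lbrakk>x \<in> unit_funs K; agree_on A x u0; \<phi> \<in> I\<rbrakk> \<Longrightarrow> norm (b \<phi> x x - b \<phi> u0 u0) \<le> e/4"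
    using oscillation_square[OF e4] by blast
  show thesis
  proof (rule that[OF A(1)])
    fix \<phi> and f :: "'a \<Rightarrow> 'k" assume \<phi>: "\<phi> \<in> I" and f: "f \<in> unit_funs K" "\<And>a. a \<in> A \<Longrightarrow> f a = 0"
    interpret bounded_form K "b \<phi>" M by (rule form[OF \<phi>])
    \<comment> \<open>Replacing f by f' in both arguments costs
      \<open>2 * M * \<eta> \<le> e/2\<close>.\<close>
    define \<eta> where "\<eta> = e / (4 * (M + 1))"
    have \<eta>: "\<eta> > 0" using e M0 by (simp add: \<eta>_def)
    obtain f' u where u: "f' \<in> unit_funs K" "u \<in> unit_funs K" "agree_on A u u0"
      "(\<lambda>t. u t + f' t) \<in> unit_funs K" "(\<lambda>t. u t - f' t) \<in> unit_funs K" "agree_on A (\<lambda>t. u t + f' t) u0" "agree_on A (\<lambda>t. u t - f' t) u0"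
      "\<And>t. norm (f t - f' t) \<le> \<eta>"
      using disjoint_perturbation[OF A f \<eta>] by blast
    have C: "f' \<in> cont_funs K" "u \<in> cont_funs K" "f \<in> cont_funs K" using u f unit_funsD(1) by auto
    define X where "X = b \<phi> u0 u0"
    define Y1 where "Y1 = b \<phi> (\<lambda>t. u t + f' t) (\<lambda>t. u t + f' t) - X"
    define Y2 where "Y2 = b \<phi> (\<lambda>t. u t - f' t) (\<lambda>t. u t - f' t) - X"
    define Y3 where "Y3 = b \<phi> u u - X"
    have n: "norm Y1 \<le> e/4" "norm Y2 \<le> e/4" "norm Y3 \<le> e/4"
      unfolding Y1_def Y2_def Y3_def X_def by (intro osc[OF u(4,6) \<phi>] osc[OF u(5,7) \<phi>] osc[OF u(2,3) \<phi>])+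
    \<comment> \<open>Parallelogram identity for u and f'. X cancels, and four errors of e/4 leave
      e/2 for the form at f'.\<close>
    have "2 * b \<phi> f' f' = Y1 + Y2 - (Y3 + Y3)"
      using C by (simp add: Y1_def Y2_def Y3_def add_left add_right diff_left diff_right cont_funs_add cont_funs_diff)
    then have "2 * norm (b \<phi> f' f') = norm (Y1 + Y2 - (Y3 + Y3))" by (metis norm_mult norm_numeral)
    also have "\<dots> \<le> e/4 + e/4 + (e/4 + e/4)"
      using n by (intro norm_triangle_le_diff norm_triangle_le add_mono)
    finally have f': "norm (b \<phi> f' f') \<le> e/2" by simp
    have "b \<phi> f f = b \<phi> f' f' + b \<phi> (\<lambda>t. f t - f' t) f + b \<phi> f' (\<lambda>t. f t - f' t)"
      using C by (simp add: diff_left diff_right)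
    moreover have "norm (b \<phi> (\<lambda>t. f t - f' t) f) \<le> M * (\<eta> * 1)" "norm (b \<phi> f' (\<lambda>t. f t - f' t)) \<le> M * (1 * \<eta>)"
      by (intro bound_le cont_funs_diff C u(8) unit_funsD(2)[OF f(1)] unit_funsD(2)[OF u(1)])+
    moreover have "2 * M * \<eta> \<le> e/2" using e M0 by (simp add: \<eta>_def field_simps)
    ultimately show "norm (b \<phi> f f) \<le> e"
      using f' norm_triangle_ineq[of "b \<phi> f' f' + b \<phi> (\<lambda>t. f t - f' t) f" "b \<phi> f' (\<lambda>t. f t - f' t)"]
        norm_triangle_ineq[of "b \<phi> f' f'" "b \<phi> (\<lambda>t. f t - f' t) f"] by simp
  qed
qed

text \<open>Polarisation with the half sum h and the half difference k: a symmetric form satisfies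
  b(f,g) = b(h,h) - b(k,k).\<close>

lemma small_vanishing:
  assumes e: "e > 0"
  obtains A where "finite A" "\<And>\<phi> f g. \<lbrakk>\<phi> \<in> I; f \<in> unit_funs K; g \<in> unit_funs K; \<And>a. a \<in> A \<Longrightarrow> f a = 0; \<And>a. a \<in> A \<Longrightarrow> g a = 0\<rbrakk> \<Longrightarrow> norm (b \<phi> f g) \<le> e"
proof -
  obtain A where A: "finite A" "\<And>\<phi> f. \<lbrakk>\<phi> \<in> I; f \<in> unit_funs K; \<And>a. a \<in> A \<Longrightarrow> f a = 0\<rbrakk> \<Longrightarrow> norm (b \<phi> f f) \<le> e/2"
    using small_square[OF half_gt_zero[OF e]] by blast
  show thesis
  proof (rule that[OF A(1)])
    fix \<phi> and f g :: "'a \<Rightarrow> 'k" assume \<phi>: "\<phi> \<in> I" and f: "f \<in> unit_funs K" "g \<in> unit_funs K" "\<And>a. a \<in> A \<Longrightarrow> f a = 0" "\<And>a. a \<in> A \<Longrightarrow> g a = 0"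
    interpret bounded_form K "b \<phi>" M by (rule form[OF \<phi>])
    have C: "f \<in> cont_funs K" "g \<in> cont_funs K" using f unit_funsD(1) by auto
    define h where "h = (\<lambda>t. (1/2) * (f t + g t))"
    define k where "k = (\<lambda>t. (1/2) * (f t - g t))"
    have n: "norm (b \<phi> h h) \<le> e/2" "norm (b \<phi> k k) \<le> e/2"
      unfolding h_def k_def
      by (intro A(2)[OF \<phi> unit_funs_half_sum[OF f(1,2)]] A(2)[OF \<phi> unit_funs_half_diff[OF f(1,2)]]; simp add: f(3,4))+
    have q: "b \<phi> h h = (1/2) * ((1/2) * (b \<phi> f f + b \<phi> f g + (b \<phi> g f + b \<phi> g g)))"
      "b \<phi> k k = (1/2) * ((1/2) * (b \<phi> f f - b \<phi> f g - (b \<phi> g f - b \<phi> g g)))"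
      unfolding h_def k_def using C
      by (simp_all only: cmult_left cmult_right add_left add_right diff_left diff_right cont_funs_add cont_funs_diff cont_funs_cmult)
    have "b \<phi> f g = b \<phi> h h - b \<phi> k k"
      unfolding q using sym[OF \<phi> C] by (simp add: field_simps)
    then show "norm (b \<phi> f g) \<le> e" using norm_triangle_ineq4[of "b \<phi> h h" "b \<phi> k k"] n by simp
  qed
qed

text \<open>With p fixed the perturbation argument is simpler: the value at f' is the difference of
  the values at u + f' and u.\<close>

lemma small_linear:
  assumes e: "e > 0" and p: "p \<in> unit_funs K"
  obtains A where "finite A" "\<And>\<phi> f. \<lbrakk>\<phi> \<in> I; f \<in> unit_funs K; \<And>a. a \<in> A \<Longrightarrow> f a = 0\<rbrakk> \<Longrightarrow> norm (b \<phi> p f) \<le> e"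
proof -
  have e4: "e/4 > 0" using e by simp
  obtain A u0 where A: "finite A" "u0 \<in> unit_funs K"
    and osc: "\<And>x \<phi>. \<lbrakk>x \<in> unit_funs K; agree_on A x u0; \<phi> \<in> I\<rbrakk> \<Longrightarrow> norm (b \<phi> p x - b \<phi> p u0) \<le> e/4"
    using oscillation_linear[OF e4 p] by blast
  show thesis
  proof (rule that[OF A(1)])
    fix \<phi> and f :: "'a \<Rightarrow> 'k" assume \<phi>: "\<phi> \<in> I" and f: "f \<in> unit_funs K" "\<And>a. a \<in> A \<Longrightarrow> f a = 0"
    interpret bounded_form K "b \<phi>" M by (rule form[OF \<phi>])
    define \<eta> where "\<eta> = e / (4 * (M + 1))"
    have \<eta>: "\<eta> > 0" using e M0 by (simp add: \<eta>_def)
    obtain f' u where u: "f' \<in> unit_funs K" "u \<in> unit_funs K" "agree_on A u u0"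
      "(\<lambda>t. u t + f' t) \<in> unit_funs K" "(\<lambda>t. u t - f' t) \<in> unit_funs K" "agree_on A (\<lambda>t. u t + f' t) u0" "agree_on A (\<lambda>t. u t - f' t) u0"
      "\<And>t. norm (f t - f' t) \<le> \<eta>"
      using disjoint_perturbation[OF A f \<eta>] by blast
    have C: "f' \<in> cont_funs K" "u \<in> cont_funs K" "f \<in> cont_funs K" "p \<in> cont_funs K" using u f p unit_funsD(1) by auto
    have "norm (b \<phi> p (\<lambda>t. u t + f' t) - b \<phi> p u0) \<le> e/4" "norm (b \<phi> p u - b \<phi> p u0) \<le> e/4"
      by (intro osc[OF u(4,6) \<phi>] osc[OF u(2,3) \<phi>])+
    moreover have eq: "b \<phi> p f = (b \<phi> p (\<lambda>t. u t + f' t) - b \<phi> p u0) - (b \<phi> p u - b \<phi> p u0) + b \<phi> p (\<lambda>t. f t - f' t)"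
      using C by (simp add: add_right diff_right)
    moreover have "norm (b \<phi> p (\<lambda>t. f t - f' t)) \<le> M * (1 * \<eta>)"
      by (intro bound_le cont_funs_diff C u(8) unit_funsD(2)[OF p])
    moreover have "M * (1 * \<eta>) \<le> e/4" using e M0 by (simp add: \<eta>_def field_simps)
    ultimately show "norm (b \<phi> p f) \<le> e"
      unfolding eq using e norm_triangle_ineq[of "(b \<phi> p (\<lambda>t. u t + f' t) - b \<phi> p u0) - (b \<phi> p u - b \<phi> p u0)" "b \<phi> p (\<lambda>t. f t - f' t)"]
        norm_triangle_ineq4[of "b \<phi> p (\<lambda>t. u t + f' t) - b \<phi> p u0" "b \<phi> p u - b \<phi> p u0"] by linarith
  qed
qed

text \<open>Here g is no longer required to vanish. If g' interpolates g at A, then g = g' + 2 h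
  where h vanishes on A: the pair f, h falls under \<open>small_vanishing\<close>, and g' is a
  combination of finitely many fixed functions q a, to which \<open>small_linear\<close>
  applies.\<close>

lemma uniformly_concentrated:
  assumes e: "e > 0"
  obtains B where "finite B" "B \<subseteq> topspace K" "\<And>\<phi> f g. \<lbrakk>\<phi> \<in> I; f \<in> unit_funs K; g \<in> unit_funs K; \<And>a. a \<in> B \<Longrightarrow> f a = 0\<rbrakk> \<Longrightarrow> norm (b \<phi> f g) \<le> e"
proof -
  have e4: "e/4 > 0" using e by simp
  obtain A0 where A0: "finite A0" "\<And>\<phi> f g. \<lbrakk>\<phi> \<in> I; f \<in> unit_funs K; g \<in> unit_funs K; \<And>a. a \<in> A0 \<Longrightarrow> f a = 0; \<And>a. a \<in> A0 \<Longrightarrow> g a = 0\<rbrakk> \<Longrightarrow> norm (b \<phi> f g) \<le> e/4"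
    using small_vanishing[OF e4] by blast
  define A where "A = A0 \<inter> topspace K"
  have A: "finite A" "A \<subseteq> topspace K" using A0 by (auto simp: A_def)
  have vanish: "f a = 0" if "f \<in> unit_funs K" "\<And>a. a \<in> S \<inter> topspace K \<Longrightarrow> f a = 0" "a \<in> S" for f :: "'a \<Rightarrow> 'k" and S a
    using that unit_funsD(1)[OF that(1)] by (cases "a \<in> topspace K") (auto simp: cont_funs_iff)
  obtain q :: "'a \<Rightarrow> 'a \<Rightarrow> 'k" where q: "\<And>a. a \<in> A \<Longrightarrow> q a \<in> unit_funs K"
    "\<And>f. f \<in> unit_funs K \<Longrightarrow> (\<lambda>t. \<Sum>a\<in>A. f a * q a t) \<in> unit_funs K"
    "\<And>f a. a \<in> A \<Longrightarrow> (\<Sum>a'\<in>A. f a' * q a' a) = f a"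
    using finite_interpolation[OF A, where 'k = 'k] by blast
  \<comment> \<open>The errors d for the points of A add up to at most e/4; the added 1 covers an
    empty A.\<close>
  define d where "d = e / (4 * (real (card A) + 1))"
  have d: "d > 0" using e by (simp add: d_def)
  have "\<forall>a\<in>A. \<exists>S. finite S \<and> (\<forall>\<phi>\<in>I. \<forall>f\<in>unit_funs K. (\<forall>s\<in>S. f s = 0) \<longrightarrow> norm (b \<phi> (q a) f) \<le> d)"
  proof
    fix a assume "a \<in> A"
    obtain S where "finite S" "\<And>\<phi> f. \<lbrakk>\<phi> \<in> I; f \<in> unit_funs K; \<And>s. s \<in> S \<Longrightarrow> f s = 0\<rbrakk> \<Longrightarrow> norm (b \<phi> (q a) f) \<le> d"
      using small_linear[OF d q(1)[OF \<open>a \<in> A\<close>]] by blast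
    then show "\<exists>S. finite S \<and> (\<forall>\<phi>\<in>I. \<forall>f\<in>unit_funs K. (\<forall>s\<in>S. f s = 0) \<longrightarrow> norm (b \<phi> (q a) f) \<le> d)" by blast
  qed
  from bchoice[OF this] obtain S where S: "\<And>a. a \<in> A \<Longrightarrow> finite (S a)"
    "\<And>a \<phi> f. \<lbrakk>a \<in> A; \<phi> \<in> I; f \<in> unit_funs K; \<forall>s\<in>S a. f s = 0\<rbrakk> \<Longrightarrow> norm (b \<phi> (q a) f) \<le> d" by blast
  define B where "B = A \<union> ((\<Union>a\<in>A. S a) \<inter> topspace K)"
  show thesis
  proof (rule that[of B])
    show "finite B" "B \<subseteq> topspace K" using A S(1) by (auto simp: B_def)
    fix \<phi> and f g :: "'a \<Rightarrow> 'k" assume \<phi>: "\<phi> \<in> I" and f: "f \<in> unit_funs K" "g \<in> unit_funs K" and fB: "\<And>a. a \<in> B \<Longrightarrow> f a = 0"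
    interpret bounded_form K "b \<phi>" M by (rule form[OF \<phi>])
    define g' where "g' = (\<lambda>t. \<Sum>a\<in>A. g a * q a t)"
    have g': "g' \<in> unit_funs K" unfolding g'_def by (rule q(2)[OF f(2)])
    have C: "f \<in> cont_funs K" "g \<in> cont_funs K" "g' \<in> cont_funs K" using f g' unit_funsD(1) by auto
    define h where "h = (\<lambda>t. (1/2) * (g t - g' t))"
    have h: "h \<in> unit_funs K" unfolding h_def by (rule unit_funs_half_diff[OF f(2) g'])
    have "norm (b \<phi> f h) \<le> e/4"
    proof (rule A0(2)[OF \<phi> f(1) h])
      show "f a = 0" if "a \<in> A0" for a using vanish[OF f(1) _ that] fB by (auto simp: A_def B_def)
      have "h a = 0" if "a \<in> A" for a using q(3)[OF that, of g] by (simp add: h_def g'_def)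
      then show "h a = 0" if "a \<in> A0" for a using vanish[OF h _ that] by (auto simp: A_def)
    qed
    moreover have "norm (b \<phi> f g') \<le> (\<Sum>a\<in>A. d)"
    proof -
      have "b \<phi> f g' = (\<Sum>a\<in>A. g a * b \<phi> f (q a))"
        unfolding g'_def using A q(1) C unit_funsD(1) by (intro sum_right) auto
      also have "norm \<dots> \<le> (\<Sum>a\<in>A. d)"
      proof (rule sum_norm_le)
        fix a assume a: "a \<in> A"
        have "f s = 0" if "s \<in> S a" for s using vanish[OF f(1) _ that] fB a by (auto simp: B_def)
        then have "norm (b \<phi> (q a) f) \<le> d" by (intro S(2)[OF a \<phi> f(1)]) auto
        then have "norm (b \<phi> f (q a)) \<le> d" using sym[OF \<phi> C(1) unit_funsD(1)[OF q(1)[OF a]]] by simp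
        then show "norm (g a * b \<phi> f (q a)) \<le> d"
          using mult_mono[of "norm (g a)" 1 "norm (b \<phi> f (q a))" d] unit_funsD(2)[OF f(2), of a] by (simp add: norm_mult)
      qed
      finally show ?thesis .
    qed
    moreover have "(\<Sum>a\<in>A. d) \<le> e/4" using e by (simp add: d_def field_simps)
    moreover have "b \<phi> f h = (1/2) * (b \<phi> f g - b \<phi> f g')"
      unfolding h_def using C by (simp only: cmult_right diff_right cont_funs_diff)
    then have eq: "b \<phi> f g = b \<phi> f g' + (b \<phi> f h + b \<phi> f h)" by (simp add: field_simps)
    ultimately show "norm (b \<phi> f g) \<le> e"
      unfolding eq using e norm_triangle_ineq[of "b \<phi> f g'" "b \<phi> f h + b \<phi> f h"] norm_triangle_ineq[of "b \<phi> f h" "b \<phi> f h"] by linarith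
  qed
qed

text \<open>Replacing f and g in turn by their interpolants at B changes the form by at most e/2
  each time, since the differences vanish on B; the interpolated form involves the values at B
  only.\<close>

lemma uniform_finite_approximation:
  assumes e: "e > 0"
  obtains B q where "finite B" "\<And>a. a \<in> B \<Longrightarrow> q a \<in> unit_funs K"
    "\<And>\<phi> f g. \<lbrakk>\<phi> \<in> I; f \<in> cont_funs K; g \<in> cont_funs K\<rbrakk> \<Longrightarrow>
      norm (b \<phi> f g - (\<Sum>a\<in>B. \<Sum>a'\<in>B. f a * g a' * b \<phi> (q a) (q a'))) \<le> e * (sup_nrm K f * sup_nrm K g)"
proof -
  have e4: "e/4 > 0" using e by simp
  obtain B where B: "finite B" "B \<subseteq> topspace K" and small: "\<And>\<phi> f g. \<lbrakk>\<phi> \<in> I; f \<in> unit_funs K; g \<in> unit_funs K; \<And>a. a \<in> B \<Longrightarrow> f a = 0\<rbrakk> \<Longrightarrow> norm (b \<phi> f g) \<le> e/4"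
    using uniformly_concentrated[OF e4] by blast
  obtain q :: "'a \<Rightarrow> 'a \<Rightarrow> 'k" where q: "\<And>a. a \<in> B \<Longrightarrow> q a \<in> unit_funs K"
    "\<And>f. f \<in> unit_funs K \<Longrightarrow> (\<lambda>t. \<Sum>a\<in>B. f a * q a t) \<in> unit_funs K"
    "\<And>f a. a \<in> B \<Longrightarrow> (\<Sum>a'\<in>B. f a' * q a' a) = f a"
    using finite_interpolation[OF B, where 'k = 'k] by blast
  have unit: "norm (b \<phi> f g - (\<Sum>a\<in>B. \<Sum>a'\<in>B. f a * g a' * b \<phi> (q a) (q a'))) \<le> e"
    if \<phi>: "\<phi> \<in> I" and f: "f \<in> unit_funs K" and g: "g \<in> unit_funs K" for \<phi> f g
  proof -
    interpret bounded_form K "b \<phi>" M by (rule form[OF \<phi>])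
    define P where "P f = (\<lambda>t. \<Sum>a\<in>B. f a * q a t)" for f :: "'a \<Rightarrow> 'k"
    have P: "P f \<in> unit_funs K" if "f \<in> unit_funs K" for f unfolding P_def by (rule q(2)[OF that])
    have qC: "q a \<in> cont_funs K" if "a \<in> B" for a using q(1)[OF that] by (rule unit_funsD)
    have C: "f \<in> cont_funs K" "g \<in> cont_funs K" "P f \<in> cont_funs K" "P g \<in> cont_funs K" using f g P unit_funsD(1) by auto
    have half: "norm (b \<phi> (\<lambda>t. (1/2) * (f t - P f t)) g) \<le> e/4"
      if "f \<in> unit_funs K" "g \<in> unit_funs K" for f g
      by (rule small[OF \<phi> unit_funs_half_diff[OF that(1) P[OF that(1)]] that(2)]) (simp add: P_def q(3))
    have diff: "norm (b \<phi> f g - b \<phi> (P f) g) \<le> e/2" if fg: "f \<in> unit_funs K" "g \<in> unit_funs K" for f g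
    proof -
      define Z where "Z = b \<phi> (\<lambda>t. (1/2) * (f t - P f t)) g"
      have "Z = (1/2) * (b \<phi> f g - b \<phi> (P f) g)" unfolding Z_def
        using unit_funsD(1)[OF fg(1)] unit_funsD(1)[OF fg(2)] unit_funsD(1)[OF P[OF fg(1)]]
        by (simp only: cmult_left diff_left cont_funs_diff)
      then have "b \<phi> f g - b \<phi> (P f) g = Z + Z" by (simp add: field_simps)
      then show ?thesis using half[OF fg] norm_triangle_ineq[of Z Z] by (simp add: Z_def)
    qed
    have "b \<phi> (P f) (P g) = (\<Sum>a\<in>B. f a * b \<phi> (q a) (P g))"
      unfolding P_def[of f] using B qC C by (intro sum_left) auto
    also have "\<dots> = (\<Sum>a\<in>B. f a * (\<Sum>a'\<in>B. g a' * b \<phi> (q a) (q a')))"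
      unfolding P_def using B qC C by (intro sum.cong refl arg_cong2[where f = "(*)"] sum_right) auto
    also have "\<dots> = (\<Sum>a\<in>B. \<Sum>a'\<in>B. f a * g a' * b \<phi> (q a) (q a'))"
      by (simp add: sum_distrib_left mult.assoc)
    finally have PP: "b \<phi> (P f) (P g) = (\<Sum>a\<in>B. \<Sum>a'\<in>B. f a * g a' * b \<phi> (q a) (q a'))" .
    have "norm (b \<phi> f g - b \<phi> (P f) g) \<le> e/2" by (rule diff[OF f g])
    moreover have "norm (b \<phi> (P f) g - b \<phi> (P f) (P g)) \<le> e/2"
      using diff[OF g P[OF f]] sym[OF \<phi> C(2,3)] sym[OF \<phi> C(4,3)] by simp
    ultimately show ?thesis
      unfolding PP[symmetric] using norm_triangle_ineq[of "b \<phi> f g - b \<phi> (P f) g" "b \<phi> (P f) g - b \<phi> (P f) (P g)"] by simp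
  qed
  show thesis
  proof (rule that[OF B(1) q(1)])
    fix \<phi> and f g :: "'a \<Rightarrow> 'k" assume \<phi>: "\<phi> \<in> I" and f: "f \<in> cont_funs K" and g: "g \<in> cont_funs K"
    interpret bounded_form K "b \<phi>" M by (rule form[OF \<phi>])
    define c where "c = sup_nrm K f"
    define d where "d = sup_nrm K g"
    have c0: "c \<ge> 0" "d \<ge> 0" using sup_nrm_nonneg[OF compact_K] f g by (auto simp: c_def d_def)
    \<comment> \<open>If c = 0 then 1 / c = 0 and f1 = 0, which is consistent because f = 0 in that
      case.\<close>
    define f1 where "f1 = (\<lambda>t. of_real (1 / c) * f t)"
    define g1 where "g1 = (\<lambda>t. of_real (1 / d) * g t)"
    have nrm1: "norm (of_real (1 / r) * x :: 'k) \<le> 1" if "norm x \<le> r" for r x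
    proof (cases "r = 0")
      case False
      then have "r > 0" using that norm_ge_zero[of x] by linarith
      then show ?thesis using that by (simp add: norm_mult norm_divide)
    qed simp
    have f1: "f1 \<in> unit_funs K" and g1: "g1 \<in> unit_funs K"
      using f g norm_le_sup_nrm[OF compact_K] by (auto simp: unit_funs_def f1_def g1_def c_def d_def intro!: cont_funs_cmult nrm1 simp del: of_real_divide)
    have f_eq: "f = (\<lambda>t. of_real c * f1 t)" and g_eq: "g = (\<lambda>t. of_real d * g1 t)"
      using norm_le_sup_nrm[OF compact_K f] norm_le_sup_nrm[OF compact_K g]
      by (auto simp: f1_def g1_def fun_eq_iff c_def d_def)
    define E where "E = b \<phi> f1 g1 - (\<Sum>a\<in>B. \<Sum>a'\<in>B. f1 a * g1 a' * b \<phi> (q a) (q a'))"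
    have "b \<phi> f g = of_real c * (of_real d * b \<phi> f1 g1)"
      unfolding f_eq g_eq using unit_funsD(1)[OF f1] unit_funsD(1)[OF g1] by (simp only: cmult_left cmult_right cont_funs_cmult)
    moreover have "(\<Sum>a\<in>B. \<Sum>a'\<in>B. f a * g a' * b \<phi> (q a) (q a')) = of_real c * (of_real d * (\<Sum>a\<in>B. \<Sum>a'\<in>B. f1 a * g1 a' * b \<phi> (q a) (q a')))"
      unfolding f_eq g_eq sum_distrib_left by (intro sum.cong refl) (simp add: mult_ac)
    ultimately have "b \<phi> f g - (\<Sum>a\<in>B. \<Sum>a'\<in>B. f a * g a' * b \<phi> (q a) (q a')) = of_real (c * d) * E"
      by (simp add: E_def algebra_simps)
    then have "norm (b \<phi> f g - (\<Sum>a\<in>B. \<Sum>a'\<in>B. f a * g a' * b \<phi> (q a) (q a'))) = (c * d) * norm E"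
      using c0 by (simp add: norm_mult)
    also have "\<dots> \<le> (c * d) * e" using unit[OF \<phi> f1 g1] c0 unfolding E_def by (intro mult_left_mono) auto
    finally show "norm (b \<phi> f g - (\<Sum>a\<in>B. \<Sum>a'\<in>B. f a * g a' * b \<phi> (q a) (q a'))) \<le> e * (sup_nrm K f * sup_nrm K g)"
      by (simp add: c_def d_def mult.commute)
  qed
qed

end


section \<open>Completions and closed spans\<close>

definition comp_class :: "('k::real_normed_field, 'v) normed_vs \<Rightarrow> (nat \<Rightarrow> 'v) \<Rightarrow> (nat \<Rightarrow> 'v) set" where
  "comp_class V s = Cauchy_rel V `` {s}"

context normed_vector_space
begin

lemma Cauchy_carrier: "Cauchy_in V s \<Longrightarrow> s n \<in> carrier V"
  by (simp add: Cauchy_in_iff)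

lemma Cauchy_relI:
  "\<lbrakk>Cauchy_in V s; Cauchy_in V t; (\<lambda>n. nrm V (s n \<ominus> t n)) \<longlonglongrightarrow> 0\<rbrakk> \<Longrightarrow> (s, t) \<in> Cauchy_rel V"
  by (simp add: Cauchy_rel_def nrm_dist_eq Cauchy_carrier)

lemma Cauchy_relD:
  assumes "(s, t) \<in> Cauchy_rel V"
  shows "Cauchy_in V s" "Cauchy_in V t" "(\<lambda>n. nrm V (s n \<ominus> t n)) \<longlonglongrightarrow> 0"
  using assms by (auto simp: Cauchy_rel_def nrm_dist_eq Cauchy_carrier)

lemma equiv_Cauchy_rel: "equiv {s. Cauchy_in V s} (Cauchy_rel V)"
proof (rule equivI)
  show "Cauchy_rel V \<subseteq> {s. Cauchy_in V s} \<times> {s. Cauchy_in V s}" by (auto simp: Cauchy_rel_def)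
  show "refl_on {s. Cauchy_in V s} (Cauchy_rel V)"
    by (rule refl_onI) (auto intro!: Cauchy_relI simp: Cauchy_carrier)
  show "sym (Cauchy_rel V)"
  proof (rule symI)
    fix s t assume st: "(s, t) \<in> Cauchy_rel V"
    note D = Cauchy_relD[OF st]
    have "(\<lambda>n. nrm V (t n \<ominus> s n)) = (\<lambda>n. nrm V (s n \<ominus> t n))"
      using nrm_diff_commute[OF Cauchy_carrier[OF D(1)] Cauchy_carrier[OF D(2)]] by simp
    then show "(t, s) \<in> Cauchy_rel V" using D by (intro Cauchy_relI) auto
  qed
  show "trans (Cauchy_rel V)"
  proof (rule transI)
    fix s t u assume st: "(s, t) \<in> Cauchy_rel V" and tu: "(t, u) \<in> Cauchy_rel V"
    note D = Cauchy_relD[OF st] and D' = Cauchy_relD[OF tu]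
    have "(\<lambda>n. nrm V (s n \<ominus> u n)) \<longlonglongrightarrow> 0"
    proof (rule tendsto_sandwich[where f = "\<lambda>_. 0"])
      show "\<forall>\<^sub>F n in sequentially. nrm V (s n \<ominus> u n) \<le> nrm V (s n \<ominus> t n) + nrm V (t n \<ominus> u n)"
        using nrm_diff_triangle D D' Cauchy_carrier by (intro always_eventually allI) auto
      show "(\<lambda>n. nrm V (s n \<ominus> t n) + nrm V (t n \<ominus> u n)) \<longlonglongrightarrow> 0"
        using tendsto_add[OF D(3) D'(3)] by simp
    qed (use D D' in \<open>auto intro!: always_eventually nrm_nonneg simp: Cauchy_carrier\<close>)
    then show "(s, u) \<in> Cauchy_rel V" using D D' by (intro Cauchy_relI)
  qed
qed

lemma comp_class_eq_iff: "\<lbrakk>Cauchy_in V s; Cauchy_in V t\<rbrakk> \<Longrightarrow>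
    comp_class V s = comp_class V t \<longleftrightarrow> (\<lambda>n. nrm V (s n \<ominus> t n)) \<longlonglongrightarrow> 0"
  unfolding comp_class_def using eq_equiv_class_iff[OF equiv_Cauchy_rel, of s t] Cauchy_relI[of s t] Cauchy_relD(3)[of s t]
  by blast

lemma mem_comp_class: "Cauchy_in V s \<Longrightarrow> s \<in> comp_class V s"
  unfolding comp_class_def by (rule equiv_class_self[OF equiv_Cauchy_rel]) simp

lemma mem_comp_classD:
  assumes "Cauchy_in V s" "t \<in> comp_class V s"
  shows "Cauchy_in V t" "comp_class V t = comp_class V s"
  using assms equiv_class_eq[OF equiv_Cauchy_rel, of s t] Cauchy_relD(2)[of s t]
  by (auto simp: comp_class_def)

lemma carrier_completion: "carrier (completion V) = comp_class V ` {s. Cauchy_in V s}"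
  by (auto simp: completion_def quotient_def comp_class_def)

lemma Cauchy_in_add:
  assumes "Cauchy_in V s" "Cauchy_in V t" shows "Cauchy_in V (\<lambda>n. s n \<oplus> t n)"
  unfolding Cauchy_in_iff
proof (intro conjI allI impI)
  show "s n \<oplus> t n \<in> carrier V" for n using assms by (simp add: Cauchy_carrier)
  fix e :: real assume e: "e > 0"
  obtain N where N: "\<And>m n. m \<ge> N \<Longrightarrow> n \<ge> N \<Longrightarrow> nrm V (s m \<ominus> s n) < e/2"
    using assms(1) half_gt_zero[OF e] unfolding Cauchy_in_iff by blast
  obtain N' where N': "\<And>m n. m \<ge> N' \<Longrightarrow> n \<ge> N' \<Longrightarrow> nrm V (t m \<ominus> t n) < e/2"
    using assms(2) half_gt_zero[OF e] unfolding Cauchy_in_iff by blast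
  have "nrm V ((s m \<oplus> t m) \<ominus> (s n \<oplus> t n)) < e" if "m \<ge> max N N'" "n \<ge> max N N'" for m n
  proof -
    have "nrm V ((s m \<oplus> t m) \<ominus> (s n \<oplus> t n)) \<le> nrm V (s m \<ominus> s n) + nrm V (t m \<ominus> t n)"
      using assms by (simp add: add_diff_add Cauchy_carrier nrm_triangle)
    then show ?thesis using N[of m n] N'[of m n] that by simp
  qed
  then show "\<exists>N. \<forall>m\<ge>N. \<forall>n\<ge>N. nrm V ((s m \<oplus> t m) \<ominus> (s n \<oplus> t n)) < e" by blast
qed

lemma Cauchy_in_smult:
  assumes "Cauchy_in V s" shows "Cauchy_in V (\<lambda>n. a \<odot> s n)"
  unfolding Cauchy_in_iff
proof (intro conjI allI impI)
  show "a \<odot> s n \<in> carrier V" for n using assms by (simp add: Cauchy_carrier)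
  fix e :: real assume e: "e > 0"
  then have "e / (norm a + 1) > 0" by (simp add: add_nonneg_pos)
  then obtain N where N: "\<And>m n. m \<ge> N \<Longrightarrow> n \<ge> N \<Longrightarrow> nrm V (s m \<ominus> s n) < e / (norm a + 1)"
    using assms(1) unfolding Cauchy_in_iff by blast
  have "nrm V (a \<odot> s m \<ominus> a \<odot> s n) < e" if "m \<ge> N" "n \<ge> N" for m n
  proof -
    have "nrm V (a \<odot> s m \<ominus> a \<odot> s n) = norm a * nrm V (s m \<ominus> s n)"
      using assms by (simp add: Cauchy_carrier nrm_smult flip: smult_diff)
    also have "\<dots> \<le> (norm a + 1) * nrm V (s m \<ominus> s n)"
      using assms by (intro mult_right_mono) (auto simp: Cauchy_carrier nrm_nonneg)
    also have "\<dots> < e" using N[OF that] by (simp add: pos_less_divide_eq add_nonneg_pos mult.commute)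
    finally show ?thesis .
  qed
  then show "\<exists>N. \<forall>m\<ge>N. \<forall>n\<ge>N. nrm V (a \<odot> s m \<ominus> a \<odot> s n) < e" by blast
qed

lemma Cauchy_in_const: "x \<in> carrier V \<Longrightarrow> Cauchy_in V (\<lambda>n. x)"
  by (simp add: Cauchy_in_iff)

lemma Cauchy_in_nrm_convergent:
  assumes "Cauchy_in V s" shows "convergent (\<lambda>n. nrm V (s n))"
proof -
  have "Cauchy (\<lambda>n. nrm V (s n))"
  proof (rule metric_CauchyI)
    fix e :: real assume "e > 0"
    then obtain N where N: "\<And>m n. m \<ge> N \<Longrightarrow> n \<ge> N \<Longrightarrow> nrm V (s m \<ominus> s n) < e"
      using assms unfolding Cauchy_in_iff by blast
    have "dist (nrm V (s m)) (nrm V (s n)) < e" if "m \<ge> N" "n \<ge> N" for m n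
      using N[OF that] abs_nrm_diff_le[OF Cauchy_carrier[OF assms] Cauchy_carrier[OF assms], of m n] by (simp add: dist_real_def)
    then show "\<exists>N. \<forall>m\<ge>N. \<forall>n\<ge>N. dist (nrm V (s m)) (nrm V (s n)) < e" by blast
  qed
  then show ?thesis by (simp add: Cauchy_convergent_iff)
qed

lemma completion_add:
  assumes s: "Cauchy_in V s" and t: "Cauchy_in V t"
  shows "comp_class V s \<oplus>\<^bsub>completion V\<^esub> comp_class V t = comp_class V (\<lambda>n. s n \<oplus> t n)"
proof -
  have eq: "comp_class V (\<lambda>n. s' n \<oplus> t' n) = comp_class V (\<lambda>n. s n \<oplus> t n)"
    if s': "s' \<in> comp_class V s" and t': "t' \<in> comp_class V t" for s' t'
  proof -
    note cs = mem_comp_classD[OF s s'] and ct = mem_comp_classD[OF t t']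
    have "(\<lambda>n. nrm V ((s' n \<oplus> t' n) \<ominus> (s n \<oplus> t n))) \<longlonglongrightarrow> 0"
    proof (rule tendsto_sandwich[where f = "\<lambda>_. 0"])
      show "\<forall>\<^sub>F n in sequentially. nrm V ((s' n \<oplus> t' n) \<ominus> (s n \<oplus> t n)) \<le> nrm V (s' n \<ominus> s n) + nrm V (t' n \<ominus> t n)"
        using cs(1) ct(1) s t by (intro always_eventually allI) (simp add: add_diff_add Cauchy_carrier nrm_triangle)
      show "(\<lambda>n. nrm V (s' n \<ominus> s n) + nrm V (t' n \<ominus> t n)) \<longlonglongrightarrow> 0"
        using tendsto_add[OF iffD1[OF comp_class_eq_iff[OF cs(1) s] cs(2)] iffD1[OF comp_class_eq_iff[OF ct(1) t] ct(2)]] by simp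
    qed (use cs(1) ct(1) s t in \<open>auto intro!: always_eventually nrm_nonneg simp: Cauchy_carrier\<close>)
    then show ?thesis using cs(1) ct(1) s t by (simp add: comp_class_eq_iff Cauchy_in_add)
  qed
  have "comp_class V s \<oplus>\<^bsub>completion V\<^esub> comp_class V t = (\<Union>s'\<in>comp_class V s. \<Union>t'\<in>comp_class V t. comp_class V (\<lambda>n. s' n \<oplus> t' n))"
    by (simp add: completion_def comp_class_def)
  also have "\<dots> = (\<Union>s'\<in>comp_class V s. \<Union>t'\<in>comp_class V t. comp_class V (\<lambda>n. s n \<oplus> t n))"
    using eq by auto
  also have "\<dots> = comp_class V (\<lambda>n. s n \<oplus> t n)" using mem_comp_class[OF s] mem_comp_class[OF t] by auto
  finally show ?thesis .
qed

lemma completion_smult: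
  assumes s: "Cauchy_in V s"
  shows "a \<odot>\<^bsub>completion V\<^esub> comp_class V s = comp_class V (\<lambda>n. a \<odot> s n)"
proof -
  have eq: "comp_class V (\<lambda>n. a \<odot> s' n) = comp_class V (\<lambda>n. a \<odot> s n)" if s': "s' \<in> comp_class V s" for s'
  proof -
    note cs = mem_comp_classD[OF s s']
    have "(\<lambda>n. nrm V (a \<odot> s' n \<ominus> a \<odot> s n)) = (\<lambda>n. norm a * nrm V (s' n \<ominus> s n))"
      using s cs(1) by (simp add: Cauchy_carrier nrm_smult flip: smult_diff)
    also have "\<dots> \<longlonglongrightarrow> 0" using tendsto_mult_right_zero[OF iffD1[OF comp_class_eq_iff[OF cs(1) s] cs(2)]] .
    finally show ?thesis using cs(1) s by (simp add: comp_class_eq_iff Cauchy_in_smult)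
  qed
  have "a \<odot>\<^bsub>completion V\<^esub> comp_class V s = (\<Union>s'\<in>comp_class V s. comp_class V (\<lambda>n. a \<odot> s' n))"
    by (simp add: completion_def comp_class_def)
  also have "\<dots> = (\<Union>s'\<in>comp_class V s. comp_class V (\<lambda>n. a \<odot> s n))" using eq by auto
  also have "\<dots> = comp_class V (\<lambda>n. a \<odot> s n)" using mem_comp_class[OF s] by auto
  finally show ?thesis .
qed

lemma completion_nrm:
  assumes s: "Cauchy_in V s"
  shows "(\<lambda>n. nrm V (s n)) \<longlonglongrightarrow> nrm (completion V) (comp_class V s)"
proof -
  obtain r where r: "(\<lambda>n. nrm V (s n)) \<longlonglongrightarrow> r" using Cauchy_in_nrm_convergent[OF s] by (auto simp: convergent_def)
  have uniq: "r' = r" if s': "s' \<in> comp_class V s" "(\<lambda>n. nrm V (s' n)) \<longlonglongrightarrow> r'" for s' r'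
  proof -
    note cs = mem_comp_classD[OF s s'(1)]
    have "(\<lambda>n. nrm V (s' n) - nrm V (s n)) \<longlonglongrightarrow> 0"
    proof (rule Lim_null_comparison)
      show "\<forall>\<^sub>F n in sequentially. norm (nrm V (s' n) - nrm V (s n)) \<le> nrm V (s' n \<ominus> s n)"
        using abs_nrm_diff_le cs(1) s by (intro always_eventually allI) (auto simp: Cauchy_carrier)
      show "(\<lambda>n. nrm V (s' n \<ominus> s n)) \<longlonglongrightarrow> 0" by (rule iffD1[OF comp_class_eq_iff[OF cs(1) s] cs(2)])
    qed
    then have "r' - r = 0" using LIMSEQ_unique[OF tendsto_diff[OF s'(2) r]] by simp
    then show ?thesis by simp
  qed
  have "(THE r. \<exists>s'\<in>comp_class V s. (\<lambda>n. nrm V (s' n)) \<longlonglongrightarrow> r) = r"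
  proof (rule the_equality)
    show "\<exists>s'\<in>comp_class V s. (\<lambda>n. nrm V (s' n)) \<longlonglongrightarrow> r" by (rule bexI[of _ s]) (rule r, rule mem_comp_class[OF s])
    show "\<And>r'. \<exists>s'\<in>comp_class V s. (\<lambda>n. nrm V (s' n)) \<longlonglongrightarrow> r' \<Longrightarrow> r' = r" by (elim bexE) (rule uniq)
  qed
  then have "nrm (completion V) (comp_class V s) = r" by (simp add: completion_def)
  then show ?thesis using r by simp
qed

lemma completion_emb_eq: "completion_emb V x = comp_class V (\<lambda>n. x)"
  by (simp add: completion_emb_def comp_class_def)

lemma zero_completion: "\<zero>\<^bsub>completion V\<^esub> = completion_emb V \<zero>"
  by (simp add: completion_def completion_emb_def)

lemma normed_vector_space_completion: "normed_vector_space (completion V)"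
proof (rule normed_vector_spaceI)
  have C0: "Cauchy_in V (\<lambda>n. \<zero>)" by (simp add: Cauchy_in_const)
  note z = zero_completion[unfolded completion_emb_eq]
  note simps = completion_add completion_smult Cauchy_in_add Cauchy_in_smult
  show "\<zero>\<^bsub>completion V\<^esub> \<in> carrier (completion V)" using C0 by (auto simp: carrier_completion z)
  fix A assume "A \<in> carrier (completion V)"
  then obtain s where s: "Cauchy_in V s" and A: "A = comp_class V s" by (auto simp: carrier_completion)
  note sC = Cauchy_carrier[OF s]
  show "a \<odot>\<^bsub>completion V\<^esub> A \<in> carrier (completion V)" for a using s by (auto simp: A simps carrier_completion)
  show "\<zero>\<^bsub>completion V\<^esub> \<oplus>\<^bsub>completion V\<^esub> A = A" using s sC C0 by (simp add: A z simps)
  show "(-1) \<odot>\<^bsub>completion V\<^esub> A \<oplus>\<^bsub>completion V\<^esub> A = \<zero>\<^bsub>completion V\<^esub>"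
    using s sC by (simp add: A z simps M.a_comm[of "(-1) \<odot> s _"] flip: diff_conv)
  show "(a + b) \<odot>\<^bsub>completion V\<^esub> A = a \<odot>\<^bsub>completion V\<^esub> A \<oplus>\<^bsub>completion V\<^esub> b \<odot>\<^bsub>completion V\<^esub> A" for a b
    using s sC by (simp add: A simps smult_add_left)
  show "(a * b) \<odot>\<^bsub>completion V\<^esub> A = a \<odot>\<^bsub>completion V\<^esub> (b \<odot>\<^bsub>completion V\<^esub> A)" for a b
    using s sC by (simp add: A simps smult_smult)
  show "1 \<odot>\<^bsub>completion V\<^esub> A = A" using s sC by (simp add: A simps)
  show "0 \<le> nrm (completion V) A"
    using LIMSEQ_le_const[OF completion_nrm[OF s], of 0] sC by (auto simp: A nrm_nonneg)
  show "A = \<zero>\<^bsub>completion V\<^esub>" if "nrm (completion V) A = 0"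
    using completion_nrm[OF s] s C0 sC that by (simp add: A z comp_class_eq_iff diff_conv)
  show "nrm (completion V) (a \<odot>\<^bsub>completion V\<^esub> A) = norm a * nrm (completion V) A" for a
    using LIMSEQ_unique[OF completion_nrm[OF Cauchy_in_smult[OF s]], of a] tendsto_mult_left[OF completion_nrm[OF s], of "norm a"] s sC
    by (simp add: A simps nrm_smult)
  fix B assume "B \<in> carrier (completion V)"
  then obtain t where t: "Cauchy_in V t" and B: "B = comp_class V t" by (auto simp: carrier_completion)
  note tC = Cauchy_carrier[OF t]
  show "A \<oplus>\<^bsub>completion V\<^esub> B \<in> carrier (completion V)" using s t by (auto simp: A B simps carrier_completion)
  show "A \<oplus>\<^bsub>completion V\<^esub> B = B \<oplus>\<^bsub>completion V\<^esub> A" using s t sC tC by (simp add: A B simps M.a_comm)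
  show "a \<odot>\<^bsub>completion V\<^esub> (A \<oplus>\<^bsub>completion V\<^esub> B) = a \<odot>\<^bsub>completion V\<^esub> A \<oplus>\<^bsub>completion V\<^esub> a \<odot>\<^bsub>completion V\<^esub> B" for a
    using s t sC tC by (simp add: A B simps smult_add_right)
  show "nrm (completion V) (A \<oplus>\<^bsub>completion V\<^esub> B) \<le> nrm (completion V) A + nrm (completion V) B"
  proof (rule LIMSEQ_le)
    show "(\<lambda>n. nrm V (s n \<oplus> t n)) \<longlonglongrightarrow> nrm (completion V) (A \<oplus>\<^bsub>completion V\<^esub> B)"
      using completion_nrm[OF Cauchy_in_add[OF s t]] s t by (simp add: A B simps)
    show "(\<lambda>n. nrm V (s n) + nrm V (t n)) \<longlonglongrightarrow> nrm (completion V) A + nrm (completion V) B"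
      unfolding A B by (intro tendsto_add completion_nrm s t)
    show "\<exists>N. \<forall>n\<ge>N. nrm V (s n \<oplus> t n) \<le> nrm V (s n) + nrm V (t n)" using sC tC nrm_triangle by blast
  qed
  fix C assume "C \<in> carrier (completion V)"
  then obtain u where u: "Cauchy_in V u" and C: "C = comp_class V u" by (auto simp: carrier_completion)
  note uC = Cauchy_carrier[OF u]
  show "(A \<oplus>\<^bsub>completion V\<^esub> B) \<oplus>\<^bsub>completion V\<^esub> C = A \<oplus>\<^bsub>completion V\<^esub> (B \<oplus>\<^bsub>completion V\<^esub> C)"
    using s t u sC tC uC by (simp add: A B C simps M.a_assoc)
qed

lemma completion_emb_carrier: "x \<in> carrier V \<Longrightarrow> completion_emb V x \<in> carrier (completion V)"
  by (auto simp: carrier_completion completion_emb_eq Cauchy_in_const)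

lemma completion_emb_add: "\<lbrakk>x \<in> carrier V; y \<in> carrier V\<rbrakk> \<Longrightarrow>
    completion_emb V (x \<oplus> y) = completion_emb V x \<oplus>\<^bsub>completion V\<^esub> completion_emb V y"
  by (simp add: completion_emb_eq completion_add Cauchy_in_const)

lemma completion_emb_smult: "x \<in> carrier V \<Longrightarrow> completion_emb V (a \<odot> x) = a \<odot>\<^bsub>completion V\<^esub> completion_emb V x"
  by (simp add: completion_emb_eq completion_smult Cauchy_in_const)

lemma nrm_completion_emb: "x \<in> carrier V \<Longrightarrow> nrm (completion V) (completion_emb V x) = nrm V x"
  using LIMSEQ_unique[OF completion_nrm[OF Cauchy_in_const]] by (auto simp: completion_emb_eq)

text \<open>Extension by continuity: a bounded T0 maps Cauchy sequences to Cauchy sequences, which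
  converge in F, and equivalent sequences have the same limit. The bound passes to the
  limit.\<close>

lemma completion_extension:
  assumes F: "banach_space F" and T: "linear_op V F T0" and M: "\<And>x. x \<in> carrier V \<Longrightarrow> nrm F (T0 x) \<le> M * nrm V x"
  obtains T where "linear_op (completion V) F T" "\<And>A. A \<in> carrier (completion V) \<Longrightarrow> nrm F (T A) \<le> M * nrm (completion V) A"
    "\<And>x. x \<in> carrier V \<Longrightarrow> T (completion_emb V x) = T0 x"
proof -
  have nF: "normed_vector_space F" and cF: "Metric_space.mcomplete (carrier F) (nrm_dist F)"
    using F by (auto simp: banach_space_def)
  interpret F: normed_vector_space F by (rule nF)
  note TC = linear_opD(1)[OF T]
  have V: "normed_vector_space V" by unfold_locales
  have diff: "nrm F (T0 x \<ominus>\<^bsub>F\<^esub> T0 y) \<le> M * nrm V (x \<ominus> y)" if "x \<in> carrier V" "y \<in> carrier V" for x y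
    using M[of "x \<ominus> y"] that by (simp add: linear_op_diff[OF V nF T])
  define lim where "lim s m \<longleftrightarrow> m \<in> carrier F \<and> (\<lambda>n. nrm F (T0 (s n) \<ominus>\<^bsub>F\<^esub> m)) \<longlonglongrightarrow> 0" for s m
  have ex: "\<exists>m. lim s m" if s: "Cauchy_in V s" for s
  proof -
    have "F.ms.MCauchy (\<lambda>n. T0 (s n))"
      unfolding F.Cauchy_in_iff
    proof (intro conjI allI impI)
      show "T0 (s n) \<in> carrier F" for n using TC Cauchy_carrier[OF s] by simp
      fix e :: real assume e: "e > 0"
      then have "e / (\<bar>M\<bar> + 1) > 0" by (simp add: add_nonneg_pos)
      then obtain N where N: "\<And>m n. m \<ge> N \<Longrightarrow> n \<ge> N \<Longrightarrow> nrm V (s m \<ominus> s n) < e / (\<bar>M\<bar> + 1)"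
        using s unfolding Cauchy_in_iff by blast
      have "nrm F (T0 (s m) \<ominus>\<^bsub>F\<^esub> T0 (s n)) < e" if "m \<ge> N" "n \<ge> N" for m n
      proof -
        have "nrm F (T0 (s m) \<ominus>\<^bsub>F\<^esub> T0 (s n)) \<le> M * nrm V (s m \<ominus> s n)" using diff Cauchy_carrier[OF s] by simp
        also have "\<dots> \<le> (\<bar>M\<bar> + 1) * nrm V (s m \<ominus> s n)" using Cauchy_carrier[OF s] by (intro mult_right_mono) (auto simp: nrm_nonneg)
        also have "\<dots> < e" using N[OF that] by (simp add: pos_less_divide_eq add_nonneg_pos mult.commute)
        finally show ?thesis .
      qed
      then show "\<exists>N. \<forall>m\<ge>N. \<forall>n\<ge>N. nrm F (T0 (s m) \<ominus>\<^bsub>F\<^esub> T0 (s n)) < e" by blast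
    qed
    then obtain m where "limitin (norm_topology F) (\<lambda>n. T0 (s n)) m sequentially"
      using cF unfolding F.ms.mcomplete_def by blast
    then show ?thesis using F.limitin_iff[of "\<lambda>n. T0 (s n)" m] TC Cauchy_carrier[OF s] by (auto simp: lim_def)
  qed
  have uniq: "m = m'" if s: "Cauchy_in V s" and t: "Cauchy_in V t" and st: "comp_class V s = comp_class V t" and l: "lim s m" "lim t m'" for s t m m'
  proof -
    have mC: "m \<in> carrier F" "m' \<in> carrier F" using l by (auto simp: lim_def)
    have z: "(\<lambda>n. nrm F (T0 (s n) \<ominus>\<^bsub>F\<^esub> m) + (\<bar>M\<bar> * nrm V (s n \<ominus> t n) + nrm F (T0 (t n) \<ominus>\<^bsub>F\<^esub> m'))) \<longlonglongrightarrow> 0 + (\<bar>M\<bar> * 0 + 0)"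
      using l iffD1[OF comp_class_eq_iff[OF s t] st] by (intro tendsto_intros) (auto simp: lim_def)
    have "nrm F (m \<ominus>\<^bsub>F\<^esub> m') \<le> nrm F (T0 (s n) \<ominus>\<^bsub>F\<^esub> m) + (\<bar>M\<bar> * nrm V (s n \<ominus> t n) + nrm F (T0 (t n) \<ominus>\<^bsub>F\<^esub> m'))" for n
    proof -
      have C: "T0 (s n) \<in> carrier F" "T0 (t n) \<in> carrier F" using TC s t by (auto simp: Cauchy_carrier)
      have "nrm F (m \<ominus>\<^bsub>F\<^esub> m') \<le> nrm F (m \<ominus>\<^bsub>F\<^esub> T0 (s n)) + nrm F (T0 (s n) \<ominus>\<^bsub>F\<^esub> m')" using mC C by (intro F.nrm_diff_triangle)
      also have "nrm F (T0 (s n) \<ominus>\<^bsub>F\<^esub> m') \<le> nrm F (T0 (s n) \<ominus>\<^bsub>F\<^esub> T0 (t n)) + nrm F (T0 (t n) \<ominus>\<^bsub>F\<^esub> m')" using mC C by (intro F.nrm_diff_triangle)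
      also have "nrm F (T0 (s n) \<ominus>\<^bsub>F\<^esub> T0 (t n)) \<le> \<bar>M\<bar> * nrm V (s n \<ominus> t n)"
        using diff[of "s n" "t n"] s t mult_right_mono[OF abs_ge_self[of M] nrm_nonneg[of "s n \<ominus> t n"]] by (simp add: Cauchy_carrier)
      finally show ?thesis using F.nrm_diff_commute[OF mC(1) C(1)] by simp
    qed
    then have "nrm F (m \<ominus>\<^bsub>F\<^esub> m') \<le> 0 + (\<bar>M\<bar> * 0 + 0)"
      by (intro LIMSEQ_le_const[OF z]) auto
    then show ?thesis using mC F.nrm_nonneg[of "m \<ominus>\<^bsub>F\<^esub> m'"] by (simp add: F.nrm_eq_0_iff F.diff_eq_zero_iff)
  qed
  define T where "T A = (THE m. \<exists>s\<in>A. Cauchy_in V s \<and> lim s m)" for A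
  have T_eq: "T (comp_class V s) = m" if s: "Cauchy_in V s" and m: "lim s m" for s m
    unfolding T_def
  proof (rule the_equality)
    show "\<exists>s\<in>comp_class V s. Cauchy_in V s \<and> lim s m" using mem_comp_class[OF s] s m by blast
    fix m' assume "\<exists>s'\<in>comp_class V s. Cauchy_in V s' \<and> lim s' m'"
    then obtain s' where s': "s' \<in> comp_class V s" "lim s' m'" by blast
    note cs = mem_comp_classD[OF s s'(1)]
    show "m' = m" by (rule uniq[OF cs(1) s cs(2) s'(2) m])
  qed
  have lin: "linear_op (completion V) F T"
    unfolding linear_op_def
  proof (intro conjI ballI allI)
    show "T \<in> carrier (completion V) \<rightarrow> carrier F"
      using ex T_eq by (fastforce simp: carrier_completion lim_def)
    fix A assume "A \<in> carrier (completion V)"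
    then obtain s where s: "Cauchy_in V s" and A: "A = comp_class V s" by (auto simp: carrier_completion)
    note sC = Cauchy_carrier[OF s]
    obtain m where m: "lim s m" using ex[OF s] by blast
    have mC: "m \<in> carrier F" using m by (simp add: lim_def)
    show "T (a \<odot>\<^bsub>completion V\<^esub> A) = a \<odot>\<^bsub>F\<^esub> T A" for a
    proof -
      have "(\<lambda>n. nrm F (T0 (a \<odot> s n) \<ominus>\<^bsub>F\<^esub> a \<odot>\<^bsub>F\<^esub> m)) = (\<lambda>n. norm a * nrm F (T0 (s n) \<ominus>\<^bsub>F\<^esub> m))"
        using sC TC mC by (simp add: linear_opD(3)[OF T] F.nrm_smult flip: F.smult_diff)
      also have "\<dots> \<longlonglongrightarrow> 0" using m by (intro tendsto_mult_right_zero) (simp add: lim_def)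
      finally have "lim (\<lambda>n. a \<odot> s n) (a \<odot>\<^bsub>F\<^esub> m)" using mC by (simp add: lim_def)
      then show ?thesis using s T_eq[OF s m] T_eq[OF Cauchy_in_smult[OF s]] by (simp add: A completion_smult)
    qed
    fix B assume "B \<in> carrier (completion V)"
    then obtain t where t: "Cauchy_in V t" and B: "B = comp_class V t" by (auto simp: carrier_completion)
    note tC = Cauchy_carrier[OF t]
    obtain m' where m': "lim t m'" using ex[OF t] by blast
    have mC': "m' \<in> carrier F" using m' by (simp add: lim_def)
    have "(\<lambda>n. nrm F (T0 (s n \<oplus> t n) \<ominus>\<^bsub>F\<^esub> (m \<oplus>\<^bsub>F\<^esub> m'))) \<longlonglongrightarrow> 0"
    proof (rule tendsto_sandwich[where f = "\<lambda>_. 0"])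
      show "\<forall>\<^sub>F n in sequentially. nrm F (T0 (s n \<oplus> t n) \<ominus>\<^bsub>F\<^esub> (m \<oplus>\<^bsub>F\<^esub> m')) \<le> nrm F (T0 (s n) \<ominus>\<^bsub>F\<^esub> m) + nrm F (T0 (t n) \<ominus>\<^bsub>F\<^esub> m')"
        using sC tC TC mC mC' by (intro always_eventually allI) (simp add: linear_opD(2)[OF T] F.add_diff_add F.nrm_triangle)
      have "(\<lambda>n. nrm F (T0 (s n) \<ominus>\<^bsub>F\<^esub> m) + nrm F (T0 (t n) \<ominus>\<^bsub>F\<^esub> m')) \<longlonglongrightarrow> 0 + 0"
        using m m' by (intro tendsto_add) (auto simp: lim_def)
      then show "(\<lambda>n. nrm F (T0 (s n) \<ominus>\<^bsub>F\<^esub> m) + nrm F (T0 (t n) \<ominus>\<^bsub>F\<^esub> m')) \<longlonglongrightarrow> 0" by simp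
    qed (use sC tC TC mC mC' in \<open>auto intro!: always_eventually F.nrm_nonneg\<close>)
    then have "lim (\<lambda>n. s n \<oplus> t n) (m \<oplus>\<^bsub>F\<^esub> m')" using mC mC' by (simp add: lim_def)
    then show "T (A \<oplus>\<^bsub>completion V\<^esub> B) = T A \<oplus>\<^bsub>F\<^esub> T B"
      using s t T_eq[OF s m] T_eq[OF t m'] T_eq[OF Cauchy_in_add[OF s t]] by (simp add: A B completion_add)
  qed
  moreover have "nrm F (T A) \<le> M * nrm (completion V) A" if AC: "A \<in> carrier (completion V)" for A
  proof -
    obtain s where s: "Cauchy_in V s" and A: "A = comp_class V s" using AC by (auto simp: carrier_completion)
    obtain m where m: "lim s m" using ex[OF s] by blast
    have mC: "m \<in> carrier F" using m by (simp add: lim_def)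
    have "nrm F m \<le> M * nrm V (s n) + nrm F (T0 (s n) \<ominus>\<^bsub>F\<^esub> m)" for n
      using F.nrm_le_add_diff[OF mC TC[OF Cauchy_carrier[OF s]], of n] M[OF Cauchy_carrier[OF s], of n]
        F.nrm_diff_commute[OF mC TC[OF Cauchy_carrier[OF s]], of n] by simp
    moreover have "(\<lambda>n. M * nrm V (s n) + nrm F (T0 (s n) \<ominus>\<^bsub>F\<^esub> m)) \<longlonglongrightarrow> M * nrm (completion V) A + 0"
      using m completion_nrm[OF s] by (intro tendsto_intros) (auto simp: lim_def A)
    ultimately have "nrm F m \<le> M * nrm (completion V) A + 0" by (intro LIMSEQ_le_const) auto
    then show ?thesis using T_eq[OF s m] by (simp add: A)
  qed
  moreover have "T (completion_emb V x) = T0 x" if x: "x \<in> carrier V" for x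
    unfolding completion_emb_eq
    by (rule T_eq[OF Cauchy_in_const[OF x]]) (use x TC in \<open>simp add: lim_def\<close>)
  ultimately show thesis by (rule that)
qed

section \<open>Closed linear spans\<close>

lemma hull_submodule:
  assumes S: "S \<subseteq> carrier V"
  defines "H \<equiv> (\<lambda>H. submodule H scalars V) hull S"
  shows "S \<subseteq> H" "H \<subseteq> carrier V" "\<zero> \<in> H" "\<And>x y. x \<in> H \<Longrightarrow> y \<in> H \<Longrightarrow> x \<oplus> y \<in> H" "\<And>a x. x \<in> H \<Longrightarrow> a \<odot> x \<in> H"
proof -
  show "S \<subseteq> H" unfolding H_def by (rule hull_subset)
  show "H \<subseteq> carrier V" unfolding H_def by (rule hull_minimal[where S = "\<lambda>H. submodule H scalars V", OF S carrier_is_submodule])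
  have sub: "\<zero> \<in> G" "\<And>x y. x \<in> G \<Longrightarrow> y \<in> G \<Longrightarrow> x \<oplus> y \<in> G" "\<And>a x. x \<in> G \<Longrightarrow> a \<odot> x \<in> G" if G: "submodule G scalars V" for G
  proof -
    interpret G: submodule G scalars V by (rule G)
    show "\<zero> \<in> G" using G.one_closed by simp
    show "\<And>x y. x \<in> G \<Longrightarrow> y \<in> G \<Longrightarrow> x \<oplus> y \<in> G" using G.m_closed by simp
    show "\<And>a x. x \<in> G \<Longrightarrow> a \<odot> x \<in> G" using G.smult_closed by simp
  qed
  show "\<zero> \<in> H" "\<And>x y. x \<in> H \<Longrightarrow> y \<in> H \<Longrightarrow> x \<oplus> y \<in> H" "\<And>a x. x \<in> H \<Longrightarrow> a \<odot> x \<in> H"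
    using sub unfolding H_def hull_def by blast+
qed

lemma submoduleI':
  assumes "G \<subseteq> carrier V" "\<zero> \<in> G" "\<And>x y. x \<in> G \<Longrightarrow> y \<in> G \<Longrightarrow> x \<oplus> y \<in> G" "\<And>a x. x \<in> G \<Longrightarrow> a \<odot> x \<in> G"
  shows "submodule G scalars V"
proof (rule submoduleI)
  show "\<ominus> x \<in> G" if "x \<in> G" for x
  proof -
    have "\<ominus> x = (-1) \<odot> x" using diff_conv[of \<zero> x] that assms(1) by (auto simp: a_minus_def subset_iff)
    then show ?thesis using assms(4)[OF that, of "-1"] by simp
  qed
qed (use assms in auto)

lemma closed_span_simps:
  "\<zero>\<^bsub>closed_span V S\<^esub> = \<zero>" "x \<oplus>\<^bsub>closed_span V S\<^esub> y = x \<oplus> y" "a \<odot>\<^bsub>closed_span V S\<^esub> x = a \<odot> x" "nrm (closed_span V S) = nrm V"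
  by (simp_all add: closed_span_def)

lemma carrier_closed_span:
  assumes S: "S \<subseteq> carrier V"
  defines "H \<equiv> (\<lambda>H. submodule H scalars V) hull S"
  shows "carrier (closed_span V S) = {x \<in> carrier V. \<forall>e>0. \<exists>h\<in>H. nrm V (x \<ominus> h) < e}"
proof -
  have H: "H \<subseteq> carrier V" unfolding H_def by (rule hull_submodule(2)[OF S])
  have "carrier (closed_span V S) = {x \<in> carrier V. \<forall>e>0. \<exists>h\<in>H. h \<in> ms.mball x e}"
    by (simp add: closed_span_def H_def ms.metric_closure_of)
  also have "\<dots> = {x \<in> carrier V. \<forall>e>0. \<exists>h\<in>H. nrm V (x \<ominus> h) < e}"
  proof -
    have "h \<in> ms.mball x e \<longleftrightarrow> nrm V (x \<ominus> h) < e" if "h \<in> H" "x \<in> carrier V" for h x e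
      using H that by (auto simp: ms.in_mball nrm_dist_eq)
    then show ?thesis by (simp cong: conj_cong)
  qed
  finally show ?thesis .
qed

lemma normed_vector_space_closed_span:
  assumes S: "S \<subseteq> carrier V"
  shows "normed_vector_space (closed_span V S)"
proof -
  define H where "H = (\<lambda>H. submodule H scalars V) hull S"
  note H = hull_submodule[OF S, folded H_def]
  note C = carrier_closed_span[OF S, folded H_def]
  have sub: "x \<in> carrier V" if "x \<in> carrier (closed_span V S)" for x using that by (simp add: C)
  show ?thesis
  proof (rule normed_vector_spaceI; (unfold closed_span_simps)?)
    show "\<zero> \<in> carrier (closed_span V S)" using H(3) by (auto simp: C intro!: bexI[of _ \<zero>])
    show "x \<oplus> y \<in> carrier (closed_span V S)" if x: "x \<in> carrier (closed_span V S)" and y: "y \<in> carrier (closed_span V S)" for x y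
      unfolding C
    proof (intro CollectI conjI allI impI)
      show "x \<oplus> y \<in> carrier V" using sub[OF x] sub[OF y] by simp
      fix e :: real assume e: "e > 0"
      obtain h where h: "h \<in> H" "nrm V (x \<ominus> h) < e/2" using x half_gt_zero[OF e] unfolding C by blast
      obtain k where k: "k \<in> H" "nrm V (y \<ominus> k) < e/2" using y half_gt_zero[OF e] unfolding C by blast
      have hk: "h \<in> carrier V" "k \<in> carrier V" using h k H(2) by auto
      have "nrm V ((x \<oplus> y) \<ominus> (h \<oplus> k)) \<le> nrm V (x \<ominus> h) + nrm V (y \<ominus> k)"
        using sub[OF x] sub[OF y] hk by (simp add: add_diff_add nrm_triangle)
      then show "\<exists>h\<in>H. nrm V ((x \<oplus> y) \<ominus> h) < e" using h k H(4) by (intro bexI[of _ "h \<oplus> k"]) auto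
    qed
    show "a \<odot> x \<in> carrier (closed_span V S)" if x: "x \<in> carrier (closed_span V S)" for a x
      unfolding C
    proof (intro CollectI conjI allI impI)
      show "a \<odot> x \<in> carrier V" using sub[OF x] by simp
      fix e :: real assume e: "e > 0"
      then have "e / (norm a + 1) > 0" by (simp add: add_nonneg_pos)
      then obtain h where h: "h \<in> H" "nrm V (x \<ominus> h) < e / (norm a + 1)" using x unfolding C by blast
      have hC: "h \<in> carrier V" using h H(2) by auto
      have "nrm V (a \<odot> x \<ominus> a \<odot> h) = norm a * nrm V (x \<ominus> h)" using sub[OF x] hC by (simp add: nrm_smult flip: smult_diff)
      also have "\<dots> \<le> (norm a + 1) * nrm V (x \<ominus> h)" using sub[OF x] hC by (intro mult_right_mono) (auto simp: nrm_nonneg)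
      also have "\<dots> < e" using h by (simp add: pos_less_divide_eq add_nonneg_pos mult.commute)
      finally show "\<exists>h\<in>H. nrm V (a \<odot> x \<ominus> h) < e" using H(5)[OF h(1)] by blast
    qed
  qed (auto dest!: sub simp: vs_ac smult_add_left smult_add_right smult_smult nrm_nonneg nrm_eq_0_iff nrm_triangle nrm_smult)
qed

end


section \<open>Projective tensor products\<close>

lemma bilinear_formsD:
  assumes "b \<in> bilinear_forms V W"
  shows "\<And>x x' y. \<lbrakk>x \<in> carrier V; x' \<in> carrier V; y \<in> carrier W\<rbrakk> \<Longrightarrow> b (x \<oplus>\<^bsub>V\<^esub> x') y = b x y + b x' y"
    and "\<And>a x y. \<lbrakk>x \<in> carrier V; y \<in> carrier W\<rbrakk> \<Longrightarrow> b (a \<odot>\<^bsub>V\<^esub> x) y = a * b x y"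
    and "\<And>x y y'. \<lbrakk>x \<in> carrier V; y \<in> carrier W; y' \<in> carrier W\<rbrakk> \<Longrightarrow> b x (y \<oplus>\<^bsub>W\<^esub> y') = b x y + b x y'"
    and "\<And>a x y. \<lbrakk>x \<in> carrier V; y \<in> carrier W\<rbrakk> \<Longrightarrow> b x (a \<odot>\<^bsub>W\<^esub> y) = a * b x y"
  using assms by (auto simp: bilinear_forms_def linear_op_def)

lemma bilinear_formsI:
  assumes "\<And>x x' y. \<lbrakk>x \<in> carrier V; x' \<in> carrier V; y \<in> carrier W\<rbrakk> \<Longrightarrow> b (x \<oplus>\<^bsub>V\<^esub> x') y = b x y + b x' y"
    and "\<And>a x y. \<lbrakk>x \<in> carrier V; y \<in> carrier W\<rbrakk> \<Longrightarrow> b (a \<odot>\<^bsub>V\<^esub> x) y = a * b x y"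
    and "\<And>x y y'. \<lbrakk>x \<in> carrier V; y \<in> carrier W; y' \<in> carrier W\<rbrakk> \<Longrightarrow> b x (y \<oplus>\<^bsub>W\<^esub> y') = b x y + b x y'"
    and "\<And>a x y. \<lbrakk>x \<in> carrier V; y \<in> carrier W\<rbrakk> \<Longrightarrow> b x (a \<odot>\<^bsub>W\<^esub> y) = a * b x y"
  shows "b \<in> bilinear_forms V W"
  using assms by (auto simp: bilinear_forms_def linear_op_def)

lemma tensor_add_left: "\<lbrakk>x \<in> carrier V; x' \<in> carrier V; y \<in> carrier W\<rbrakk> \<Longrightarrow> tensor V W (x \<oplus>\<^bsub>V\<^esub> x') y b = tensor V W x y b + tensor V W x' y b"
  and tensor_smult_left: "\<lbrakk>x \<in> carrier V; y \<in> carrier W\<rbrakk> \<Longrightarrow> tensor V W (a \<odot>\<^bsub>V\<^esub> x) y b = a * tensor V W x y b"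
  and tensor_add_right: "\<lbrakk>x \<in> carrier V; y \<in> carrier W; y' \<in> carrier W\<rbrakk> \<Longrightarrow> tensor V W x (y \<oplus>\<^bsub>W\<^esub> y') b = tensor V W x y b + tensor V W x y' b"
  and tensor_smult_right: "\<lbrakk>x \<in> carrier V; y \<in> carrier W\<rbrakk> \<Longrightarrow> tensor V W x (a \<odot>\<^bsub>W\<^esub> y) b = a * tensor V W x y b"
  by (auto simp: tensor_def bilinear_formsD)

lemma tensor_repD:
  assumes "tensor_rep V W u n x y"
  shows "\<And>i. i < n \<Longrightarrow> x i \<in> carrier V" "\<And>i. i < n \<Longrightarrow> y i \<in> carrier W" "u b = (\<Sum>i<n. tensor V W (x i) (y i) b)"
  using assms by (auto simp: tensor_rep_def)

lemma sum_append:
  fixes f g :: "nat \<Rightarrow> 'a::comm_monoid_add"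
  shows "(\<Sum>i<n + m. if i < n then f i else g (i - n)) = (\<Sum>i<n. f i) + (\<Sum>i<m. g i)"
proof (induction m)
  case (Suc m)
  then show ?case by (simp add: add.assoc)
qed simp

lemma tensor_rep_add:
  assumes "tensor_rep V W u n x y" "tensor_rep V W v m x' y'"
  shows "tensor_rep V W (\<lambda>b. u b + v b) (n + m) (\<lambda>i. if i < n then x i else x' (i - n)) (\<lambda>i. if i < n then y i else y' (i - n))"
proof -
  have "(\<Sum>i<n + m. tensor V W (if i < n then x i else x' (i - n)) (if i < n then y i else y' (i - n)) b)
      = (\<Sum>i<n. tensor V W (x i) (y i) b) + (\<Sum>i<m. tensor V W (x' i) (y' i) b)" for b
    unfolding sum_append[symmetric] by (intro sum.cong) auto
  then show ?thesis using assms unfolding tensor_rep_def by auto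
qed

lemma tensor_rep_smult:
  assumes V: "normed_vector_space V" and u: "tensor_rep V W u n x y"
  shows "tensor_rep V W (\<lambda>b. a * u b) n (\<lambda>i. a \<odot>\<^bsub>V\<^esub> x i) y"
proof -
  interpret V: normed_vector_space V by fact
  note D = tensor_repD[OF u]
  show ?thesis unfolding tensor_rep_def
    using D by (auto simp: tensor_smult_left sum_distrib_left)
qed

lemma tensor_rep_single: "\<lbrakk>x \<in> carrier V; y \<in> carrier W\<rbrakk> \<Longrightarrow> tensor_rep V W (tensor V W x y) 1 (\<lambda>_. x) (\<lambda>_. y)"
  by (simp add: tensor_rep_def)

lemma algebraic_tensor_simps:
  "u \<in> carrier (algebraic_tensor V W) \<longleftrightarrow> (\<exists>n x y. tensor_rep V W u n x y)"
  "\<zero>\<^bsub>algebraic_tensor V W\<^esub> = (\<lambda>b. 0)" "u \<oplus>\<^bsub>algebraic_tensor V W\<^esub> v = (\<lambda>b. u b + v b)"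
  "a \<odot>\<^bsub>algebraic_tensor V W\<^esub> u = (\<lambda>b. a * u b)" "nrm (algebraic_tensor V W) = projective_norm V W"
  by (simp_all add: algebraic_tensor_def)

context
  fixes V :: "('k::real_normed_field, 'v) normed_vs" and W :: "('k, 'w) normed_vs"
  assumes V: "normed_vector_space V" and W: "normed_vector_space W"
begin

interpretation V: normed_vector_space V by (rule V)
interpretation W: normed_vector_space W by (rule W)

lemma projective_norm_lower:
  assumes u: "tensor_rep V W u n x y" and N: "\<And>n x y. tensor_rep V W u n x y \<Longrightarrow> r \<le> (\<Sum>i<n. nrm V (x i) * nrm W (y i))"
  shows "r \<le> projective_norm V W u"
  unfolding projective_norm_def using u N by (intro cInf_greatest) auto

lemma rep_sum_nonneg: "tensor_rep V W u n x y \<Longrightarrow> 0 \<le> (\<Sum>i<n. nrm V (x i) * nrm W (y i))"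
  by (intro sum_nonneg mult_nonneg_nonneg) (auto simp: tensor_repD V.nrm_nonneg W.nrm_nonneg)

lemma projective_norm_upper:
  assumes u: "tensor_rep V W u n x y" shows "projective_norm V W u \<le> (\<Sum>i<n. nrm V (x i) * nrm W (y i))"
  unfolding projective_norm_def
proof (rule cInf_lower)
  show "bdd_below {\<Sum>i<n. nrm V (x i) * nrm W (y i) |n x y. tensor_rep V W u n x y}"
    using rep_sum_nonneg by (intro bdd_belowI[of _ 0]) blast
qed (use u in blast)

lemma projective_norm_approx:
  assumes u: "tensor_rep V W u n x y" and e: "e > 0"
  obtains n x y where "tensor_rep V W u n x y" "(\<Sum>i<n. nrm V (x i) * nrm W (y i)) < projective_norm V W u + e"
proof -
  have "\<exists>z\<in>{\<Sum>i<n. nrm V (x i) * nrm W (y i) |n x y. tensor_rep V W u n x y}. z < projective_norm V W u + e"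
    by (rule cInf_lessD) (use u e in \<open>auto simp: projective_norm_def\<close>)
  then show thesis using that by blast
qed

lemma projective_norm_nonneg: "tensor_rep V W u n x y \<Longrightarrow> 0 \<le> projective_norm V W u"
  by (rule projective_norm_lower) (use rep_sum_nonneg in auto)

text \<open>Passes an estimate for all representations on to the infimum; bounded operators and
  functionals on the tensor product are obtained through it.\<close>

lemma projective_norm_dominates:
  assumes u: "u \<in> carrier (algebraic_tensor V W)" and M: "M \<ge> 0"
    and N: "\<And>n x y. tensor_rep V W u n x y \<Longrightarrow> r \<le> M * (\<Sum>i<n. nrm V (x i) * nrm W (y i))"
  shows "r \<le> M * projective_norm V W u"
proof (rule field_le_epsilon)
  fix e :: real assume e: "e > 0"
  obtain n x y where u: "tensor_rep V W u n x y" using u by (auto simp: algebraic_tensor_simps)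
  have e': "e / (M + 1) > 0" using e M by (simp add: add_nonneg_pos)
  obtain n x y where xy: "tensor_rep V W u n x y" "(\<Sum>i<n. nrm V (x i) * nrm W (y i)) < projective_norm V W u + e / (M + 1)"
    using projective_norm_approx[OF u e'] by blast
  have "r \<le> M * (\<Sum>i<n. nrm V (x i) * nrm W (y i))" by (rule N[OF xy(1)])
  also have "\<dots> \<le> M * (projective_norm V W u + e / (M + 1))" using xy(2) M by (intro mult_left_mono) auto
  also have "\<dots> \<le> M * projective_norm V W u + e" using e M by (simp add: field_simps)
  finally show "r \<le> M * projective_norm V W u + e" .
qed

text \<open>Definiteness is delegated to the particular spaces: tensors are separated by all
  bilinear forms, while the norm controls the bounded ones only. For C(K) point evaluations bridge
  the gap.\<close>

lemma normed_vector_space_algebraic_tensor: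
  assumes definite: "\<And>u n x y. tensor_rep V W u n x y \<Longrightarrow> projective_norm V W u = 0 \<Longrightarrow> u = (\<lambda>b. 0)"
  shows "normed_vector_space (algebraic_tensor V W)"
proof (rule normed_vector_spaceI; (unfold algebraic_tensor_simps)?)
  show "\<exists>n x y. tensor_rep V W (\<lambda>b. 0) n x y" by (intro exI[of _ 0]) (simp add: tensor_rep_def)
  fix u assume "\<exists>n x y. tensor_rep V W u n x y"
  then obtain n x y where u: "tensor_rep V W u n x y" by blast
  show "\<exists>n x y. tensor_rep V W (\<lambda>b. a * u b) n x y" for a using tensor_rep_smult[OF V u] by blast
  show "0 \<le> projective_norm V W u" by (rule projective_norm_nonneg[OF u])
  show "u = (\<lambda>b. 0)" if "projective_norm V W u = 0" by (rule definite[OF u that])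
  have le: "projective_norm V W (\<lambda>b. a * v b) \<le> norm a * projective_norm V W v" if v: "tensor_rep V W v m x' y'" for a v m x' y'
  proof (rule projective_norm_dominates)
    show "v \<in> carrier (algebraic_tensor V W)" using v by (auto simp: algebraic_tensor_simps)
    fix m x' y' assume v: "tensor_rep V W v m x' y'"
    have "projective_norm V W (\<lambda>b. a * v b) \<le> (\<Sum>i<m. nrm V (a \<odot>\<^bsub>V\<^esub> x' i) * nrm W (y' i))"
      by (rule projective_norm_upper[OF tensor_rep_smult[OF V v]])
    also have "\<dots> = norm a * (\<Sum>i<m. nrm V (x' i) * nrm W (y' i))"
      by (simp add: sum_distrib_left V.nrm_smult tensor_repD(1)[OF v] mult.assoc)
    finally show "projective_norm V W (\<lambda>b. a * v b) \<le> norm a * (\<Sum>i<m. nrm V (x' i) * nrm W (y' i))" .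
  qed simp
  show "projective_norm V W (\<lambda>b. a * u b) = norm a * projective_norm V W u" for a
  proof (cases "a = 0")
    case True
    have "projective_norm V W (\<lambda>b. 0 * u b) \<le> 0" using le[OF u, of 0] by simp
    then show ?thesis using True projective_norm_nonneg[OF tensor_rep_smult[OF V u, of 0]] by simp
  next
    case False
    have "projective_norm V W u \<le> norm (inverse a) * projective_norm V W (\<lambda>b. a * u b)"
      using le[OF tensor_rep_smult[OF V u, of a], of "inverse a"] False by (simp flip: mult.assoc)
    then have "norm a * projective_norm V W u \<le> norm a * (norm (inverse a) * projective_norm V W (\<lambda>b. a * u b))"
      by (rule mult_left_mono) simp
    then have "norm a * projective_norm V W u \<le> projective_norm V W (\<lambda>b. a * u b)"
      using False by (simp add: norm_inverse flip: mult.assoc)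
    then show ?thesis using le[OF u, of a] by simp
  qed
  fix v assume "\<exists>n x y. tensor_rep V W v n x y"
  then obtain m x' y' where v: "tensor_rep V W v m x' y'" by blast
  show "\<exists>n x y. tensor_rep V W (\<lambda>b. u b + v b) n x y" using tensor_rep_add[OF u v] by blast
  show "projective_norm V W (\<lambda>b. u b + v b) \<le> projective_norm V W u + projective_norm V W v"
  proof (rule field_le_epsilon)
    fix e :: real assume "e > 0"
    then have e: "e/2 > 0" by simp
    obtain n x y where u: "tensor_rep V W u n x y" "(\<Sum>i<n. nrm V (x i) * nrm W (y i)) < projective_norm V W u + e/2"
      using projective_norm_approx[OF u e] by blast
    obtain m x' y' where v: "tensor_rep V W v m x' y'" "(\<Sum>i<m. nrm V (x' i) * nrm W (y' i)) < projective_norm V W v + e/2"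
      using projective_norm_approx[OF v e] by blast
    have "projective_norm V W (\<lambda>b. u b + v b) \<le> (\<Sum>i<n + m. nrm V (if i < n then x i else x' (i - n)) * nrm W (if i < n then y i else y' (i - n)))"
      by (rule projective_norm_upper[OF tensor_rep_add[OF u(1) v(1)]])
    also have "\<dots> = (\<Sum>i<n + m. if i < n then nrm V (x i) * nrm W (y i) else nrm V (x' (i - n)) * nrm W (y' (i - n)))"
      by (intro sum.cong) auto
    also have "\<dots> = (\<Sum>i<n. nrm V (x i) * nrm W (y i)) + (\<Sum>i<m. nrm V (x' i) * nrm W (y' i))"
      by (rule sum_append)
    finally show "projective_norm V W (\<lambda>b. u b + v b) \<le> projective_norm V W u + projective_norm V W v + e"
      using u(2) v(2) by linarith
  qed
qed (auto simp: algebra_simps)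

lemma functional_le_projective_norm:
  assumes u: "u \<in> carrier (algebraic_tensor V W)" and b: "b \<in> bilinear_forms V W" and M: "M \<ge> 0"
    and bd: "\<And>x y. \<lbrakk>x \<in> carrier V; y \<in> carrier W\<rbrakk> \<Longrightarrow> norm (b x y) \<le> M * (nrm V x * nrm W y)"
  shows "norm (u b) \<le> M * projective_norm V W u"
proof (rule projective_norm_dominates[OF u M])
  fix n x y assume u: "tensor_rep V W u n x y"
  note D = tensor_repD[OF u]
  show "norm (u b) \<le> M * (\<Sum>i<n. nrm V (x i) * nrm W (y i))"
    unfolding D(3) sum_distrib_left using b D(1,2) bd by (intro sum_norm_le) (auto simp: tensor_def)
qed

end

section \<open>Definiteness of the projective norm over C(K)\<close>

lemma C_space_linear_sum:
  fixes n :: nat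
  assumes "linear_op (C_space K) scalars \<phi>" and "\<And>i. i < n \<Longrightarrow> g i \<in> cont_funs K"
  shows "\<phi> (\<lambda>t. \<Sum>i<n. c i * g i t) = (\<Sum>i<n. c i * \<phi> (g i))"
  using assms(2)
proof (induction n)
  case 0
  then show ?case using linear_op_scalarsD(2)[OF assms(1), of "\<lambda>t. 0" 0] by simp
next
  case (Suc n)
  have "\<phi> (\<lambda>t. (\<Sum>i<n. c i * g i t) + c n * g n t) = \<phi> (\<lambda>t. \<Sum>i<n. c i * g i t) + \<phi> (\<lambda>t. c n * g n t)"
  proof -
    have "(\<lambda>t. \<Sum>i<n. c i * g i t) \<in> cont_funs K"
      by (rule cont_funs_sum) (use Suc.prems in \<open>auto intro: cont_funs_cmult\<close>)
    moreover have "(\<lambda>t. c n * g n t) \<in> cont_funs K" using Suc.prems by (intro cont_funs_cmult) simp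
    ultimately show ?thesis using linear_op_scalarsD(1)[OF assms(1)] by fastforce
  qed
  moreover have "\<phi> (\<lambda>t. c n * g n t) = c n * \<phi> (g n)"
    using linear_op_scalarsD(2)[OF assms(1), of "g n" "c n"] Suc.prems by simp
  ultimately show ?case using Suc by simp
qed

text \<open>An elementary tensor \<open>f n \<otimes> g n\<close> with \<open>f n s \<noteq> 0\<close> can be eliminated, since the vanishing of the
  sum at \<open>s\<close> expresses \<open>g n\<close> as a linear combination of the other \<open>g i\<close>.\<close>

lemma bilinear_form_sum_eq_0:
  fixes f g :: "nat \<Rightarrow> 'a \<Rightarrow> 'k::real_normed_field"
  assumes "b \<in> bilinear_forms (C_space K) (C_space K)"
    and "\<And>i. i < n \<Longrightarrow> f i \<in> cont_funs K" "\<And>i. i < n \<Longrightarrow> g i \<in> cont_funs K"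
    and "\<And>s t. (\<Sum>i<n. f i s * g i t) = 0"
  shows "(\<Sum>i<n. b (f i) (g i)) = 0"
  using assms(2-4)
proof (induction n arbitrary: f g)
  case (Suc n)
  note b = bilinear_formsD[OF assms(1)]
  have linL: "linear_op (C_space K) scalars (\<lambda>h. b h (g i))" if "i \<le> n" for i
    using assms(1) Suc.prems(2)[of i] that by (auto simp: bilinear_forms_def)
  have linR: "linear_op (C_space K) scalars (b (f n))"
    using assms(1) Suc.prems(1)[of n] by (auto simp: bilinear_forms_def)
  show ?case
  proof (cases "\<exists>s. f n s \<noteq> 0")
    case False
    then have fn: "f n = (\<lambda>t. 0)" by auto
    have "b (f n) (g n) = 0" using b(2)[of "\<lambda>t. 0" "g n" 0] Suc.prems(2)[of n] by (simp add: fn)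
    moreover have "(\<Sum>i<n. b (f i) (g i)) = 0" using Suc.prems fn by (intro Suc.IH) auto
    ultimately show ?thesis by simp
  next
    case True
    then obtain s where s: "f n s \<noteq> 0" by blast
    define c where "c i = f i s / f n s" for i
    have gn: "g n = (\<lambda>t. \<Sum>i<n. (- c i) * g i t)"
    proof
      fix t
      have "f n s * g n t = - (\<Sum>i<n. f i s * g i t)" using Suc.prems(3)[of s t] by (simp add: eq_neg_iff_add_eq_0 add.commute)
      then have "g n t = - (\<Sum>i<n. f i s * g i t) / f n s" using s by (simp add: field_simps)
      then show "g n t = (\<Sum>i<n. (- c i) * g i t)" by (simp add: c_def sum_divide_distrib sum_negf)
    qed
    \<comment> \<open>Substituting for g n distributes f n over the other terms; the new sum has one
      term less and still vanishes pointwise.\<close>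
    have "(\<Sum>i<n. b (\<lambda>t. f i t + (- c i) * f n t) (g i)) = 0"
    proof (rule Suc.IH)
      show "(\<lambda>t. f i t + (- c i) * f n t) \<in> cont_funs K" if "i < n" for i
        using that Suc.prems(1)[of i] Suc.prems(1)[of n] by (intro cont_funs_add cont_funs_cmult) auto
      show "g i \<in> cont_funs K" if "i < n" for i using Suc.prems(2)[of i] that by simp
      show "(\<Sum>i<n. (f i s' + (- c i) * f n s') * g i t) = 0" for s' t
      proof -
        have "(\<Sum>i<n. (f i s' + (- c i) * f n s') * g i t) = (\<Sum>i<n. f i s' * g i t + f n s' * ((- c i) * g i t))"
          by (intro sum.cong) (auto simp: algebra_simps)
        also have "\<dots> = (\<Sum>i<n. f i s' * g i t) + f n s' * (\<Sum>i<n. (- c i) * g i t)"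
          by (simp only: sum.distrib sum_distrib_left)
        also have "(\<Sum>i<n. (- c i) * g i t) = g n t" using fun_cong[OF gn, of t] by simp
        finally show ?thesis using Suc.prems(3)[of s' t] by simp
      qed
    qed
    moreover have "b (\<lambda>t. f i t + (- c i) * f n t) (g i) = b (f i) (g i) + (- c i) * b (f n) (g i)" if "i < n" for i
      using b(1)[of "f i" "\<lambda>t. (- c i) * f n t" "g i"] b(2)[of "f n" "g i" "- c i"] that Suc.prems(1)[of i] Suc.prems(1)[of n] Suc.prems(2)[of i] cont_funs_cmult[of "f n" K "- c i"]
      by simp
    moreover have "b (f n) (g n) = (\<Sum>i<n. (- c i) * b (f n) (g i))"
    proof -
      have "b (f n) (g n) = b (f n) (\<lambda>t. \<Sum>i<n. (- c i) * g i t)" by (rule arg_cong[OF gn])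
      also have "\<dots> = (\<Sum>i<n. (- c i) * b (f n) (g i))"
        using Suc.prems(2) by (intro C_space_linear_sum[OF linR]) auto
      finally show ?thesis .
    qed
    ultimately show ?thesis by (simp add: sum.distrib sum_subtractf sum_negf)
  qed
qed simp

lemma point_evaluation_bilinear: "(\<lambda>f g. f s * g t) \<in> bilinear_forms (C_space K) (C_space K)"
  by (rule bilinear_formsI) (auto simp: algebra_simps)

text \<open>The evaluations f(s) g(t) are forms of norm at most 1, so they vanish on a tensor of
  norm 0. It is then zero as a function on K x K, and by elimination every bilinear form annihilates
  it.\<close>

lemma normed_vector_space_algebraic_tensor_C:
  fixes K :: "'a topology"
  assumes K: "compact_space K"
  shows "normed_vector_space (algebraic_tensor (C_space K :: ('k::real_normed_field, 'a \<Rightarrow> 'k) normed_vs) (C_space K))"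
proof (rule normed_vector_space_algebraic_tensor)
  let ?C = "C_space K :: ('k, 'a \<Rightarrow> 'k) normed_vs"
  show C: "normed_vector_space ?C" "normed_vector_space ?C" using K by (rule normed_vector_space_C_space)+
  fix u n and x y :: "nat \<Rightarrow> 'a \<Rightarrow> 'k" assume u: "tensor_rep ?C ?C u n x y" and 0: "projective_norm ?C ?C u = 0"
  note D = tensor_repD[OF u]
  have "u (\<lambda>f g. f s * g t) = 0" for s t
  proof -
    have "norm (u (\<lambda>f g. f s * g t)) \<le> 1 * projective_norm ?C ?C u"
    proof (rule functional_le_projective_norm[OF C _ point_evaluation_bilinear])
      show "u \<in> carrier (algebraic_tensor ?C ?C)" using u by (auto simp: algebraic_tensor_simps)
      show "norm (f s * g t) \<le> 1 * (sup_nrm K f * sup_nrm K g)" if "f \<in> cont_funs K" "g \<in> cont_funs K" for f g :: "'a \<Rightarrow> 'k"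
        using norm_le_sup_nrm[OF K that(1), of s] norm_le_sup_nrm[OF K that(2), of t] sup_nrm_nonneg[OF K that(1)]
        by (simp add: norm_mult mult_mono)
    qed simp
    then show ?thesis using 0 by simp
  qed
  then have z: "(\<Sum>i<n. x i s * y i t) = 0" for s t
    by (simp add: D(3) tensor_def point_evaluation_bilinear)
  show "u = (\<lambda>b. 0)"
  proof
    fix b show "u b = 0"
    proof (cases "b \<in> bilinear_forms ?C ?C")
      case True
      then show ?thesis using bilinear_form_sum_eq_0[OF True D(1,2) z] by (simp add: D(3) tensor_def)
    next
      case False
      then show ?thesis by (simp add: D(3) tensor_def)
    qed
  qed
qed

section \<open>Symmetric tensors\<close>

locale sym_tensor_space = V: normed_vector_space V + A: normed_vector_space "algebraic_tensor V V"
  for V :: "('k::real_normed_field, 'v) normed_vs"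
begin

text \<open>The factor 1/2 makes f . f the square of f and keeps the norm of f . g below the product
  of the norms.\<close>

definition symt :: "'v \<Rightarrow> 'v \<Rightarrow> ('v \<Rightarrow> 'v \<Rightarrow> 'k) \<Rightarrow> 'k" where
  "symt f g = (\<lambda>b. (1/2) * (tensor V V f g b + tensor V V g f b))"

definition sym_tensor :: "'v \<Rightarrow> 'v \<Rightarrow> (nat \<Rightarrow> ('v \<Rightarrow> 'v \<Rightarrow> 'k) \<Rightarrow> 'k) set" where
  "sym_tensor f g = completion_emb (algebraic_tensor V V) (symt f g)"

abbreviation "AT \<equiv> algebraic_tensor V V"
abbreviation "ET \<equiv> sym_projective_tensor V"
abbreviation "emb \<equiv> completion_emb AT"
abbreviation "squares \<equiv> (\<lambda>x. emb (tensor V V x x)) ` carrier V"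

lemma nvs_V: "normed_vector_space V" and nvs_A: "normed_vector_space AT"
  by unfold_locales

lemma tensor_carrier: "\<lbrakk>f \<in> carrier V; g \<in> carrier V\<rbrakk> \<Longrightarrow> tensor V V f g \<in> carrier AT"
  using tensor_rep_single[of f V g V] by (auto simp: algebraic_tensor_simps)

lemma symt_eq: "symt f g = (1/2) \<odot>\<^bsub>AT\<^esub> (tensor V V f g \<oplus>\<^bsub>AT\<^esub> tensor V V g f)"
  by (simp add: symt_def algebraic_tensor_simps)

lemma symt_carrier: "\<lbrakk>f \<in> carrier V; g \<in> carrier V\<rbrakk> \<Longrightarrow> symt f g \<in> carrier AT"
  unfolding symt_eq by (intro A.smult_carrier A.add_carrier tensor_carrier)

lemma squares_subset: "squares \<subseteq> carrier (completion AT)"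
  by (auto intro: A.completion_emb_carrier tensor_carrier)

lemma nvs_X: "normed_vector_space (completion AT)" by (rule A.normed_vector_space_completion)

sublocale X: normed_vector_space "completion (algebraic_tensor V V)" by (rule nvs_X)

lemma ET_eq: "ET = closed_span (completion AT) squares"
  by (simp add: sym_projective_tensor_def projective_tensor_def)

lemma nvs_E: "normed_vector_space ET"
  unfolding ET_eq by (rule X.normed_vector_space_closed_span[OF squares_subset])

sublocale E: normed_vector_space "sym_projective_tensor V" by (rule nvs_E)

lemma ET_simps:
  "\<zero>\<^bsub>ET\<^esub> = \<zero>\<^bsub>completion AT\<^esub>" "x \<oplus>\<^bsub>ET\<^esub> y = x \<oplus>\<^bsub>completion AT\<^esub> y" "a \<odot>\<^bsub>ET\<^esub> x = a \<odot>\<^bsub>completion AT\<^esub> x" "nrm ET = nrm (completion AT)"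
  unfolding ET_eq X.closed_span_simps by simp_all

definition "hullE = (\<lambda>H. submodule H scalars (completion AT)) hull squares"

lemmas hullE = X.hull_submodule[OF squares_subset, folded hullE_def]

lemma carrier_ET: "carrier ET = {x \<in> carrier (completion AT). \<forall>e>0. \<exists>h\<in>hullE. nrm (completion AT) (x \<ominus>\<^bsub>completion AT\<^esub> h) < e}"
  unfolding ET_eq hullE_def by (rule X.carrier_closed_span[OF squares_subset])

lemma carrier_ET_subset: "x \<in> carrier ET \<Longrightarrow> x \<in> carrier (completion AT)"
  by (simp add: carrier_ET)

lemma hullE_subset: "hullE \<subseteq> carrier ET"
proof
  fix x assume x: "x \<in> hullE"
  then have xC: "x \<in> carrier (completion AT)" using hullE(2) by auto
  have "nrm (completion AT) (x \<ominus>\<^bsub>completion AT\<^esub> x) = 0" using xC by simp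
  then show "x \<in> carrier ET" unfolding carrier_ET using x xC by (auto intro!: bexI[of _ x])
qed

text \<open>Polarisation: 2 f . g = (f + g) . (f + g) - f . f - g . g.\<close>

lemma sym_tensor_hull:
  assumes f: "f \<in> carrier V" and g: "g \<in> carrier V"
  shows "sym_tensor f g \<in> hullE"
proof -
  have fg: "f \<oplus>\<^bsub>V\<^esub> g \<in> carrier V" using f g by simp
  have "symt f g = (1/2) \<odot>\<^bsub>AT\<^esub> (tensor V V (f \<oplus>\<^bsub>V\<^esub> g) (f \<oplus>\<^bsub>V\<^esub> g) \<oplus>\<^bsub>AT\<^esub> (-1) \<odot>\<^bsub>AT\<^esub> (tensor V V f f \<oplus>\<^bsub>AT\<^esub> tensor V V g g))"
    using f g by (simp add: symt_def algebraic_tensor_simps tensor_add_left tensor_add_right fun_eq_iff)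
  then have "sym_tensor f g = (1/2) \<odot>\<^bsub>completion AT\<^esub> (emb (tensor V V (f \<oplus>\<^bsub>V\<^esub> g) (f \<oplus>\<^bsub>V\<^esub> g)) \<oplus>\<^bsub>completion AT\<^esub>
      (-1) \<odot>\<^bsub>completion AT\<^esub> (emb (tensor V V f f) \<oplus>\<^bsub>completion AT\<^esub> emb (tensor V V g g)))"
    using f g fg by (simp add: sym_tensor_def A.completion_emb_add A.completion_emb_smult tensor_carrier)
  also have "\<dots> \<in> hullE" using hullE(1) f g fg by (intro hullE(4,5)) auto
  finally show ?thesis .
qed

lemma sym_tensor_carrier: "\<lbrakk>f \<in> carrier V; g \<in> carrier V\<rbrakk> \<Longrightarrow> sym_tensor f g \<in> carrier ET"
  using sym_tensor_hull hullE_subset by blast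

lemma sym_tensor_commute: "sym_tensor f g = sym_tensor g f"
  by (simp add: sym_tensor_def symt_def add.commute)

lemma sym_tensor_add_left: "\<lbrakk>f \<in> carrier V; f' \<in> carrier V; g \<in> carrier V\<rbrakk> \<Longrightarrow> sym_tensor (f \<oplus>\<^bsub>V\<^esub> f') g = sym_tensor f g \<oplus>\<^bsub>ET\<^esub> sym_tensor f' g"
proof -
  assume f: "f \<in> carrier V" "f' \<in> carrier V" "g \<in> carrier V"
  have "symt (f \<oplus>\<^bsub>V\<^esub> f') g = symt f g \<oplus>\<^bsub>AT\<^esub> symt f' g"
    using f by (simp add: symt_def algebraic_tensor_simps tensor_add_left tensor_add_right fun_eq_iff algebra_simps)
  then show ?thesis using f by (simp add: sym_tensor_def ET_simps A.completion_emb_add symt_carrier)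
qed

lemma sym_tensor_smult_left: "\<lbrakk>f \<in> carrier V; g \<in> carrier V\<rbrakk> \<Longrightarrow> sym_tensor (a \<odot>\<^bsub>V\<^esub> f) g = a \<odot>\<^bsub>ET\<^esub> sym_tensor f g"
proof -
  assume f: "f \<in> carrier V" "g \<in> carrier V"
  have "symt (a \<odot>\<^bsub>V\<^esub> f) g = a \<odot>\<^bsub>AT\<^esub> symt f g"
    using f by (simp add: symt_def algebraic_tensor_simps tensor_smult_left tensor_smult_right fun_eq_iff algebra_simps)
  then show ?thesis using f by (simp add: sym_tensor_def ET_simps A.completion_emb_smult symt_carrier)
qed

lemma nrm_sym_tensor:
  assumes f: "f \<in> carrier V" and g: "g \<in> carrier V"
  shows "nrm ET (sym_tensor f g) \<le> nrm V f * nrm V g"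
proof -
  have t: "nrm AT (tensor V V f g) \<le> nrm V f * nrm V g" if "f \<in> carrier V" "g \<in> carrier V" for f g
    using projective_norm_upper[OF nvs_V nvs_V tensor_rep_single[OF that]] by (simp add: algebraic_tensor_simps)
  have "nrm ET (sym_tensor f g) = nrm AT (symt f g)"
    using f g by (simp add: sym_tensor_def ET_simps A.nrm_completion_emb symt_carrier)
  also have "\<dots> = (1/2) * nrm AT (tensor V V f g \<oplus>\<^bsub>AT\<^esub> tensor V V g f)"
    unfolding symt_eq using f g by (simp add: A.nrm_smult tensor_carrier norm_divide)
  also have "\<dots> \<le> (1/2) * (nrm AT (tensor V V f g) + nrm AT (tensor V V g f))"
    using f g by (intro mult_left_mono A.nrm_triangle tensor_carrier) auto
  also have "\<dots> \<le> nrm V f * nrm V g" using t[OF f g] t[OF g f] by (simp add: mult.commute)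
  finally show ?thesis .
qed

lemma flip_bilinear: "b \<in> bilinear_forms V V \<Longrightarrow> (\<lambda>x y. b y x) \<in> bilinear_forms V V"
  by (auto simp: bilinear_forms_def)

text \<open>The flip-invariant tensors form a submodule containing the squares, hence the hull. This
  permits the symmetrisation of arbitrary representations below.\<close>

lemma hullE_symmetric:
  assumes "h \<in> hullE"
  obtains v where "h = emb v" "v \<in> carrier AT" "\<And>b. b \<in> bilinear_forms V V \<Longrightarrow> v (\<lambda>x y. b y x) = v b"
proof -
  define G where "G = {emb v | v. v \<in> carrier AT \<and> (\<forall>b\<in>bilinear_forms V V. v (\<lambda>x y. b y x) = v b)}"
  have "submodule G scalars (completion AT)"
  proof (rule X.submoduleI')
    show "G \<subseteq> carrier (completion AT)" by (auto simp: G_def A.completion_emb_carrier)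
    show "\<zero>\<^bsub>completion AT\<^esub> \<in> G"
      unfolding G_def A.zero_completion using A.zero_carrier by (auto simp: algebraic_tensor_simps(2) intro!: exI[of _ "\<lambda>b. 0"])
    fix h assume "h \<in> G"
    then obtain v where v: "h = emb v" "v \<in> carrier AT" "\<forall>b\<in>bilinear_forms V V. v (\<lambda>x y. b y x) = v b" by (auto simp: G_def)
    have "\<forall>b\<in>bilinear_forms V V. (a \<odot>\<^bsub>AT\<^esub> v) (\<lambda>x y. b y x) = (a \<odot>\<^bsub>AT\<^esub> v) b" for a
      using v(3) by (simp add: algebraic_tensor_simps(4))
    then show "a \<odot>\<^bsub>completion AT\<^esub> h \<in> G" for a
      unfolding G_def using v by (intro CollectI exI[of _ "a \<odot>\<^bsub>AT\<^esub> v"]) (simp add: A.completion_emb_smult)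
    fix k assume "k \<in> G"
    then obtain w where w: "k = emb w" "w \<in> carrier AT" "\<forall>b\<in>bilinear_forms V V. w (\<lambda>x y. b y x) = w b" by (auto simp: G_def)
    have "\<forall>b\<in>bilinear_forms V V. (v \<oplus>\<^bsub>AT\<^esub> w) (\<lambda>x y. b y x) = (v \<oplus>\<^bsub>AT\<^esub> w) b"
      using v(3) w(3) by (simp add: algebraic_tensor_simps(3))
    then show "h \<oplus>\<^bsub>completion AT\<^esub> k \<in> G"
      unfolding G_def using v w by (intro CollectI exI[of _ "v \<oplus>\<^bsub>AT\<^esub> w"]) (simp add: A.completion_emb_add)
  qed
  moreover have "squares \<subseteq> G"
  proof (rule image_subsetI)
    fix x assume "x \<in> carrier V"
    then have "tensor V V x x \<in> carrier AT \<and> (\<forall>b\<in>bilinear_forms V V. tensor V V x x (\<lambda>x y. b y x) = tensor V V x x b)"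
      using tensor_carrier flip_bilinear by (simp add: tensor_def)
    then show "emb (tensor V V x x) \<in> G" unfolding G_def by blast
  qed
  ultimately have "hullE \<subseteq> G" unfolding hullE_def by (intro hull_minimal)
  then show thesis using assms that by (auto simp: G_def)
qed

text \<open>u is close to a flip-invariant algebraic tensor v. The terms of a nearly optimal
  representation of v need not be symmetric, but symmetrising each of them does not change v. The
  closeness is stated through functionals, so that no finite sums in \<open>ET\<close> have to be
  formed.\<close>

lemma sym_tensor_approximation:
  assumes u: "u \<in> carrier ET" and e: "e > 0"
  obtains n f g where "\<And>i::nat. i < n \<Longrightarrow> f i \<in> carrier V" "\<And>i. i < n \<Longrightarrow> g i \<in> carrier V"
    "(\<Sum>i<n. nrm V (f i) * nrm V (g i)) \<le> nrm ET u + e"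
    "\<And>\<psi> C. \<lbrakk>linear_op ET scalars \<psi>; C \<ge> 0; \<And>x. x \<in> carrier ET \<Longrightarrow> norm (\<psi> x) \<le> C * nrm ET x\<rbrakk> \<Longrightarrow>
        norm (\<psi> u - (\<Sum>i<n. \<psi> (sym_tensor (f i) (g i)))) \<le> C * e"
proof -
  have e2: "e/2 > 0" using e by simp
  obtain h where h: "h \<in> hullE" "nrm (completion AT) (u \<ominus>\<^bsub>completion AT\<^esub> h) < e/2"
    using u e2 unfolding carrier_ET by blast
  obtain v where v: "h = emb v" "v \<in> carrier AT" "\<And>b. b \<in> bilinear_forms V V \<Longrightarrow> v (\<lambda>x y. b y x) = v b"
    using hullE_symmetric[OF h(1)] by blast
  have uX: "u \<in> carrier (completion AT)" and hX: "h \<in> carrier (completion AT)" using u h(1) hullE(2) by (auto simp: carrier_ET)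
  have hE: "h \<in> carrier ET" using h(1) hullE_subset by blast
  have diff: "u \<ominus>\<^bsub>ET\<^esub> h = u \<ominus>\<^bsub>completion AT\<^esub> h"
    using u hE uX hX by (simp add: E.diff_conv X.diff_conv ET_simps)
  have "nrm (completion AT) h \<le> nrm (completion AT) u + nrm (completion AT) (h \<ominus>\<^bsub>completion AT\<^esub> u)"
    by (rule X.nrm_le_add_diff[OF hX uX])
  then have nv: "projective_norm V V v \<le> nrm ET u + e/2"
    using h(2) X.nrm_diff_commute[OF hX uX] v by (simp add: ET_simps A.nrm_completion_emb algebraic_tensor_simps)
  obtain n0 f0 g0 where "tensor_rep V V v n0 f0 g0" using v(2) by (auto simp: algebraic_tensor_simps)
  from projective_norm_approx[OF nvs_V nvs_V this e2] obtain n f g where rep: "tensor_rep V V v n f g"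
    and sm: "(\<Sum>i<n. nrm V (f i) * nrm V (g i)) < projective_norm V V v + e/2" by blast
  note D = tensor_repD[OF rep]
  define w where "w k = (\<lambda>b. \<Sum>i<k. symt (f i) (g i) b)" for k
  have wS: "w (Suc k) = w k \<oplus>\<^bsub>AT\<^esub> symt (f k) (g k)" and w0: "w 0 = \<zero>\<^bsub>AT\<^esub>" for k
    by (simp_all add: w_def algebraic_tensor_simps)
  \<comment> \<open>Symmetrising all terms replaces v by the mean of v and its flip, which is v
    itself.\<close>
  have wn: "w n = v"
  proof
    fix b show "w n b = v b"
    proof (cases "b \<in> bilinear_forms V V")
      case True
      have "w n b = (1/2) * (v b + v (\<lambda>x y. b y x))"
        using True flip_bilinear[OF True] by (simp add: w_def symt_def D(3) tensor_def sum_distrib_left distrib_left sum.distrib)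
      then show ?thesis using v(3)[OF True] by simp
    next
      case False
      then show ?thesis by (simp add: w_def symt_def D(3) tensor_def)
    qed
  qed
  show thesis
  proof (rule that[OF D(1,2)])
    show "(\<Sum>i<n. nrm V (f i) * nrm V (g i)) \<le> nrm ET u + e" using sm nv by simp
    fix \<psi> C assume \<psi>: "linear_op ET scalars \<psi>" and C: "C \<ge> 0" and bd: "\<And>x. x \<in> carrier ET \<Longrightarrow> norm (\<psi> x) \<le> C * nrm ET x"
    have "w k \<in> carrier AT \<and> emb (w k) \<in> carrier ET \<and> \<psi> (emb (w k)) = (\<Sum>i<k. \<psi> (sym_tensor (f i) (g i)))" if "k \<le> n" for k
      using that
    proof (induction k)
      case 0
      have "emb (w 0) = \<zero>\<^bsub>ET\<^esub>" by (simp add: w0 ET_simps A.zero_completion)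
      then show ?case using linear_op_zero[OF nvs_E normed_vector_space_scalars \<psi>] by (simp add: w0)
    next
      case (Suc k)
      then have IH: "w k \<in> carrier AT" "emb (w k) \<in> carrier ET" "\<psi> (emb (w k)) = (\<Sum>i<k. \<psi> (sym_tensor (f i) (g i)))" by auto
      have s: "symt (f k) (g k) \<in> carrier AT" "sym_tensor (f k) (g k) \<in> carrier ET"
        using D(1,2)[of k] Suc.prems by (auto intro: symt_carrier sym_tensor_carrier)
      have "emb (w (Suc k)) = emb (w k) \<oplus>\<^bsub>ET\<^esub> sym_tensor (f k) (g k)"
        using IH s by (simp add: wS ET_simps A.completion_emb_add sym_tensor_def)
      then show ?case using IH s linear_op_scalarsD(1)[OF \<psi> IH(2) s(2)] by (simp add: wS)
    qed
    from this[of n] have "\<psi> h = (\<Sum>i<n. \<psi> (sym_tensor (f i) (g i)))" by (simp add: wn v(1))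
    then have "\<psi> u - (\<Sum>i<n. \<psi> (sym_tensor (f i) (g i))) = \<psi> (u \<ominus>\<^bsub>ET\<^esub> h)"
      using linear_op_scalars_diff[OF nvs_E \<psi> u hE] by simp
    also have "norm \<dots> \<le> C * nrm ET (u \<ominus>\<^bsub>ET\<^esub> h)" using u hE by (intro bd) simp
    also have "\<dots> \<le> C * e" using h(2) e C by (intro mult_left_mono) (simp_all add: diff ET_simps)
    finally show "norm (\<psi> u - (\<Sum>i<n. \<psi> (sym_tensor (f i) (g i)))) \<le> C * e" .
  qed
qed

text \<open>T is the restriction to the symmetric part of the extension of T0 to the
  completion.\<close>

lemma operator_on_sym_tensor:
  assumes F: "banach_space F" and T: "linear_op AT F T0" and M: "\<And>x. x \<in> carrier AT \<Longrightarrow> nrm F (T0 x) \<le> M * projective_norm V V x"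
  obtains T where "operator ET F T" "\<And>x. x \<in> carrier ET \<Longrightarrow> nrm F (T x) \<le> M * nrm ET x"
    "\<And>f g. \<lbrakk>f \<in> carrier V; g \<in> carrier V\<rbrakk> \<Longrightarrow> T (sym_tensor f g) = T0 (symt f g)"
proof -
  obtain T where T': "linear_op (completion AT) F T" "\<And>A. A \<in> carrier (completion AT) \<Longrightarrow> nrm F (T A) \<le> M * nrm (completion AT) A"
    "\<And>x. x \<in> carrier AT \<Longrightarrow> T (emb x) = T0 x"
    using A.completion_extension[OF F T, of M] M by (auto simp: algebraic_tensor_simps(5))
  have "linear_op ET F T"
    using T'(1) carrier_ET_subset by (auto simp: linear_op_def ET_simps)
  moreover have bd: "nrm F (T x) \<le> M * nrm ET x" if "x \<in> carrier ET" for x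
    using T'(2)[OF carrier_ET_subset[OF that]] by (simp add: ET_simps)
  ultimately have "operator ET F T"
    using F by (intro operatorI[OF nvs_E]) (auto simp: banach_space_def)
  then show thesis using that bd T'(3) symt_carrier by (simp add: sym_tensor_def)
qed

end


section \<open>Scattered spaces\<close>

text \<open>C is a parameter because K alone does not fix the scalar field; the locale is
  interpreted once for the reals and once for the complex numbers.\<close>

locale C_sym_tensor = compact_Hausdorff K for K :: "'a topology" +
  fixes C :: "('k::{real_normed_field, euclidean_space}, 'a \<Rightarrow> 'k) normed_vs"
  assumes C_def: "C = C_space K"
begin

sublocale sym_tensor_space C
  unfolding C_def sym_tensor_space_def
  using normed_vector_space_C_space[OF compact_K] normed_vector_space_algebraic_tensor_C[OF compact_K] by blast

lemma functional_bounded_form: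
  assumes \<psi>: "linear_op ET scalars \<psi>" and M: "M \<ge> 0" and bd: "\<And>x. x \<in> carrier ET \<Longrightarrow> norm (\<psi> x) \<le> M * nrm ET x"
  shows "bounded_form K (\<lambda>f g. \<psi> (sym_tensor f g)) M"
proof unfold_locales
  note lin = linear_op_scalarsD[OF \<psi>]
  fix f g :: "'a \<Rightarrow> 'k" assume f: "f \<in> cont_funs K" and g: "g \<in> cont_funs K"
  then have fC: "f \<in> carrier C" and gC: "g \<in> carrier C" by (simp_all add: C_def)
  show sl: "\<psi> (sym_tensor (\<lambda>t. a * f t) g) = a * \<psi> (sym_tensor f g)" for a
    using sym_tensor_smult_left[OF fC gC, of a] lin(2)[OF sym_tensor_carrier[OF fC gC]] by (simp add: C_def)
  show "\<psi> (sym_tensor f (\<lambda>t. a * g t)) = a * \<psi> (sym_tensor f g)" for a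
    using sym_tensor_smult_left[OF gC fC, of a] lin(2)[OF sym_tensor_carrier[OF gC fC]] sym_tensor_commute by (simp add: C_def)
  show "norm (\<psi> (sym_tensor f g)) \<le> M * (sup_nrm K f * sup_nrm K g)"
  proof -
    have "norm (\<psi> (sym_tensor f g)) \<le> M * nrm ET (sym_tensor f g)" by (rule bd[OF sym_tensor_carrier[OF fC gC]])
    also have "\<dots> \<le> M * (nrm C f * nrm C g)" using nrm_sym_tensor[OF fC gC] M by (rule mult_left_mono)
    finally show ?thesis by (simp add: C_def)
  qed
  fix h :: "'a \<Rightarrow> 'k" assume h: "h \<in> cont_funs K"
  then have hC: "h \<in> carrier C" by (simp add: C_def)
  show "\<psi> (sym_tensor (\<lambda>t. f t + g t) h) = \<psi> (sym_tensor f h) + \<psi> (sym_tensor g h)"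
    using sym_tensor_add_left[OF fC gC hC] lin(1)[OF sym_tensor_carrier[OF fC hC] sym_tensor_carrier[OF gC hC]] by (simp add: C_def)
  show "\<psi> (sym_tensor f (\<lambda>t. g t + h t)) = \<psi> (sym_tensor f g) + \<psi> (sym_tensor f h)"
    using sym_tensor_add_left[OF gC hC fC] lin(1)[OF sym_tensor_carrier[OF gC fC] sym_tensor_carrier[OF hC fC]]
      sym_tensor_commute[of f] by (simp add: C_def)
qed (rule M)

text \<open>The functional is evaluation at (s, t) when elements of the tensor product are regarded
  as functions on K x K.\<close>

lemma point_functional:
  obtains \<epsilon> where "operator ET scalars \<epsilon>" "\<And>x. x \<in> carrier ET \<Longrightarrow> norm (\<epsilon> x) \<le> nrm ET x"
    "\<And>f g. \<lbrakk>f \<in> carrier C; g \<in> carrier C\<rbrakk> \<Longrightarrow> \<epsilon> (sym_tensor f g) = (1/2) * (f s * g t + g s * f t)"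
proof -
  define b where "b = (\<lambda>f g. f s * g t :: 'k)"
  have b: "b \<in> bilinear_forms C C" unfolding b_def C_def by (rule point_evaluation_bilinear)
  have lin: "linear_op AT scalars (\<lambda>u. u b)" by (simp add: linear_op_def algebraic_tensor_simps)
  have "norm (u b) \<le> 1 * projective_norm C C u" if u: "u \<in> carrier AT" for u
  proof (rule functional_le_projective_norm[OF nvs_V nvs_V u b])
    show "norm (b f g) \<le> 1 * (nrm C f * nrm C g)" if "f \<in> carrier C" "g \<in> carrier C" for f g
      using that norm_le_sup_nrm[OF compact_K, of f s] norm_le_sup_nrm[OF compact_K, of g t] sup_nrm_nonneg[OF compact_K, of f]
      by (simp add: b_def C_def norm_mult mult_mono)
  qed simp
  from operator_on_sym_tensor[OF banach_space_scalars lin, of 1] this obtain \<epsilon> where \<epsilon>: "operator ET scalars \<epsilon>"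
    "\<And>x. x \<in> carrier ET \<Longrightarrow> nrm scalars (\<epsilon> x) \<le> 1 * nrm ET x"
    "\<And>f g. \<lbrakk>f \<in> carrier C; g \<in> carrier C\<rbrakk> \<Longrightarrow> \<epsilon> (sym_tensor f g) = symt f g b"
    by (metis scalars_simps(7))
  show thesis
    by (rule that[OF \<epsilon>(1)]) (use \<epsilon>(2,3) b in \<open>auto simp: symt_def tensor_def b_def\<close>)
qed

lemma unit_funs_carrier: "f \<in> unit_funs K \<Longrightarrow> f \<in> carrier C"
  using unit_funsD(1)[of f K] by (simp add: C_def)

lemma nrm_sym_tensor_unit: "f \<in> unit_funs K \<Longrightarrow> g \<in> unit_funs K \<Longrightarrow> nrm ET (sym_tensor f g) \<le> 1"
  using nrm_sym_tensor[OF unit_funs_carrier unit_funs_carrier, of f g]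
    mult_mono[OF unit_funs_sup_nrm[of f K] unit_funs_sup_nrm[of g K]] sup_nrm_nonneg[OF compact_K, of g] unit_funsD(1)[of g K]
  by (simp add: C_def)

text \<open>Apply \<open>small_oscillation\<close> to the families T(x . x) and T(p . x): each
  single functional is concentrated because K is scattered, and cluster points come from weak
  compactness. A small norm difference in F is small under all functionals of the dual ball, whence
  the uniformity.\<close>

lemma weakly_compact_operator_form_family:
  fixes F :: "('k, 'w) normed_vs"
  assumes scat: "scattered_space K" and F: "normed_vector_space F"
    and T: "linear_op ET F T" "weakly_compact_op ET F T" and M: "M \<ge> 0" "\<And>x. x \<in> carrier ET \<Longrightarrow> nrm F (T x) \<le> M * nrm ET x"
  shows "form_family K (dual_ball F) (\<lambda>\<phi> f g. \<phi> (T (sym_tensor f g))) M"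
proof -
  interpret F: normed_vector_space F by (rule F)
  note TC = linear_opD(1)[OF T(1)]
  have form: "bounded_form K (\<lambda>f g. \<phi> (T (sym_tensor f g))) M" if \<phi>: "\<phi> \<in> dual_ball F" for \<phi>
  proof (rule functional_bounded_form[of "\<lambda>x. \<phi> (T x)", OF _ M(1)])
    show "linear_op ET scalars (\<lambda>x. \<phi> (T x))"
      using linear_opD[OF T(1)] dual_ballD[OF \<phi>] by (auto simp: linear_op_def)
    show "norm (\<phi> (T x)) \<le> M * nrm ET x" if "x \<in> carrier ET" for x
      using dual_ballD(3)[OF \<phi> TC[OF that]] M(2)[OF that] by simp
  qed
  have cluster: "\<exists>z\<in>carrier F. \<forall>\<phi>\<in>dual_ball F. \<forall>e>0. \<forall>N. \<exists>n\<ge>N. norm (\<phi> (T (x n)) - \<phi> z) < e"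
    if x: "\<And>n::nat. x n \<in> carrier ET" "\<And>n. nrm ET (x n) \<le> 1" for x
  proof -
    obtain z where z: "z \<in> carrier F" "\<And>\<phi> e N. \<lbrakk>operator F scalars \<phi>; 0 < e\<rbrakk> \<Longrightarrow> \<exists>n\<ge>N. norm (\<phi> (T (x n)) - \<phi> z) < e"
    proof (rule weakly_compact_op_cluster_point[where x = x, OF nvs_E F T x])
      fix z assume "z \<in> carrier F" "\<And>\<phi> e N. \<lbrakk>operator F scalars \<phi>; 0 < e\<rbrakk> \<Longrightarrow> \<exists>n\<ge>N. norm (\<phi> (T (x n)) - \<phi> z) < e"
      then show thesis by (rule that)
    qed
    show ?thesis using z(2)[OF dual_ball_operator[OF F]] by (intro bexI[OF _ z(1)]) simp
  qed
  have ne: "unit_funs K \<noteq> ({} :: ('a \<Rightarrow> 'k) set)" using zero_unit_funs by blast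
  interpret sq: weakly_compact_family F "unit_funs K" "\<lambda>x. T (sym_tensor x x)"
  proof (unfold_locales, rule ne)
    show "T (sym_tensor x x) \<in> carrier F" if "x \<in> unit_funs K" for x
      using that by (intro TC sym_tensor_carrier unit_funs_carrier)
    show "\<exists>z\<in>carrier F. \<forall>\<phi>\<in>dual_ball F. \<forall>e>0. \<forall>N. \<exists>n\<ge>N. norm (\<phi> (T (sym_tensor (s n) (s n))) - \<phi> z) < e"
      if "\<And>n. s n \<in> unit_funs K" for s :: "nat \<Rightarrow> _"
      using that by (intro cluster sym_tensor_carrier unit_funs_carrier nrm_sym_tensor_unit)
    fix \<phi> and e :: real assume \<phi>: "\<phi> \<in> dual_ball F" and e: "e > 0"
    interpret bounded_form K "\<lambda>f g. \<phi> (T (sym_tensor f g))" M by (rule form[OF \<phi>])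
    show "\<exists>A. finite A \<and> (\<forall>x\<in>unit_funs K. \<forall>x'\<in>unit_funs K. agree_on A x x' \<longrightarrow> norm (\<phi> (T (sym_tensor x x)) - \<phi> (T (sym_tensor x' x'))) \<le> e)"
      using concentrated_square[OF scat e] unfolding agree_on_def by metis
  qed
  show ?thesis
  proof (intro form_family.intro form_family_axioms.intro)
    show "compact_Hausdorff K" by unfold_locales
  next
    fix \<phi> assume \<phi>: "\<phi> \<in> dual_ball F"
    show "bounded_form K (\<lambda>f g. \<phi> (T (sym_tensor f g))) M" by (rule form[OF \<phi>])
    show "\<phi> (T (sym_tensor f g)) = \<phi> (T (sym_tensor g f))" for f g by (simp add: sym_tensor_commute)
  next
    show "0 \<le> M" by (rule M)
  next
    fix e :: real assume e: "e > 0"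
    obtain A u where Au: "finite A" "u \<in> unit_funs K"
      "\<And>x. x \<in> unit_funs K \<Longrightarrow> agree_on A x u \<Longrightarrow> nrm F (T (sym_tensor x x) \<ominus>\<^bsub>F\<^esub> T (sym_tensor u u)) \<le> e"
      using sq.small_oscillation[OF e] by blast
    have "norm (\<phi> (T (sym_tensor x x)) - \<phi> (T (sym_tensor u u))) \<le> e" if x: "x \<in> unit_funs K" "agree_on A x u" and \<phi>: "\<phi> \<in> dual_ball F" for x \<phi>
      using Au(3)[OF x] dual_ballD(3)[OF \<phi>, of "T (sym_tensor x x) \<ominus>\<^bsub>F\<^esub> T (sym_tensor u u)"] sq.yF[OF x(1)] sq.yF[OF Au(2)]
      by (simp add: dual_ball_diff[OF F \<phi>])
    then show "\<exists>A u. finite A \<and> u \<in> unit_funs K \<and> (\<forall>x\<in>unit_funs K. agree_on A x u \<longrightarrow>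
        (\<forall>\<phi>\<in>dual_ball F. norm (\<phi> (T (sym_tensor x x)) - \<phi> (T (sym_tensor u u))) \<le> e))"
      using Au(1,2) by blast
  next
    fix e :: real and p :: "'a \<Rightarrow> 'k" assume e: "e > 0" and p: "p \<in> unit_funs K"
    interpret lin: weakly_compact_family F "unit_funs K" "\<lambda>x. T (sym_tensor p x)"
    proof (unfold_locales, rule ne)
      show "T (sym_tensor p x) \<in> carrier F" if "x \<in> unit_funs K" for x
        using that p by (intro TC sym_tensor_carrier unit_funs_carrier)
      show "\<exists>z\<in>carrier F. \<forall>\<phi>\<in>dual_ball F. \<forall>e>0. \<forall>N. \<exists>n\<ge>N. norm (\<phi> (T (sym_tensor p (s n))) - \<phi> z) < e"
        if "\<And>n. s n \<in> unit_funs K" for s :: "nat \<Rightarrow> _"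
        using that p by (intro cluster sym_tensor_carrier unit_funs_carrier nrm_sym_tensor_unit)
      fix \<phi> and e :: real assume \<phi>: "\<phi> \<in> dual_ball F" and e: "e > 0"
      interpret bounded_form K "\<lambda>f g. \<phi> (T (sym_tensor f g))" M by (rule form[OF \<phi>])
      obtain A where "finite A" "\<And>f f' g. \<lbrakk>f \<in> unit_funs K; f' \<in> unit_funs K; g \<in> unit_funs K; \<And>a. a \<in> A \<Longrightarrow> f a = f' a\<rbrakk> \<Longrightarrow>
          norm (\<phi> (T (sym_tensor f g)) - \<phi> (T (sym_tensor f' g))) \<le> e"
        using concentrated_difference[OF scat e] by metis
      then show "\<exists>A. finite A \<and> (\<forall>x\<in>unit_funs K. \<forall>x'\<in>unit_funs K. agree_on A x x' \<longrightarrow> norm (\<phi> (T (sym_tensor p x)) - \<phi> (T (sym_tensor p x'))) \<le> e)"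
        using p sym_tensor_commute[of p] by (intro exI[of _ A]) (simp add: agree_on_def)
    qed
    obtain A u where Au: "finite A" "u \<in> unit_funs K"
      "\<And>x. x \<in> unit_funs K \<Longrightarrow> agree_on A x u \<Longrightarrow> nrm F (T (sym_tensor p x) \<ominus>\<^bsub>F\<^esub> T (sym_tensor p u)) \<le> e"
      using lin.small_oscillation[OF e] by blast
    have "norm (\<phi> (T (sym_tensor p x)) - \<phi> (T (sym_tensor p u))) \<le> e" if x: "x \<in> unit_funs K" "agree_on A x u" and \<phi>: "\<phi> \<in> dual_ball F" for x \<phi>
      using Au(3)[OF x] dual_ballD(3)[OF \<phi>, of "T (sym_tensor p x) \<ominus>\<^bsub>F\<^esub> T (sym_tensor p u)"] lin.yF[OF x(1)] lin.yF[OF Au(2)]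
      by (simp add: dual_ball_diff[OF F \<phi>])
    then show "\<exists>A u. finite A \<and> u \<in> unit_funs K \<and> (\<forall>x\<in>unit_funs K. agree_on A x u \<longrightarrow>
        (\<forall>\<phi>\<in>dual_ball F. norm (\<phi> (T (sym_tensor p x)) - \<phi> (T (sym_tensor p u))) \<le> e))"
      using Au(1,2) by blast
  qed
qed

text \<open>Up to a small multiple of the norm, a weakly compact operator depends on finitely many values
  of its argument only, when this is regarded as a function on \<open>K \<times> K\<close>.\<close>

lemma operator_finite_approximation:
  fixes F :: "('k, 'w) normed_vs"
  assumes scat: "scattered_space K" and F: "normed_vector_space F"
    and T: "operator ET F T" "weakly_compact_op ET F T" and e: "e > 0"
  obtains \<E> M where "finite \<E>" "\<And>\<epsilon>. \<epsilon> \<in> \<E> \<Longrightarrow> operator ET scalars \<epsilon>"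
    "\<And>x. x \<in> carrier ET \<Longrightarrow> nrm F (T x) \<le> e * nrm ET x + M * (\<Sum>\<epsilon>\<in>\<E>. norm (\<epsilon> x))"
proof -
  interpret F: normed_vector_space F by (rule F)
  have Tl: "linear_op ET F T" using T by (simp add: operator_def)
  note TC = linear_opD(1)[OF Tl]
  obtain M where M: "0 < M" "\<And>x. x \<in> carrier ET \<Longrightarrow> nrm F (T x) \<le> M * nrm ET x"
    using operator_bounded[OF nvs_E F T(1)] by blast
  define b where "b = (\<lambda>\<phi> f g. \<phi> (T (sym_tensor f g)) :: 'k)"
  interpret fam: form_family K "dual_ball F" b M
    unfolding b_def by (rule weakly_compact_operator_form_family[OF scat F Tl T(2)]) (use M in auto)
  obtain B q where B: "finite B" "\<And>a. a \<in> B \<Longrightarrow> q a \<in> unit_funs K"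
    and approx: "\<And>\<phi> f g. \<lbrakk>\<phi> \<in> dual_ball F; f \<in> cont_funs K; g \<in> cont_funs K\<rbrakk> \<Longrightarrow>
      norm (b \<phi> f g - (\<Sum>a\<in>B. \<Sum>a'\<in>B. f a * g a' * b \<phi> (q a) (q a'))) \<le> e * (sup_nrm K f * sup_nrm K g)"
    using fam.uniform_finite_approximation[OF e] by blast
  have "\<exists>\<epsilon>. operator ET scalars \<epsilon> \<and> (\<forall>x\<in>carrier ET. norm (\<epsilon> x) \<le> nrm ET x) \<and>
      (\<forall>f\<in>carrier C. \<forall>g\<in>carrier C. \<epsilon> (sym_tensor f g) = (1/2) * (f s * g t + g s * f t))" for s t
    using point_functional[of s t] by metis
  then obtain \<epsilon> where \<epsilon>: "\<And>s t. operator ET scalars (\<epsilon> s t)" "\<And>s t x. x \<in> carrier ET \<Longrightarrow> norm (\<epsilon> s t x) \<le> nrm ET x"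
    "\<And>s t f g. \<lbrakk>f \<in> carrier C; g \<in> carrier C\<rbrakk> \<Longrightarrow> \<epsilon> s t (sym_tensor f g) = (1/2) * (f s * g t + g s * f t)"
    by metis
  have bound: "nrm F (T x) \<le> e * nrm ET x + M * (\<Sum>a\<in>B. \<Sum>a'\<in>B. norm (\<epsilon> a a' x))" if x: "x \<in> carrier ET" for x
  proof (rule nrm_le_by_functionals[OF F TC[OF x]], rule field_le_epsilon)
    fix \<phi> and d :: real assume \<phi>: "\<phi> \<in> dual_ball F" and d: "d > 0"
    \<comment> \<open>L collects the factors of \<open>\<eta>\<close> in the three estimates below,
      so that the total error is d.\<close>
    define L where "L = M + e + M * (real (card B) * real (card B))"
    have L: "L > 0" using M e unfolding L_def by (intro add_pos_nonneg) auto
    define \<eta> where "\<eta> = d / L"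
    have \<eta>: "\<eta> > 0" using d L by (simp add: \<eta>_def)
    obtain n f g where fg: "\<And>i::nat. i < n \<Longrightarrow> f i \<in> carrier C" "\<And>i. i < n \<Longrightarrow> g i \<in> carrier C"
      and sm: "(\<Sum>i<n. nrm C (f i) * nrm C (g i)) \<le> nrm ET x + \<eta>"
      and ap: "\<And>\<psi> c. \<lbrakk>linear_op ET scalars \<psi>; c \<ge> 0; \<And>x. x \<in> carrier ET \<Longrightarrow> norm (\<psi> x) \<le> c * nrm ET x\<rbrakk> \<Longrightarrow>
        norm (\<psi> x - (\<Sum>i<n. \<psi> (sym_tensor (f i) (g i)))) \<le> c * \<eta>"
      using sym_tensor_approximation[OF x \<eta>] by blast
    define \<beta> where "\<beta> a a' = b \<phi> (q a) (q a')" for a a'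
    have \<beta>sym: "\<beta> a a' = \<beta> a' a" for a a' by (simp add: \<beta>_def b_def sym_tensor_commute)
    have \<beta>M: "norm (\<beta> a a') \<le> M" if "a \<in> B" "a' \<in> B" for a a'
    proof -
      have s: "sym_tensor (q a) (q a') \<in> carrier ET" using B(2) that by (intro sym_tensor_carrier unit_funs_carrier)
      have "norm (\<beta> a a') \<le> nrm F (T (sym_tensor (q a) (q a')))" unfolding \<beta>_def b_def by (rule dual_ballD(3)[OF \<phi> TC[OF s]])
      also have "\<dots> \<le> M * nrm ET (sym_tensor (q a) (q a'))" by (rule M(2)[OF s])
      also have "\<dots> \<le> M * 1" using nrm_sym_tensor_unit[OF B(2) B(2), OF that] M(1) by (intro mult_left_mono) auto
      finally show ?thesis by simp
    qed
    \<comment> \<open>phi(T x) is compared with X, its value on the approximating sum, and X with Y,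
      which results from interpolating both factors at B.\<close>
    define X where "X = (\<Sum>i<n. b \<phi> (f i) (g i))"
    define Y where "Y = (\<Sum>i<n. \<Sum>a\<in>B. \<Sum>a'\<in>B. f i a * g i a' * \<beta> a a')"
    have "linear_op ET scalars (\<lambda>x. \<phi> (T x))"
      using linear_opD[OF Tl] dual_ballD[OF \<phi>] by (auto simp: linear_op_def)
    then have 1: "norm (\<phi> (T x) - X) \<le> M * \<eta>"
      unfolding X_def b_def using M dual_ballD(3)[OF \<phi> TC] by (intro ap) (auto intro: order_trans)
    have "norm (X - Y) \<le> (\<Sum>i<n. e * (nrm C (f i) * nrm C (g i)))"
      unfolding X_def Y_def sum_subtractf[symmetric] \<beta>_def
    proof (rule sum_norm_le)
      fix i assume i: "i \<in> {..<n}"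
      have "f i \<in> cont_funs K" "g i \<in> cont_funs K" using fg i by (auto simp: C_def)
      from approx[OF \<phi> this] show "norm (b \<phi> (f i) (g i) - (\<Sum>a\<in>B. \<Sum>a'\<in>B. f i a * g i a' * b \<phi> (q a) (q a'))) \<le> e * (nrm C (f i) * nrm C (g i))"
        by (simp add: C_def)
    qed
    also have "\<dots> \<le> e * (nrm ET x + \<eta>)" using sm e by (simp flip: sum_distrib_left)
    finally have 2: "norm (X - Y) \<le> e * (nrm ET x + \<eta>)" .
    define E where "E a a' = (\<Sum>i<n. \<epsilon> a a' (sym_tensor (f i) (g i)))" for a a'
    have E: "norm (E a a') \<le> norm (\<epsilon> a a' x) + \<eta>" for a a'
    proof -
      have "norm (\<epsilon> a a' x - E a a') \<le> 1 * \<eta>" unfolding E_def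
        using \<epsilon>(1)[of a a'] \<epsilon>(2) by (intro ap) (auto simp: operator_def)
      then show ?thesis using norm_triangle_sub[of "E a a'" "\<epsilon> a a' x"] by (simp add: norm_minus_commute)
    qed
    \<comment> \<open>The functionals \<open>\<epsilon> a a'\<close> evaluate symmetrised tensors;
      as \<open>\<beta>\<close> is symmetric, the double sum is unaffected.\<close>
    have Ysym: "(\<Sum>a\<in>B. \<Sum>a'\<in>B. f i a * g i a' * \<beta> a a') = (\<Sum>a\<in>B. \<Sum>a'\<in>B. \<epsilon> a a' (sym_tensor (f i) (g i)) * \<beta> a a')" if i: "i < n" for i
    proof -
      have "(\<Sum>a\<in>B. \<Sum>a'\<in>B. g i a * f i a' * \<beta> a a') = (\<Sum>a'\<in>B. \<Sum>a\<in>B. g i a * f i a' * \<beta> a a')" by (rule sum.swap)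
      also have "\<dots> = (\<Sum>a\<in>B. \<Sum>a'\<in>B. f i a * g i a' * \<beta> a a')"
        by (intro sum.cong refl) (simp add: \<beta>sym mult_ac)
      finally have sw: "(\<Sum>a\<in>B. \<Sum>a'\<in>B. g i a * f i a' * \<beta> a a') = (\<Sum>a\<in>B. \<Sum>a'\<in>B. f i a * g i a' * \<beta> a a')" .
      have "(\<Sum>a\<in>B. \<Sum>a'\<in>B. \<epsilon> a a' (sym_tensor (f i) (g i)) * \<beta> a a') = (\<Sum>a\<in>B. \<Sum>a'\<in>B. (1/2) * (f i a * g i a' * \<beta> a a' + g i a * f i a' * \<beta> a a'))"
        by (intro sum.cong refl) (simp only: \<epsilon>(3)[OF fg(1)[OF i] fg(2)[OF i]], simp add: algebra_simps)
      also have "\<dots> = (1/2) * ((\<Sum>a\<in>B. \<Sum>a'\<in>B. f i a * g i a' * \<beta> a a') + (\<Sum>a\<in>B. \<Sum>a'\<in>B. g i a * f i a' * \<beta> a a'))"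
        by (simp only: sum_distrib_left sum.distrib distrib_left)
      finally show ?thesis unfolding sw by simp
    qed
    have "Y = (\<Sum>i<n. \<Sum>a\<in>B. \<Sum>a'\<in>B. \<epsilon> a a' (sym_tensor (f i) (g i)) * \<beta> a a')"
      unfolding Y_def by (rule sum.cong[OF refl]) (rule Ysym, simp)
    also have "\<dots> = (\<Sum>a\<in>B. \<Sum>i<n. \<Sum>a'\<in>B. \<epsilon> a a' (sym_tensor (f i) (g i)) * \<beta> a a')" by (rule sum.swap)
    also have "\<dots> = (\<Sum>a\<in>B. \<Sum>a'\<in>B. E a a' * \<beta> a a')"
      unfolding E_def sum_distrib_right by (intro sum.cong refl sum.swap)
    finally have "Y = (\<Sum>a\<in>B. \<Sum>a'\<in>B. E a a' * \<beta> a a')" .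
    also have "norm \<dots> \<le> (\<Sum>a\<in>B. \<Sum>a'\<in>B. M * (norm (\<epsilon> a a' x) + \<eta>))"
    proof (intro sum_norm_le)
      fix a a' assume a: "a \<in> B" "a' \<in> B"
      have "norm (E a a' * \<beta> a a') = norm (\<beta> a a') * norm (E a a')" by (simp add: norm_mult)
      also have "\<dots> \<le> M * (norm (\<epsilon> a a' x) + \<eta>)" using \<beta>M[OF a] E[of a a'] M by (intro mult_mono) auto
      finally show "norm (E a a' * \<beta> a a') \<le> M * (norm (\<epsilon> a a' x) + \<eta>)" .
    qed
    also have "\<dots> = M * (\<Sum>a\<in>B. \<Sum>a'\<in>B. norm (\<epsilon> a a' x)) + M * (real (card B) * real (card B)) * \<eta>"
      by (simp add: distrib_left sum.distrib sum_distrib_left)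
    finally have 3: "norm Y \<le> M * (\<Sum>a\<in>B. \<Sum>a'\<in>B. norm (\<epsilon> a a' x)) + M * (real (card B) * real (card B)) * \<eta>" .
    have "norm (\<phi> (T x)) \<le> norm (\<phi> (T x) - X) + norm (X - Y) + norm Y"
      using norm_triangle_ineq[of "\<phi> (T x) - X" X] norm_triangle_ineq[of "X - Y" Y] by simp
    also have "\<dots> \<le> M * \<eta> + e * (nrm ET x + \<eta>) + (M * (\<Sum>a\<in>B. \<Sum>a'\<in>B. norm (\<epsilon> a a' x)) + M * (real (card B) * real (card B)) * \<eta>)"
      using 1 2 3 by (intro add_mono)
    also have "\<dots> = e * nrm ET x + M * (\<Sum>a\<in>B. \<Sum>a'\<in>B. norm (\<epsilon> a a' x)) + L * \<eta>" by (simp add: L_def algebra_simps)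
    also have "L * \<eta> = d" using L by (simp add: \<eta>_def)
    finally show "norm (\<phi> (T x)) \<le> e * nrm ET x + M * (\<Sum>a\<in>B. \<Sum>a'\<in>B. norm (\<epsilon> a a' x)) + d" .
  qed
  define \<E> where "\<E> = (\<lambda>(a, a'). \<epsilon> a a') ` (B \<times> B)"
  show thesis
  proof (rule that[of \<E> "M * (real (card B) * real (card B))"])
    show fin: "finite \<E>" using B by (simp add: \<E>_def)
    show "operator ET scalars \<delta>" if "\<delta> \<in> \<E>" for \<delta> using that \<epsilon>(1) by (auto simp: \<E>_def)
    fix x assume x: "x \<in> carrier ET"
    \<comment> \<open>Different pairs may give the same functional, so each of the card B squared
      terms is bounded by the whole sum over the set \<open>\<E>\<close>.\<close>
    have "(\<Sum>a\<in>B. \<Sum>a'\<in>B. norm (\<epsilon> a a' x)) \<le> (\<Sum>a\<in>B. \<Sum>a'\<in>B. \<Sum>\<delta>\<in>\<E>. norm (\<delta> x))"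
    proof (intro sum_mono)
      fix a a' assume "a \<in> B" "a' \<in> B"
      then have "\<epsilon> a a' \<in> \<E>" unfolding \<E>_def by force
      then show "norm (\<epsilon> a a' x) \<le> (\<Sum>\<delta>\<in>\<E>. norm (\<delta> x))" using fin by (intro member_le_sum) auto
    qed
    then have "M * (\<Sum>a\<in>B. \<Sum>a'\<in>B. norm (\<epsilon> a a' x)) \<le> M * (real (card B) * real (card B)) * (\<Sum>\<delta>\<in>\<E>. norm (\<delta> x))"
      using M(1) by (simp add: mult.assoc)
    then show "nrm F (T x) \<le> e * nrm ET x + M * (real (card B) * real (card B)) * (\<Sum>\<epsilon>\<in>\<E>. norm (\<epsilon> x))"
      using bound[OF x] by simp
  qed
qed

text \<open>A weakly null sequence z is bounded, which makes the first term of the finite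
  approximation uniformly small, and the finitely many functionals in its second term tend to 0
  along z.\<close>

lemma scattered_imp_completely_continuous:
  fixes F :: "('k, 'w) normed_vs"
  assumes scat: "scattered_space K" and F: "normed_vector_space F"
    and T: "operator ET F T" "weakly_compact_op ET F T"
  shows "completely_continuous_op ET F T"
  unfolding completely_continuous_op_def
proof (intro allI impI, elim conjE)
  fix s l assume lim: "limitin (weak_topology ET) s l sequentially" and s: "range s \<subseteq> carrier ET"
  interpret F: normed_vector_space F by (rule F)
  have Tl: "linear_op ET F T" using T by (simp add: operator_def)
  note TC = linear_opD(1)[OF Tl]
  have sE: "s n \<in> carrier ET" for n using s by auto
  have lE: "l \<in> carrier ET" using limitin_topspace[OF lim] by (simp add: topspace_weak_topology[OF nvs_E])
  define z where "z n = s n \<ominus>\<^bsub>ET\<^esub> l" for n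
  have zE: "z n \<in> carrier ET" for n using sE lE by (simp add: z_def)
  have z0: "(\<lambda>n. \<phi> (z n)) \<longlonglongrightarrow> 0" if \<phi>: "operator ET scalars \<phi>" for \<phi>
  proof -
    have "\<phi> (z n) = \<phi> (s n) - \<phi> l" for n
      unfolding z_def using \<phi> sE lE by (intro linear_op_scalars_diff[OF nvs_E]) (auto simp: operator_def)
    moreover have "(\<lambda>n. \<phi> (s n) - \<phi> l) \<longlonglongrightarrow> \<phi> l - \<phi> l"
      by (intro tendsto_diff limitin_weak_topologyD[OF nvs_E lim \<phi>] tendsto_const)
    ultimately show ?thesis by simp
  qed
  have "\<exists>M. \<forall>n. norm (\<phi> (z n)) \<le> M" if "operator ET scalars \<phi>" for \<phi>
    using convergent_imp_Bseq[OF convergentI[OF z0[OF that]]] by (auto simp: Bseq_def)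
  from weakly_bounded_imp_bounded[where z = z, OF nvs_E zE this] obtain R where R: "\<And>n. nrm ET (z n) \<le> R" by blast
  have R0: "0 \<le> R" using R[of 0] E.nrm_nonneg[OF zE[of 0]] by simp
  have "(\<lambda>n. nrm F (T (z n))) \<longlonglongrightarrow> 0"
  proof (rule metric_LIMSEQ_I)
    fix r :: real assume r: "r > 0"
    \<comment> \<open>Chosen to give e R <= r/2; the added 1 keeps the denominator positive for R =
      0.\<close>
    define e where "e = r / (2 * (R + 1))"
    have e: "e > 0" using r R0 by (simp add: e_def)
    obtain \<E> M where \<E>: "finite \<E>" "\<And>\<epsilon>. \<epsilon> \<in> \<E> \<Longrightarrow> operator ET scalars \<epsilon>"
      and ap: "\<And>x. x \<in> carrier ET \<Longrightarrow> nrm F (T x) \<le> e * nrm ET x + M * (\<Sum>\<epsilon>\<in>\<E>. norm (\<epsilon> x))"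
      using operator_finite_approximation[OF scat F T e] by blast
    have "(\<lambda>n. M * (\<Sum>\<epsilon>\<in>\<E>. norm (\<epsilon> (z n)))) \<longlonglongrightarrow> M * (\<Sum>\<epsilon>\<in>\<E>. 0)"
      using z0[OF \<E>(2)] by (intro tendsto_intros tendsto_norm_zero) auto
    then have "\<forall>\<^sub>F n in sequentially. M * (\<Sum>\<epsilon>\<in>\<E>. norm (\<epsilon> (z n))) < r/2"
      using r by (intro order_tendstoD(2)) auto
    then obtain N where N: "\<And>n. n \<ge> N \<Longrightarrow> M * (\<Sum>\<epsilon>\<in>\<E>. norm (\<epsilon> (z n))) < r/2"
      by (auto simp: eventually_sequentially)
    have "dist (nrm F (T (z n))) 0 < r" if n: "n \<ge> N" for n
    proof -
      have "e * nrm ET (z n) \<le> e * R" using R e by (intro mult_left_mono) auto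
      also have "\<dots> \<le> r/2" using r R0 by (simp add: e_def field_simps)
      finally show ?thesis using ap[OF zE, of n] N[OF n] F.nrm_nonneg[OF TC[OF zE], of n] by (simp add: dist_real_def)
    qed
    then show "\<exists>N. \<forall>n\<ge>N. dist (nrm F (T (z n))) 0 < r" by blast
  qed
  moreover have "T (z n) = T (s n) \<ominus>\<^bsub>F\<^esub> T l" for n
    unfolding z_def by (rule linear_op_diff[OF nvs_E F Tl sE lE])
  ultimately have "limitin (norm_topology F) (\<lambda>n. T (s n)) (T l) sequentially"
    using F.limitin_iff[of "\<lambda>n. T (s n)" "T l"] TC sE lE by simp
  then show "\<exists>m. limitin (norm_topology F) (\<lambda>n. T (s n)) m sequentially" by blast
qed

theorem scattered_imp_dunford_pettis:
  assumes "scattered_space K"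
  shows "dunford_pettis TYPE('u) ET"
  using scattered_imp_completely_continuous[OF assms] by (auto simp: dunford_pettis_def banach_space_def)

end


section \<open>Square-summable sequences\<close>

definition l2_seqs :: "(nat \<Rightarrow> 'k::real_normed_field) set" where
  "l2_seqs = {a. summable (\<lambda>n. (norm (a n))\<^sup>2)}"

definition l2_nrm :: "(nat \<Rightarrow> 'k::real_normed_field) \<Rightarrow> real" where
  "l2_nrm a = sqrt (\<Sum>n. (norm (a n))\<^sup>2)"

abbreviation part_nrm :: "(nat \<Rightarrow> 'k::real_normed_field) \<Rightarrow> nat \<Rightarrow> real" where
  "part_nrm a N \<equiv> L2_set (\<lambda>n. norm (a n)) {..<N}"

text \<open>Replaces membership together with a norm bound by conditions on finitely many
  coordinates each. These survive coordinatewise limits, which serves completeness and compactness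
  alike.\<close>

lemma l2_nrm_le_iff:
  assumes "0 \<le> R"
  shows "a \<in> l2_seqs \<and> l2_nrm a \<le> R \<longleftrightarrow> (\<forall>N. part_nrm a N \<le> R)"
proof
  assume a: "a \<in> l2_seqs \<and> l2_nrm a \<le> R"
  show "\<forall>N. part_nrm a N \<le> R"
  proof
    fix N
    have "(\<Sum>n<N. (norm (a n))\<^sup>2) \<le> (\<Sum>n. (norm (a n))\<^sup>2)"
      using a by (intro sum_le_suminf) (auto simp: l2_seqs_def)
    then have "part_nrm a N \<le> l2_nrm a" by (simp add: L2_set_def l2_nrm_def)
    then show "part_nrm a N \<le> R" using a by simp
  qed
next
  assume p: "\<forall>N. part_nrm a N \<le> R"
  have le: "(\<Sum>n<N. (norm (a n))\<^sup>2) \<le> R\<^sup>2" for N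
  proof -
    have "(part_nrm a N)\<^sup>2 \<le> R\<^sup>2" using p by (intro power_mono) auto
    then show ?thesis by (simp add: L2_set_def sum_nonneg)
  qed
  have s: "summable (\<lambda>n. (norm (a n))\<^sup>2)"
    by (rule bounded_imp_summable[OF _ le[of "Suc _", unfolded lessThan_Suc_atMost]]) simp
  moreover have "(\<Sum>n. (norm (a n))\<^sup>2) \<le> R\<^sup>2" by (rule suminf_le_const[OF s le])
  then have "l2_nrm a \<le> R" using assms by (simp add: l2_nrm_def real_le_lsqrt)
  ultimately show "a \<in> l2_seqs \<and> l2_nrm a \<le> R" by (simp add: l2_seqs_def)
qed

lemma l2_nrm_nonneg: "a \<in> l2_seqs \<Longrightarrow> 0 \<le> l2_nrm a"
  by (simp add: l2_nrm_def l2_seqs_def suminf_nonneg)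

lemma part_nrm_le: "a \<in> l2_seqs \<Longrightarrow> part_nrm a N \<le> l2_nrm a"
  using l2_nrm_le_iff[OF l2_nrm_nonneg, of a a] by blast

lemma norm_le_part_nrm: "n < N \<Longrightarrow> norm (a n) \<le> part_nrm a N"
  by (rule member_le_L2_set) auto

lemma norm_le_l2_nrm: "a \<in> l2_seqs \<Longrightarrow> norm (a n) \<le> l2_nrm a"
  using norm_le_part_nrm[of n "Suc n" a] part_nrm_le[of a "Suc n"] by simp

lemma part_nrm_add: "part_nrm (\<lambda>n. a n + b n) N \<le> part_nrm a N + part_nrm b N"
  by (rule order_trans[OF _ L2_set_triangle_ineq]) (auto intro!: L2_set_mono norm_triangle_ineq)

lemma l2_add:
  assumes "a \<in> l2_seqs" "b \<in> l2_seqs"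
  shows "(\<lambda>n. a n + b n) \<in> l2_seqs" "l2_nrm (\<lambda>n. a n + b n) \<le> l2_nrm a + l2_nrm b"
proof -
  have "\<forall>N. part_nrm (\<lambda>n. a n + b n) N \<le> l2_nrm a + l2_nrm b"
    using order_trans[OF part_nrm_add add_mono[OF part_nrm_le[OF assms(1)] part_nrm_le[OF assms(2)]]] by blast
  then show "(\<lambda>n. a n + b n) \<in> l2_seqs" "l2_nrm (\<lambda>n. a n + b n) \<le> l2_nrm a + l2_nrm b"
    using l2_nrm_le_iff[of "l2_nrm a + l2_nrm b" "\<lambda>n. a n + b n"] l2_nrm_nonneg[OF assms(1)] l2_nrm_nonneg[OF assms(2)] by auto
qed

lemma l2_cmult:
  assumes a: "a \<in> l2_seqs"
  shows "(\<lambda>n. c * a n) \<in> l2_seqs" "l2_nrm (\<lambda>n. c * a n) = norm c * l2_nrm a"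
proof -
  have s: "summable (\<lambda>n. (norm (a n))\<^sup>2)" using a by (simp add: l2_seqs_def)
  show "(\<lambda>n. c * a n) \<in> l2_seqs" using summable_mult[OF s, of "(norm c)\<^sup>2"] by (simp add: l2_seqs_def norm_mult power_mult_distrib)
  have "(\<Sum>n. (norm (c * a n))\<^sup>2) = (norm c)\<^sup>2 * (\<Sum>n. (norm (a n))\<^sup>2)"
    using suminf_mult[OF s, of "(norm c)\<^sup>2"] by (simp add: norm_mult power_mult_distrib)
  then show "l2_nrm (\<lambda>n. c * a n) = norm c * l2_nrm a" by (simp add: l2_nrm_def real_sqrt_mult)
qed

lemma l2_zero [simp]: "(\<lambda>n. 0) \<in> l2_seqs" by (simp add: l2_seqs_def)

lemma l2_diff: "a \<in> l2_seqs \<Longrightarrow> b \<in> l2_seqs \<Longrightarrow> (\<lambda>n. a n - b n) \<in> l2_seqs"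
  using l2_add(1)[OF _ l2_cmult(1)[of b "-1"], of a] by simp

text \<open>The definition of the Dunford-Pettis Property only involves Banach spaces on the type \<open>(nat \<Rightarrow> 'e) + 'u\<close>,
  so the sequence space has to be copied to a type into which \<open>nat \<Rightarrow> 'k\<close> can be injected.\<close>

definition l2_copy :: "((nat \<Rightarrow> 'k) \<Rightarrow> 'w) \<Rightarrow> ('k::real_normed_field, 'w) normed_vs" where
  "l2_copy j = \<lparr>carrier = j ` l2_seqs, monoid.mult = undefined, one = undefined, zero = j (\<lambda>n. 0),
     add = (\<lambda>x y. j (\<lambda>n. inv_into UNIV j x n + inv_into UNIV j y n)), module.smult = (\<lambda>a x. j (\<lambda>n. a * inv_into UNIV j x n)),
     nrm = (\<lambda>x. l2_nrm (inv_into UNIV j x))\<rparr>"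

section \<open>The sequence space as a Banach space with weakly compact balls\<close>

locale l2_injection =
  fixes j :: "(nat \<Rightarrow> 'k::{real_normed_field, euclidean_space}) \<Rightarrow> 'w"
  assumes inj: "inj j"
begin

abbreviation "L \<equiv> l2_copy j"

lemma inv_j [simp]: "inv_into UNIV j (j a) = a" using inj by simp

lemma L_simps [simp]:
  "carrier L = j ` l2_seqs" "\<zero>\<^bsub>L\<^esub> = j (\<lambda>n. 0)" "j a \<oplus>\<^bsub>L\<^esub> j b = j (\<lambda>n. a n + b n)"
  "c \<odot>\<^bsub>L\<^esub> j a = j (\<lambda>n. c * a n)" "nrm L (j a) = l2_nrm a"
  by (simp_all add: l2_copy_def)

lemma nvs_L: "normed_vector_space L"
proof (rule normed_vector_spaceI)
  fix x assume "x \<in> carrier L" "nrm L x = 0"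
  then obtain a where a: "x = j a" "a \<in> l2_seqs" "l2_nrm a = 0" by auto
  have "a n = 0" for n using norm_le_l2_nrm[OF a(2), of n] a(3) by simp
  then have "a = (\<lambda>n. 0)" by auto
  then show "x = \<zero>\<^bsub>L\<^esub>" by (simp add: a(1))
qed (auto simp: l2_add l2_cmult l2_nrm_nonneg algebra_simps)

sublocale L: normed_vector_space "l2_copy j" by (rule nvs_L)

lemma L_diff [simp]: "a \<in> l2_seqs \<Longrightarrow> b \<in> l2_seqs \<Longrightarrow> j a \<ominus>\<^bsub>L\<^esub> j b = j (\<lambda>n. a n - b n)"
  by (simp add: L.diff_conv)

lemma banach_L: "banach_space L"
  unfolding banach_space_def L.ms.mcomplete_def
proof (intro conjI allI impI)
  show "normed_vector_space L" by (rule nvs_L)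
  fix s assume s: "L.ms.MCauchy s"
  have "s n \<in> carrier L" for n using s unfolding L.Cauchy_in_iff by blast
  then have "\<forall>n. \<exists>a. a \<in> l2_seqs \<and> s n = j a" by auto
  then obtain a where a: "\<And>n. a n \<in> l2_seqs" "\<And>n. s n = j (a n)" by metis
  have C: "\<exists>N. \<forall>m\<ge>N. \<forall>n\<ge>N. l2_nrm (\<lambda>k. a m k - a n k) < e" if "e > 0" for e
  proof -
    have "\<exists>N. \<forall>m\<ge>N. \<forall>n\<ge>N. nrm L (s m \<ominus>\<^bsub>L\<^esub> s n) < e" using s that unfolding L.Cauchy_in_iff by blast
    then show ?thesis using a by simp
  qed
  have "Cauchy (\<lambda>n. a n k)" for k
  proof (rule metric_CauchyI)
    fix e :: real assume "e > 0"
    then obtain N where N: "\<And>m n. m \<ge> N \<Longrightarrow> n \<ge> N \<Longrightarrow> l2_nrm (\<lambda>k. a m k - a n k) < e" using C by blast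
    have "dist (a m k) (a n k) < e" if "m \<ge> N" "n \<ge> N" for m n
      using N[OF that] norm_le_l2_nrm[OF l2_diff[OF a(1)[of m] a(1)[of n]], of k] by (simp add: dist_norm)
    then show "\<exists>N. \<forall>m\<ge>N. \<forall>n\<ge>N. dist (a m k) (a n k) < e" by blast
  qed
  then have "\<exists>l. (\<lambda>n. a n k) \<longlonglongrightarrow> l" for k by (simp add: Cauchy_convergent_iff convergent_def)
  then obtain l where l: "\<And>k. (\<lambda>n. a n k) \<longlonglongrightarrow> l k" by metis
  \<comment> \<open>The Cauchy estimate bounds every partial norm, and partial norms pass to the
    coordinatewise limit.\<close>
  have near: "\<exists>N. \<forall>m\<ge>N. \<forall>M. part_nrm (\<lambda>k. a m k - l k) M \<le> e" if e: "e > 0" for e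
  proof -
    obtain N where N: "\<And>m n. m \<ge> N \<Longrightarrow> n \<ge> N \<Longrightarrow> l2_nrm (\<lambda>k. a m k - a n k) < e" using C[OF e] by blast
    have "part_nrm (\<lambda>k. a m k - l k) M \<le> e" if m: "m \<ge> N" for m M
    proof (rule LIMSEQ_le_const2)
      show "(\<lambda>n. part_nrm (\<lambda>k. a m k - a n k) M) \<longlonglongrightarrow> part_nrm (\<lambda>k. a m k - l k) M"
        unfolding L2_set_def using l by (intro tendsto_intros)
      have "part_nrm (\<lambda>k. a m k - a n k) M \<le> e" if "n \<ge> N" for n
        using part_nrm_le[OF l2_diff[OF a(1)[of m] a(1)[of n]], of M] N[OF m that] by simp
      then show "\<exists>N. \<forall>n\<ge>N. part_nrm (\<lambda>k. a m k - a n k) M \<le> e" by blast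
    qed
    then show ?thesis by blast
  qed
  have dl: "(\<lambda>k. a m k - l k) \<in> l2_seqs \<and> l2_nrm (\<lambda>k. a m k - l k) \<le> e"
    if "\<forall>M. part_nrm (\<lambda>k. a m k - l k) M \<le> e" "e > 0" for m e
    using that l2_nrm_le_iff[of e "\<lambda>k. a m k - l k"] by simp
  obtain N1 where "\<forall>m\<ge>N1. \<forall>M. part_nrm (\<lambda>k. a m k - l k) M \<le> 1" using near[of 1] by auto
  then have "(\<lambda>k. a N1 k - l k) \<in> l2_seqs" using dl[of N1 1] by simp
  from l2_diff[OF a(1)[of N1] this] have lL: "l \<in> l2_seqs" by simp
  have "(\<lambda>n. l2_nrm (\<lambda>k. a n k - l k)) \<longlonglongrightarrow> 0"
  proof (rule metric_LIMSEQ_I)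
    fix e :: real assume "e > 0"
    then have e: "e/2 > 0" by simp
    obtain N where "\<forall>m\<ge>N. \<forall>M. part_nrm (\<lambda>k. a m k - l k) M \<le> e/2" using near[OF e] by blast
    then have "dist (l2_nrm (\<lambda>k. a n k - l k)) 0 < e" if "n \<ge> N" for n
      using dl[of n "e/2"] e that l2_nrm_nonneg[OF l2_diff[OF a(1) lL], of n] by (fastforce simp: dist_real_def)
    then show "\<exists>N. \<forall>n\<ge>N. dist (l2_nrm (\<lambda>k. a n k - l k)) 0 < e" by blast
  qed
  then have "limitin L.ms.mtopology s (j l) sequentially"
    using L.limitin_iff[of s "j l"] a lL by simp
  then show "\<exists>x. limitin L.ms.mtopology s x sequentially" by blast
qed

text \<open>Riesz representation on the sequence space: c consists of the values of
  \<open>\<phi>\<close> at the unit vectors, and truncations of a converge to a in norm.\<close>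

lemma functional_coefficients:
  assumes \<phi>: "linear_op L scalars \<phi>" and M: "M \<ge> 0" "\<And>x. x \<in> carrier L \<Longrightarrow> norm (\<phi> x) \<le> M * nrm L x"
  obtains c where "\<And>N. part_nrm c N \<le> M" "\<And>a. a \<in> l2_seqs \<Longrightarrow> (\<lambda>N. \<Sum>n<N. a n * c n) \<longlonglongrightarrow> \<phi> (j a)"
proof -
  define \<delta> where "\<delta> m = (\<lambda>n. if n = m then 1 else 0 :: 'k)" for m :: nat
  have fin: "a \<in> l2_seqs" if "\<And>n. n \<ge> N \<Longrightarrow> a n = 0" for a :: "nat \<Rightarrow> 'k" and N
    unfolding l2_seqs_def by (rule CollectI, rule summable_finite[of "{..<N}"]) (use that in \<open>auto simp: not_less\<close>)
  define c where "c m = \<phi> (j (\<delta> m))" for m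
  define trunc where "trunc a N = (\<lambda>n. if n < N then a n else 0 :: 'k)" for a and N :: nat
  have tr: "trunc a N \<in> l2_seqs" for a N by (rule fin[of N]) (simp add: trunc_def)
  have \<delta>: "\<delta> m \<in> l2_seqs" for m by (rule fin[of "Suc m"]) (simp add: \<delta>_def)
  have \<phi>tr: "\<phi> (j (trunc a N)) = (\<Sum>n<N. a n * c n)" for a N
  proof (induction N)
    case 0
    have "\<phi> \<zero>\<^bsub>L\<^esub> = 0" using linear_op_zero[OF nvs_L normed_vector_space_scalars \<phi>] by simp
    then show ?case by (simp add: trunc_def)
  next
    case (Suc N)
    have "j (trunc a (Suc N)) = j (trunc a N) \<oplus>\<^bsub>L\<^esub> a N \<odot>\<^bsub>L\<^esub> j (\<delta> N)"
      by (auto simp: trunc_def \<delta>_def fun_eq_iff less_Suc_eq intro!: arg_cong[where f = j])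
    moreover have "j (trunc a N) \<in> carrier L" "j (\<delta> N) \<in> carrier L" using tr \<delta> by auto
    ultimately show ?case using linear_op_scalarsD[OF \<phi>] Suc L.smult_carrier by (simp add: c_def del: L_simps)
  qed
  have "part_nrm c N \<le> M" for N
  proof -
    \<comment> \<open>This is the complex conjugate of c, written so as to make sense in any normed
      field. Testing \<open>\<phi>\<close> on its truncation gives s^2 <= M s for s =
      \<open>part_nrm c N\<close>.\<close>
    define a where "a n = (if c n = 0 then 0 else of_real ((norm (c n))\<^sup>2) / c n)" for n
    have ac: "a n * c n = of_real ((norm (c n))\<^sup>2)" "norm (a n) = norm (c n)" for n
      by (auto simp: a_def norm_divide norm_mult power2_eq_square)
    have n1: "l2_nrm (trunc a N) = part_nrm c N"
    proof -
      have "(\<Sum>n. (norm (trunc a N n))\<^sup>2) = (\<Sum>n<N. (norm (trunc a N n))\<^sup>2)"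
        by (rule suminf_finite) (auto simp: trunc_def)
      then show ?thesis by (simp add: l2_nrm_def L2_set_def trunc_def ac)
    qed
    have e: "\<phi> (j (trunc a N)) = of_real (\<Sum>n<N. (norm (c n))\<^sup>2)" unfolding \<phi>tr by (simp add: ac)
    have "(\<Sum>n<N. (norm (c n))\<^sup>2) = norm (\<phi> (j (trunc a N)))"
      unfolding e norm_of_real by (simp add: sum_nonneg)
    also have "\<dots> \<le> M * part_nrm c N" using M(2)[of "j (trunc a N)"] tr n1 by simp
    finally have "(part_nrm c N)\<^sup>2 \<le> M * part_nrm c N" by (simp add: L2_set_def sum_nonneg)
    then show ?thesis
      using M(1) L2_set_nonneg[of "\<lambda>n. norm (c n)" "{..<N}"] by (cases "part_nrm c N = 0") (auto simp: power2_eq_square)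
  qed
  moreover have "(\<lambda>N. \<Sum>n<N. a n * c n) \<longlonglongrightarrow> \<phi> (j a)" if a: "a \<in> l2_seqs" for a
  proof -
    have s: "summable (\<lambda>n. (norm (a n))\<^sup>2)" using a by (simp add: l2_seqs_def)
    have tail: "l2_nrm (\<lambda>n. a n - trunc a N n) = sqrt ((\<Sum>n. (norm (a n))\<^sup>2) - (\<Sum>n<N. (norm (a n))\<^sup>2))" for N
    proof -
      have e: "(\<lambda>n. (norm (a n - trunc a N n))\<^sup>2) = (\<lambda>n. (norm (a n))\<^sup>2 - (norm (trunc a N n))\<^sup>2)"
        by (auto simp: trunc_def)
      have "summable (\<lambda>n. (norm (trunc a N n))\<^sup>2)" using tr by (simp add: l2_seqs_def)
      then have "(\<Sum>n. (norm (a n - trunc a N n))\<^sup>2) = (\<Sum>n. (norm (a n))\<^sup>2) - (\<Sum>n. (norm (trunc a N n))\<^sup>2)"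
        unfolding e by (rule suminf_diff[OF s, symmetric])
      also have "(\<Sum>n. (norm (trunc a N n))\<^sup>2) = (\<Sum>n<N. (norm (trunc a N n))\<^sup>2)"
        by (rule suminf_finite) (auto simp: trunc_def)
      finally show ?thesis by (simp add: l2_nrm_def trunc_def)
    qed
    have "(\<lambda>N. sqrt ((\<Sum>n. (norm (a n))\<^sup>2) - (\<Sum>n<N. (norm (a n))\<^sup>2))) \<longlonglongrightarrow> sqrt ((\<Sum>n. (norm (a n))\<^sup>2) - (\<Sum>n. (norm (a n))\<^sup>2))"
      by (intro tendsto_intros summable_LIMSEQ s)
    then have t0: "(\<lambda>N. M * l2_nrm (\<lambda>n. a n - trunc a N n)) \<longlonglongrightarrow> M * 0"
      by (intro tendsto_mult_left) (simp add: tail)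
    have "(\<lambda>N. \<phi> (j a) - (\<Sum>n<N. a n * c n)) \<longlonglongrightarrow> 0"
    proof (rule Lim_null_comparison)
      have "norm (\<phi> (j a) - (\<Sum>n<N. a n * c n)) \<le> M * l2_nrm (\<lambda>n. a n - trunc a N n)" for N
        using linear_op_scalars_diff[OF nvs_L \<phi>, of "j a" "j (trunc a N)"] M(2)[of "j (\<lambda>n. a n - trunc a N n)"] a tr[of a N] l2_diff[OF a tr[of a N]]
        by (simp add: \<phi>tr)
      then show "\<forall>\<^sub>F N in sequentially. norm (\<phi> (j a) - (\<Sum>n<N. a n * c n)) \<le> M * l2_nrm (\<lambda>n. a n - trunc a N n)" by simp
    qed (use t0 in simp)
    then have "(\<lambda>N. \<phi> (j a) - (\<phi> (j a) - (\<Sum>n<N. a n * c n))) \<longlonglongrightarrow> \<phi> (j a) - 0" by (intro tendsto_diff tendsto_const)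
    then show ?thesis by simp
  qed
  ultimately show thesis by (rule that)
qed

text \<open>On a bounded set the series for \<open>\<phi>\<close> converges uniformly, by
  Cauchy-Schwarz and the smallness of the tails of c; its partial sums depend continuously on
  finitely many coordinates.\<close>

lemma functional_continuous_pointwise:
  assumes \<phi>: "operator L scalars \<phi>"
  shows "continuous_on {a. \<forall>N. part_nrm a N \<le> R} (\<lambda>a. \<phi> (j a))"
proof -
  define D where "D = {a :: nat \<Rightarrow> 'k. \<forall>N. part_nrm a N \<le> R}"
  obtain M where M: "0 < M" "\<And>x. x \<in> carrier L \<Longrightarrow> norm (\<phi> x) \<le> M * nrm L x"
    using operator_bounded[OF nvs_L normed_vector_space_scalars \<phi>] by auto
  obtain c where c: "\<And>N. part_nrm c N \<le> M" "\<And>a. a \<in> l2_seqs \<Longrightarrow> (\<lambda>N. \<Sum>n<N. a n * c n) \<longlonglongrightarrow> \<phi> (j a)"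
    using functional_coefficients[of \<phi> M] \<phi> M by (auto simp: operator_def)
  have cs: "summable (\<lambda>n. (norm (c n))\<^sup>2)" using l2_nrm_le_iff[of M c] c(1) M(1) by (simp add: l2_seqs_def)
  have aL: "a \<in> l2_seqs" if "a \<in> D" for a
  proof -
    have "part_nrm a 0 \<le> R" using that unfolding D_def by blast
    then have "0 \<le> R" by simp
    then show ?thesis using that l2_nrm_le_iff[of R a] by (simp add: D_def)
  qed
  have "uniform_limit D (\<lambda>N a. \<Sum>n<N. a n * c n) (\<lambda>a. \<phi> (j a)) sequentially"
  proof (rule uniform_limitI)
    fix e :: real assume e: "e > 0"
    \<comment> \<open>The tail will be at most \<open>\<bar>R\<bar> * r\<close>, which is below e.
      The absolute value and the added 1 allow R <= 0.\<close>
    define r where "r = e / (2 * (\<bar>R\<bar> + 1))"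
    have r: "r > 0" using e by (simp add: r_def add_nonneg_pos)
    have "Cauchy (\<lambda>N. \<Sum>n<N. (norm (c n))\<^sup>2)"
      using summable_LIMSEQ[OF cs] by (rule LIMSEQ_imp_Cauchy)
    from metric_CauchyD[OF this, of "r\<^sup>2"] r obtain N0 where N0: "\<And>m n. m \<ge> N0 \<Longrightarrow> n \<ge> N0 \<Longrightarrow> dist (\<Sum>i<m. (norm (c i))\<^sup>2) (\<Sum>i<n. (norm (c i))\<^sup>2) < r\<^sup>2"
      by auto
    have "dist (\<Sum>n<N. a n * c n) (\<phi> (j a)) < e" if N: "N \<ge> N0" and a: "a \<in> D" for N a
    proof -
      have "norm ((\<Sum>n<m. a n * c n) - (\<Sum>n<N. a n * c n)) \<le> \<bar>R\<bar> * r" if m: "m \<ge> N" for m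
      proof -
        have diff: "(\<Sum>n<m. f n) - (\<Sum>n<N. f n) = (\<Sum>n=N..<m. f n)" for f :: "nat \<Rightarrow> 'z::ab_group_add"
          using sum_diff_nat_ivl[of 0 N m f] m by (simp add: atLeast0LessThan)
        have "L2_set (\<lambda>n. norm (c n)) {N..<m} \<le> r"
          unfolding L2_set_def diff[symmetric] using N0[of m N] N m r by (intro real_le_lsqrt) (auto simp: dist_real_def)
        moreover have "L2_set (\<lambda>n. norm (a n)) {N..<m} \<le> part_nrm a m"
          unfolding L2_set_def by (intro real_sqrt_le_mono sum_mono2) auto
        moreover have "part_nrm a m \<le> R" using a unfolding D_def by blast
        ultimately have "L2_set (\<lambda>n. norm (c n)) {N..<m} \<le> r" "L2_set (\<lambda>n. norm (a n)) {N..<m} \<le> \<bar>R\<bar>" by linarith+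
        then have p: "L2_set (\<lambda>n. norm (a n)) {N..<m} * L2_set (\<lambda>n. norm (c n)) {N..<m} \<le> \<bar>R\<bar> * r"
          by (intro mult_mono) (auto simp: L2_set_nonneg)
        have "norm ((\<Sum>n<m. a n * c n) - (\<Sum>n<N. a n * c n)) \<le> (\<Sum>n=N..<m. \<bar>norm (a n)\<bar> * \<bar>norm (c n)\<bar>)"
          unfolding diff by (rule order_trans[OF norm_sum]) (simp add: norm_mult)
        also have "\<dots> \<le> L2_set (\<lambda>n. norm (a n)) {N..<m} * L2_set (\<lambda>n. norm (c n)) {N..<m}"
          by (rule L2_set_mult_ineq)
        finally show ?thesis using p by simp
      qed
      then have "norm (\<phi> (j a) - (\<Sum>n<N. a n * c n)) \<le> \<bar>R\<bar> * r"
        by (intro LIMSEQ_le_const2[OF tendsto_norm[OF tendsto_diff[OF c(2)[OF aL[OF a]] tendsto_const]]]) blast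
      also have "\<dots> < (\<bar>R\<bar> + 1) * (2 * r)" using r by (simp add: algebra_simps add_strict_increasing2)
      also have "(\<bar>R\<bar> + 1) * (2 * r) = e"
      proof -
        have "\<bar>R\<bar> + 1 \<noteq> 0" by (simp add: add_nonneg_eq_0_iff)
        then show ?thesis unfolding r_def by (simp add: divide_simps)
      qed
      finally show ?thesis by (simp add: dist_norm norm_minus_commute)
    qed
    then show "\<forall>\<^sub>F N in sequentially. \<forall>a\<in>D. dist (\<Sum>n<N. a n * c n) (\<phi> (j a)) < e"
      by (auto simp: eventually_sequentially)
  qed
  then show ?thesis
    unfolding D_def[symmetric]
    by (rule uniform_limit_theorem[rotated])
      (auto intro!: always_eventually continuous_on_sum continuous_on_mult continuous_on_subset[OF continuous_on_product_coordinates subset_UNIV])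
qed

text \<open>The ball is a closed subset of a product of discs, compact by Tychonoff's theorem, and j
  is continuous from the coordinatewise topology on it to the weak topology. Reflexivity need not be
  discussed.\<close>

lemma compactin_weak_ball: "compactin (weak_topology L) {x \<in> carrier L. nrm L x \<le> R}"
proof (cases "R < 0")
  case True
  then have e: "{x \<in> carrier L. nrm L x \<le> R} = {}" using L.nrm_nonneg by (fastforce simp del: L_simps)
  show ?thesis unfolding e by simp
next
  case False
  define D where "D = {a :: nat \<Rightarrow> 'k. \<forall>N. part_nrm a N \<le> R}"
  have D: "j ` D = {x \<in> carrier L. nrm L x \<le> R}"
  proof -
    have "D = {a \<in> l2_seqs. l2_nrm a \<le> R}" using l2_nrm_le_iff[of R] False by (auto simp: D_def)
    then show ?thesis by auto
  qed
  have "compactin (product_topology (\<lambda>_::nat. euclidean :: 'k topology) UNIV) (PiE UNIV (\<lambda>_. cball 0 R))"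
    unfolding compactin_PiE by simp
  then have comp: "compact (PiE UNIV (\<lambda>_::nat. cball (0::'k) R))" by (simp add: euclidean_product_topology)
  have "closed D"
  proof -
    have "D = (\<Inter>N. {a. part_nrm a N \<le> R})" by (auto simp: D_def)
    moreover have "closed {a :: nat \<Rightarrow> 'k. part_nrm a N \<le> R}" for N
      unfolding L2_set_def
      by (intro closed_Collect_le continuous_on_real_sqrt continuous_on_sum continuous_on_power continuous_on_norm continuous_on_product_coordinates continuous_on_const)
    ultimately show ?thesis by (simp add: closed_INT)
  qed
  moreover have "D \<subseteq> PiE UNIV (\<lambda>_. cball 0 R)"
  proof
    fix a assume "a \<in> D"
    then have "norm (a n) \<le> R" for n using norm_le_part_nrm[of n "Suc n" a] order_trans by (auto simp: D_def)
    then show "a \<in> PiE UNIV (\<lambda>_. cball 0 R)" by (simp add: PiE_UNIV_domain)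
  qed
  ultimately have cD: "compact D" using closed_Int_compact[OF _ comp, of D] by (simp add: inf.absorb1)
  have "continuous_map (top_of_set D) (weak_topology L) j"
    unfolding weak_topology_def continuous_on_generated_topo_iff
  proof (intro conjI allI impI)
    fix U assume "U \<in> {{x \<in> carrier L. \<phi> x \<in> V} |\<phi> V. operator L scalars \<phi> \<and> open V}"
    then obtain \<phi> V where U: "U = {x \<in> carrier L. \<phi> x \<in> V}" "operator L scalars \<phi>" "open V" by blast
    have "continuous_on D (\<lambda>a. \<phi> (j a))" unfolding D_def by (rule functional_continuous_pointwise[OF U(2)])
    then have "openin (top_of_set D) (D \<inter> (\<lambda>a. \<phi> (j a)) -` V)" using U(3) by (rule continuous_openin_preimage_gen)
    moreover have "j -` U \<inter> topspace (top_of_set D) = D \<inter> (\<lambda>a. \<phi> (j a)) -` V"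
      using D by (auto simp: U(1))
    ultimately show "openin (top_of_set D) (j -` U \<inter> topspace (top_of_set D))" by simp
  next
    have "j ` D \<subseteq> topspace (weak_topology L)" using D by (auto simp: topspace_weak_topology[OF nvs_L])
    then show "j ` topspace (top_of_set D) \<subseteq> \<Union> {{x \<in> carrier L. \<phi> x \<in> V} |\<phi> V. operator L scalars \<phi> \<and> open V}"
      by (simp add: weak_topology_def topology_generated_by_topspace)
  qed
  moreover have "compactin (top_of_set D) D" using cD by (simp add: compactin_subtopology)
  ultimately have "compactin (weak_topology L) (j ` D)" using image_compactin by blast
  then show ?thesis by (simp add: D)
qed

text \<open>Bounded sets are mapped into a ball, which is weakly compact. It also contains the weak
  closure of the image: the norming functional of a point outside exceeds R there, but not on the
  ball.\<close>

lemma weakly_compact_op_into_L: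
  assumes V: "normed_vector_space V" and T: "operator V L T"
  shows "weakly_compact_op V L T"
  unfolding weakly_compact_op_def
proof (intro allI impI)
  interpret V: normed_vector_space V by fact
  obtain M where M: "0 < M" "\<And>x. x \<in> carrier V \<Longrightarrow> nrm L (T x) \<le> M * nrm V x"
    using operator_bounded[OF V nvs_L T] by blast
  fix B assume "V.ms.mbounded B"
  then obtain x r where "B \<subseteq> V.ms.mcball x r" unfolding V.ms.mbounded_def by blast
  then have B: "v \<in> carrier V" "x \<in> carrier V" "nrm V (x \<ominus>\<^bsub>V\<^esub> v) \<le> r" if "v \<in> B" for v
    using that by (auto simp: V.ms.mcball_def V.nrm_dist_eq subset_iff)
  define R where "R = M * (nrm V x + r)"
  define D where "D = {y \<in> carrier L. nrm L y \<le> R}"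
  have TB: "T ` B \<subseteq> D"
  proof (rule image_subsetI)
    fix v assume v: "v \<in> B"
    have "nrm V v \<le> nrm V x + r"
      using V.nrm_le_add_diff[OF B(1,2)[OF v]] V.nrm_diff_commute[OF B(1,2)[OF v]] B(3)[OF v] by simp
    then have "M * nrm V v \<le> R" using M unfolding R_def by (intro mult_left_mono) auto
    then have "nrm L (T v) \<le> R" using M(2)[OF B(1)[OF v]] by simp
    then show "T v \<in> D" using T B(1)[OF v] linear_opD(1)[of V L T v] by (auto simp: D_def operator_def simp del: L_simps)
  qed
  have "weak_topology L closure_of (T ` B) \<subseteq> D"
  proof
    fix y assume y: "y \<in> weak_topology L closure_of (T ` B)"
    have yL: "y \<in> carrier L"
      using y closure_of_subset_topspace[of "weak_topology L"] unfolding topspace_weak_topology[OF nvs_L] by blast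
    have "nrm L y \<le> R"
    proof (rule ccontr)
      assume "\<not> nrm L y \<le> R"
      then have yR: "R < nrm L y" by simp
      obtain \<phi> where \<phi>: "\<phi> \<in> dual_ball L" "norm (\<phi> y) = nrm L y" using norming_functional[OF nvs_L yL] by blast
      have "openin (weak_topology L) {x \<in> carrier L. \<phi> x \<in> {z. R < norm z}}"
        by (rule openin_weak_topology[OF dual_ball_operator[OF nvs_L \<phi>(1)]]) (intro open_Collect_less continuous_intros)
      moreover have "y \<in> {x \<in> carrier L. \<phi> x \<in> {z. R < norm z}}" using yL yR \<phi>(2) by (simp del: L_simps)
      ultimately have "\<exists>x. x \<in> T ` B \<and> x \<in> {x \<in> carrier L. \<phi> x \<in> {z. R < norm z}}"
        by (intro in_closure_of[THEN iffD1, OF y, THEN conjunct2, rule_format] conjI)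
      then obtain x where "x \<in> D" "R < norm (\<phi> x)"
        using TB by auto
      then have "nrm L x \<le> R" "R < norm (\<phi> x)" "norm (\<phi> x) \<le> nrm L x"
        using dual_ballD(3)[OF \<phi>(1)] by (simp_all add: D_def del: L_simps)
      then show False by simp
    qed
    then show "y \<in> D" using yL by (simp add: D_def del: L_simps)
  qed
  then show "compactin (weak_topology L) (weak_topology L closure_of (T ` B))"
    using closed_compactin[OF compactin_weak_ball[of R]] closedin_closure_of by (auto simp: D_def simp del: L_simps)
qed

end


section \<open>Spaces that are not scattered\<close>

context compact_Hausdorff
begin

text \<open>Since no point of S is isolated, U contains two points of S; normality gives them
  neighbourhoods with disjoint closures inside U.\<close>

lemma splitting:
  assumes S: "S \<subseteq> topspace K" "\<And>x. x \<in> S \<Longrightarrow> \<not> openin (subtopology K S) {x}" and U: "openin K U" "U \<inter> S \<noteq> {}"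
  shows "\<exists>D :: bool \<Rightarrow> 'a set. (\<forall>e. openin K (D e) \<and> D e \<inter> S \<noteq> {} \<and> K closure_of D e \<subseteq> U) \<and>
    K closure_of D True \<inter> K closure_of D False = {}"
proof -
  obtain x where x: "x \<in> U" "x \<in> S" using U(2) by blast
  have "U \<inter> S \<noteq> {x}" using S(2)[OF x(2)] U(1) openin_subtopology_Int by metis
  then obtain y where y: "y \<in> U" "y \<in> S" "y \<noteq> x" using x by blast
  have cx: "closedin K {x}" "closedin K {y}" using x y S(1) by (auto intro: closedin_finite)
  obtain V where V: "openin K V" "{x} \<subseteq> V" "K closure_of V \<subseteq> U - {y}"
  proof (rule shrink_open[OF cx(1)])
    show "openin K (U - {y})" using U(1) cx(2) by (rule openin_diff)
  qed (use x y in auto)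
  obtain W where W: "openin K W" "{y} \<subseteq> W" "K closure_of W \<subseteq> U - K closure_of V"
  proof (rule shrink_open[OF cx(2)])
    show "openin K (U - K closure_of V)" using U(1) by (rule openin_diff) simp
  qed (use V y in auto)
  show ?thesis
    by (rule exI[of _ "\<lambda>e. if e then V else W"]) (use V W x y in auto)
qed

text \<open>Iterated splitting yields a Cantor scheme. The True half of K carries the disjoint sets
  B n that support the f n, the False half carries the tree Tr. Its level n + 1 decides the sign of
  \<open>\<gamma> n\<close>, and \<open>x N \<epsilon>\<close> lies in the node reached by the first
  N choices, so on these points the first N functions \<open>\<gamma> n\<close> act as independent
  signs.\<close>

lemma perfect_systems:
  assumes "\<not> scattered_space K"
  obtains t :: "nat \<Rightarrow> 'a" and f \<gamma> :: "nat \<Rightarrow> 'a \<Rightarrow> real" and x :: "nat \<Rightarrow> (nat \<Rightarrow> bool) \<Rightarrow> 'a"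
  where "\<And>n. continuous_map K euclideanreal (f n)" "\<And>n s. 0 \<le> f n s" "\<And>n s. s \<notin> topspace K \<Longrightarrow> f n s = 0"
    "\<And>N s. (\<Sum>n<N. f n s) \<le> 1" "\<And>n k. f n (t k) = (if n = k then 1 else 0)"
    "\<And>n. continuous_map K euclideanreal (\<gamma> n)" "\<And>n s. \<bar>\<gamma> n s\<bar> \<le> 1" "\<And>n s. s \<notin> topspace K \<Longrightarrow> \<gamma> n s = 0"
    "\<And>n N \<epsilon>. n < N \<Longrightarrow> \<gamma> n (x N \<epsilon>) = sign (\<epsilon> n)" "\<And>n N \<epsilon>. f n (x N \<epsilon>) = 0"
proof -
  obtain S where S: "S \<subseteq> topspace K" "S \<noteq> {}" "\<And>x. x \<in> S \<Longrightarrow> \<not> openin (subtopology K S) {x}"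
    using assms unfolding scattered_space_def by blast
  define good where "good U \<longleftrightarrow> openin K U \<and> U \<inter> S \<noteq> {}" for U
  \<comment> \<open>The choice is made for all sets at once, the implication covering those that
    miss S, so that d can be iterated.\<close>
  have "\<forall>U. \<exists>D :: bool \<Rightarrow> 'a set. good U \<longrightarrow> (\<forall>e. good (D e) \<and> K closure_of D e \<subseteq> U) \<and>
      K closure_of D True \<inter> K closure_of D False = {}" (is "\<forall>U. ?D U")
  proof
    fix U
    show "?D U"
    proof (cases "good U")
      case True
      then show ?thesis using splitting[OF S(1,3), of U] by (simp add: good_def)
    qed simp
  qed
  from choice[OF this] obtain d :: "'a set \<Rightarrow> bool \<Rightarrow> 'a set" where
    dP: "\<forall>U. good U \<longrightarrow> (\<forall>e. good (d U e) \<and> K closure_of d U e \<subseteq> U) \<and> K closure_of d U True \<inter> K closure_of d U False = {}"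
    by (rule exE)
  have d: "\<And>U e. good U \<Longrightarrow> good (d U e)"
    "\<And>U e. good U \<Longrightarrow> K closure_of d U e \<subseteq> U"
    "\<And>U. good U \<Longrightarrow> K closure_of d U True \<inter> K closure_of d U False = {}"
    using dP by simp_all
  have cl: "U \<subseteq> K closure_of U" if "good U" for U
    using that openin_subset by (intro closure_of_subset) (auto simp: good_def)
  have dU: "d U e \<subseteq> U" if "good U" for U e using cl[OF d(1)[OF that]] d(2)[OF that] by (rule order_trans)
  have dd: "d U True \<inter> d U False = {}" if "good U" for U
    using d(3)[OF that] cl[OF d(1)[OF that]] by blast
  have g0: "good (topspace K)" using S by (auto simp: good_def)

  \<comment> \<open>The exponent is \<open>Suc n\<close>, so that A 0 is already the True half of K
    and stays clear of the tree.\<close>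
  define A where "A n = ((\<lambda>U. d U True) ^^ Suc n) (topspace K)" for n
  define B where "B n = d (A n) False" for n
  have A_Suc: "A (Suc n) = d (A n) True" for n by (simp add: A_def)
  have gA: "good (A n)" for n
    by (induction n) (use d(1) g0 A_Suc in \<open>auto simp: A_def\<close>)
  have gB: "good (B n)" for n unfolding B_def by (rule d(1)[OF gA])
  have A_mono: "A n \<subseteq> A m" if "m \<le> n" for m n
    using that by (rule lift_Suc_antimono_le[rotated]) (simp add: A_Suc dU gA)
  have BA: "B n \<subseteq> A 0" for n using dU[OF gA, of n False] A_mono[of 0 n] unfolding B_def by blast
  have B_lt: "B m \<inter> B n = {}" if "m < n" for m n
    using dU[OF gA, of n False] A_mono[of "Suc m" n] dd[OF gA, of m] that unfolding B_def A_Suc by auto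
  have BB: "B m \<inter> B n = {}" if "m \<noteq> n" for m n
    using B_lt[of m n] B_lt[of n m] that by (cases "m < n") auto
  have "\<forall>n. \<exists>s. s \<in> B n \<and> s \<in> S" using gB by (auto simp: good_def)
  from choice[OF this] obtain t where t: "\<And>n. t n \<in> B n" "\<And>n. t n \<in> S" by blast
  have tK: "t n \<in> topspace K" for n using t(2) S(1) by blast
  have "\<exists>\<xi>. continuous_map K euclideanreal \<xi> \<and> (\<forall>s\<in>topspace K. 0 \<le> \<xi> s \<and> \<xi> s \<le> 1) \<and> (\<forall>s\<in>topspace K - B n. \<xi> s = 0) \<and> \<xi> (t n) = 1" for n
  proof -
    have "closedin K (topspace K - B n)" using gB[of n] by (intro closedin_diff closedin_topspace) (simp add: good_def)
    moreover have "closedin K {t n}" using tK[of n] by (intro closedin_finite) auto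
    moreover have "(topspace K - B n) \<inter> {t n} = {}" using t(1)[of n] by blast
    ultimately obtain \<xi> where "continuous_map K euclideanreal \<xi>" "\<And>t. t \<in> topspace K \<Longrightarrow> 0 \<le> \<xi> t \<and> \<xi> t \<le> 1"
      "\<And>s. s \<in> topspace K - B n \<Longrightarrow> \<xi> s = 0" "\<And>s. s \<in> {t n} \<Longrightarrow> \<xi> s = 1"
      by (rule Urysohn01) blast
    then show ?thesis by (intro exI[of _ \<xi>]) auto
  qed
  from choice[OF allI, OF this] obtain \<xi> where
    "\<forall>n. continuous_map K euclideanreal (\<xi> n) \<and> (\<forall>s\<in>topspace K. 0 \<le> \<xi> n s \<and> \<xi> n s \<le> 1) \<and> (\<forall>s\<in>topspace K - B n. \<xi> n s = 0) \<and> \<xi> n (t n) = 1"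
    by (rule exE)
  then have \<xi>: "\<And>n. continuous_map K euclideanreal (\<xi> n)" "\<And>n s. s \<in> topspace K \<Longrightarrow> 0 \<le> \<xi> n s \<and> \<xi> n s \<le> 1"
    "\<And>n s. s \<in> topspace K \<Longrightarrow> s \<notin> B n \<Longrightarrow> \<xi> n s = 0" "\<And>n. \<xi> n (t n) = 1"
    by auto
  define f where "f n s = (if s \<in> topspace K then \<xi> n s else 0)" for n s
  have f1: "continuous_map K euclideanreal (f n)" for n
    by (rule continuous_map_eq[OF \<xi>(1)[of n]]) (simp add: f_def)
  have f2: "0 \<le> f n s" "f n s \<le> 1" "s \<notin> B n \<Longrightarrow> f n s = 0" for n s
    using \<xi>(2,3)[of s n] by (auto simp: f_def)
  have f4: "(\<Sum>n<N. f n s) \<le> 1" for N s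
  proof (cases "\<exists>m<N. s \<in> B m")
    case True
    then obtain m where m: "m < N" "s \<in> B m" by blast
    have "(\<Sum>n<N. f n s) = (\<Sum>n<N. if n = m then f m s else 0)"
    proof (intro sum.cong refl)
      show "f n s = (if n = m then f m s else 0)" for n using BB[of n m] m(2) f2(3)[of s n] by auto
    qed
    then show ?thesis using m(1) f2(2)[of m s] by simp
  next
    case False
    then have "(\<Sum>n<N. f n s) = 0" using f2(3) by (intro sum.neutral) auto
    then show ?thesis by simp
  qed
  have f5: "f n (t k) = (if n = k then 1 else 0)" for n k
    using \<xi>(4)[of n] tK[of k] f2(3)[of "t k" n] BB[of n k] t(1)[of k] by (auto simp: f_def)

  \<comment> \<open>A node is a list of choices with the latest one at the head.\<close>
  define Tr where "Tr = rec_list (d (topspace K) False) (\<lambda>e s U. d U e)"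
  have Tr: "Tr [] = d (topspace K) False" "Tr (e # s) = d (Tr s) e" for e s by (simp_all add: Tr_def)
  have gT: "good (Tr s)" for s by (induction s) (simp_all add: Tr d(1) g0)
  have TrT: "Tr (u @ s) \<subseteq> Tr s" for u s
  proof (induction u)
    case (Cons e u)
    then show ?case using dU[OF gT, of "u @ s" e] by (simp add: Tr)
  qed simp
  have Tdis: "Tr s \<inter> Tr s' = {}" if "length s = length s'" "s \<noteq> s'" for s s'
    using that
  proof (induction s s' rule: list_induct2)
    case (Cons e s e' s')
    show ?case
    proof (cases "s = s'")
      case True
      then show ?thesis using Cons.prems dd[OF gT, of s] by (cases e; cases e') (auto simp: Tr)
    next
      case False
      then show ?thesis using Cons.IH dU[OF gT, of s e] dU[OF gT, of s' e'] by (auto simp: Tr)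
    qed
  qed simp
  \<comment> \<open>The closures of the finitely many nodes at level n + 1 whose latest choice is e.
    For the two values of e these unions are closed and disjoint, so one Urysohn function separates
    them.\<close>
  define P where "P e n = (\<Union>s\<in>{s. length s = n}. K closure_of Tr (e # s))" for e :: bool and n :: nat
  have cP: "closedin K (P e n)" for e n
    unfolding P_def using finite_lists_length_eq[of "UNIV :: bool set" n] by (intro closedin_Union) auto
  have dP: "P False n \<inter> P True n = {}" for n
  proof -
    have dis: "K closure_of Tr (False # s) \<inter> K closure_of Tr (True # s') = {}" if "length s = length s'" for s s'
    proof (cases "s = s'")
      case True
      then show ?thesis using d(3)[OF gT, of s] by (auto simp: Tr)
    next
      case False
      then show ?thesis using Tdis[OF that] d(2)[OF gT, of s False] d(2)[OF gT, of s' True] by (auto simp: Tr)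
    qed
    show ?thesis
    proof (rule equals0I)
      fix z assume "z \<in> P False n \<inter> P True n"
      then obtain s s' where "length s = n" "length s' = n" "z \<in> K closure_of Tr (False # s)" "z \<in> K closure_of Tr (True # s')"
        unfolding P_def by auto
      then show False using dis[of s s'] by auto
    qed
  qed
  have "\<exists>\<xi>. continuous_map K euclideanreal \<xi> \<and> (\<forall>s\<in>topspace K. 0 \<le> \<xi> s \<and> \<xi> s \<le> 1) \<and> (\<forall>s\<in>P False n. \<xi> s = 0) \<and> (\<forall>s\<in>P True n. \<xi> s = 1)" for n
    by (rule Urysohn01[OF cP cP dP[of n]]) blast
  from choice[OF allI, OF this] obtain \<eta> where
    "\<forall>n. continuous_map K euclideanreal (\<eta> n) \<and> (\<forall>s\<in>topspace K. 0 \<le> \<eta> n s \<and> \<eta> n s \<le> 1) \<and> (\<forall>s\<in>P False n. \<eta> n s = 0) \<and> (\<forall>s\<in>P True n. \<eta> n s = 1)"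
    by (rule exE)
  then have \<eta>: "\<And>n. continuous_map K euclideanreal (\<eta> n)" "\<And>n s. s \<in> topspace K \<Longrightarrow> 0 \<le> \<eta> n s \<and> \<eta> n s \<le> 1"
    "\<And>n s. s \<in> P False n \<Longrightarrow> \<eta> n s = 0" "\<And>n s. s \<in> P True n \<Longrightarrow> \<eta> n s = 1"
    by auto
  define \<gamma> where "\<gamma> n s = (if s \<in> topspace K then 2 * \<eta> n s - 1 else 0)" for n s
  have \<gamma>1: "continuous_map K euclideanreal (\<gamma> n)" for n
  proof (rule continuous_map_eq)
    show "continuous_map K euclideanreal (\<lambda>s. 2 * \<eta> n s - 1)"
      using \<eta>(1)[of n] by (intro continuous_intros) auto
  qed (simp add: \<gamma>_def)
  have \<gamma>2: "\<bar>\<gamma> n s\<bar> \<le> 1" for n s using \<eta>(2)[of s n] by (auto simp: \<gamma>_def abs_le_iff)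
  have "\<forall>s. \<exists>y. y \<in> Tr s \<and> y \<in> topspace K" using gT S(1) unfolding good_def by blast
  from choice[OF this] obtain y where y: "\<And>s. y s \<in> Tr s" "\<And>s. y s \<in> topspace K" by blast
  \<comment> \<open>Reversal puts the choice with index 0 last, since it is made first; the code for
    n + 1 choices is then a suffix of the code for any N > n.\<close>
  define code where "code N \<epsilon> = map \<epsilon> (rev [0..<N])" for N and \<epsilon> :: "nat \<Rightarrow> bool"
  define x where "x N \<epsilon> = y (code N \<epsilon>)" for N \<epsilon>
  have \<gamma>x: "\<gamma> n (x N \<epsilon>) = sign (\<epsilon> n)" if "n < N" for n N \<epsilon>
  proof -
    have "[0..<N] = [0..<n] @ [n] @ [Suc n..<N]" using that
      using upt_add_eq_append[of 0 n "N - n"] upt_conv_Cons[of n N] by simp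
    then have "code N \<epsilon> = map \<epsilon> (rev [Suc n..<N]) @ (\<epsilon> n # code n \<epsilon>)" by (simp add: code_def)
    then have "Tr (code N \<epsilon>) \<subseteq> Tr (\<epsilon> n # code n \<epsilon>)" using TrT by simp
    then have "x N \<epsilon> \<in> K closure_of Tr (\<epsilon> n # code n \<epsilon>)"
      using y(1)[of "code N \<epsilon>"] cl[OF gT] unfolding x_def by blast
    then have "x N \<epsilon> \<in> P (\<epsilon> n) n" unfolding P_def by (intro UN_I[of "code n \<epsilon>"]) (simp_all add: code_def)
    then show ?thesis using \<eta>(3,4)[of "x N \<epsilon>" n] y(2) by (cases "\<epsilon> n") (auto simp: \<gamma>_def x_def sign_def)
  qed
  have fx: "f n (x N \<epsilon>) = 0" for n N \<epsilon>
  proof (rule f2(3))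
    have "x N \<epsilon> \<in> Tr []" using y(1)[of "code N \<epsilon>"] TrT[of "code N \<epsilon>" "[]"] unfolding x_def by auto
    then show "x N \<epsilon> \<notin> B n" using BA[of n] dd[OF g0] unfolding Tr A_def by auto
  qed
  show thesis
    by (rule that[of f t \<gamma> x]) (use f1 f2 f4 f5 \<gamma>1 \<gamma>2 \<gamma>x fx in \<open>auto simp: f_def \<gamma>_def\<close>)
qed

end

text \<open>Expand the sum of |w - p|^2 >= 0, where p is the orthogonal projection of w onto the
  span of the r n. The coefficients are vectors of a real inner product space, so complex values are
  covered by regarding that field as such a space.\<close>

lemma bessel_inequality:
  fixes w :: "'e \<Rightarrow> 'v::real_inner" and r :: "nat \<Rightarrow> 'e \<Rightarrow> real"
  assumes fin: "finite \<Omega>" "\<Omega> \<noteq> {}"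
    and orth: "\<And>n m. \<lbrakk>n < N; m < N\<rbrakk> \<Longrightarrow> (\<Sum>e\<in>\<Omega>. r n e * r m e) = (if n = m then card \<Omega> else 0)"
    and w: "\<And>e. norm (w e) \<le> C"
  shows "(\<Sum>n<N. (norm ((\<Sum>e\<in>\<Omega>. r n e *\<^sub>R w e) /\<^sub>R card \<Omega>))\<^sup>2) \<le> C\<^sup>2"
proof -
  define k where "k = real (card \<Omega>)"
  have k: "k > 0" using fin by (simp add: k_def card_gt_0_iff)
  define c where "c n = (\<Sum>e\<in>\<Omega>. r n e *\<^sub>R w e) /\<^sub>R k" for n
  define p where "p e = (\<Sum>n<N. r n e *\<^sub>R c n)" for e
  have "(\<Sum>e\<in>\<Omega>. w e \<bullet> p e) = (\<Sum>n<N. \<Sum>e\<in>\<Omega>. (r n e *\<^sub>R w e) \<bullet> c n)"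
    unfolding p_def inner_sum_right by (subst sum.swap) simp
  also have "\<dots> = (\<Sum>n<N. k * (c n \<bullet> c n))"
    using k unfolding inner_sum_left[symmetric] by (intro sum.cong) (auto simp: c_def)
  finally have wp: "(\<Sum>e\<in>\<Omega>. w e \<bullet> p e) = k * (\<Sum>n<N. (norm (c n))\<^sup>2)"
    by (simp add: sum_distrib_left power2_norm_eq_inner)
  have "(\<Sum>e\<in>\<Omega>. p e \<bullet> p e) = (\<Sum>e\<in>\<Omega>. \<Sum>n<N. \<Sum>m<N. (r n e * r m e) * (c n \<bullet> c m))"
    unfolding p_def inner_sum_left inner_sum_right by (simp add: mult_ac inner_commute)
  also have "\<dots> = (\<Sum>n<N. \<Sum>m<N. \<Sum>e\<in>\<Omega>. (r n e * r m e) * (c n \<bullet> c m))"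
    by (subst sum.swap) (intro sum.cong refl sum.swap)
  also have "\<dots> = (\<Sum>n<N. \<Sum>m<N. if n = m then k * (c n \<bullet> c m) else 0)"
    unfolding sum_distrib_right[symmetric] using orth by (intro sum.cong refl) (auto simp: k_def)
  finally have pp: "(\<Sum>e\<in>\<Omega>. p e \<bullet> p e) = k * (\<Sum>n<N. (norm (c n))\<^sup>2)"
    by (simp add: sum_distrib_left power2_norm_eq_inner)
  have "0 \<le> (\<Sum>e\<in>\<Omega>. (w e - p e) \<bullet> (w e - p e))" by (intro sum_nonneg) simp
  also have "\<dots> = (\<Sum>e\<in>\<Omega>. w e \<bullet> w e) - 2 * (\<Sum>e\<in>\<Omega>. w e \<bullet> p e) + (\<Sum>e\<in>\<Omega>. p e \<bullet> p e)"
    by (simp add: inner_diff_left inner_diff_right inner_commute sum_subtractf sum.distrib sum_distrib_left)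
  finally have "k * (\<Sum>n<N. (norm (c n))\<^sup>2) \<le> (\<Sum>e\<in>\<Omega>. w e \<bullet> w e)" using wp pp by simp
  also have "\<dots> \<le> (\<Sum>e\<in>\<Omega>. C\<^sup>2)"
    unfolding power2_norm_eq_inner[symmetric] using w by (intro sum_mono power_mono) auto
  also have "\<dots> = k * C\<^sup>2" by (simp add: k_def)
  finally show ?thesis using k unfolding c_def k_def by (simp only: mult_le_cancel_left_pos)
qed

text \<open>Flipping the n-th sign is a bijection of \<open>signs N\<close> that negates the product
  when m differs from n.\<close>

lemma sign_orthogonal:
  assumes "n < N" "m < N"
  shows "(\<Sum>\<epsilon>\<in>signs N. sign (\<epsilon> n) * sign (\<epsilon> m)) = (if n = m then card (signs N) else 0)"
proof (cases "n = m")
  case False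
  define flip where "flip \<epsilon> = \<epsilon>(n := \<not> \<epsilon> n)" for \<epsilon> :: "nat \<Rightarrow> bool"
  have "bij_betw flip (signs N) (signs N)"
    by (rule bij_betwI[of _ _ _ flip]) (use assms in \<open>auto simp: flip_def PiE_iff extensional_def\<close>)
  moreover have flip: "sign (flip \<epsilon> n) * sign (flip \<epsilon> m) = - (sign (\<epsilon> n) * sign (\<epsilon> m))" for \<epsilon>
    using False by (auto simp: flip_def sign_def)
  ultimately have "(\<Sum>\<epsilon>\<in>signs N. - (sign (\<epsilon> n) * sign (\<epsilon> m))) = (\<Sum>\<epsilon>\<in>signs N. sign (\<epsilon> n) * sign (\<epsilon> m))"
    using sum.reindex_bij_betw[of flip "signs N" "signs N" "\<lambda>\<epsilon>. sign (\<epsilon> n) * sign (\<epsilon> m)"] by simp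
  then show ?thesis using False by (simp add: sum_negf)
qed simp

text \<open>A weak* cluster point of the averages \<open>g \<mapsto> 2\<^sup>-\<^sup>N \<Sum>\<^sub>\<epsilon> \<epsilon>\<^sub>n g (x N \<epsilon>)\<close>: the coefficients of \<open>g\<close> with
  respect to an orthonormal sequence of sign functions.\<close>

lemma sign_coefficients:
  fixes x :: "nat \<Rightarrow> (nat \<Rightarrow> bool) \<Rightarrow> 'a"
  assumes K: "compact_space K"
  obtains q :: "nat \<Rightarrow> ('a \<Rightarrow> 'k) \<Rightarrow> 'k::{real_normed_field, euclidean_space}"
  where "\<And>n g h. \<lbrakk>g \<in> cont_funs K; h \<in> cont_funs K\<rbrakk> \<Longrightarrow> q n (\<lambda>t. g t + h t) = q n g + q n h"
    "\<And>n a g. g \<in> cont_funs K \<Longrightarrow> q n (\<lambda>t. a * g t) = a * q n g"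
    "\<And>g m. g \<in> cont_funs K \<Longrightarrow> part_nrm (\<lambda>n. q n g) m \<le> sup_nrm K g"
    "\<And>n g. \<lbrakk>g \<in> cont_funs K; \<And>N \<epsilon>. n < N \<Longrightarrow> g (x N \<epsilon>) = of_real (sign (\<epsilon> n))\<rbrakk> \<Longrightarrow> q n g = 1"
    "\<And>n g. \<lbrakk>g \<in> cont_funs K; \<And>N \<epsilon>. g (x N \<epsilon>) = 0\<rbrakk> \<Longrightarrow> q n g = 0"
proof -
  \<comment> \<open>All coefficients together form one point of a product indexed by the pairs (n,
    g), so that Tychonoff's theorem provides a cluster point Q.\<close>
  define y :: "nat \<Rightarrow> nat \<times> ('a \<Rightarrow> 'k) \<Rightarrow> 'k" where
    "y N = (\<lambda>(n, g). if n < N \<and> g \<in> cont_funs K then (\<Sum>\<epsilon>\<in>signs N. sign (\<epsilon> n) *\<^sub>R g (x N \<epsilon>)) /\<^sub>R 2 ^ N else 0)" for N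
  have ne: "signs N \<noteq> {}" for N by (simp add: PiE_eq_empty_iff)
  have bes: "part_nrm (\<lambda>n. y N (n, g)) m \<le> sup_nrm K g" if g: "g \<in> cont_funs K" for N g m
  proof -
    have "(\<Sum>n<N. (norm ((\<Sum>\<epsilon>\<in>signs N. sign (\<epsilon> n) *\<^sub>R g (x N \<epsilon>)) /\<^sub>R card (signs N)))\<^sup>2) \<le> (sup_nrm K g)\<^sup>2"
      using sign_orthogonal by (intro bessel_inequality ne norm_le_sup_nrm K g) auto
    then have le: "(\<Sum>n<N. (norm (y N (n, g)))\<^sup>2) \<le> (sup_nrm K g)\<^sup>2" using g by (simp add: y_def)
    \<comment> \<open>Coefficients with n >= N are 0 by definition, so Bessel's inequality for n < N
      covers every m.\<close>
    have "(\<Sum>n<m. (norm (y N (n, g)))\<^sup>2) \<le> (\<Sum>n<max m N. (norm (y N (n, g)))\<^sup>2)" by (rule sum_mono2) auto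
    also have "\<dots> = (\<Sum>n<N. (norm (y N (n, g)))\<^sup>2)" by (rule sum.mono_neutral_right) (auto simp: y_def)
    finally have "(\<Sum>n<m. (norm (y N (n, g)))\<^sup>2) \<le> (sup_nrm K g)\<^sup>2" using le by simp
    then show ?thesis unfolding L2_set_def by (intro real_le_lsqrt sup_nrm_nonneg K g)
  qed
  define D :: "nat \<times> ('a \<Rightarrow> 'k) \<Rightarrow> 'k set" where
    "D = (\<lambda>(n, g). cball 0 (if g \<in> cont_funs K then sup_nrm K g else 0))"
  have "compactin (product_topology (\<lambda>_. euclidean) UNIV) (PiE UNIV D)"
    unfolding compactin_PiE by (auto simp: D_def)
  then have comp: "compactin euclidean (PiE UNIV D)" by (simp add: euclidean_product_topology)
  have yD: "y N \<in> PiE UNIV D" for N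
  proof -
    have "norm (y N (n, g)) \<le> sup_nrm K g" if "g \<in> cont_funs K" for n g
      using norm_le_part_nrm[of n "Suc n" "\<lambda>n. y N (n, g)"] bes[OF that, of N "Suc n"] by simp
    then show ?thesis by (auto simp: PiE_UNIV_domain D_def y_def)
  qed
  obtain Q where Q: "\<And>U N. open U \<Longrightarrow> Q \<in> U \<Longrightarrow> \<exists>n\<ge>N. y n \<in> U"
  proof (rule compactin_cluster_point[of euclidean "PiE UNIV D" y, OF comp yD])
    fix z assume "\<And>U N. openin euclidean U \<Longrightarrow> z \<in> U \<Longrightarrow> \<exists>n\<ge>N. y n \<in> U"
    then show thesis unfolding open_openin[symmetric] by (rule that)
  qed
  \<comment> \<open>Every required property is a closed condition on finitely many coordinates that
    holds for all large N, so it passes to Q.\<close>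
  have closed: "Q \<in> Z" if "closed Z" "\<And>N. N \<ge> N0 \<Longrightarrow> y N \<in> Z" for Z N0
    using Q[of "- Z" N0] that by auto
  note coord = continuous_on_product_coordinates
  show thesis
  proof (rule that[of "\<lambda>n g. Q (n, g)"])
    fix n :: nat and g :: "'a \<Rightarrow> 'k" assume g: "g \<in> cont_funs K"
    show "Q (n, \<lambda>t. g t + h t) = Q (n, g) + Q (n, h)" if h: "h \<in> cont_funs K" for h
    proof -
      have "Q \<in> {Q. Q (n, \<lambda>t. g t + h t) = Q (n, g) + Q (n, h)}"
        by (rule closed[of _ 0], intro closed_Collect_eq continuous_on_add coord)
          (use g h in \<open>auto simp: y_def cont_funs_add scaleR_right_distrib sum.distrib\<close>)
      then show ?thesis by simp
    qed
    show "Q (n, \<lambda>t. a * g t) = a * Q (n, g)" for a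
    proof -
      have "Q \<in> {Q. Q (n, \<lambda>t. a * g t) = a * Q (n, g)}"
        by (rule closed[of _ 0], intro closed_Collect_eq continuous_on_mult continuous_on_const coord)
          (use g in \<open>auto simp: y_def cont_funs_cmult sum_distrib_left\<close>)
      then show ?thesis by simp
    qed
    show "part_nrm (\<lambda>n. Q (n, g)) m \<le> sup_nrm K g" for m
    proof -
      have "Q \<in> {Q. part_nrm (\<lambda>n. Q (n, g)) m \<le> sup_nrm K g}"
      proof (rule closed[of _ 0])
        show "closed {Q :: nat \<times> ('a \<Rightarrow> 'k) \<Rightarrow> 'k. part_nrm (\<lambda>n. Q (n, g)) m \<le> sup_nrm K g}"
          unfolding L2_set_def
          by (intro closed_Collect_le continuous_on_real_sqrt continuous_on_sum continuous_on_power continuous_on_norm coord continuous_on_const)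
      qed (use bes[OF g] in auto)
      then show ?thesis by simp
    qed
    show "Q (n, g) = 1" if s: "\<And>N \<epsilon>. n < N \<Longrightarrow> g (x N \<epsilon>) = of_real (sign (\<epsilon> n))"
    proof -
      have "y N (n, g) = 1" if "N \<ge> Suc n" for N
        using that s[of N] g by (simp add: y_def scaleR_conv_of_real flip: of_real_mult)
      then have "Q \<in> {Q. Q (n, g) = 1}"
        by (intro closed[of _ "Suc n"] closed_Collect_eq continuous_on_const coord) auto
      then show ?thesis by simp
    qed
    show "Q (n, g) = 0" if "\<And>N \<epsilon>. g (x N \<epsilon>) = 0"
    proof -
      have "Q \<in> {Q. Q (n, g) = 0}"
        by (intro closed[of _ 0] closed_Collect_eq continuous_on_const coord) (use that in \<open>auto simp: y_def\<close>)
      then show ?thesis by simp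
    qed
  qed
qed


lemma limitin_weak_topologyI:
  assumes V: "normed_vector_space V" and s: "\<And>n. s n \<in> carrier V" and l: "l \<in> carrier V"
    and lim: "\<And>\<phi>. operator V scalars \<phi> \<Longrightarrow> (\<lambda>n. \<phi> (s n)) \<longlonglongrightarrow> \<phi> l"
  shows "limitin (weak_topology V) s l sequentially"
  unfolding limitin_def
proof (intro conjI allI impI)
  show "l \<in> topspace (weak_topology V)" using l by (simp add: V)
  fix U assume "openin (weak_topology V) U \<and> l \<in> U"
  then have "generate_topology_on {{x \<in> carrier V. \<phi> x \<in> U} | \<phi> U. operator V scalars \<phi> \<and> open U} U" and "l \<in> U"
    by (auto simp: weak_topology_def openin_topology_generated_by_iff)
  then show "\<forall>\<^sub>F n in sequentially. s n \<in> U"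
  proof (induction rule: generate_topology_on.induct)
    case (Int A B)
    then show ?case by (auto intro: eventually_conj)
  next
    case (UN \<A>)
    then obtain A where A: "A \<in> \<A>" "l \<in> A" by blast
    then have "\<forall>\<^sub>F n in sequentially. s n \<in> A" using UN.IH by blast
    then show ?case by (rule eventually_mono) (use A in blast)
  next
    case (Basis A)
    then obtain \<phi> W where A: "A = {x \<in> carrier V. \<phi> x \<in> W}" "operator V scalars \<phi>" "open W" by blast
    have "\<forall>\<^sub>F n in sequentially. \<phi> (s n) \<in> W"
      using topological_tendstoD[OF lim[OF A(2)] A(3)] Basis.prems by (simp add: A(1))
    then show ?case using s by (simp add: A(1))
  qed simp
qed

text \<open>If the values stayed above some \<open>\<delta>\<close> in modulus on an infinite set of
  indices, the diagonal bound along that set would give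
  \<open>N * \<delta> \<le> 2 * M * sqrt N\<close> for every N > 0.\<close>

lemma (in bounded_form) diagonal_tendsto_0:
  assumes f: "\<And>n. continuous_map K euclideanreal (f n)" "\<And>n t. 0 \<le> f n t" "\<And>n t. t \<notin> topspace K \<Longrightarrow> f n t = 0" "\<And>N t. (\<Sum>n<N. f n t) \<le> 1"
    and \<gamma>: "\<And>n. continuous_map K euclideanreal (\<gamma> n)" "\<And>n t. \<bar>\<gamma> n t\<bar> \<le> 1" "\<And>n t. t \<notin> topspace K \<Longrightarrow> \<gamma> n t = 0"
  shows "(\<lambda>n. b (\<lambda>t. of_real (f n t)) (\<lambda>t. of_real (\<gamma> n t))) \<longlonglongrightarrow> 0"
proof (rule ccontr)
  define \<beta> where "\<beta> n = b (\<lambda>t. of_real (f n t)) (\<lambda>t. of_real (\<gamma> n t))" for n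
  assume "\<not> (\<lambda>n. b (\<lambda>t. of_real (f n t)) (\<lambda>t. of_real (\<gamma> n t))) \<longlonglongrightarrow> 0"
  then have "\<not> \<beta> \<longlonglongrightarrow> 0" unfolding \<beta>_def .
  then obtain \<delta> where \<delta>: "\<delta> > 0" "\<And>N. \<exists>n\<ge>N. \<delta> \<le> norm (\<beta> n)"
    by (auto simp: LIMSEQ_iff not_less)
  define I where "I = {n. \<delta> \<le> norm (\<beta> n)}"
  have "infinite I" unfolding infinite_nat_iff_unbounded_le I_def using \<delta>(2) by blast
  then have r: "strict_mono (enumerate I)" "\<And>n. \<delta> \<le> norm (\<beta> (enumerate I n))"
    using enumerate_in_set[of I] by (auto simp: strict_mono_enumerate I_def)
  define r where "r = enumerate I"
  \<comment> \<open>The default 1 at z = 0 keeps the factor unimodular.\<close>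
  have "\<exists>\<theta>. norm \<theta> = 1 \<and> \<theta> * z = of_real (norm z)" for z :: 'k
    by (rule exI[of _ "if z = 0 then 1 else of_real (norm z) / z"]) (simp add: norm_divide)
  then obtain \<theta> :: "'k \<Rightarrow> 'k" where \<theta>: "\<And>z. norm (\<theta> z) = 1" "\<And>z. \<theta> z * z = of_real (norm z)" by metis
  have fc: "(\<lambda>t. of_real (f n t) :: 'k) \<in> cont_funs K" for n
    using f by (simp add: cont_funs_iff continuous_map_of_real)
  have gc: "(\<lambda>t. of_real (\<gamma> n t) :: 'k) \<in> cont_funs K" for n
    using \<gamma> by (simp add: cont_funs_iff continuous_map_of_real)
  have le: "N * \<delta> \<le> 2 * M * sqrt N" if N: "N > 0" for N :: nat
  proof -
    have "norm (\<Sum>i<N. b (\<lambda>t. \<theta> (\<beta> (r i)) * of_real (f (r i) t)) (\<lambda>t. of_real (\<gamma> (r i) t))) \<le> 2 * M * sqrt N"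
    proof (rule diagonal_bound[OF N])
      show "(\<lambda>t. \<theta> (\<beta> (r i)) * of_real (f (r i) t)) \<in> cont_funs K" for i by (rule cont_funs_cmult[OF fc])
      fix t
      have "(\<Sum>i<N. norm (\<theta> (\<beta> (r i)) * of_real (f (r i) t))) = (\<Sum>i<N. f (r i) t)"
        using f(2) by (simp add: norm_mult \<theta>(1))
      also have "\<dots> = (\<Sum>n\<in>r ` {..<N}. f n t)"
        using r(1) by (subst sum.reindex) (auto simp: r_def strict_mono_imp_inj_on intro: inj_on_subset)
      also have "\<dots> \<le> (\<Sum>n<r N. f n t)"
        using r(1) f(2) by (intro sum_mono2) (auto simp: r_def strict_mono_less)
      finally show "(\<Sum>i<N. norm (\<theta> (\<beta> (r i)) * of_real (f (r i) t))) \<le> 1" using f(4)[where N = "r N" and t = t] by simp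
    qed (use \<gamma> in auto)
    also have "(\<Sum>i<N. b (\<lambda>t. \<theta> (\<beta> (r i)) * of_real (f (r i) t)) (\<lambda>t. of_real (\<gamma> (r i) t))) = of_real (\<Sum>i<N. norm (\<beta> (r i)))"
      using fc gc by (simp add: cmult_left \<theta>(2) flip: \<beta>_def)
    finally have "(\<Sum>i<N. norm (\<beta> (r i))) \<le> 2 * M * sqrt N"
      unfolding norm_of_real by simp
    moreover have "(\<Sum>i<N. \<delta>) \<le> (\<Sum>i<N. norm (\<beta> (r i)))" using r(2) by (intro sum_mono) (simp add: r_def)
    ultimately show ?thesis by simp
  qed
  \<comment> \<open>The bound is used for N = k^2, which makes the square root exact.\<close>
  obtain k :: nat where k: "2 * M / \<delta> < k" using reals_Archimedean2 by blast
  have k0: "k > 0" using k M_nonneg \<delta>(1) by (cases k) (auto simp: divide_less_0_iff)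
  have "real k * (real k * \<delta>) \<le> real k * (2 * M)"
    using le[of "k * k"] k0 by (simp add: real_sqrt_mult mult_ac)
  then have "real k * \<delta> \<le> 2 * M" using k0 by (simp only: mult_le_cancel_left_pos of_nat_0_less_iff)
  then show False using k \<delta>(1) by (simp add: field_simps)
qed

section \<open>A weakly compact operator that is not completely continuous\<close>

context C_sym_tensor
begin

text \<open>The n-th coordinate comes from the bilinear form g(t n) q n(h). The sup norm of g bounds
  the first factor and the third assumption the second in the square-sum norm, so an elementary
  tensor has image of norm at most |g| |h|; summing over representations gives the projective
  norm.\<close>

lemma l2_operator:
  fixes q :: "nat \<Rightarrow> ('a \<Rightarrow> 'k) \<Rightarrow> 'k" and j :: "(nat \<Rightarrow> 'k) \<Rightarrow> 'w"
  assumes q: "\<And>n g h. \<lbrakk>g \<in> cont_funs K; h \<in> cont_funs K\<rbrakk> \<Longrightarrow> q n (\<lambda>t. g t + h t) = q n g + q n h"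
    "\<And>n a g. g \<in> cont_funs K \<Longrightarrow> q n (\<lambda>t. a * g t) = a * q n g"
    "\<And>g m. g \<in> cont_funs K \<Longrightarrow> part_nrm (\<lambda>n. q n g) m \<le> sup_nrm K g"
    and j: "inj j"
  obtains T where "operator ET (l2_copy j) T"
    "\<And>g h. \<lbrakk>g \<in> carrier C; h \<in> carrier C\<rbrakk> \<Longrightarrow>
      T (sym_tensor g h) = j (\<lambda>n. (1/2) * (g (t n) * q n h + h (t n) * q n g))"
proof -
  interpret l2_injection j using j by unfold_locales
  define b where "b n = (\<lambda>g h. g (t n) * q n h)" for n
  have b: "b n \<in> bilinear_forms C C" for n
    by (rule bilinear_formsI) (auto simp: b_def C_def q algebra_simps)
  define T0 where "T0 u = j (\<lambda>n. u (b n))" for u :: "(('a \<Rightarrow> 'k) \<Rightarrow> ('a \<Rightarrow> 'k) \<Rightarrow> 'k) \<Rightarrow> 'k"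
  have part: "part_nrm (\<lambda>n. u (b n)) m \<le> 1 * projective_norm C C u" if u: "u \<in> carrier AT" for u m
  proof (rule projective_norm_dominates[OF nvs_V nvs_V u])
    fix k x y assume u: "tensor_rep C C u k x y"
    note D = tensor_repD[OF u]
    have xy: "x i \<in> cont_funs K" "y i \<in> cont_funs K" if "i < k" for i
      using D(1,2) that by (simp_all add: C_def)
    have "u (b n) = (\<Sum>i<k. x i (t n) * q n (y i))" for n
      unfolding D(3) tensor_def using b by (simp add: b_def)
    then have "part_nrm (\<lambda>n. u (b n)) m = part_nrm (\<lambda>n. \<Sum>i<k. x i (t n) * q n (y i)) m" by simp
    also have "\<dots> \<le> (\<Sum>i<k. part_nrm (\<lambda>n. x i (t n) * q n (y i)) m)"
    proof (induction k)
      case (Suc k)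
      then show ?case using part_nrm_add[of "\<lambda>n. \<Sum>i<k. x i (t n) * q n (y i)" "\<lambda>n. x k (t n) * q n (y k)" m] by simp
    qed (simp add: L2_set_def)
    also have "\<dots> \<le> (\<Sum>i<k. sup_nrm K (x i) * sup_nrm K (y i))"
    proof (rule sum_mono)
      fix i assume "i \<in> {..<k}"
      then have i: "x i \<in> cont_funs K" "y i \<in> cont_funs K" using xy by auto
      have "part_nrm (\<lambda>n. x i (t n) * q n (y i)) m \<le> L2_set (\<lambda>n. sup_nrm K (x i) * norm (q n (y i))) {..<m}"
        using norm_le_sup_nrm[OF compact_K i(1)] by (intro L2_set_mono) (auto simp: norm_mult intro: mult_right_mono)
      also have "\<dots> = sup_nrm K (x i) * part_nrm (\<lambda>n. q n (y i)) m"
        using sup_nrm_nonneg[OF compact_K i(1)] by (simp add: L2_set_right_distrib)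
      also have "\<dots> \<le> sup_nrm K (x i) * sup_nrm K (y i)"
        by (intro mult_left_mono q(3) i sup_nrm_nonneg compact_K)
      finally show "part_nrm (\<lambda>n. x i (t n) * q n (y i)) m \<le> sup_nrm K (x i) * sup_nrm K (y i)" .
    qed
    finally show "part_nrm (\<lambda>n. u (b n)) m \<le> 1 * (\<Sum>i<k. nrm C (x i) * nrm C (y i))" by (simp add: C_def)
  qed simp
  have l2: "(\<lambda>n. u (b n)) \<in> l2_seqs \<and> l2_nrm (\<lambda>n. u (b n)) \<le> projective_norm C C u" if u: "u \<in> carrier AT" for u
  proof -
    have "0 \<le> projective_norm C C u" using part[OF u, of 0] by simp
    then show ?thesis using l2_nrm_le_iff[of "projective_norm C C u" "\<lambda>n. u (b n)"] part[OF u] by simp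
  qed
  have lin: "linear_op AT L T0"
    using l2 by (auto simp: linear_op_def T0_def algebraic_tensor_simps(3,4))
  have bd: "nrm L (T0 u) \<le> 1 * projective_norm C C u" if "u \<in> carrier AT" for u
    using l2[OF that] by (simp add: T0_def)
  obtain T where T: "operator ET L T" "\<And>x. x \<in> carrier ET \<Longrightarrow> nrm L (T x) \<le> 1 * nrm ET x"
    "\<And>f g. \<lbrakk>f \<in> carrier C; g \<in> carrier C\<rbrakk> \<Longrightarrow> T (sym_tensor f g) = T0 (symt f g)"
    by (rule operator_on_sym_tensor[OF banach_L lin bd]) blast+
  show thesis
  proof (rule that[OF T(1)])
    fix g h assume gh: "g \<in> carrier C" "h \<in> carrier C"
    show "T (sym_tensor g h) = j (\<lambda>n. (1/2) * (g (t n) * q n h + h (t n) * q n g))"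
      unfolding T(3)[OF gh] T0_def symt_def tensor_def using b by (simp add: b_def)
  qed
qed

lemma not_scattered_imp_not_dunford_pettis:
  assumes "\<not> scattered_space K"
  shows "\<not> dunford_pettis TYPE('u) ET"
proof
  assume DP: "dunford_pettis TYPE('u) ET"
  obtain t :: "nat \<Rightarrow> 'a" and f \<gamma> :: "nat \<Rightarrow> 'a \<Rightarrow> real" and x :: "nat \<Rightarrow> (nat \<Rightarrow> bool) \<Rightarrow> 'a"
    where f: "\<And>n. continuous_map K euclideanreal (f n)" "\<And>n s. 0 \<le> f n s" "\<And>n s. s \<notin> topspace K \<Longrightarrow> f n s = 0"
      "\<And>N s. (\<Sum>n<N. f n s) \<le> 1" "\<And>n k. f n (t k) = (if n = k then 1 else 0)"
    and \<gamma>: "\<And>n. continuous_map K euclideanreal (\<gamma> n)" "\<And>n s. \<bar>\<gamma> n s\<bar> \<le> 1" "\<And>n s. s \<notin> topspace K \<Longrightarrow> \<gamma> n s = 0"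
    and x: "\<And>n N \<epsilon>. n < N \<Longrightarrow> \<gamma> n (x N \<epsilon>) = sign (\<epsilon> n)" "\<And>n N \<epsilon>. f n (x N \<epsilon>) = 0"
    by (rule perfect_systems[OF assms]) blast
  obtain q :: "nat \<Rightarrow> ('a \<Rightarrow> 'k) \<Rightarrow> 'k"
    where q: "\<And>n g h. \<lbrakk>g \<in> cont_funs K; h \<in> cont_funs K\<rbrakk> \<Longrightarrow> q n (\<lambda>t. g t + h t) = q n g + q n h"
      "\<And>n a g. g \<in> cont_funs K \<Longrightarrow> q n (\<lambda>t. a * g t) = a * q n g"
      "\<And>g m. g \<in> cont_funs K \<Longrightarrow> part_nrm (\<lambda>n. q n g) m \<le> sup_nrm K g"
    and q1: "\<And>n g. \<lbrakk>g \<in> cont_funs K; \<And>N \<epsilon>. n < N \<Longrightarrow> g (x N \<epsilon>) = of_real (sign (\<epsilon> n))\<rbrakk> \<Longrightarrow> q n g = 1"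
    and q0: "\<And>n g. \<lbrakk>g \<in> cont_funs K; \<And>N \<epsilon>. g (x N \<epsilon>) = 0\<rbrakk> \<Longrightarrow> q n g = 0"
    by (rule sign_coefficients[OF compact_K, of x]) blast
  define F where "F n = (\<lambda>s. of_real (f n s) :: 'k)" for n
  define H where "H n = (\<lambda>s. of_real (\<gamma> n s) :: 'k)" for n
  have F: "F n \<in> cont_funs K" and H: "H n \<in> cont_funs K" for n
    using f \<gamma> by (simp_all add: F_def H_def cont_funs_iff continuous_map_of_real)
  have qF: "q k (F n) = 0" for n k by (rule q0[OF F]) (simp add: F_def x)
  have qH: "q n (H n) = 1" for n by (rule q1[OF H]) (simp add: H_def x)
  have FC: "F n \<in> carrier C" and HC: "H n \<in> carrier C" for n using F H by (simp_all add: C_def)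
  define u where "u n = sym_tensor (F n) (H n)" for n
  have uE: "u n \<in> carrier ET" for n unfolding u_def by (rule sym_tensor_carrier[OF FC HC])
  have null: "limitin (weak_topology ET) u \<zero>\<^bsub>ET\<^esub> sequentially"
  proof (rule limitin_weak_topologyI[OF nvs_E uE])
    fix \<psi> assume \<psi>: "operator ET scalars \<psi>"
    obtain M where M: "0 < M" "\<And>x. x \<in> carrier ET \<Longrightarrow> norm (\<psi> x) \<le> M * nrm ET x"
      using operator_bounded[OF nvs_E normed_vector_space_scalars \<psi>] by auto
    have lin: "linear_op ET scalars \<psi>" using \<psi> by (simp add: operator_def)
    interpret bounded_form K "\<lambda>f g. \<psi> (sym_tensor f g)" M
      by (rule functional_bounded_form[OF lin _ M(2)]) (use M(1) in auto)
    have "\<psi> \<zero>\<^bsub>ET\<^esub> = 0" using linear_op_zero[OF nvs_E normed_vector_space_scalars lin] by simp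
    then show "(\<lambda>n. \<psi> (u n)) \<longlonglongrightarrow> \<psi> \<zero>\<^bsub>ET\<^esub>"
      using diagonal_tendsto_0[OF f(1-4) \<gamma>] by (simp add: u_def F_def H_def)
  qed simp

  \<comment> \<open>A nonzero vector e is needed, since its multiples embed the scalars into the
    tensor space; sequences of scalars thus fit into the left summand of the type on which the
    property tests F. The functional \<open>\<epsilon>\<close> recovers the multiple.\<close>
  define e where "e = sym_tensor (F 0) (F 0)"
  have eE: "e \<in> carrier ET" unfolding e_def by (rule sym_tensor_carrier[OF FC FC])
  obtain \<epsilon> where \<epsilon>: "operator ET scalars \<epsilon>" "\<epsilon> e = 1"
  proof (rule point_functional[of "t 0" "t 0"])
    fix \<epsilon> assume "operator ET scalars \<epsilon>"
      "\<And>f g. \<lbrakk>f \<in> carrier C; g \<in> carrier C\<rbrakk> \<Longrightarrow> \<epsilon> (sym_tensor f g) = (1/2) * (f (t 0) * g (t 0) + g (t 0) * f (t 0))"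
    then show thesis using FC by (intro that[of \<epsilon>]) (auto simp: e_def F_def f(5))
  qed
  define j :: "(nat \<Rightarrow> 'k) \<Rightarrow> (nat \<Rightarrow> (nat \<Rightarrow> (('a \<Rightarrow> 'k) \<Rightarrow> ('a \<Rightarrow> 'k) \<Rightarrow> 'k) \<Rightarrow> 'k) set) + 'u" where "j a = Inl (\<lambda>n. a n \<odot>\<^bsub>ET\<^esub> e)" for a
  have "inj j"
  proof (rule injI)
    fix a c :: "nat \<Rightarrow> 'k" assume "j a = j c"
    then have "a n \<odot>\<^bsub>ET\<^esub> e = c n \<odot>\<^bsub>ET\<^esub> e" for n by (auto simp: j_def fun_eq_iff)
    then have "\<epsilon> (a n \<odot>\<^bsub>ET\<^esub> e) = \<epsilon> (c n \<odot>\<^bsub>ET\<^esub> e)" for n by simp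
    then show "a = c" using \<epsilon> linear_op_scalarsD(2)[of ET \<epsilon>, OF _ eE] by (auto simp: operator_def)
  qed
  then interpret l2_injection j
    by unfold_locales
  obtain T where T: "operator ET L T"
    "\<And>g h. \<lbrakk>g \<in> carrier C; h \<in> carrier C\<rbrakk> \<Longrightarrow> T (sym_tensor g h) = j (\<lambda>n. (1/2) * (g (t n) * q n h + h (t n) * q n g))"
  proof (rule l2_operator[OF q inj, of t])
    fix T assume "operator ET L T" "\<And>g h. \<lbrakk>g \<in> carrier C; h \<in> carrier C\<rbrakk> \<Longrightarrow> T (sym_tensor g h) = j (\<lambda>n. (1/2) * (g (t n) * q n h + h (t n) * q n g))"
    then show thesis by (rule that)
  qed
  have Ft: "F n (t k) = (if n = k then 1 else 0)" for n k by (simp add: F_def f(5))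
  \<comment> \<open>The term with q k (F n) vanishes and F n (t k) singles out k = n; the 1/2 comes
    from the symmetrisation.\<close>
  have Tu: "T (u n) = j (\<lambda>k. if k = n then 1/2 else 0)" for n
    unfolding u_def T(2)[OF FC HC]
    by (intro arg_cong[where f = j]) (auto simp: Ft qF qH)
  have "completely_continuous_op ET L T"
    using DP banach_L T(1) weakly_compact_op_into_L[OF nvs_E T(1)] unfolding dunford_pettis_def by blast
  then obtain m where m: "limitin (norm_topology L) (\<lambda>n. T (u n)) m sequentially"
    unfolding completely_continuous_op_def using null uE by blast
  have TuL: "T (u n) \<in> carrier L" for n
    using linear_opD(1)[of ET L T "u n"] T(1) uE by (simp add: operator_def del: L_simps)
  have mL: "m \<in> carrier L" and lim: "(\<lambda>n. nrm L (T (u n) \<ominus>\<^bsub>L\<^esub> m)) \<longlonglongrightarrow> 0"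
    using m L.limitin_iff[OF TuL] by auto
  obtain a where a: "m = j a" "a \<in> l2_seqs" using mL by auto
  have near: "norm ((if k = n then 1/2 else 0) - a k) \<le> nrm L (T (u n) \<ominus>\<^bsub>L\<^esub> m)" for k n
  proof -
    have l: "(\<lambda>k. if k = n then 1/2 else 0 :: 'k) \<in> l2_seqs" using TuL[of n] inj by (auto simp: Tu inj_image_mem_iff)
    show ?thesis using norm_le_l2_nrm[OF l2_diff[OF l a(2)], of k] l a by (simp add: Tu)
  qed
  \<comment> \<open>For n > k the k-th coordinate of T (u n) is 0, so a limit could only be 0,
    whereas every T (u n) has a coordinate 1/2.\<close>
  have "norm (a k) \<le> 0" for k
  proof (rule LIMSEQ_le_const[OF lim])
    have "norm (a k) \<le> nrm L (T (u n) \<ominus>\<^bsub>L\<^esub> m)" if "n \<ge> Suc k" for n using near[of k n] that by simp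
    then show "\<exists>N. \<forall>n\<ge>N. norm (a k) \<le> nrm L (T (u n) \<ominus>\<^bsub>L\<^esub> m)" by blast
  qed
  then have "1/2 \<le> nrm L (T (u n) \<ominus>\<^bsub>L\<^esub> m)" for n using near[of n n] by simp
  then have "(1/2 :: real) \<le> 0" by (intro LIMSEQ_le_const[OF lim]) blast
  then show False by simp
qed

end

theorem theorem2p6:
  fixes K :: "'a topology"
  assumes "compact_space K" and "Hausdorff_space K"
  shows "(dunford_pettis TYPE('u)
            (sym_projective_tensor (C_space K :: (real, 'a \<Rightarrow> real) normed_vs))
          \<longleftrightarrow> scattered_space K) \<and>
         (dunford_pettis TYPE('u)
            (sym_projective_tensor (C_space K :: (complex, 'a \<Rightarrow> complex) normed_vs))
          \<longleftrightarrow> scattered_space K)"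
proof -
  interpret R: C_sym_tensor K "C_space K :: (real, 'a \<Rightarrow> real) normed_vs"
    by unfold_locales (use assms in auto)
  interpret C: C_sym_tensor K "C_space K :: (complex, 'a \<Rightarrow> complex) normed_vs"
    by unfold_locales (use assms in auto)
  show ?thesis
    using R.scattered_imp_dunford_pettis R.not_scattered_imp_not_dunford_pettis
      C.scattered_imp_dunford_pettis C.not_scattered_imp_not_dunford_pettis by blast
qed

end
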